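(* Let $f$ be a continuous map and let $X$ be an isolated invariant continuum for $f$. Let $i^*\colon\check H^1(W^u_\infty;\mathbb K)\to\check H^1(\tilde X;\mathbb K)$ be the map induced in one-dimensional cohomology by the inclusion $i\colon\tilde X\subseteq W^u_\infty$. Let $J$ be the (finite) set of essential quasicomponents of $W^u_\infty\setminus(\tilde X\cup\{\infty\})$ and $\varphi\colon J\to J$ the permutation induced by $\tilde f^{-1}$. Then for every $n\ge1$ the trace of the first cohomological Conley index of $X$ is $$\mathrm{trace}(h^1(f^n,X))=-1+\#\mathrm{Fix}(\varphi^n)+\mathrm{trace}\big((\tilde f^* )^n|_{\mathrm{im}\,i^*}\big),$$ unless $X$ is an asymptotically stable attractor, in which case $\mathrm{trace}(h^1(f^n,X))=\mathrm{trace}\big((\tilde f^* )^n|_{\mathrm{im}\,i^*}\big)$.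
   Context: Setting. $M$ is a locally compact, paracompact Hausdorff space, $f\colon D\to M$ is a continuous map defined on an open set $D\subseteq M$. $\check H^*$ denotes Čech cohomology with coefficients in the field $\mathbb K$, where $\mathbb K=\mathbb Q$ or $\mathbb C$. For $A\subseteq D$, $\mathrm{Inv}(A)$ is the set of $p\in A$ for which there is a sequence $(p_i)_{i\in\mathbb Z}$ in $A$ with $p_0=p$ and $f(p_i)=p_{i+1}$ for all $i$. A compact set $X\subseteq D$ with $f(X)=X$ is an isolated invariant set if it has a compact neighbourhood $A\subseteq D$ with $X=\mathrm{Inv}(A)$ (such $A$ is an isolating neighbourhood of $X$). A continuum is a nonempty compact connected set. $X$ is an (asymptotically stable) attractor if it has a neighbourhood basis of positively invariant sets and a neighbourhood $V$ such that the forward iterates of every $p\in V$ eventually enter any prescribed neighbourhood of $X$. Index pairs. An index pair for $f$ and $X$ is a pair of compact sets $L\subseteq N\subseteq D$ such that (i) $\overline{N\setminus L}$ is an isolating neighbourhood of $X$ and $X\cap L=\emptyset$; (ii) $f(N\setminus L)\subseteq N$; (iii) $f(L)\cap N\subseteq L$. The index map is the continuous map $f_\#\colon (N/L,[L])\to(N/L,[L])$ of the pointed quotient space given by $f_\#(p)=f(p)$ if $p,f(p)\in N\setminus L$ and $f_\#(p)=[L]$ otherwise (if $L=\emptyset$, $N/L$ is $N$ with a disjoint base point added). Conley index. The $q$-cohomological Conley index $h^q(f,X)$ is the shift equivalence class of $f_\#^*\colon\check H^q(N/L,[L])\to\check H^q(N/L,[L])$; it does not depend on the index pair. Its trace is the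 trace of $f_\#^*$ for any index pair with finite dimensional cohomology. For $n\ge1$, $X$ is also an isolated invariant set of $f^n$, and $\mathrm{trace}(h^q(f^n,X))=\mathrm{trace}((f_\#^* )^n)$. Compactified unstable manifold. $W^u_\infty$ is the inverse limit of $N/L\xleftarrow{f_\#}N/L\xleftarrow{f_\#}\cdots$, i.e. the compact Hausdorff space of sequences $\xi=(\xi_i)_{i\ge0}$ in $N/L$ with $f_\#(\xi_{i+1})=\xi_i$; the point $\infty$ is the constant sequence $([L],[L],\ldots)$. The map $\tilde f(\xi_0,\xi_1,\ldots)=(f_\#(\xi_0),\xi_0,\xi_1,\ldots)$ is a homeomorphism of $W^u_\infty$ fixing $\infty$, and $\tilde X=\{\xi\in W^u_\infty:\xi_i\in X\text{ for all }i\}$ is a compact $\tilde f$-invariant subset. (Up to homeomorphism and conjugation these objects do not depend on the index pair.) The map $\tilde f^*$ on $\check H^1(\tilde X)$ is induced by $\tilde f|_{\tilde X}$ and preserves the subspace $\mathrm{im}\,i^*$. Quasicomponents. The quasicomponent of a point $z$ in a space $Z$ is the intersection of all clopen subsets of $Z$ containing $z$. A quasicomponent $F$ of $W^u_\infty\setminus(\tilde X\cup\{\infty\})$ is essential if its closure in $W^u_\infty$ contains $\infty$ and meets $\tilde X$. The homeomorphism $\tilde f$ permutes the essential quasicomponents. Standing assumption. $X$ has an index pair $(N,L)$ such that $\check H^q(N/L;\mathbb K)$ is finite dimensional in every degree (automatic if $M$ is a locally compact metrizable absolute neighbourhood retract, e.g. a topological manifold); consequently $\check H^q(W^u_\infty;\mathbb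 K)$ is finite dimensional in every degree $q$. *)

theory Defs
  imports "HOL-Analysis.Analysis" "Jordan_Normal_Form.VS_Connect"
begin

section \<open>Coefficient fields\<close>

text \<open>Fields isomorphic to the field of rational or of complex numbers.\<close>

class rat_or_complex = field +
  assumes iso_rat_or_complex:
    "(\<exists>h :: 'a \<Rightarrow> rat. bij h \<and> (\<forall>x y. h (x + y) = h x + h y \<and> h (x * y) = h x * h y)) \<or>
     (\<exists>h :: 'a \<Rightarrow> complex. bij h \<and> (\<forall>x y. h (x + y) = h x + h y \<and> h (x * y) = h x * h y))"

instance rat :: rat_or_complex
  by standard (intro disjI1 exI[of _ id], simp)

instance complex :: rat_or_complex
  by standard (intro disjI2 exI[of _ id], simp)


section \<open>Linear algebra\<close>

text \<open>Only meaningful for finite dimensional \<open>V\<close>; the value is then independent of the basis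
  \<open>B\<close>, and \<open>a b b'\<close> is the coefficient of \<open>b'\<close> in \<open>T b\<close>.\<close>

definition linear_trace :: "('k::field, 'v) module \<Rightarrow> ('v \<Rightarrow> 'v) \<Rightarrow> 'k" where
  "linear_trace V T = (THE t. \<exists>B a. finite B \<and> vectorspace.basis class_ring V B \<and>
     (\<forall>b\<in>B. T b = module.lincomb V (a b) B) \<and> t = (\<Sum>b\<in>B. a b b))"

definition shift_equivalent ::
  "('k::field, 'v) module \<times> ('v \<Rightarrow> 'v) \<Rightarrow> ('k, 'w) module \<times> ('w \<Rightarrow> 'w) \<Rightarrow> bool" where
  "shift_equivalent = (\<lambda>(V, S) (W, T).
     linear_map class_ring V V S \<and> linear_map class_ring W W T \<and>
     (\<exists>r s m. linear_map class_ring V W r \<and> linear_map class_ring W V s \<and>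
        (\<forall>v\<in>carrier V. r (S v) = T (r v)) \<and> (\<forall>w\<in>carrier W. s (T w) = S (s w)) \<and>
        (\<forall>v\<in>carrier V. s (r v) = (S ^^ m) v) \<and> (\<forall>w\<in>carrier W. r (s w) = (T ^^ m) w)))"


section \<open>Cech cohomology\<close>

definition open_cover :: "'x topology \<Rightarrow> 'x set set \<Rightarrow> bool" where
  "open_cover X \<U> \<longleftrightarrow> (\<forall>U\<in>\<U>. openin X U) \<and> \<Union>\<U> = topspace X"

text \<open>Ordered \<open>q\<close>-simplices (repetitions allowed) of the nerve of \<open>\<U>\<close>.\<close>

definition nerve :: "'x set set \<Rightarrow> nat \<Rightarrow> 'x set list set" where
  "nerve \<U> q = {\<sigma>. length \<sigma> = Suc q \<and> set \<sigma> \<subseteq> \<U> \<and> \<Inter>(set \<sigma>) \<noteq> {}}"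

text \<open>Cochains of the nerve of \<open>\<U>\<close> relative to the subcomplex of those simplices whose common
  intersection meets \<open>A\<close>.  They are extended by \<open>0\<close> outside the nerve.\<close>

definition cochains :: "'x set set \<Rightarrow> 'x set \<Rightarrow> nat \<Rightarrow> ('x set list \<Rightarrow> 'k::field) set" where
  "cochains \<U> A q = {c. \<forall>\<sigma>. \<sigma> \<notin> nerve \<U> q \<or> A \<inter> \<Inter>(set \<sigma>) \<noteq> {} \<longrightarrow> c \<sigma> = 0}"

definition coboundary ::
  "'x set set \<Rightarrow> nat \<Rightarrow> ('x set list \<Rightarrow> 'k::field) \<Rightarrow> 'x set list \<Rightarrow> 'k" where
  "coboundary \<U> q c \<sigma> = (if \<sigma> \<in> nerve \<U> (Suc q)
     then \<Sum>i<length \<sigma>. (-1) ^ i * c (take i \<sigma> @ drop (Suc i) \<sigma>) else 0)"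

definition cocycles :: "'x set set \<Rightarrow> 'x set \<Rightarrow> nat \<Rightarrow> ('x set list \<Rightarrow> 'k::field) set" where
  "cocycles \<U> A q = {c \<in> cochains \<U> A q. coboundary \<U> q c = (\<lambda>_. 0)}"

definition coboundaries :: "'x set set \<Rightarrow> 'x set \<Rightarrow> nat \<Rightarrow> ('x set list \<Rightarrow> 'k::field) set" where
  "coboundaries \<U> A q =
     (case q of 0 \<Rightarrow> {\<lambda>_. 0} | Suc p \<Rightarrow> coboundary \<U> p ` cochains \<U> A p)"

text \<open>The map \<open>p\<close> exhibits \<open>\<V>\<close> as a refinement of the pullback of \<open>\<U>\<close> along \<open>g\<close>.\<close>

definition refinement :: "('x \<Rightarrow> 'y) \<Rightarrow> 'x set set \<Rightarrow> 'y set set \<Rightarrow> ('x set \<Rightarrow> 'y set) \<Rightarrow> bool" where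
  "refinement g \<V> \<U> p \<longleftrightarrow> (\<forall>V\<in>\<V>. p V \<in> \<U> \<and> g ` V \<subseteq> p V)"

definition pullback_cochain ::
  "'x set set \<Rightarrow> nat \<Rightarrow> ('x set \<Rightarrow> 'y set) \<Rightarrow> ('y set list \<Rightarrow> 'k::field) \<Rightarrow> 'x set list \<Rightarrow> 'k" where
  "pullback_cochain \<V> q p c \<sigma> = (if \<sigma> \<in> nerve \<V> q then c (map p \<sigma>) else 0)"

text \<open>The elements of the direct limit, over all open covers ordered by refinement, of the
  cohomology of the nerves: a cocycle on \<open>\<U>\<close> and a cocycle on \<open>\<V>\<close> represent the same element
  iff they become cohomologous on a common refinement.\<close>

type_synonym ('x, 'k) cech = "('x set set \<times> ('x set list \<Rightarrow> 'k)) set"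

definition cech_class :: "'x topology \<Rightarrow> 'x set \<Rightarrow> nat \<Rightarrow> 'x set set \<Rightarrow> ('x set list \<Rightarrow> 'k::field)
    \<Rightarrow> ('x, 'k) cech" where
  "cech_class X A q \<U> c = {(\<V>, d). open_cover X \<V> \<and> d \<in> cocycles \<V> A q \<and>
     (\<exists>\<W> p r. open_cover X \<W> \<and> refinement id \<W> \<U> p \<and> refinement id \<W> \<V> r \<and>
        (\<lambda>\<sigma>. pullback_cochain \<W> q p c \<sigma> - pullback_cochain \<W> q r d \<sigma>) \<in> coboundaries \<W> A q)}"

text \<open>The cohomology of the pair \<open>(X, A)\<close> as a vector space.  In the operations, the unions are
  over representatives and all the classes in a union coincide.  The ring components of the
  record play no role.\<close>

definition cech_cohomology ::
  "'x topology \<Rightarrow> 'x set \<Rightarrow> nat \<Rightarrow> ('k::field, ('x, 'k) cech) module" where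
  "cech_cohomology X A q = \<lparr>
     carrier = {cech_class X A q \<U> c | \<U> c. open_cover X \<U> \<and> c \<in> cocycles \<U> A q},
     mult = undefined, one = undefined,
     zero = cech_class X A q {topspace X} (\<lambda>_. 0),
     add = (\<lambda>x y. \<Union>{cech_class X A q \<U> (\<lambda>\<sigma>. c \<sigma> + d \<sigma>) | \<U> c d. (\<U>, c) \<in> x \<and> (\<U>, d) \<in> y}),
     smult = (\<lambda>a x. \<Union>{cech_class X A q \<U> (\<lambda>\<sigma>. a * c \<sigma>) | \<U> c. (\<U>, c) \<in> x})\<rparr>"

text \<open>The map induced by a continuous map of pairs \<open>g : (X, A) \<rightarrow> (Y, B)\<close>, defined on the
  cohomology of \<open>(Y, B)\<close>.\<close>

definition cech_map :: "'x topology \<Rightarrow> 'x set \<Rightarrow> nat \<Rightarrow> ('x \<Rightarrow> 'y) \<Rightarrow> ('y, 'k::field) cech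
    \<Rightarrow> ('x, 'k) cech" where
  "cech_map X A q g y = \<Union>{cech_class X A q \<V> (pullback_cochain \<V> q p c) | \<U> c \<V> p.
     (\<U>, c) \<in> y \<and> open_cover X \<V> \<and> refinement g \<V> \<U> p}"


section \<open>Isolated invariant sets\<close>

definition paracompact_space :: "'a topology \<Rightarrow> bool" where
  "paracompact_space M \<longleftrightarrow> (\<forall>\<U>. open_cover M \<U> \<longrightarrow>
     (\<exists>\<V>. open_cover M \<V> \<and> locally_finite_in M \<V> \<and> (\<forall>V\<in>\<V>. \<exists>U\<in>\<U>. V \<subseteq> U)))"

definition neighbourhood_of :: "'a topology \<Rightarrow> 'a set \<Rightarrow> 'a set \<Rightarrow> bool" where
  "neighbourhood_of M A X \<longleftrightarrow> A \<subseteq> topspace M \<and> X \<subseteq> M interior_of A"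

text \<open>A partially defined map \<open>f\<close> is given by a total function of which only the values on the
  open set \<open>D\<close> matter.\<close>

definition Inv :: "('a \<Rightarrow> 'a) \<Rightarrow> 'a set \<Rightarrow> 'a set" where
  "Inv f A = {x \<in> A. \<exists>p :: int \<Rightarrow> 'a. (\<forall>i. p i \<in> A) \<and> p 0 = x \<and> (\<forall>i. f (p i) = p (i + 1))}"

definition isolating_neighbourhood ::
  "'a topology \<Rightarrow> ('a \<Rightarrow> 'a) \<Rightarrow> 'a set \<Rightarrow> 'a set \<Rightarrow> 'a set \<Rightarrow> bool" where
  "isolating_neighbourhood M f D X A \<longleftrightarrow>
     compactin M A \<and> A \<subseteq> D \<and> neighbourhood_of M A X \<and> X = Inv f A"

definition isolated_invariant_set ::
  "'a topology \<Rightarrow> ('a \<Rightarrow> 'a) \<Rightarrow> 'a set \<Rightarrow> 'a set \<Rightarrow> bool" where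
  "isolated_invariant_set M f D X \<longleftrightarrow>
     compactin M X \<and> X \<subseteq> D \<and> f ` X = X \<and> (\<exists>A. isolating_neighbourhood M f D X A)"

definition continuum_in :: "'a topology \<Rightarrow> 'a set \<Rightarrow> bool" where
  "continuum_in M X \<longleftrightarrow> X \<noteq> {} \<and> compactin M X \<and> connectedin M X"

definition iterate_domain :: "('a \<Rightarrow> 'a) \<Rightarrow> 'a set \<Rightarrow> nat \<Rightarrow> 'a set" where
  "iterate_domain f D n = {x. \<forall>i<n. (f ^^ i) x \<in> D}"

definition attractor :: "'a topology \<Rightarrow> ('a \<Rightarrow> 'a) \<Rightarrow> 'a set \<Rightarrow> 'a set \<Rightarrow> bool" where
  "attractor M f D X \<longleftrightarrow>
     (\<forall>U. neighbourhood_of M U X \<longrightarrow>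
        (\<exists>P. neighbourhood_of M P X \<and> P \<subseteq> U \<and> P \<subseteq> D \<and> f ` P \<subseteq> P)) \<and>
     (\<exists>V. neighbourhood_of M V X \<and>
        (\<forall>x\<in>V. \<forall>U. neighbourhood_of M U X \<longrightarrow>
           (\<exists>k. \<forall>j\<ge>k. x \<in> iterate_domain f D j \<and> (f ^^ j) x \<in> U)))"


section \<open>Index pairs and the cohomological Conley index\<close>

definition index_pair ::
  "'a topology \<Rightarrow> ('a \<Rightarrow> 'a) \<Rightarrow> 'a set \<Rightarrow> 'a set \<Rightarrow> 'a set \<Rightarrow> 'a set \<Rightarrow> bool" where
  "index_pair M f D X N L \<longleftrightarrow>
     compactin M N \<and> compactin M L \<and> L \<subseteq> N \<and> N \<subseteq> D \<and>
     isolating_neighbourhood M f D X (M closure_of (N - L)) \<and> X \<inter> L = {} \<and>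
     f ` (N - L) \<subseteq> N \<and>
     f ` L \<inter> N \<subseteq> L"

text \<open>Points of \<open>N/L\<close> are \<open>Some x\<close> with \<open>x \<in> N - L\<close>, and the base point \<open>None\<close>, which stands
  for \<open>[L]\<close> and is isolated if \<open>L\<close> is empty.\<close>

definition collapse :: "'a set \<Rightarrow> 'a \<Rightarrow> 'a option" where
  "collapse L x = (if x \<in> L then None else Some x)"

definition quotient_space :: "'a topology \<Rightarrow> 'a set \<Rightarrow> 'a set \<Rightarrow> 'a option topology" where
  "quotient_space M N L = topology (\<lambda>U. U \<subseteq> insert None (Some ` (N - L)) \<and>
     openin (subtopology M N) {x \<in> topspace (subtopology M N). collapse L x \<in> U})"

lemma openin_quotient_space:
  "openin (quotient_space M N L) U \<longleftrightarrow> U \<subseteq> insert None (Some ` (N - L)) \<and>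
     openin (subtopology M N) {x \<in> topspace (subtopology M N). collapse L x \<in> U}"
proof -
  let ?Y = "subtopology M N" and ?Q = "insert None (Some ` (N - L))"
  let ?P = "\<lambda>U. U \<subseteq> ?Q \<and> openin ?Y {x \<in> topspace ?Y. collapse L x \<in> U}"
  have "istopology ?P"
    unfolding istopology_def
  proof (intro conjI allI impI)
    fix S T assume "?P S" "?P T"
    moreover have "{x \<in> topspace ?Y. collapse L x \<in> S \<inter> T} =
        {x \<in> topspace ?Y. collapse L x \<in> S} \<inter> {x \<in> topspace ?Y. collapse L x \<in> T}"
      by auto
    ultimately show "S \<inter> T \<subseteq> ?Q" "openin ?Y {x \<in> topspace ?Y. collapse L x \<in> S \<inter> T}"
      by (blast, simp only: openin_Int)
  next
    fix \<K> assume K: "\<forall>K\<in>\<K>. ?P K"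
    then show "\<Union>\<K> \<subseteq> ?Q" by blast
    have eq: "{x \<in> topspace ?Y. collapse L x \<in> \<Union>\<K>} =
        (\<Union>K\<in>\<K>. {x \<in> topspace ?Y. collapse L x \<in> K})"
      by auto
    show "openin ?Y {x \<in> topspace ?Y. collapse L x \<in> \<Union>\<K>}"
      unfolding eq by (rule openin_Union) (use K in blast)
  qed
  then show ?thesis
    unfolding quotient_space_def by (simp add: topology_inverse')
qed

lemma topspace_quotient_space:
  "N \<subseteq> topspace M \<Longrightarrow> topspace (quotient_space M N L) = insert None (Some ` (N - L))"
proof -
  assume N: "N \<subseteq> topspace M"
  have "{x \<in> topspace (subtopology M N). collapse L x \<in> insert None (Some ` (N - L))} =
      topspace (subtopology M N)"
    using N by (auto simp: collapse_def)
  then have "openin (quotient_space M N L) (insert None (Some ` (N - L)))"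
    by (simp only: openin_quotient_space openin_topspace order_refl simp_thms)
  moreover have "topspace (quotient_space M N L) \<subseteq> insert None (Some ` (N - L))"
    using openin_topspace[of "quotient_space M N L"] unfolding openin_quotient_space[where U = "topspace _"] by (rule conjunct1)
  ultimately show ?thesis
    by (intro subset_antisym openin_subset)
qed

definition index_map :: "('a \<Rightarrow> 'a) \<Rightarrow> 'a set \<Rightarrow> 'a set \<Rightarrow> 'a option \<Rightarrow> 'a option" where
  "index_map f N L z = (case z of None \<Rightarrow> None
     | Some x \<Rightarrow> if x \<in> N - L \<and> f x \<in> N - L then Some (f x) else None)"

abbreviation pointed_cohomology :: "'a topology \<Rightarrow> 'a set \<Rightarrow> 'a set \<Rightarrow> nat
    \<Rightarrow> ('k::field, ('a option, 'k) cech) module" where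
  "pointed_cohomology M N L q \<equiv> cech_cohomology (quotient_space M N L) {None} q"

abbreviation index_cohomology_map :: "'a topology \<Rightarrow> ('a \<Rightarrow> 'a) \<Rightarrow> 'a set \<Rightarrow> 'a set \<Rightarrow> nat
    \<Rightarrow> ('a option, 'k::field) cech \<Rightarrow> ('a option, 'k) cech" where
  "index_cohomology_map M f N L q \<equiv> cech_map (quotient_space M N L) {None} q (index_map f N L)"

text \<open>The shift equivalence class, among endomorphisms of vector spaces whose elements have the
  type of the elements of the cohomology of \<open>N/L\<close>.  The union over all index pairs is a single
  class since any two index pairs give shift equivalent maps.\<close>

definition conley_index :: "'a topology \<Rightarrow> ('a \<Rightarrow> 'a) \<Rightarrow> 'a set \<Rightarrow> 'a set \<Rightarrow> nat
    \<Rightarrow> (('k::field, ('a option, 'k) cech) module \<times>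
        (('a option, 'k) cech \<Rightarrow> ('a option, 'k) cech)) set" where
  "conley_index M f D X q = {VT. \<exists>N L. index_pair M f D X N L \<and>
     shift_equivalent VT (pointed_cohomology M N L q, index_cohomology_map M f N L q)}"

text \<open>Shift equivalent endomorphisms of finite dimensional spaces have the same trace, so any
  finite dimensional representative computes the trace of the class.\<close>

definition shift_class_trace :: "(('k::field, 'v) module \<times> ('v \<Rightarrow> 'v)) set \<Rightarrow> 'k" where
  "shift_class_trace C =
     (THE t. \<exists>(V, T)\<in>C. vectorspace.fin_dim class_ring V \<and> t = linear_trace V T)"


section \<open>The compactified unstable manifold\<close>

definition unstable_compactification ::
  "'a topology \<Rightarrow> ('a \<Rightarrow> 'a) \<Rightarrow> 'a set \<Rightarrow> 'a set \<Rightarrow> (nat \<Rightarrow> 'a option) topology" where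
  "unstable_compactification M f N L =
     subtopology (product_topology (\<lambda>_. quotient_space M N L) UNIV)
       {\<xi>. \<forall>i. index_map f N L (\<xi> (Suc i)) = \<xi> i}"

definition infinity_point :: "nat \<Rightarrow> 'a option" where
  "infinity_point = (\<lambda>_. None)"

definition lifted_map ::
  "('a \<Rightarrow> 'a) \<Rightarrow> 'a set \<Rightarrow> 'a set \<Rightarrow> (nat \<Rightarrow> 'a option) \<Rightarrow> nat \<Rightarrow> 'a option" where
  "lifted_map f N L \<xi> = case_nat (index_map f N L (\<xi> 0)) \<xi>"

definition lifted_set ::
  "'a topology \<Rightarrow> ('a \<Rightarrow> 'a) \<Rightarrow> 'a set \<Rightarrow> 'a set \<Rightarrow> 'a set \<Rightarrow> (nat \<Rightarrow> 'a option) set" where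
  "lifted_set M f N L X =
     {\<xi> \<in> topspace (unstable_compactification M f N L). \<forall>i. \<xi> i \<in> Some ` X}"

definition essential_quasicomponents ::
  "'a topology \<Rightarrow> ('a \<Rightarrow> 'a) \<Rightarrow> 'a set \<Rightarrow> 'a set \<Rightarrow> 'a set \<Rightarrow> (nat \<Rightarrow> 'a option) set set" where
  "essential_quasicomponents M f N L X =
     (let W = unstable_compactification M f N L; X' = lifted_set M f N L X in
      {F \<in> quasi_components_of (subtopology W (topspace W - (X' \<union> {infinity_point}))).
         infinity_point \<in> W closure_of F \<and> W closure_of F \<inter> X' \<noteq> {}})"

text \<open>The action of the inverse of the lifted map on subsets.\<close>

definition quasicomponent_shift :: "'a topology \<Rightarrow> ('a \<Rightarrow> 'a) \<Rightarrow> 'a set \<Rightarrow> 'a set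
    \<Rightarrow> (nat \<Rightarrow> 'a option) set \<Rightarrow> (nat \<Rightarrow> 'a option) set" where
  "quasicomponent_shift M f N L F =
     inv_into (topspace (unstable_compactification M f N L)) (lifted_map f N L) ` F"

end

theory Submission imports Defs
begin

text \<open>The unstable compactification \<open>W\<close> is the inverse limit of the index map, so \<open>H\<^sup>1(W)\<close> is
  the direct limit of \<open>H\<^sup>1(N/L)\<close>; on a finite dimensional space passing to this limit only kills
  the nilpotent part, and the trace of the Conley index of \<open>f\<^sup>n\<close> is the trace of the lifted map
  on \<open>H\<^sup>1(W)\<close>.  It splits into the trace on the image of \<open>i\<^sup>*\<close> and the trace on its kernel.

  For the kernel, let \<open>K\<close> be the lifted invariant set and \<open>p\<close> the point at infinity: \<open>K\<close>
  repels and \<open>p\<close> attracts every other orbit.  A class that vanishes on \<open>K\<close> has a potential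
  near \<open>K\<close> and another one near \<open>p\<close>.  As the kernel is invariant and finite dimensional, the
  dynamics propagate these to potentials \<open>\<alpha>\<close> on \<open>W - {p}\<close> and \<open>\<beta>\<close> on \<open>W - K\<close>.  The difference
  \<open>\<alpha> - \<beta>\<close> is locally constant on \<open>W - (K \<union> {p})\<close>, hence constant on quasicomponents, and the
  class is zero iff \<open>\<alpha> - \<beta>\<close> takes a single value on the essential ones.  So the kernel is the
  space of functions on \<open>J\<close> modulo constants, and the lifted map acts by permuting \<open>J\<close>, which
  gives the trace \<open>#Fix - 1\<close> unless \<open>J\<close> is empty.  The latter happens only when \<open>W = K \<union> {p}\<close>,
  i.e. when \<open>X\<close> is an attractor, and then \<open>i\<^sup>*\<close> is injective.\<close>

section \<open>Traces of endomorphisms\<close>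

text \<open>The index pair with finite dimensional cohomology need not be the one in which
  \<open>W\<close> is formed. Two index pairs of \<open>f\<close>, and likewise a power of an index
  map and an index pair of \<open>f ^^ n\<close>, are linked by maps \<open>r\<close> and
  \<open>s\<close> between the quotients whose composites are powers of the index maps; what is
  known for one quotient is moved along them. Finite dimension of the first cohomology of
  \<open>W\<close> is derived: a power of the lifted map moves each class into the image of a finite
  dimensional space. The lifted map is a homeomorphism, so it acts bijectively on this image, which
  must then be everything. Potentials near \<open>K\<close> are equivariant only up to a locally
  constant error. Connectedness of \<open>X\<close>, inherited by \<open>K\<close>, makes this error
  a constant, and only then can they be continued along orbits. If \<open>J\<close> is empty,
  \<open>K\<close> and infinity are separated by a clopen set; orbits running from \<open>K\<close>
  to infinity are excluded by the finite dimension of the cohomology in degree zero.\<close>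

abbreviation is_vs :: "('k::field, 'v) module \<Rightarrow> bool" where
  "is_vs V \<equiv> vectorspace class_ring V"

text \<open>Linearity apart from the vector space axioms of the two sides, so that it survives a
  restriction of the carrier; \<open>linear_map_iff\<close> relates it to
  \<open>linear_map\<close>.\<close>

definition lin_map :: "('k::field, 'v) module \<Rightarrow> ('k, 'w) module \<Rightarrow> ('v \<Rightarrow> 'w) \<Rightarrow> bool" where
  "lin_map V W T \<longleftrightarrow> (\<forall>v\<in>carrier V. T v \<in> carrier W) \<and>
     (\<forall>v\<in>carrier V. \<forall>w\<in>carrier V. T (v \<oplus>\<^bsub>V\<^esub> w) = T v \<oplus>\<^bsub>W\<^esub> T w) \<and>
     (\<forall>a. \<forall>v\<in>carrier V. T (a \<odot>\<^bsub>V\<^esub> v) = a \<odot>\<^bsub>W\<^esub> T v)"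

definition functional :: "('k::field, 'v) module \<Rightarrow> ('v \<Rightarrow> 'k) \<Rightarrow> bool" where
  "functional V f \<longleftrightarrow> (\<forall>v\<in>carrier V. \<forall>w\<in>carrier V. f (v \<oplus>\<^bsub>V\<^esub> w) = f v + f w) \<and>
     (\<forall>a. \<forall>v\<in>carrier V. f (a \<odot>\<^bsub>V\<^esub> v) = a * f v)"

text \<open>A finite basis with its coordinate functionals. The last clause, that the functionals
  separate vectors, replaces spanning (see \<open>dual_system_expand\<close>). A family indexed by
  \<open>I\<close>, rather than a set of vectors, lets essential quasicomponents index a basis
  later.\<close>

definition dual_system ::
  "('k::field, 'v) module \<Rightarrow> 'i set \<Rightarrow> ('i \<Rightarrow> 'v) \<Rightarrow> ('i \<Rightarrow> 'v \<Rightarrow> 'k) \<Rightarrow> bool" where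
  "dual_system V I b e \<longleftrightarrow> finite I \<and> (\<forall>i\<in>I. b i \<in> carrier V) \<and> (\<forall>i\<in>I. functional V (e i)) \<and>
     (\<forall>i\<in>I. \<forall>j\<in>I. e i (b j) = (if i = j then 1 else 0)) \<and>
     (\<forall>v\<in>carrier V. (\<forall>i\<in>I. e i v = 0) \<longrightarrow> v = \<zero>\<^bsub>V\<^esub>)"

lemma linear_map_iff: "linear_map class_ring V W T \<longleftrightarrow> is_vs V \<and> is_vs W \<and> lin_map V W T"
  unfolding linear_map_def mod_hom_def mod_hom_axioms_def module_hom_def lin_map_def vectorspace_def
  by auto

lemma lin_mapD:
  assumes "lin_map V W T" "v \<in> carrier V"
  shows "T v \<in> carrier W" "w \<in> carrier V \<Longrightarrow> T (v \<oplus>\<^bsub>V\<^esub> w) = T v \<oplus>\<^bsub>W\<^esub> T w"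
    "T (a \<odot>\<^bsub>V\<^esub> v) = a \<odot>\<^bsub>W\<^esub> T v"
  using assms unfolding lin_map_def by auto

lemma functionalD:
  assumes "functional V f" "v \<in> carrier V"
  shows "w \<in> carrier V \<Longrightarrow> f (v \<oplus>\<^bsub>V\<^esub> w) = f v + f w" "f (a \<odot>\<^bsub>V\<^esub> v) = a * f v"
  using assms unfolding functional_def by auto

lemma lin_map_comp: "lin_map V W S \<Longrightarrow> lin_map W U T \<Longrightarrow> lin_map V U (\<lambda>v. T (S v))"
  unfolding lin_map_def by auto

lemma lin_map_funpow: "lin_map V V T \<Longrightarrow> lin_map V V (T ^^ n)"
proof (induction n)
  case (Suc n) then show ?case using lin_map_comp[of V V "T ^^ n" V T] by (simp add: comp_def)
qed (auto simp: lin_map_def)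

lemma funpow_closed:
  assumes "\<And>v. v \<in> A \<Longrightarrow> T v \<in> A" "v \<in> A" shows "(T ^^ n) v \<in> A"
  using assms by (induction n) auto

lemma functional_comp: "lin_map V W T \<Longrightarrow> functional W f \<Longrightarrow> functional V (\<lambda>v. f (T v))"
  unfolding lin_map_def functional_def by auto

lemma vs_zero_eq:
  fixes V :: "('k::field, 'v) module"
  assumes "is_vs V" "v \<in> carrier V" shows "0 \<odot>\<^bsub>V\<^esub> v = \<zero>\<^bsub>V\<^esub>"
proof -
  interpret vectorspace "class_ring :: 'k ring" V by fact
  show ?thesis using lmult_0[OF assms(2)] by simp
qed

lemma functional_zero: "is_vs V \<Longrightarrow> functional V f \<Longrightarrow> f \<zero>\<^bsub>V\<^esub> = 0"
proof -
  assume V: "is_vs V" and f: "functional V f"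
  interpret vectorspace class_ring V by fact
  have z: "\<zero>\<^bsub>V\<^esub> \<in> carrier V" by (rule M.zero_closed)
  show ?thesis using functionalD(2)[OF f z, of 0] vs_zero_eq[OF V z] by simp
qed

lemma lin_map_zero: "is_vs V \<Longrightarrow> is_vs W \<Longrightarrow> lin_map V W f \<Longrightarrow> f \<zero>\<^bsub>V\<^esub> = \<zero>\<^bsub>W\<^esub>"
proof -
  assume V: "is_vs V" and W: "is_vs W" and f: "lin_map V W f"
  interpret vectorspace class_ring V by fact
  have z: "\<zero>\<^bsub>V\<^esub> \<in> carrier V" by (rule M.zero_closed)
  show ?thesis using lin_mapD(3)[OF f z, of 0] vs_zero_eq[OF V z] vs_zero_eq[OF W lin_mapD(1)[OF f z]] by simp
qed

lemma finsum_in_vs: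
  fixes V :: "('k::field, 'v) module"
  assumes V: "is_vs V" and "finite I" "\<And>i. i \<in> I \<Longrightarrow> g i \<in> carrier V"
  shows "finsum V g I \<in> carrier V"
    "functional V f \<Longrightarrow> f (finsum V g I) = (\<Sum>i\<in>I. f (g i))"
    "is_vs W \<Longrightarrow> lin_map V W T \<Longrightarrow> T (finsum V g I) = finsum W (\<lambda>i. T (g i)) I"
proof -
  interpret V: vectorspace "class_ring :: 'k ring" V by fact
  show *: "finsum V g I \<in> carrier V" using assms by (auto intro: V.M.finsum_closed)
  show "functional V f \<Longrightarrow> f (finsum V g I) = (\<Sum>i\<in>I. f (g i))"
    using assms(2,3)
  proof (induction I)
    case empty then show ?case using functional_zero[OF V] by simp
  next
    case (insert x F)
    have "finsum V g F \<in> carrier V" using insert by (auto intro: V.M.finsum_closed)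
    then show ?case using insert by (simp add: V.M.finsum_insert functionalD Pi_iff)
  qed
  assume W: "is_vs W" and T: "lin_map V W T"
  interpret W: vectorspace "class_ring :: 'k ring" W by fact
  show "T (finsum V g I) = finsum W (\<lambda>i. T (g i)) I"
    using assms(2,3)
  proof (induction I)
    case empty then show ?case using lin_map_zero[OF V W T] by simp
  next
    case (insert x F)
    have "finsum V g F \<in> carrier V" using insert by (auto intro: V.M.finsum_closed)
    then show ?case using insert T by (simp add: V.M.finsum_insert W.M.finsum_insert lin_mapD Pi_iff)
  qed
qed

lemma functional_lincomb:
  fixes V :: "('k::field, 'v) module"
  assumes V: "is_vs V" and "finite B" "B \<subseteq> carrier V" "functional V f"
  shows "f (module.lincomb V a B) = (\<Sum>b\<in>B. a b * f b)"
proof -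
  interpret V: vectorspace "class_ring :: 'k ring" V by fact
  have "f (module.lincomb V a B) = (\<Sum>b\<in>B. f (a b \<odot>\<^bsub>V\<^esub> b))"
    unfolding V.lincomb_def
    by (rule finsum_in_vs(2)[OF V]) (use assms in auto)
  also have "\<dots> = (\<Sum>b\<in>B. a b * f b)"
    by (rule sum.cong) (use assms in \<open>auto simp: functionalD\<close>)
  finally show ?thesis .
qed

lemma vs_minus:
  fixes V :: "('k::field, 'v) module"
  assumes V: "is_vs V" and "v \<in> carrier V" "w \<in> carrier V"
  shows "v \<oplus>\<^bsub>V\<^esub> (-1) \<odot>\<^bsub>V\<^esub> w = \<zero>\<^bsub>V\<^esub> \<Longrightarrow> v = w" "v \<oplus>\<^bsub>V\<^esub> (-1) \<odot>\<^bsub>V\<^esub> w \<in> carrier V"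
    "functional V f \<Longrightarrow> f (v \<oplus>\<^bsub>V\<^esub> (-1) \<odot>\<^bsub>V\<^esub> w) = f v - f w"
proof -
  interpret V: vectorspace "class_ring :: 'k ring" V by fact
  have w: "(-1) \<odot>\<^bsub>V\<^esub> w \<in> carrier V" using assms by auto
  have m: "(-1) \<odot>\<^bsub>V\<^esub> w = \<ominus>\<^bsub>V\<^esub> w"
    using V.smult_minus_1[of w] assms by (simp add: class_ring_simps)
  show "v \<oplus>\<^bsub>V\<^esub> (-1) \<odot>\<^bsub>V\<^esub> w \<in> carrier V" using assms w by auto
  show "v = w" if "v \<oplus>\<^bsub>V\<^esub> (-1) \<odot>\<^bsub>V\<^esub> w = \<zero>\<^bsub>V\<^esub>"
    using V.M.minus_equality[of v "\<ominus>\<^bsub>V\<^esub> w"] that assms unfolding m by simp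
  show "f (v \<oplus>\<^bsub>V\<^esub> (-1) \<odot>\<^bsub>V\<^esub> w) = f v - f w" if "functional V f"
    using that assms w by (simp add: functionalD)
qed

lemma dual_system_finite: "dual_system V I b e \<Longrightarrow> finite I"
  and dual_system_carrier: "dual_system V I b e \<Longrightarrow> i \<in> I \<Longrightarrow> b i \<in> carrier V"
  and dual_system_functional: "dual_system V I b e \<Longrightarrow> i \<in> I \<Longrightarrow> functional V (e i)"
  and dual_system_delta: "dual_system V I b e \<Longrightarrow> i \<in> I \<Longrightarrow> j \<in> I \<Longrightarrow> e i (b j) = (if i = j then 1 else 0)"
  and dual_system_zero: "dual_system V I b e \<Longrightarrow> v \<in> carrier V \<Longrightarrow> (\<And>i. i \<in> I \<Longrightarrow> e i v = 0) \<Longrightarrow> v = \<zero>\<^bsub>V\<^esub>"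
  unfolding dual_system_def by blast+

lemma dual_system_expand:
  fixes V :: "('k::field, 'v) module"
  assumes V: "is_vs V" and d: "dual_system V I b e" and v: "v \<in> carrier V"
  shows "v = finsum V (\<lambda>i. e i v \<odot>\<^bsub>V\<^esub> b i) I"
    "functional V f \<Longrightarrow> f v = (\<Sum>i\<in>I. e i v * f (b i))"
proof -
  interpret V: vectorspace "class_ring :: 'k ring" V by fact
  have I: "finite I" using d by (rule dual_system_finite)
  let ?s = "finsum V (\<lambda>i. e i v \<odot>\<^bsub>V\<^esub> b i) I"
  have c: "e i v \<odot>\<^bsub>V\<^esub> b i \<in> carrier V" if "i \<in> I" for i
    using dual_system_carrier[OF d that] by auto
  have s: "?s \<in> carrier V" by (rule finsum_in_vs(1)[OF V I c])
  have fs: "f ?s = (\<Sum>i\<in>I. e i v * f (b i))" if "functional V f" for f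
  proof -
    have "f ?s = (\<Sum>i\<in>I. f (e i v \<odot>\<^bsub>V\<^esub> b i))"
      by (rule finsum_in_vs(2)[OF V I c that])
    also have "\<dots> = (\<Sum>i\<in>I. e i v * f (b i))"
      by (rule sum.cong) (use that dual_system_carrier[OF d] in \<open>auto simp: functionalD\<close>)
    finally show ?thesis .
  qed
  show eq: "v = ?s"
  proof (rule vs_minus(1)[OF V v s], rule dual_system_zero[OF d vs_minus(2)[OF V v s]])
    fix j assume j: "j \<in> I"
    have fj: "functional V (e j)" using d j by (rule dual_system_functional)
    have "e j ?s = (\<Sum>i\<in>I. e i v * (if j = i then 1 else 0))"
      unfolding fs[OF fj] by (rule sum.cong) (use dual_system_delta[OF d j] in auto)
    also have "\<dots> = e j v" using I j by (simp add: if_distrib cong: if_cong)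
    finally show "e j (v \<oplus>\<^bsub>V\<^esub> (-1) \<odot>\<^bsub>V\<^esub> ?s) = 0"
      using vs_minus(3)[OF V v s fj] by simp
  qed
  show "f v = (\<Sum>i\<in>I. e i v * f (b i))" if "functional V f"
    using fs[OF that] eq by simp
qed

text \<open>Both traces equal the double sum of \<open>e' j (T (b i)) * e i (b' j)\<close>: on one
  side \<open>T (b i)\<close> is expanded in the second system, on the other \<open>b' j\<close> in
  the first.\<close>

lemma dual_trace_independent:
  fixes V :: "('k::field, 'v) module"
  assumes V: "is_vs V" and d: "dual_system V I b e" and d': "dual_system V J b' e'"
    and T: "lin_map V V T"
  shows "(\<Sum>i\<in>I. e i (T (b i))) = (\<Sum>j\<in>J. e' j (T (b' j)))"
proof -
  have "(\<Sum>i\<in>I. e i (T (b i))) = (\<Sum>i\<in>I. \<Sum>j\<in>J. e' j (T (b i)) * e i (b' j))"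
    by (intro sum.cong refl dual_system_expand(2)[OF V d'])
      (use dual_system_functional[OF d] dual_system_carrier[OF d] lin_mapD(1)[OF T] in auto)
  also have "\<dots> = (\<Sum>j\<in>J. \<Sum>i\<in>I. e i (b' j) * e' j (T (b i)))"
    by (subst sum.swap) (simp add: mult.commute)
  also have "\<dots> = (\<Sum>j\<in>J. e' j (T (b' j)))"
  proof (rule sum.cong[OF refl])
    fix j assume j: "j \<in> J"
    show "(\<Sum>i\<in>I. e i (b' j) * e' j (T (b i))) = e' j (T (b' j))"
      using dual_system_expand(2)[OF V d dual_system_carrier[OF d' j]
        functional_comp[OF T dual_system_functional[OF d' j]]] by simp
  qed
  finally show ?thesis .
qed

lemma basis_dual_system:
  fixes V :: "('k::field, 'v) module"
  assumes V: "is_vs V" and B: "finite B" "vectorspace.basis class_ring V B"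
  obtains e where "dual_system V B (\<lambda>b. b) e"
    "\<And>a b. b \<in> B \<Longrightarrow> e b (module.lincomb V a B) = a b"
proof -
  interpret V: vectorspace "class_ring :: 'k ring" V by fact
  have BV: "B \<subseteq> carrier V" using B V.basis_def by auto
  have ex1: "\<exists>!a. a \<in> B \<rightarrow>\<^sub>E UNIV \<and> V.lincomb a B = v" if "v \<in> carrier V" for v
    using V.basis_criterion[OF B(1) BV] B(2) that by auto
  define c where "c v = (THE a. a \<in> B \<rightarrow>\<^sub>E UNIV \<and> V.lincomb a B = v)" for v
  have c: "c v \<in> B \<rightarrow>\<^sub>E UNIV" "V.lincomb (c v) B = v" if "v \<in> carrier V" for v
    using theI'[OF ex1[OF that]] unfolding c_def by auto
  have c': "c (V.lincomb a B) = restrict a B" for a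
  proof -
    have v: "V.lincomb a B \<in> carrier V" using BV by auto
    have "V.lincomb (restrict a B) B = V.lincomb a B"
      by (rule V.lincomb_cong) (use BV in auto)
    then show ?thesis using ex1[OF v] c[OF v] by auto
  qed
  define e where "e b v = c v b" for b v
  have e: "e b (V.lincomb a B) = a b" if "b \<in> B" for a b
    unfolding e_def c' using that by simp
  have lin1: "V.lincomb a B \<oplus>\<^bsub>V\<^esub> V.lincomb a' B = V.lincomb (\<lambda>b. a b + a' b) B" for a a'
    using V.lincomb_sum[OF B(1) BV, of a a'] by simp
  have lin2: "x \<odot>\<^bsub>V\<^esub> V.lincomb a B = V.lincomb (\<lambda>b. x * a b) B" for x a
    using V.lincomb_smult[OF BV, of a x] by simp
  have f: "functional V (e b)" if "b \<in> B" for b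
    unfolding functional_def
  proof (intro conjI ballI allI)
    fix v w assume v: "v \<in> carrier V" and w: "w \<in> carrier V"
    show "e b (v \<oplus>\<^bsub>V\<^esub> w) = e b v + e b w"
      using lin1[of "c v" "c w"] e[OF that, of "\<lambda>b. c v b + c w b"] c(2)[OF v] c(2)[OF w]
      by (simp add: e_def)
    show "e b (x \<odot>\<^bsub>V\<^esub> v) = x * e b v" for x
      using lin2[of x "c v"] e[OF that, of "\<lambda>b. x * c v b"] c(2)[OF v] by (simp add: e_def)
  qed
  have d: "e b b' = (if b = b' then 1 else 0)" if b: "b \<in> B" "b' \<in> B" for b b'
  proof -
    have "b' = V.lincomb (\<lambda>b. if b = b' then 1 else 0) B"
    proof -
      have "V.lincomb (\<lambda>b. if b = b' then 1 else 0) B =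
          (1 \<odot>\<^bsub>V\<^esub> b') \<oplus>\<^bsub>V\<^esub> V.lincomb (\<lambda>b. if b = b' then 1 else 0) (B - {b'})"
        using V.lincomb_del2[OF B(1) BV _ b(2), of "\<lambda>b. if b = b' then 1 else 0"] by auto
      also have "V.lincomb (\<lambda>b. if b = b' then 1 else 0) (B - {b'}) = \<zero>\<^bsub>V\<^esub>"
      proof -
        have "V.lincomb (\<lambda>b. if b = b' then 1 else 0) (B - {b'}) = finsum V (\<lambda>b. \<zero>\<^bsub>V\<^esub>) (B - {b'})"
          unfolding V.lincomb_def
          by (rule V.M.finsum_cong') (use BV in \<open>auto simp: vs_zero_eq[OF V]\<close>)
        then show ?thesis by simp
      qed
      finally have "V.lincomb (\<lambda>b. if b = b' then 1 else 0) B = 1 \<odot>\<^bsub>V\<^esub> b'"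
        using BV b by (simp add: subset_iff)
      moreover have "1 \<odot>\<^bsub>V\<^esub> b' = b'" using V.smult_one[of b'] BV b by auto
      ultimately show ?thesis by simp
    qed
    then have "e b b' = e b (V.lincomb (\<lambda>b. if b = b' then 1 else 0) B)" by (rule arg_cong)
    then show ?thesis by (simp add: e[OF b(1)])
  qed
  have z: "v = \<zero>\<^bsub>V\<^esub>" if v: "v \<in> carrier V" "\<forall>b\<in>B. e b v = 0" for v
  proof -
    have "v = V.lincomb (c v) B" using c[OF v(1)] by simp
    also have "\<dots> = finsum V (\<lambda>b. \<zero>\<^bsub>V\<^esub>) B"
      unfolding V.lincomb_def
      by (rule V.M.finsum_cong') (use BV v in \<open>auto simp: vs_zero_eq[OF V] e_def\<close>)
    finally show ?thesis by simp
  qed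
  show ?thesis
    by (rule that[of e]) (use e f d z B BV in \<open>auto simp: dual_system_def\<close>)
qed

lemma dual_system_basis:
  fixes V :: "('k::field, 'v) module"
  assumes V: "is_vs V" and d: "dual_system V I b e"
  shows "inj_on b I" "finite (b ` I)" "vectorspace.basis class_ring V (b ` I)"
    "v \<in> carrier V \<Longrightarrow> v = module.lincomb V (\<lambda>w. e (inv_into I b w) v) (b ` I)"
proof -
  interpret V: vectorspace "class_ring :: 'k ring" V by fact
  show inj: "inj_on b I"
    using dual_system_delta[OF d] by (metis inj_onI one_neq_zero)
  show fin: "finite (b ` I)" using dual_system_finite[OF d] by simp
  have bV: "b ` I \<subseteq> carrier V" using dual_system_carrier[OF d] by auto
  have ex: "v = V.lincomb (\<lambda>w. e (inv_into I b w) v) (b ` I)" if v: "v \<in> carrier V" for v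
  proof -
    have "v = finsum V (\<lambda>i. e i v \<odot>\<^bsub>V\<^esub> b i) I" by (rule dual_system_expand(1)[OF V d v])
    also have "\<dots> = finsum V (\<lambda>i. e (inv_into I b (b i)) v \<odot>\<^bsub>V\<^esub> b i) I"
      by (rule V.M.finsum_cong') (use inj dual_system_carrier[OF d] in auto)
    also have "\<dots> = V.lincomb (\<lambda>w. e (inv_into I b w) v) (b ` I)"
      unfolding V.lincomb_def
      by (rule V.M.add.finprod_reindex[symmetric]) (use inj bV in auto)
    finally show ?thesis .
  qed
  then show "v \<in> carrier V \<Longrightarrow> v = V.lincomb (\<lambda>w. e (inv_into I b w) v) (b ` I)" .
  have sp: "V.span (b ` I) = carrier V"
  proof
    show "V.span (b ` I) \<subseteq> carrier V" by (rule V.span_is_subset2[OF bV])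
    show "carrier V \<subseteq> V.span (b ` I)"
      using ex fin unfolding V.span_def by fastforce
  qed
  have "V.lin_indpt (b ` I)"
  proof (rule V.finite_lin_indpt2[OF fin bV])
    fix a assume a: "V.lincomb a (b ` I) = \<zero>\<^bsub>V\<^esub>"
    show "\<forall>v\<in>b ` I. a v = \<zero>\<^bsub>class_ring\<^esub>"
    proof safe
      fix i assume i: "i \<in> I"
      have "0 = e i (V.lincomb a (b ` I))"
        using functional_zero[OF V dual_system_functional[OF d i]] a by simp
      also have "\<dots> = (\<Sum>w\<in>b ` I. a w * e i w)"
        by (rule functional_lincomb[OF V fin bV dual_system_functional[OF d i]])
      also have "\<dots> = (\<Sum>j\<in>I. a (b j) * e i (b j))"
        by (rule sum.reindex_cong[OF inj]) auto
      also have "\<dots> = (\<Sum>j\<in>I. a (b j) * (if i = j then 1 else 0))"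
        by (rule sum.cong) (use dual_system_delta[OF d i] in auto)
      also have "\<dots> = a (b i)" using dual_system_finite[OF d] i by (simp add: if_distrib cong: if_cong)
      finally show "a (b i) = \<zero>\<^bsub>class_ring\<^esub>" by simp
    qed
  qed
  then show "V.basis (b ` I)" using sp bV unfolding V.basis_def by auto
qed

lemma linear_trace_dual_system:
  fixes V :: "('k::field, 'v) module"
  assumes V: "is_vs V" and d: "dual_system V I b e" and T: "lin_map V V T"
  shows "linear_trace V T = (\<Sum>i\<in>I. e i (T (b i)))"
  unfolding linear_trace_def
proof (rule the_equality)
  note B = dual_system_basis[OF V d]
  show "\<exists>B a. finite B \<and> vectorspace.basis class_ring V B \<and>
     (\<forall>b\<in>B. T b = module.lincomb V (a b) B) \<and> (\<Sum>i\<in>I. e i (T (b i))) = (\<Sum>b\<in>B. a b b)"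
  proof (intro exI conjI)
    show "finite (b ` I)" "vectorspace.basis class_ring V (b ` I)" using B by auto
    show "\<forall>v\<in>b ` I. T v = module.lincomb V ((\<lambda>v w. e (inv_into I b w) (T v)) v) (b ` I)"
      using B(4) dual_system_carrier[OF d] lin_mapD(1)[OF T] by auto
    show "(\<Sum>i\<in>I. e i (T (b i))) = (\<Sum>v\<in>b ` I. (\<lambda>v w. e (inv_into I b w) (T v)) v v)"
      by (subst sum.reindex[OF B(1)]) (use B(1) in simp)
  qed
next
  fix t assume "\<exists>B a. finite B \<and> vectorspace.basis class_ring V B \<and>
     (\<forall>b\<in>B. T b = module.lincomb V (a b) B) \<and> t = (\<Sum>b\<in>B. a b b)"
  then obtain B a where B: "finite B" "vectorspace.basis class_ring V B"
    "\<And>b. b \<in> B \<Longrightarrow> T b = module.lincomb V (a b) B" "t = (\<Sum>b\<in>B. a b b)" by blast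
  obtain e' where e': "dual_system V B (\<lambda>b. b) e'" "\<And>a b. b \<in> B \<Longrightarrow> e' b (module.lincomb V a B) = a b"
    using basis_dual_system[OF V B(1,2)] by metis
  have "t = (\<Sum>b\<in>B. e' b (T b))" unfolding B(4) by (rule sum.cong) (use B(3) e'(2) in auto)
  also have "\<dots> = (\<Sum>i\<in>I. e i (T (b i)))" by (rule dual_trace_independent[OF V e'(1) d T])
  finally show "t = (\<Sum>i\<in>I. e i (T (b i)))" .
qed

section \<open>Invariant subspaces and additivity of the trace\<close>

definition is_sub :: "('k::field, 'v) module \<Rightarrow> 'v set \<Rightarrow> bool" where
  "is_sub V U \<longleftrightarrow> U \<subseteq> carrier V \<and> \<zero>\<^bsub>V\<^esub> \<in> U \<and> (\<forall>v\<in>U. \<forall>w\<in>U. v \<oplus>\<^bsub>V\<^esub> w \<in> U) \<and>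
     (\<forall>a. \<forall>v\<in>U. a \<odot>\<^bsub>V\<^esub> v \<in> U)"

definition fin_dim_vs :: "('k::field, 'v) module \<Rightarrow> bool" where
  "fin_dim_vs V \<longleftrightarrow> is_vs V \<and> (\<exists>B e. dual_system V B (\<lambda>b. b) e)"

lemma is_sub_submodule:
  fixes V :: "('k::field, 'v) module"
  assumes "is_vs V" "is_sub V U" shows "submodule class_ring U V"
  using assms unfolding submodule_def is_sub_def vectorspace_def by auto

lemma is_sub_vs:
  fixes V :: "('k::field, 'v) module"
  assumes "is_vs V" "is_sub V U" shows "is_vs (V\<lparr>carrier := U\<rparr>)"
proof -
  interpret vectorspace "class_ring :: 'k ring" V by fact
  have "subspace class_ring U V" using is_sub_submodule[OF assms] assms by (auto simp: subspace_def)
  then show ?thesis by (rule subspace_is_vs)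
qed

lemma functional_sub: "is_sub V U \<Longrightarrow> functional V f \<Longrightarrow> functional (V\<lparr>carrier := U\<rparr>) f"
  unfolding functional_def is_sub_def by (auto simp: subset_iff)

lemma lin_map_sub:
  "is_sub V U \<Longrightarrow> lin_map V W T \<Longrightarrow> lin_map (V\<lparr>carrier := U\<rparr>) W T"
  "is_sub V U \<Longrightarrow> lin_map V V T \<Longrightarrow> (\<And>u. u \<in> U \<Longrightarrow> T u \<in> U) \<Longrightarrow>
     lin_map (V\<lparr>carrier := U\<rparr>) (V\<lparr>carrier := U\<rparr>) T"
  "is_sub V U \<Longrightarrow> lin_map V W T \<Longrightarrow> lin_map (V\<lparr>carrier := U\<rparr>) (W\<lparr>carrier := T ` U\<rparr>) T"
  unfolding lin_map_def is_sub_def by (auto simp: subset_iff)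

lemma is_sub_ker:
  assumes "is_vs V" "is_vs W" "lin_map V W T"
  shows "is_sub V {v \<in> carrier V. T v = \<zero>\<^bsub>W\<^esub>}"
proof -
  interpret V: vectorspace class_ring V by fact
  interpret W: vectorspace class_ring W by fact
  show ?thesis unfolding is_sub_def
    using assms lin_map_zero[OF assms] by (auto simp: lin_mapD)
qed

lemma is_sub_image:
  assumes "is_vs V" "is_vs W" "lin_map V W T"
  shows "is_sub W (T ` carrier V)"
proof -
  interpret V: vectorspace class_ring V by fact
  have 1: "T v \<oplus>\<^bsub>W\<^esub> T w \<in> T ` carrier V" if "v \<in> carrier V" "w \<in> carrier V" for v w
    using lin_mapD(2)[OF assms(3) that] that by (metis V.M.a_closed imageI)
  have 2: "a \<odot>\<^bsub>W\<^esub> T v \<in> T ` carrier V" if "v \<in> carrier V" for v a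
    using lin_mapD(3)[OF assms(3) that, of a, symmetric] V.smult_closed[of a v] that by auto
  have 3: "\<zero>\<^bsub>W\<^esub> \<in> T ` carrier V"
    using lin_map_zero[OF assms] by (metis V.M.zero_closed imageI)
  show ?thesis unfolding is_sub_def
    using assms(3) 1 2 3 by (auto simp: lin_mapD)
qed

lemma is_sub_vimage:
  assumes "is_vs V" "lin_map V V T" "is_sub V U"
  shows "is_sub V {v \<in> carrier V. T v \<in> U}"
proof -
  interpret V: vectorspace class_ring V by fact
  show ?thesis using assms lin_map_zero[OF assms(1,1,2)] unfolding is_sub_def
    by (auto simp: lin_mapD)
qed

lemma fin_dim_vs_iff: "fin_dim_vs V \<longleftrightarrow> is_vs V \<and> vectorspace.fin_dim class_ring V"
proof safe
  fix V :: "('k::field, 'v) module"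
  assume "fin_dim_vs V"
  then show V: "is_vs V" unfolding fin_dim_vs_def by auto
  obtain B e where d: "dual_system V B (\<lambda>b. b) e" using \<open>fin_dim_vs V\<close> unfolding fin_dim_vs_def by auto
  interpret vectorspace "class_ring :: 'k ring" V by fact
  show "fin_dim" using dual_system_basis(2,3)[OF V d] unfolding fin_dim_def basis_def by auto
next
  fix V :: "('k::field, 'v) module"
  assume V: "is_vs V" and fd: "vectorspace.fin_dim class_ring V"
  interpret vectorspace "class_ring :: 'k ring" V by fact
  obtain B where "finite B" "basis B" using finite_basis_exists[OF fd] by auto
  then show "fin_dim_vs V" using basis_dual_system[OF V] V unfolding fin_dim_vs_def by metis
qed

text \<open>A basis \<open>A\<close> of \<open>U\<close> is completed by \<open>C\<close>. The
  coordinates along \<open>C\<close> vanish on \<open>U\<close> because \<open>A\<close> already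
  spans it; they are thus coordinates of the quotient by \<open>U\<close>.\<close>

lemma dual_system_extend:
  fixes V :: "('k::field, 'v) module"
  assumes fd: "fin_dim_vs V" and U: "is_sub V U"
  obtains A C e where "A \<inter> C = {}" "dual_system V (A \<union> C) (\<lambda>b. b) e"
    "A \<subseteq> U" "dual_system (V\<lparr>carrier := U\<rparr>) A (\<lambda>b. b) e" "\<And>c u. c \<in> C \<Longrightarrow> u \<in> U \<Longrightarrow> e c u = 0"
proof -
  have V: "is_vs V" and fd': "vectorspace.fin_dim class_ring V" using fd fin_dim_vs_iff by auto
  interpret V: vectorspace "class_ring :: 'k ring" V by fact
  let ?U = "V\<lparr>carrier := U\<rparr>"
  have vU: "is_vs ?U" by (rule is_sub_vs[OF V U])
  interpret U: vectorspace "class_ring :: 'k ring" ?U by fact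
  have UV: "U \<subseteq> carrier V" using U unfolding is_sub_def by auto
  note fin = V.li_le_dim[OF fd']
  have indep_eq: "U.lin_dep S = V.lin_dep S" if "S \<subseteq> U" for S
    using V.span_li_not_depend(2)[OF that is_sub_submodule[OF V U]] .
  have li0: "V.lin_indpt {}" unfolding V.lin_dep_def by auto
  \<comment> \<open>Independent sets have at most \<open>V.dim\<close> elements, so one of greatest
    cardinality inside \<open>U\<close> exists, and it is maximal for inclusion. The same is done
    below among the independent sets that contain it.\<close>
  have "\<exists>A. (A \<subseteq> U \<and> V.lin_indpt A) \<and> (\<forall>B. B \<subseteq> U \<and> V.lin_indpt B \<longrightarrow> card B \<le> card A)"
    by (rule ex_has_greatest_nat[of _ "{}" _ "Suc V.dim"])
      (use li0 fin(2) UV in \<open>auto simp: less_Suc_eq_le\<close>)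
  then obtain A where A: "A \<subseteq> U \<and> V.lin_indpt A" "\<And>B. B \<subseteq> U \<and> V.lin_indpt B \<Longrightarrow> card B \<le> card A"
    by metis
  have AV: "A \<subseteq> carrier V" using A UV by auto
  have finA: "finite A" by (rule fin(1)) (use A AV in auto)
  have "maximal A (\<lambda>S. S \<subseteq> carrier ?U \<and> U.lin_indpt S)"
    unfolding maximal_def
  proof (intro conjI allI impI)
    show "A \<subseteq> carrier ?U" "U.lin_indpt A" using A indep_eq by auto
    fix B assume B: "A \<subseteq> B \<and> B \<subseteq> carrier ?U \<and> U.lin_indpt B"
    then have B': "B \<subseteq> U \<and> V.lin_indpt B" using indep_eq by auto
    have "finite B" using fin(1)[of B] B' UV by auto
    then show "B = A" using A(2)[OF B'] B by (metis card_seteq)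
  qed
  then have basU: "U.basis A" by (rule U.max_li_is_basis)
  have "\<exists>B. (A \<subseteq> B \<and> B \<subseteq> carrier V \<and> V.lin_indpt B) \<and>
      (\<forall>B'. A \<subseteq> B' \<and> B' \<subseteq> carrier V \<and> V.lin_indpt B' \<longrightarrow> card B' \<le> card B)"
    by (rule ex_has_greatest_nat[of _ A _ "Suc V.dim"])
      (use A AV fin(2) in \<open>auto simp: less_Suc_eq_le\<close>)
  then obtain B where B: "A \<subseteq> B \<and> B \<subseteq> carrier V \<and> V.lin_indpt B"
      "\<And>B'. A \<subseteq> B' \<and> B' \<subseteq> carrier V \<and> V.lin_indpt B' \<Longrightarrow> card B' \<le> card B"
    by metis
  have finB: "finite B" by (rule fin(1)) (use B in auto)
  have "maximal B (\<lambda>S. S \<subseteq> carrier V \<and> V.lin_indpt S)"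
    unfolding maximal_def
  proof (intro conjI allI impI)
    show "B \<subseteq> carrier V" "V.lin_indpt B" using B by auto
    fix S assume S: "B \<subseteq> S \<and> S \<subseteq> carrier V \<and> V.lin_indpt S"
    have "finite S" using fin(1)[of S] S by auto
    moreover have "card S \<le> card B" using B S by auto
    ultimately show "S = B" using S by (metis card_seteq)
  qed
  then have basV: "V.basis B" by (rule V.max_li_is_basis)
  obtain e where e: "dual_system V B (\<lambda>b. b) e" using basis_dual_system[OF V finB basV] by metis
  obtain e' where e': "dual_system ?U A (\<lambda>b. b) e'" using basis_dual_system[OF vU finA basU] by metis
  have AB: "a \<in> B" if "a \<in> A" for a using B that by auto
  have eC: "e c u = 0" if "c \<in> B - A" "u \<in> U" for c u
  proof -
    have f: "functional ?U (e c)"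
      using functional_sub[OF U dual_system_functional[OF e]] that by auto
    have "e c u = (\<Sum>a\<in>A. e' a u * e c a)"
      using dual_system_expand(2)[OF vU e' _ f] that by auto
    also have "\<dots> = 0" by (rule sum.neutral) (use that AB dual_system_delta[OF e] in auto)
    finally show ?thesis .
  qed
  have "dual_system ?U A (\<lambda>b. b) e"
    unfolding dual_system_def
  proof (intro conjI ballI impI)
    show "finite A" by fact
    show "a \<in> carrier ?U" if "a \<in> A" for a using that A by auto
    show "functional ?U (e a)" if "a \<in> A" for a
      using functional_sub[OF U dual_system_functional[OF e]] that B by auto
    show "e i j = (if i = j then 1 else 0)" if "i \<in> A" "j \<in> A" for i j
      using that AB dual_system_delta[OF e] by auto
    show "u = \<zero>\<^bsub>?U\<^esub>" if "u \<in> carrier ?U" "\<forall>i\<in>A. e i u = 0" for u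
    proof -
      have "e i u = 0" if "i \<in> B" for i using that \<open>\<forall>i\<in>A. e i u = 0\<close> \<open>u \<in> carrier ?U\<close> eC by auto
      then have "u = \<zero>\<^bsub>V\<^esub>" using dual_system_zero[OF e, of u] that(1) UV by auto
      then show ?thesis by simp
    qed
  qed
  moreover have "A \<union> (B - A) = B" using B by auto
  ultimately show ?thesis
    using that[of A "B - A" e] eC A e by auto
qed

lemma fin_dim_sub:
  assumes "fin_dim_vs V" "is_sub V U" shows "fin_dim_vs (V\<lparr>carrier := U\<rparr>)"
  by (rule dual_system_extend[OF assms]) (use assms is_sub_vs[of V U] in \<open>auto simp: fin_dim_vs_def\<close>)

text \<open>\<open>T\<close> takes values in \<open>U\<close>, so the diagonal entries outside a
  basis of \<open>U\<close> are zero.\<close>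

lemma linear_trace_sub_step:
  fixes V :: "('k::field, 'v) module"
  assumes fd: "fin_dim_vs V" and U: "is_sub V U" and T: "lin_map V V T"
    and TU: "\<And>v. v \<in> carrier V \<Longrightarrow> T v \<in> U"
  shows "linear_trace V T = linear_trace (V\<lparr>carrier := U\<rparr>) T"
proof -
  have V: "is_vs V" using fd fin_dim_vs_def by auto
  have UV: "U \<subseteq> carrier V" using U unfolding is_sub_def by auto
  obtain A C e where d: "A \<inter> C = {}" "dual_system V (A \<union> C) (\<lambda>b. b) e"
    "A \<subseteq> U" "dual_system (V\<lparr>carrier := U\<rparr>) A (\<lambda>b. b) e" "\<And>c u. c \<in> C \<Longrightarrow> u \<in> U \<Longrightarrow> e c u = 0"
    by (rule dual_system_extend[OF fd U]) (blast intro: that)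
  have f: "finite A" "finite C" using dual_system_finite[OF d(2)] by auto
  have "linear_trace V T = (\<Sum>i\<in>A. e i (T i)) + (\<Sum>i\<in>C. e i (T i))"
    unfolding linear_trace_dual_system[OF V d(2) T] by (rule sum.union_disjoint) (use f d in auto)
  also have "(\<Sum>i\<in>C. e i (T i)) = 0"
    by (rule sum.neutral) (use d(5) TU dual_system_carrier[OF d(2)] in auto)
  also have "(\<Sum>i\<in>A. e i (T i)) = linear_trace (V\<lparr>carrier := U\<rparr>) T"
    by (rule linear_trace_dual_system[OF is_sub_vs[OF V U] d(4), symmetric])
      (rule lin_map_sub(2)[OF U T], use TU UV in auto)
  finally show ?thesis by simp
qed

text \<open>The preimages \<open>W j\<close> of \<open>U\<close> under the powers of
  \<open>T\<close> increase, and \<open>T\<close> maps \<open>W (Suc j)\<close> into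
  \<open>W j\<close>, so no step of this filtration changes the trace. A finite basis makes the
  exponent uniform, so some \<open>W m\<close> is the whole space.\<close>

lemma linear_trace_sub_eventually:
  fixes V :: "('k::field, 'v) module"
  assumes fd: "fin_dim_vs V" and U: "is_sub V U" and T: "lin_map V V T"
    and TU: "\<And>u. u \<in> U \<Longrightarrow> T u \<in> U"
    and ev: "\<And>v. v \<in> carrier V \<Longrightarrow> \<exists>j. (T ^^ j) v \<in> U"
  shows "linear_trace V T = linear_trace (V\<lparr>carrier := U\<rparr>) T"
proof -
  have V: "is_vs V" using fd fin_dim_vs_def by auto
  have UV: "U \<subseteq> carrier V" using U unfolding is_sub_def by auto
  define W where "W j = {v \<in> carrier V. (T ^^ j) v \<in> U}" for j
  have W0: "W 0 = U" using UV unfolding W_def by auto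
  have Wsub: "is_sub V (W j)" for j
    unfolding W_def by (rule is_sub_vimage[OF V lin_map_funpow[OF T] U])
  have Wmono: "W j \<subseteq> W (Suc j)" for j unfolding W_def using TU by auto
  have Tc: "T v \<in> carrier V" if "v \<in> carrier V" for v using lin_mapD(1)[OF T that] .
  have TW: "T v \<in> W j" if "v \<in> W (Suc j)" for v j
    using that Tc unfolding W_def by (auto simp: funpow_swap1)
  have TW': "T v \<in> W j" if "v \<in> W j" for v j
    using that Tc TU unfolding W_def by (auto simp flip: funpow_swap1)
  have step: "linear_trace (V\<lparr>carrier := W (Suc j)\<rparr>) T = linear_trace (V\<lparr>carrier := W j\<rparr>) T" for j
  proof -
    let ?V = "V\<lparr>carrier := W (Suc j)\<rparr>"
    have "is_sub ?V (W j)" using Wsub[of j] Wmono unfolding is_sub_def by auto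
    then have "linear_trace ?V T = linear_trace (?V\<lparr>carrier := W j\<rparr>) T"
      by (rule linear_trace_sub_step[OF fin_dim_sub[OF fd Wsub]])
        (use TW lin_map_sub(2)[OF Wsub T] TW' in auto)
    then show ?thesis by simp
  qed
  have all: "linear_trace (V\<lparr>carrier := W j\<rparr>) T = linear_trace (V\<lparr>carrier := U\<rparr>) T" for j
    by (induction j) (auto simp: W0 step)
  obtain B e where d: "dual_system V B (\<lambda>b. b) e" using fd unfolding fin_dim_vs_def by auto
  have Wle: "W i \<subseteq> W j" if "i \<le> j" for i j by (rule lift_Suc_mono_le[of W]) (use Wmono that in auto)
  have "\<forall>b\<in>B. \<exists>j. b \<in> W j" using ev dual_system_carrier[OF d] unfolding W_def by auto
  then obtain jj where jj: "\<And>b. b \<in> B \<Longrightarrow> b \<in> W (jj b)" by metis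
  define m where "m = Max (insert 0 (jj ` B))"
  have "jj b \<le> m" if "b \<in> B" for b
    unfolding m_def by (rule Max_ge) (use that dual_system_finite[OF d] in auto)
  then have Bm: "b \<in> W m" if "b \<in> B" for b using jj[OF that] Wle that by blast
  interpret W: vectorspace "class_ring :: 'k ring" "V\<lparr>carrier := W m\<rparr>" by (rule is_sub_vs[OF V Wsub])
  interpret V: vectorspace "class_ring :: 'k ring" V by fact
  have "carrier V \<subseteq> W m"
  proof
    fix v assume v: "v \<in> carrier V"
    have "(T ^^ m) v = finsum V (\<lambda>i. (T ^^ m) (e i v \<odot>\<^bsub>V\<^esub> i)) B"
      by (subst dual_system_expand(1)[OF V d v], rule finsum_in_vs(3)[OF V dual_system_finite[OF d] _ V lin_map_funpow[OF T]])
         (use dual_system_carrier[OF d] in auto)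
    also have "\<dots> \<in> U"
      using dual_system_finite[OF d] Bm
    proof (induction B rule: finite_induct)
      case empty then show ?case using U by (auto simp: is_sub_def)
    next
      case (insert x F)
      have 1: "(T ^^ m) (e i v \<odot>\<^bsub>V\<^esub> i) \<in> U" if "i \<in> insert x F" for i
        using insert.prems[OF that] Wsub[of m] unfolding is_sub_def W_def by auto
      show ?case using insert 1 UV U
        by (subst V.M.finsum_insert) (auto simp: is_sub_def)
    qed
    finally show "v \<in> W m" using v unfolding W_def by auto
  qed
  then have "W m = carrier V" unfolding W_def by auto
  then show ?thesis using all[of m] by simp
qed

lemma linear_trace_zero_space:
  fixes V :: "('k::field, 'v) module"
  assumes "is_vs V" shows "linear_trace (V\<lparr>carrier := {\<zero>\<^bsub>V\<^esub>}\<rparr>) T = 0"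
proof -
  have z: "is_sub V {\<zero>\<^bsub>V\<^esub>}"
  proof -
    interpret vectorspace "class_ring :: 'k ring" V by fact
    show ?thesis unfolding is_sub_def using M.zero_closed rmult_0 by auto
  qed
  let ?Z = "V\<lparr>carrier := {\<zero>\<^bsub>V\<^esub>}\<rparr>"
  have d: "dual_system ?Z {} (\<lambda>b. b) e" for e unfolding dual_system_def by auto
  have vs: "is_vs ?Z" by (rule is_sub_vs[OF assms z])
  show ?thesis unfolding linear_trace_def
  proof (rule the_equality)
    show "\<exists>B a. finite B \<and> vectorspace.basis class_ring ?Z B \<and>
     (\<forall>b\<in>B. T b = module.lincomb ?Z (a b) B) \<and> 0 = (\<Sum>b\<in>B. a b b)"
      using dual_system_basis(3)[OF vs d] by (intro exI[of _ "{}"]) auto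
    fix t assume "\<exists>B a. finite B \<and> vectorspace.basis class_ring ?Z B \<and>
     (\<forall>b\<in>B. T b = module.lincomb ?Z (a b) B) \<and> t = (\<Sum>b\<in>B. a b b)"
    then obtain B a where B: "finite B" "vectorspace.basis class_ring ?Z B" "t = (\<Sum>b\<in>B. a b b)" by blast
    interpret vectorspace "class_ring :: 'k ring" ?Z by fact
    have "B \<subseteq> {\<zero>\<^bsub>V\<^esub>}" "\<zero>\<^bsub>V\<^esub> \<notin> B"
      using B(2) vs_zero_lin_dep[of B] unfolding basis_def by auto
    then have "B = {}" by auto
    then show "t = 0" using B by simp
  qed
qed

text \<open>In a basis adapted to the kernel of \<open>p\<close>, the part \<open>A\<close> gives
  the trace on the kernel, and \<open>p\<close> carries the complementary part \<open>C\<close> to a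
  basis of the image.\<close>

lemma
  fixes V :: "('k::field, 'v) module" and W :: "('k, 'w) module"
  assumes fd: "fin_dim_vs V" and W: "is_vs W" and p: "lin_map V W p"
    and T: "lin_map V V T" and S: "lin_map W W S" and eq: "\<And>v. v \<in> carrier V \<Longrightarrow> p (T v) = S (p v)"
  shows linear_trace_exact: "linear_trace V T = linear_trace (V\<lparr>carrier := {v \<in> carrier V. p v = \<zero>\<^bsub>W\<^esub>}\<rparr>) T +
      linear_trace (W\<lparr>carrier := p ` carrier V\<rparr>) S"
    and fin_dim_image: "fin_dim_vs (W\<lparr>carrier := p ` carrier V\<rparr>)"
proof -
  have V: "is_vs V" using fd fin_dim_vs_def by auto
  define K where "K = {v \<in> carrier V. p v = \<zero>\<^bsub>W\<^esub>}"
  have K: "is_sub V K" unfolding K_def by (rule is_sub_ker[OF V W p])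
  have I: "is_sub W (p ` carrier V)" by (rule is_sub_image[OF V W p])
  obtain A C e where d: "A \<inter> C = {}" "dual_system V (A \<union> C) (\<lambda>b. b) e"
    "A \<subseteq> K" "dual_system (V\<lparr>carrier := K\<rparr>) A (\<lambda>b. b) e" "\<And>c u. c \<in> C \<Longrightarrow> u \<in> K \<Longrightarrow> e c u = 0"
    by (rule dual_system_extend[OF fd K]) (blast intro: that)
  have f: "finite A" "finite C" using dual_system_finite[OF d(2)] by auto
  note fe = dual_system_functional[OF d(2)]
  \<comment> \<open>A coordinate along \<open>C\<close> is evaluated at any preimage under
    \<open>p\<close>; it vanishes on the kernel of \<open>p\<close>, so the choice is
    immaterial.\<close>
  define e' where "e' c w = e c (SOME v. v \<in> carrier V \<and> p v = w)" for c w
  have e': "e' c (p v) = e c v" if c: "c \<in> C" and v: "v \<in> carrier V" for c v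
  proof -
    let ?v = "SOME u. u \<in> carrier V \<and> p u = p v"
    have v': "?v \<in> carrier V" "p ?v = p v"
      using someI[of "\<lambda>u. u \<in> carrier V \<and> p u = p v" v] v by auto
    have "p (?v \<oplus>\<^bsub>V\<^esub> (-1) \<odot>\<^bsub>V\<^esub> v) = \<zero>\<^bsub>W\<^esub>"
    proof -
      interpret V: vectorspace "class_ring :: 'k ring" V by fact
      interpret W: vectorspace "class_ring :: 'k ring" W by fact
      have m: "(-1) \<odot>\<^bsub>W\<^esub> p v = \<ominus>\<^bsub>W\<^esub> p v"
        using W.smult_minus_1[of "p v"] lin_mapD(1)[OF p v] by (simp add: class_ring_simps)
      show ?thesis using v v' p lin_mapD(1)[OF p v] by (simp add: lin_mapD m W.M.r_neg)
    qed
    then have "e c (?v \<oplus>\<^bsub>V\<^esub> (-1) \<odot>\<^bsub>V\<^esub> v) = 0"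
      using d(5)[OF c] vs_minus(2)[OF V v'(1) v] unfolding K_def by auto
    then show ?thesis
      using vs_minus(3)[OF V v'(1) v fe] c unfolding e'_def by auto
  qed
  interpret V: vectorspace "class_ring :: 'k ring" V by fact
  have d': "dual_system (W\<lparr>carrier := p ` carrier V\<rparr>) C p e'"
    unfolding dual_system_def
  proof (intro conjI ballI impI)
    show "finite C" by fact
    show "p i \<in> carrier (W\<lparr>carrier := p ` carrier V\<rparr>)" if "i \<in> C" for i
      using dual_system_carrier[OF d(2)] that by auto
    show "functional (W\<lparr>carrier := p ` carrier V\<rparr>) (e' i)" if i: "i \<in> C" for i
      unfolding functional_def
    proof (intro conjI ballI allI)
      fix v w assume "v \<in> carrier (W\<lparr>carrier := p ` carrier V\<rparr>)" "w \<in> carrier (W\<lparr>carrier := p ` carrier V\<rparr>)"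
      then obtain v0 w0 where *: "v = p v0" "w = p w0" "v0 \<in> carrier V" "w0 \<in> carrier V" by auto
      have "e' i (p (v0 \<oplus>\<^bsub>V\<^esub> w0)) = e' i (p v0) + e' i (p w0)"
        using * i fe by (simp add: e' functionalD)
      then show "e' i (v \<oplus>\<^bsub>W\<lparr>carrier := p ` carrier V\<rparr>\<^esub> w) = e' i v + e' i w"
        using * p by (simp add: lin_mapD)
      have "e' i (p (a \<odot>\<^bsub>V\<^esub> v0)) = a * e' i (p v0)" for a
        using * i fe by (simp add: e' functionalD)
      then show "e' i (a \<odot>\<^bsub>W\<lparr>carrier := p ` carrier V\<rparr>\<^esub> v) = a * e' i v" for a
        using * p by (simp add: lin_mapD)
    qed
    show "e' i (p j) = (if i = j then 1 else 0)" if "i \<in> C" "j \<in> C" for i j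
      using that e' dual_system_carrier[OF d(2)] dual_system_delta[OF d(2)] by auto
    fix w assume w: "w \<in> carrier (W\<lparr>carrier := p ` carrier V\<rparr>)" "\<forall>i\<in>C. e' i w = 0"
    then obtain v where v: "w = p v" "v \<in> carrier V" by auto
    have ec: "e c v = 0" if "c \<in> C" for c using w(2) e'[OF that v(2)] v that by auto
    have "w = p (finsum V (\<lambda>i. e i v \<odot>\<^bsub>V\<^esub> i) (A \<union> C))"
      using dual_system_expand(1)[OF V d(2) v(2)] v by simp
    also have "\<dots> = finsum W (\<lambda>i. p (e i v \<odot>\<^bsub>V\<^esub> i)) (A \<union> C)"
      by (rule finsum_in_vs(3)[OF V _ _ W p]) (use f dual_system_carrier[OF d(2)] in auto)
    also have "\<dots> = finsum W (\<lambda>i. \<zero>\<^bsub>W\<^esub>) (A \<union> C)"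
    proof -
      interpret W: vectorspace "class_ring :: 'k ring" W by fact
      have "p (e i v \<odot>\<^bsub>V\<^esub> i) = \<zero>\<^bsub>W\<^esub>" if "i \<in> A \<union> C" for i
      proof -
        have iV: "i \<in> carrier V" using that dual_system_carrier[OF d(2)] by auto
        show ?thesis
        proof (cases "i \<in> A")
          case True then show ?thesis using d(3)[unfolded K_def] iV lin_mapD(3)[OF p iV] W.rmult_0 by auto
        next
          case False then show ?thesis
            using ec that iV lin_mapD(3)[OF p iV] vs_zero_eq[OF W lin_mapD(1)[OF p iV]] by auto
        qed
      qed
      then show ?thesis by (intro W.M.finsum_cong') auto
    qed
    also have "\<dots> = \<zero>\<^bsub>W\<^esub>"
    proof -
      interpret W: vectorspace "class_ring :: 'k ring" W by fact
      show ?thesis by simp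
    qed
    finally show "w = \<zero>\<^bsub>W\<lparr>carrier := p ` carrier V\<rparr>\<^esub>" by simp
  qed
  have vI: "is_vs (W\<lparr>carrier := p ` carrier V\<rparr>)" by (rule is_sub_vs[OF W I])
  show "fin_dim_vs (W\<lparr>carrier := p ` carrier V\<rparr>)"
    unfolding fin_dim_vs_iff
  proof
    interpret I: vectorspace "class_ring :: 'k ring" "W\<lparr>carrier := p ` carrier V\<rparr>" by fact
    show "I.fin_dim"
      using dual_system_basis(2,3)[OF vI d'] unfolding I.fin_dim_def I.basis_def by auto
  qed (fact vI)
  have "linear_trace V T = (\<Sum>i\<in>A. e i (T i)) + (\<Sum>i\<in>C. e i (T i))"
    unfolding linear_trace_dual_system[OF V d(2) T] by (rule sum.union_disjoint) (use f d in auto)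
  also have "(\<Sum>i\<in>A. e i (T i)) = linear_trace (V\<lparr>carrier := K\<rparr>) T"
  proof (rule linear_trace_dual_system[OF is_sub_vs[OF V K] d(4), symmetric])
    show "lin_map (V\<lparr>carrier := K\<rparr>) (V\<lparr>carrier := K\<rparr>) T"
      by (rule lin_map_sub(2)[OF K T]) (use eq lin_map_zero[OF W W S] lin_mapD(1)[OF T] in \<open>auto simp: K_def\<close>)
  qed
  also have "(\<Sum>i\<in>C. e i (T i)) = (\<Sum>i\<in>C. e' i (S (p i)))"
    by (rule sum.cong) (use e' eq dual_system_carrier[OF d(2)] lin_mapD(1)[OF T] in \<open>auto simp flip: eq\<close>)
  also have "\<dots> = linear_trace (W\<lparr>carrier := p ` carrier V\<rparr>) S"
  proof (rule linear_trace_dual_system[OF vI d', symmetric], rule lin_map_sub(2)[OF I S])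
    show "S u \<in> p ` carrier V" if "u \<in> p ` carrier V" for u
      using that eq lin_mapD(1)[OF T] by (auto simp flip: eq)
  qed
  finally show "linear_trace V T = linear_trace (V\<lparr>carrier := {v \<in> carrier V. p v = \<zero>\<^bsub>W\<^esub>}\<rparr>) T +
      linear_trace (W\<lparr>carrier := p ` carrier V\<rparr>) S"
    unfolding K_def .
qed

lemma linear_trace_eventually_zero:
  fixes V :: "('k::field, 'v) module"
  assumes fd: "fin_dim_vs V" and T: "lin_map V V T"
    and ev: "\<And>v. v \<in> carrier V \<Longrightarrow> \<exists>j. (T ^^ j) v = \<zero>\<^bsub>V\<^esub>"
  shows "linear_trace V T = 0"
proof -
  have V: "is_vs V" using fd fin_dim_vs_def by auto
  have z: "is_sub V {\<zero>\<^bsub>V\<^esub>}"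
  proof -
    interpret vectorspace "class_ring :: 'k ring" V by fact
    show ?thesis unfolding is_sub_def using M.zero_closed rmult_0 by auto
  qed
  show ?thesis
    using linear_trace_sub_eventually[OF fd z T] lin_map_zero[OF V V T] ev linear_trace_zero_space[OF V] by auto
qed

text \<open>\<open>T\<close> is nilpotent on the kernel of \<open>p\<close> and \<open>S\<close> on its cokernel, so neither contributes to
  the trace.\<close>

lemma linear_trace_eventual_iso:
  fixes V :: "('k::field, 'v) module" and W :: "('k, 'w) module"
  assumes fd: "fin_dim_vs V" and fdW: "fin_dim_vs W" and p: "lin_map V W p"
    and T: "lin_map V V T" and S: "lin_map W W S" and eq: "\<And>v. v \<in> carrier V \<Longrightarrow> p (T v) = S (p v)"
    and ker: "\<And>v. v \<in> carrier V \<Longrightarrow> p v = \<zero>\<^bsub>W\<^esub> \<Longrightarrow> \<exists>j. (T ^^ j) v = \<zero>\<^bsub>V\<^esub>"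
    and coker: "\<And>w. w \<in> carrier W \<Longrightarrow> \<exists>j. (S ^^ j) w \<in> p ` carrier V"
  shows "linear_trace V T = linear_trace W S"
proof -
  have V: "is_vs V" and W: "is_vs W" using fd fdW fin_dim_vs_def by auto
  let ?K = "{v \<in> carrier V. p v = \<zero>\<^bsub>W\<^esub>}"
  have K: "is_sub V ?K" by (rule is_sub_ker[OF V W p])
  have "linear_trace (V\<lparr>carrier := ?K\<rparr>) T = 0"
    by (rule linear_trace_eventually_zero[OF fin_dim_sub[OF fd K] lin_map_sub(2)[OF K T]])
      (use ker eq lin_map_zero[OF W W S] lin_mapD(1)[OF T] in auto)
  moreover have "linear_trace W S = linear_trace (W\<lparr>carrier := p ` carrier V\<rparr>) S"
    by (rule linear_trace_sub_eventually[OF fdW is_sub_image[OF V W p] S _ coker])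
      (use lin_mapD(1)[OF T] in \<open>auto simp flip: eq\<close>)
  ultimately show ?thesis using linear_trace_exact[OF fd W p T S eq] by simp
qed

text \<open>The relations \<open>s (r v) = (S ^^ m) v\<close> and
  \<open>r (s w) = (T ^^ m) w\<close> make \<open>S\<close> nilpotent on the kernel of
  \<open>r\<close> and \<open>T\<close> nilpotent on its cokernel.\<close>

lemma shift_equivalent_trace:
  fixes V :: "('k::field, 'v) module" and W :: "('k, 'w) module"
  assumes se: "shift_equivalent (V, S) (W, T)"
    and fd: "vectorspace.fin_dim class_ring V" "vectorspace.fin_dim class_ring W"
  shows "linear_trace V S = linear_trace W T"
proof -
  obtain r s m where *: "is_vs V" "is_vs W" "lin_map V V S" "lin_map W W T"
    "lin_map V W r" "lin_map W V s" "\<forall>v\<in>carrier V. r (S v) = T (r v)"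
    "\<forall>v\<in>carrier V. s (r v) = (S ^^ m) v" "\<forall>w\<in>carrier W. r (s w) = (T ^^ m) w"
    using se unfolding shift_equivalent_def linear_map_iff by auto
  show ?thesis
  proof (rule linear_trace_eventual_iso[OF _ _ *(5,3,4)])
    show "fin_dim_vs V" "fin_dim_vs W" using * fd fin_dim_vs_iff by auto
    show "\<exists>j. (S ^^ j) v = \<zero>\<^bsub>V\<^esub>" if "v \<in> carrier V" "r v = \<zero>\<^bsub>W\<^esub>" for v
      using that *(8) lin_map_zero[OF *(2,1,6)] by metis
    show "\<exists>j. (T ^^ j) w \<in> r ` carrier V" if "w \<in> carrier W" for w
      using that *(9) lin_mapD(1)[OF *(6)] by (metis imageI)
  qed (use * in auto)
qed

lemma shift_equivalent_trans:
  assumes "shift_equivalent (V, S) (W, T)" "shift_equivalent (W, T) (U, R)"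
  shows "shift_equivalent (V, S) (U, R)"
proof -
  obtain r s m where 1: "is_vs V" "is_vs W" "lin_map V V S" "lin_map W W T"
    "lin_map V W r" "lin_map W V s" "\<forall>v\<in>carrier V. r (S v) = T (r v)" "\<forall>w\<in>carrier W. s (T w) = S (s w)"
    "\<forall>v\<in>carrier V. s (r v) = (S ^^ m) v" "\<forall>w\<in>carrier W. r (s w) = (T ^^ m) w"
    using assms(1) unfolding shift_equivalent_def linear_map_iff by auto
  obtain r' s' m' where 2: "is_vs U" "lin_map U U R"
    "lin_map W U r'" "lin_map U W s'" "\<forall>v\<in>carrier W. r' (T v) = R (r' v)" "\<forall>w\<in>carrier U. s' (R w) = T (s' w)"
    "\<forall>v\<in>carrier W. s' (r' v) = (T ^^ m') v" "\<forall>w\<in>carrier U. r' (s' w) = (R ^^ m') w"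
    using assms(2) unfolding shift_equivalent_def linear_map_iff by auto
  have c: "T w \<in> carrier W" "s w \<in> carrier V" "r' w \<in> carrier U" if "w \<in> carrier W" for w
    using that 1 2 by (auto simp: lin_mapD)
  have cV: "S v \<in> carrier V" "r v \<in> carrier W" if "v \<in> carrier V" for v
    using that 1 by (auto simp: lin_mapD)
  have cU: "R v \<in> carrier U" "s' v \<in> carrier W" if "v \<in> carrier U" for v
    using that 2 by (auto simp: lin_mapD)
  have sT: "s ((T ^^ k) w) = (S ^^ k) (s w)" if "w \<in> carrier W" for k w
  proof (induction k)
    case (Suc k) then show ?case using 1(8) funpow_closed[of "carrier W" T w k] c that by auto
  qed auto
  have rT: "r' ((T ^^ k) w) = (R ^^ k) (r' w)" if "w \<in> carrier W" for k w
  proof (induction k)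
    case (Suc k) then show ?case using 2(5) funpow_closed[of "carrier W" T w k] c that by auto
  qed auto
  show ?thesis
    unfolding shift_equivalent_def linear_map_iff prod.case
  proof (intro conjI exI[of _ "\<lambda>v. r' (r v)"] exI[of _ "\<lambda>u. s (s' u)"] exI[of _ "m' + m"] ballI)
    fix v assume v: "v \<in> carrier V"
    show "s (s' (r' (r v))) = (S ^^ (m' + m)) v"
      using 2(7) 1(9) cV[OF v] sT v by (simp add: funpow_add)
  next
    fix u assume u: "u \<in> carrier U"
    have "r' (r (s (s' u))) = (R ^^ m) ((R ^^ m') u)"
      using 2(8) 1(10) cU[OF u] rT u by simp
    also have "\<dots> = (R ^^ (m' + m)) u" by (simp add: funpow_add[symmetric] add.commute flip: comp_apply[of "R ^^ m"])
    finally show "r' (r (s (s' u))) = (R ^^ (m' + m)) u" .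
  qed (use 1 2 c cV cU lin_map_comp[OF 1(5) 2(3)] lin_map_comp[OF 2(4) 1(6)] in auto)
qed

lemma shift_equivalent_sym: "shift_equivalent (V, S) (W, T) \<Longrightarrow> shift_equivalent (W, T) (V, S)"
  unfolding shift_equivalent_def prod.case by blast

text \<open>By rank-nullity. It serves the lifted map on the image of the cohomology of an index
  quotient, where it yields that this image is the whole first cohomology of the limit.\<close>

lemma injective_endo_surj:
  fixes V :: "('k::field, 'v) module"
  assumes fd: "fin_dim_vs V" and T: "lin_map V V T" and inj: "inj_on T (carrier V)"
  shows "T ` carrier V = carrier V"
proof -
  have V: "is_vs V" and fd': "vectorspace.fin_dim class_ring V" using fd fin_dim_vs_iff by auto
  let ?U = "V\<lparr>carrier := T ` carrier V\<rparr>"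
  have U: "is_sub V (T ` carrier V)" by (rule is_sub_image[OF V V T])
  have "linear_map class_ring V V T" unfolding linear_map_iff using V T by simp
  interpret linear_map "class_ring :: 'k ring" V V T by fact
  have rn: "vectorspace.dim class_ring ?U = vectorspace.dim class_ring V"
    using rank_nullity[OF fd'] inj_imp_dim_ker0[OF inj] unfolding im_def by simp
  obtain A C e where AC: "A \<inter> C = {}" "dual_system V (A \<union> C) (\<lambda>b. b) e"
    "A \<subseteq> T ` carrier V" "dual_system ?U A (\<lambda>b. b) e" "\<And>c u. c \<in> C \<Longrightarrow> u \<in> T ` carrier V \<Longrightarrow> e c u = 0"
    by (rule dual_system_extend[OF fd U]) (rule that)
  have fin: "finite A" "finite C" using dual_system_finite[OF AC(2)] by auto
  have dV: "vectorspace.dim class_ring V = card (A \<union> C)"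
    using V.dim_basis[of "A \<union> C"] dual_system_basis(3)[OF V AC(2)] fin by simp
  interpret U: vectorspace "class_ring :: 'k ring" ?U by (rule is_sub_vs[OF V U])
  have "vectorspace.dim class_ring ?U = card A"
    using U.dim_basis[of A] dual_system_basis(3)[OF is_sub_vs[OF V U] AC(4)] fin by simp
  then have "card (A \<union> C) = card A"
    using dV rn by simp
  then have "C = {}" using fin AC(1) by (simp add: card_Un_disjoint)
  then have "V.module.span A = carrier V" using dual_system_basis(3)[OF V AC(2)] unfolding V.basis_def by simp
  moreover have "V.module.span A \<subseteq> T ` carrier V"
    by (rule V.module.span_is_subset[OF AC(3) is_sub_submodule[OF V U]])
  ultimately show ?thesis using U unfolding is_sub_def by auto
qed

text \<open>Elements of Cech cohomology are sets of representatives. The axioms are checked on the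
  functions that name the classes and transported along \<open>cl\<close>.\<close>

lemma vs_of_functions:
  fixes V :: "('k::field, 'v) module" and \<C> :: "('i \<Rightarrow> 'k) set" and cl :: "('i \<Rightarrow> 'k) \<Rightarrow> 'v"
  assumes car: "carrier V = cl ` \<C>" and zero: "\<zero>\<^bsub>V\<^esub> = cl (\<lambda>_. 0)"
    and add: "\<And>C D. C \<in> \<C> \<Longrightarrow> D \<in> \<C> \<Longrightarrow> cl C \<oplus>\<^bsub>V\<^esub> cl D = cl (\<lambda>i. C i + D i)"
    and smult: "\<And>a C. C \<in> \<C> \<Longrightarrow> a \<odot>\<^bsub>V\<^esub> cl C = cl (\<lambda>i. a * C i)"
    and closed: "(\<lambda>_. 0) \<in> \<C>" "\<And>C D. C \<in> \<C> \<Longrightarrow> D \<in> \<C> \<Longrightarrow> (\<lambda>i. C i + D i) \<in> \<C>"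
      "\<And>a C. C \<in> \<C> \<Longrightarrow> (\<lambda>i. a * C i) \<in> \<C>"
  shows "is_vs V"
proof (rule vs_criteria[OF class_field])
  show "\<forall>v\<in>carrier V. \<exists>w\<in>carrier V. v \<oplus>\<^bsub>V\<^esub> w = \<zero>\<^bsub>V\<^esub>"
  proof
    fix v assume "v \<in> carrier V"
    then obtain C where C: "C \<in> \<C>" "v = cl C" using car by auto
    then show "\<exists>w\<in>carrier V. v \<oplus>\<^bsub>V\<^esub> w = \<zero>\<^bsub>V\<^esub>"
      using car zero add[OF C(1) closed(3)[of C "-1"]] closed(3)[of C "-1"]
      by (intro bexI[of _ "cl (\<lambda>i. -1 * C i)"]) auto
  qed
qed (auto simp: car zero add smult closed algebra_simps)

section \<open>Alexander-Spanier cochains\<close>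

text \<open>\<open>P\<close> holds on a neighbourhood of the diagonal; Alexander-Spanier cochains
  are compared only there.\<close>

definition near :: "'x topology \<Rightarrow> ('x \<Rightarrow> 'x \<Rightarrow> bool) \<Rightarrow> bool" where
  "near X P \<longleftrightarrow> (\<forall>x\<in>topspace X. \<exists>U. openin X U \<and> x \<in> U \<and> (\<forall>y\<in>U. \<forall>z\<in>U. P y z))"

text \<open>The potential \<open>\<alpha>\<close> is an arbitrary function, without continuity. With
  this sign a potential is minus a primitive in the sense of \<open>primitives\<close>, whence the
  minus signs in later constructions.\<close>

definition cobounds :: "'x topology \<Rightarrow> ('x \<times> 'x \<Rightarrow> 'k::field) \<Rightarrow> bool" where
  "cobounds X C \<longleftrightarrow> (\<exists>\<alpha>. near X (\<lambda>y z. C (y, z) = \<alpha> z - \<alpha> y))"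

text \<open>Degree one classes are handled through Alexander-Spanier cocycles \<open>C\<close>, which pull back
  along maps without the choice of a refinement.  A cover \<open>\<U>\<close> with primitives \<open>s U\<close> of \<open>C\<close>
  yields the Cech cocycle \<open>c [U, V] = s V - s U\<close>; asking this to be constant on the whole of
  \<open>U \<inter> V\<close> (which need not be connected) is what makes it a cochain of the nerve.\<close>

definition primitives :: "'x set set \<Rightarrow> ('x set \<Rightarrow> 'x \<Rightarrow> 'k::field) \<Rightarrow> ('x \<times> 'x \<Rightarrow> 'k) \<Rightarrow> bool" where
  "primitives \<U> s C \<longleftrightarrow> (\<forall>U\<in>\<U>. \<forall>x\<in>U. \<forall>y\<in>U. C (x, y) = s U x - s U y) \<and>
     (\<forall>U\<in>\<U>. \<forall>V\<in>\<U>. \<forall>x\<in>U \<inter> V. \<forall>y\<in>U \<inter> V. s V x - s U x = s V y - s U y)"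

definition asc :: "'x topology \<Rightarrow> ('x \<times> 'x \<Rightarrow> 'k::field) set" where
  "asc X = {C. \<exists>\<U> s. open_cover X \<U> \<and> primitives \<U> s C}"

definition represents ::
  "'x topology \<Rightarrow> 'x set set \<Rightarrow> ('x set list \<Rightarrow> 'k::field) \<Rightarrow> ('x \<times> 'x \<Rightarrow> 'k) \<Rightarrow> bool" where
  "represents X \<U> c C \<longleftrightarrow> open_cover X \<U> \<and> (\<exists>s. primitives \<U> s C \<and>
     (\<forall>U\<in>\<U>. \<forall>V\<in>\<U>. \<forall>x\<in>U \<inter> V. s V x - s U x = c [U, V]))"

text \<open>A class is the set of all its Cech representatives, as in \<open>cech_class\<close>.
  \<open>A\<close> restricts which cocycles may represent it; for the \<open>pointlike\<close> sets
  below this does not affect when two classes agree (\<open>as_class_eq_iff\<close>).\<close>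

definition as_class :: "'x topology \<Rightarrow> 'x set \<Rightarrow> ('x \<times> 'x \<Rightarrow> 'k::field) \<Rightarrow> ('x, 'k) cech" where
  "as_class X A C = {(\<U>, c). open_cover X \<U> \<and> c \<in> cocycles \<U> A 1 \<and>
     (\<exists>C'. represents X \<U> c C' \<and> cobounds X (\<lambda>w. C w - C' w))}"

lemma near_mono: "near X P \<Longrightarrow> (\<And>x y. x \<in> topspace X \<Longrightarrow> y \<in> topspace X \<Longrightarrow> P x y \<Longrightarrow> Q x y) \<Longrightarrow> near X Q"
  unfolding near_def by (meson openin_subset subsetD)

lemma nearE:
  assumes "near X P" "x \<in> topspace X"
  obtains U where "openin X U" "x \<in> U" "\<And>y z. y \<in> U \<Longrightarrow> z \<in> U \<Longrightarrow> P y z"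
  using assms unfolding near_def by metis

lemma nearI:
  assumes "\<And>x. x \<in> topspace X \<Longrightarrow> \<exists>U. openin X U \<and> x \<in> U \<and> (\<forall>y\<in>U. \<forall>z\<in>U. P y z)"
  shows "near X P"
  using assms unfolding near_def by simp

lemma near_conj:
  assumes "near X P" "near X Q" shows "near X (\<lambda>x y. P x y \<and> Q x y)"
  unfolding near_def
proof
  fix x assume x: "x \<in> topspace X"
  obtain U V where "openin X U" "x \<in> U" "\<forall>y\<in>U. \<forall>z\<in>U. P y z" "openin X V" "x \<in> V" "\<forall>y\<in>V. \<forall>z\<in>V. Q y z"
    using assms x unfolding near_def by metis
  then show "\<exists>U. openin X U \<and> x \<in> U \<and> (\<forall>y\<in>U. \<forall>z\<in>U. P y z \<and> Q y z)"
    by (intro exI[of _ "U \<inter> V"]) auto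
qed

lemma near_continuous:
  assumes "near Y P" "continuous_map X Y g" shows "near X (\<lambda>x y. P (g x) (g y))"
  unfolding near_def
proof
  fix x assume x: "x \<in> topspace X"
  then have "g x \<in> topspace Y" using assms(2) by (auto simp: continuous_map_def)
  then obtain U where U: "openin Y U" "g x \<in> U" "\<forall>y\<in>U. \<forall>z\<in>U. P y z"
    using assms(1) unfolding near_def by metis
  then show "\<exists>U. openin X U \<and> x \<in> U \<and> (\<forall>y\<in>U. \<forall>z\<in>U. P (g y) (g z))"
    using openin_continuous_map_preimage[OF assms(2) U(1)] x
    by (intro exI[of _ "{x \<in> topspace X. g x \<in> U}"]) auto
qed

lemma near_subtopology: "near X P \<Longrightarrow> near (subtopology X A) P"
  using near_continuous[of X P "subtopology X A" id] by (simp add: continuous_map_from_subtopology)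

lemma cobounds_add: "cobounds X C \<Longrightarrow> cobounds X D \<Longrightarrow> cobounds X (\<lambda>w. C w + D w)"
proof -
  assume "cobounds X C" "cobounds X D"
  then obtain a b where "near X (\<lambda>y z. C (y, z) = a z - a y)" "near X (\<lambda>y z. D (y, z) = b z - b y)"
    unfolding cobounds_def by auto
  note ab = near_conj[OF this]
  show ?thesis unfolding cobounds_def
    by (rule exI[of _ "\<lambda>x. a x + b x"], rule near_mono[OF ab], elim conjE, simp)
qed

lemma cobounds_smult: "cobounds X C \<Longrightarrow> cobounds X (\<lambda>w. a * C w)"
proof -
  assume "cobounds X C"
  then obtain b where "near X (\<lambda>y z. C (y, z) = b z - b y)" unfolding cobounds_def by auto
  then show ?thesis unfolding cobounds_def
    by (intro exI[of _ "\<lambda>x. a * b x"]) (erule near_mono, simp add: right_diff_distrib)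
qed

lemma cobounds_0: "cobounds X (\<lambda>w. 0)"
  unfolding cobounds_def near_def by (intro exI[of _ "\<lambda>x. 0"]) auto

lemma cobounds_continuous:
  assumes "cobounds Y C" "continuous_map X Y g" shows "cobounds X (\<lambda>(x, y). C (g x, g y))"
proof -
  obtain a where "near Y (\<lambda>y z. C (y, z) = a z - a y)" using assms(1) unfolding cobounds_def by auto
  from near_continuous[OF this assms(2)]
  show ?thesis unfolding cobounds_def by (intro exI[of _ "\<lambda>x. a (g x)"]) simp
qed

lemma primitivesD:
  assumes "primitives \<U> s C" "U \<in> \<U>" "x \<in> U" "y \<in> U"
  shows "C (x, y) = s U x - s U y"
    "V \<in> \<U> \<Longrightarrow> x \<in> V \<Longrightarrow> y \<in> V \<Longrightarrow> s V x - s U x = s V y - s U y"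
  using assms unfolding primitives_def by blast+

lemma primitivesI:
  assumes "\<And>U x y. U \<in> \<U> \<Longrightarrow> x \<in> U \<Longrightarrow> y \<in> U \<Longrightarrow> C (x, y) = s U x - s U y"
    "\<And>U V x y. U \<in> \<U> \<Longrightarrow> V \<in> \<U> \<Longrightarrow> x \<in> U \<Longrightarrow> x \<in> V \<Longrightarrow> y \<in> U \<Longrightarrow> y \<in> V \<Longrightarrow>
       s V x - s U x = s V y - s U y"
  shows "primitives \<U> s C"
  using assms unfolding primitives_def by simp

lemma cobounds_diff_sym: "cobounds X (\<lambda>w. C w - D w) \<Longrightarrow> cobounds X (\<lambda>w. D w - C w)"
  using cobounds_smult[of X "\<lambda>w. C w - D w" "-1"] by simp

lemma cobounds_diff_trans:
  "cobounds X (\<lambda>w. C w - D w) \<Longrightarrow> cobounds X (\<lambda>w. D w - E w) \<Longrightarrow> cobounds X (\<lambda>w. C w - E w)"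
  using cobounds_add[of X "\<lambda>w. C w - D w" "\<lambda>w. D w - E w"] by simp

lemma primitives_pullback:
  assumes "primitives \<U> s C" "refinement g \<V> \<U> p"
  shows "primitives \<V> (\<lambda>V x. s (p V) (g x)) (\<lambda>(x, y). C (g x, g y))"
  unfolding primitives_def
proof (intro conjI ballI)
  fix V x y assume V: "V \<in> \<V>" "x \<in> V" "y \<in> V"
  then have "p V \<in> \<U>" "g x \<in> p V" "g y \<in> p V" using assms(2) unfolding refinement_def by auto
  then show "(\<lambda>(x, y). C (g x, g y)) (x, y) = s (p V) (g x) - s (p V) (g y)"
    using assms(1) unfolding primitives_def by auto
next
  fix V V' x y assume V: "V \<in> \<V>" "V' \<in> \<V>" "x \<in> V \<inter> V'" "y \<in> V \<inter> V'"
  then have "p V \<in> \<U>" "p V' \<in> \<U>" "g x \<in> p V \<inter> p V'" "g y \<in> p V \<inter> p V'"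
    using assms(2) unfolding refinement_def by blast+
  then show "s (p V') (g x) - s (p V) (g x) = s (p V') (g y) - s (p V) (g y)"
    using assms(1) unfolding primitives_def by blast
qed

lemma continuous_refinement:
  assumes "continuous_map X Y g" "open_cover Y \<U>"
  obtains \<V> p where "open_cover X \<V>" "refinement g \<V> \<U> p"
proof -
  define \<V> where "\<V> = (\<lambda>U. {x \<in> topspace X. g x \<in> U}) ` \<U>"
  have "open_cover X \<V>" unfolding open_cover_def
  proof
    show "\<forall>V\<in>\<V>. openin X V"
      using assms openin_continuous_map_preimage unfolding \<V>_def open_cover_def by fastforce
    show "\<Union>\<V> = topspace X"
      using assms unfolding \<V>_def open_cover_def continuous_map_def by auto
  qed
  moreover have "\<forall>V\<in>\<V>. \<exists>U. U \<in> \<U> \<and> g ` V \<subseteq> U" unfolding \<V>_def by auto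
  then obtain p where "\<forall>V\<in>\<V>. p V \<in> \<U> \<and> g ` V \<subseteq> p V" by metis
  ultimately show ?thesis using that unfolding refinement_def by auto
qed

lemma asc_continuous: "C \<in> asc Y \<Longrightarrow> continuous_map X Y g \<Longrightarrow> (\<lambda>(x, y). C (g x, g y)) \<in> asc X"
proof -
  assume "C \<in> asc Y" and g: "continuous_map X Y g"
  then obtain \<U> s where U: "open_cover Y \<U>" "primitives \<U> s C" unfolding asc_def by auto
  obtain \<V> p where "open_cover X \<V>" "refinement g \<V> \<U> p" using continuous_refinement[OF g U(1)] by metis
  then show ?thesis using primitives_pullback[OF U(2)] unfolding asc_def by blast
qed

lemma common_refinement:
  assumes "open_cover X \<U>" "open_cover X \<V>"
  obtains \<W> p r where "open_cover X \<W>" "refinement id \<W> \<U> p" "refinement id \<W> \<V> r"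
proof -
  define \<W> where "\<W> = {U \<inter> V | U V. U \<in> \<U> \<and> V \<in> \<V>}"
  have "open_cover X \<W>" using assms unfolding open_cover_def \<W>_def by (auto; blast)
  moreover have "\<forall>W\<in>\<W>. \<exists>U V. U \<in> \<U> \<and> W \<subseteq> U \<and> V \<in> \<V> \<and> W \<subseteq> V" unfolding \<W>_def by blast
  then obtain p r where "\<forall>W\<in>\<W>. p W \<in> \<U> \<and> W \<subseteq> p W \<and> r W \<in> \<V> \<and> W \<subseteq> r W" by metis
  then have "refinement id \<W> \<U> p" "refinement id \<W> \<V> r" unfolding refinement_def by auto
  ultimately show ?thesis using that by blast
qed

lemma asc_add:
  assumes "C \<in> asc X" "D \<in> asc X" shows "(\<lambda>w. C w + D w) \<in> asc X"
proof -
  obtain \<U> s \<V> t where U: "open_cover X \<U>" "primitives \<U> s C" and V: "open_cover X \<V>" "primitives \<V> t D"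
    using assms unfolding asc_def by auto
  obtain \<W> p r where W: "open_cover X \<W>" "refinement id \<W> \<U> p" "refinement id \<W> \<V> r"
    using common_refinement[OF U(1) V(1)] by metis
  have 1: "primitives \<W> (\<lambda>W. s (p W)) C" "primitives \<W> (\<lambda>W. t (r W)) D"
    using primitives_pullback[OF U(2) W(2)] primitives_pullback[OF V(2) W(3)] by auto
  have "primitives \<W> (\<lambda>W x. s (p W) x + t (r W) x) (\<lambda>w. C w + D w)"
  proof (rule primitivesI)
    fix U x y assume *: "U \<in> \<W>" "x \<in> U" "y \<in> U"
    show "C (x, y) + D (x, y) = s (p U) x + t (r U) x - (s (p U) y + t (r U) y)"
      using primitivesD(1)[OF 1(1) *] primitivesD(1)[OF 1(2) *] by simp
  next
    fix U V x y assume *: "U \<in> \<W>" "V \<in> \<W>" "x \<in> U" "x \<in> V" "y \<in> U" "y \<in> V"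
    have "s (p V) x + t (r V) x - (s (p U) x + t (r U) x) = (s (p V) x - s (p U) x) + (t (r V) x - t (r U) x)"
      by simp
    also have "\<dots> = (s (p V) y - s (p U) y) + (t (r V) y - t (r U) y)"
      using primitivesD(2)[OF 1(1) *(1,3,5,2,4,6)] primitivesD(2)[OF 1(2) *(1,3,5,2,4,6)] by simp
    finally show "s (p V) x + t (r V) x - (s (p U) x + t (r U) x) = s (p V) y + t (r V) y - (s (p U) y + t (r U) y)"
      by simp
  qed
  then show ?thesis using W(1) unfolding asc_def by auto
qed

lemma asc_smult: "C \<in> asc X \<Longrightarrow> (\<lambda>w. a * C w) \<in> asc X"
proof -
  assume "C \<in> asc X"
  then obtain \<U> s where U: "open_cover X \<U>" "primitives \<U> s C" unfolding asc_def by auto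
  have "primitives \<U> (\<lambda>U x. a * s U x) (\<lambda>w. a * C w)"
  proof (rule primitivesI)
    fix V x y assume *: "V \<in> \<U>" "x \<in> V" "y \<in> V"
    show "a * C (x, y) = a * s V x - a * s V y"
      using primitivesD(1)[OF U(2) *] by (simp add: right_diff_distrib)
  next
    fix V W x y assume *: "V \<in> \<U>" "W \<in> \<U>" "x \<in> V" "x \<in> W" "y \<in> V" "y \<in> W"
    show "a * s W x - a * s V x = a * s W y - a * s V y"
      using primitivesD(2)[OF U(2) *(1,3,5,2,4,6)] by (simp add: right_diff_distrib[symmetric])
  qed
  then show ?thesis using U(1) unfolding asc_def by auto
qed

lemma open_cover_topspace: "open_cover X {topspace X}"
  unfolding open_cover_def by auto

lemma asc_0: "(\<lambda>w. 0) \<in> asc X"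
  unfolding asc_def primitives_def using open_cover_topspace[of X]
  by (intro CollectI exI[of _ "{topspace X}"] exI[of _ "\<lambda>_ _. 0"]) auto

lemma asc_sum: "(\<And>i. i \<in> I \<Longrightarrow> C i \<in> asc X) \<Longrightarrow> (\<lambda>w. \<Sum>i\<in>I. C i w) \<in> asc X"
  by (induction I rule: infinite_finite_induct) (auto simp: asc_0 intro: asc_add)

section \<open>Low-dimensional Cech cohomology\<close>

lemma nerve_1: "\<sigma> \<in> nerve \<U> 1 \<longleftrightarrow> (\<exists>U V. \<sigma> = [U, V] \<and> U \<in> \<U> \<and> V \<in> \<U> \<and> U \<inter> V \<noteq> {})"
  unfolding nerve_def by (auto simp: length_Suc_conv numeral_2_eq_2)

lemma nerve_0: "\<sigma> \<in> nerve \<U> 0 \<longleftrightarrow> (\<exists>U. \<sigma> = [U] \<and> U \<in> \<U> \<and> U \<noteq> {})"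
  unfolding nerve_def by (auto simp: length_Suc_conv)

lemma nerve_2: "\<sigma> \<in> nerve \<U> (Suc 1) \<longleftrightarrow>
   (\<exists>U V W. \<sigma> = [U, V, W] \<and> U \<in> \<U> \<and> V \<in> \<U> \<and> W \<in> \<U> \<and> U \<inter> V \<inter> W \<noteq> {})"
  unfolding nerve_def by (auto simp: length_Suc_conv numeral_2_eq_2 Int_assoc)

lemma coboundary_0: "[U, V] \<in> nerve \<U> 1 \<Longrightarrow> coboundary \<U> 0 b [U, V] = b [V] - b [U]"
  unfolding coboundary_def by (simp add: numeral_2_eq_2)

lemma coboundary_0_eq: "coboundary \<U> 0 b = (\<lambda>_. 0) \<longleftrightarrow>
   (\<forall>U\<in>\<U>. \<forall>V\<in>\<U>. U \<inter> V \<noteq> {} \<longrightarrow> b [V] = b [U])"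
proof -
  have "coboundary \<U> 0 b = (\<lambda>_. 0) \<longleftrightarrow> (\<forall>\<sigma>. \<sigma> \<in> nerve \<U> 1 \<longrightarrow> coboundary \<U> 0 b \<sigma> = 0)"
    unfolding fun_eq_iff by (auto simp: coboundary_def)
  also have "\<dots> \<longleftrightarrow> (\<forall>U\<in>\<U>. \<forall>V\<in>\<U>. U \<inter> V \<noteq> {} \<longrightarrow> b [V] = b [U])"
    (is "?L \<longleftrightarrow> ?R")
  proof -
    have "?L \<longleftrightarrow> (\<forall>U\<in>\<U>. \<forall>V\<in>\<U>. U \<inter> V \<noteq> {} \<longrightarrow> coboundary \<U> 0 b [U, V] = 0)"
      unfolding nerve_1 by blast
    moreover have "coboundary \<U> 0 b [U, V] = b [V] - b [U]"
      if "U \<in> \<U>" "V \<in> \<U>" "U \<inter> V \<noteq> {}" for U V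
      by (rule coboundary_0) (use that nerve_1 in blast)
    ultimately show ?thesis by auto
  qed
  finally show ?thesis .
qed

lemma coboundary_1: "[U, V, W] \<in> nerve \<U> (Suc 1) \<Longrightarrow>
    coboundary \<U> 1 c [U, V, W] = c [V, W] - c [U, W] + c [U, V]"
  unfolding coboundary_def by (simp add: eval_nat_numeral algebra_simps)

lemma coboundary_1_eq: "coboundary \<U> 1 c = (\<lambda>_. 0) \<longleftrightarrow>
   (\<forall>U\<in>\<U>. \<forall>V\<in>\<U>. \<forall>W\<in>\<U>. U \<inter> V \<inter> W \<noteq> {} \<longrightarrow> c [V, W] - c [U, W] + c [U, V] = 0)"
proof -
  have "coboundary \<U> 1 c = (\<lambda>_. 0) \<longleftrightarrow> (\<forall>\<sigma>. \<sigma> \<in> nerve \<U> (Suc 1) \<longrightarrow> coboundary \<U> 1 c \<sigma> = 0)"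
    unfolding fun_eq_iff by (auto simp: coboundary_def)
  also have "\<dots> \<longleftrightarrow> (\<forall>U\<in>\<U>. \<forall>V\<in>\<U>. \<forall>W\<in>\<U>. U \<inter> V \<inter> W \<noteq> {} \<longrightarrow> c [V, W] - c [U, W] + c [U, V] = 0)"
    (is "?L \<longleftrightarrow> ?R")
  proof -
    have "?L \<longleftrightarrow> (\<forall>U\<in>\<U>. \<forall>V\<in>\<U>. \<forall>W\<in>\<U>. U \<inter> V \<inter> W \<noteq> {} \<longrightarrow> coboundary \<U> 1 c [U, V, W] = 0)"
      unfolding nerve_2 by blast
    moreover have "coboundary \<U> 1 c [U, V, W] = c [V, W] - c [U, W] + c [U, V]"
      if "U \<in> \<U>" "V \<in> \<U>" "W \<in> \<U>" "U \<inter> V \<inter> W \<noteq> {}" for U V W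
      by (rule coboundary_1) (use that nerve_2 in blast)
    ultimately show ?thesis by auto
  qed
  finally show ?thesis .
qed

lemma cocycle_1D:
  assumes "c \<in> cocycles \<U> A 1" "U \<in> \<U>" "V \<in> \<U>" "W \<in> \<U>" "x \<in> U" "x \<in> V" "x \<in> W"
  shows "c [U, W] = c [U, V] + c [V, W]"
proof -
  have "U \<inter> V \<inter> W \<noteq> {}" using assms by auto
  then have "c [V, W] - c [U, W] + c [U, V] = 0"
    using assms(1-4) unfolding cocycles_def coboundary_1_eq by blast
  then show ?thesis by (simp add: algebra_simps)
qed

text \<open>With a member \<open>u x\<close> of the cover chosen around every point,
  \<open>c [u x, V]\<close> is a function of \<open>x\<close> on \<open>V\<close>, and by the
  cocycle identity it changes by \<open>c [U, V]\<close> from \<open>U\<close> to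
  \<open>V\<close>.\<close>

lemma cocycle_represents:
  fixes c :: "'x set list \<Rightarrow> 'k::field"
  assumes U: "open_cover X \<U>" and c: "c \<in> cocycles \<U> A 1"
  obtains C where "represents X \<U> c C"
proof -
  have "\<forall>x\<in>topspace X. \<exists>U. U \<in> \<U> \<and> x \<in> U" using U unfolding open_cover_def by auto
  then obtain u where u: "\<And>x. x \<in> topspace X \<Longrightarrow> u x \<in> \<U> \<and> x \<in> u x" by metis
  have top: "x \<in> topspace X" if "x \<in> V" "V \<in> \<U>" for x V using that U unfolding open_cover_def by auto
  define s where "s V x = c [u x, V]" for V x
  have s: "s V x - s U x = c [U, V]" if "U \<in> \<U>" "V \<in> \<U>" "x \<in> U" "x \<in> V" for U V x
    using cocycle_1D[OF c _ that(1,2) _ that(3,4)] u[OF top[OF that(3,1)]] unfolding s_def by simp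
  \<comment> \<open>Any member containing both points gives the same value, because primitives on
    two members differ by a constant on the overlap.\<close>
  define C where "C = (\<lambda>(x, y). s (SOME V. V \<in> \<U> \<and> x \<in> V \<and> y \<in> V) x - s (SOME V. V \<in> \<U> \<and> x \<in> V \<and> y \<in> V) y)"
  have C: "C (x, y) = s V x - s V y" if "V \<in> \<U>" "x \<in> V" "y \<in> V" for V x y
  proof -
    let ?V = "SOME V. V \<in> \<U> \<and> x \<in> V \<and> y \<in> V"
    have V: "?V \<in> \<U> \<and> x \<in> ?V \<and> y \<in> ?V" by (rule someI[of _ V]) (use that in auto)
    then have "s V x - s ?V x = s V y - s ?V y" using s[of ?V V] that by auto
    then show ?thesis unfolding C_def by (simp add: algebra_simps)
  qed
  have "primitives \<U> s C" unfolding primitives_def using C s by auto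
  then show ?thesis using that[of C] U s unfolding represents_def by blast
qed

text \<open>The two cases that occur: absolute cohomology, and cohomology relative to a base point.
  In degree one a potential can be shifted by a constant so as to vanish at a single point, so
  \<open>cobounds\<close> classifies both.\<close>

definition pointlike :: "'x set \<Rightarrow> bool" where
  "pointlike A \<longleftrightarrow> A = {} \<or> (\<exists>a. A = {a})"

lemma asc_represents:
  fixes C :: "'x \<times> 'x \<Rightarrow> 'k::field"
  assumes C: "C \<in> asc X" and A: "pointlike A"
  obtains \<U> c where "represents X \<U> c C" "c \<in> cocycles \<U> A 1"
proof -
  obtain \<U> s where U: "open_cover X \<U>" "primitives \<U> s C" using C unfolding asc_def by auto
  \<comment> \<open>Normalization at the point of \<open>A\<close>: members containing it get a
    primitive that vanishes there, so the cochain \<open>c\<close> below is zero on simplices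
    meeting \<open>A\<close>.\<close>
  define s' where "s' V x = s V x - (if A \<inter> V \<noteq> {} then s V (SOME a. a \<in> A) else 0)" for V x
  have s': "primitives \<U> s' C" using U(2) unfolding primitives_def s'_def by (auto simp: algebra_simps)
  define c where "c \<sigma> = (if \<sigma> \<in> nerve \<U> 1 then s' (\<sigma> ! 1) (SOME x. x \<in> \<Inter>(set \<sigma>)) - s' (\<sigma> ! 0) (SOME x. x \<in> \<Inter>(set \<sigma>)) else 0)" for \<sigma>
  have c: "c [U, V] = s' V x - s' U x" if "U \<in> \<U>" "V \<in> \<U>" "x \<in> U" "x \<in> V" for U V x
  proof -
    let ?x = "SOME x. x \<in> U \<and> x \<in> V"
    have x: "?x \<in> U \<and> ?x \<in> V" by (rule someI[of _ x]) (use that in auto)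
    have "[U, V] \<in> nerve \<U> 1" unfolding nerve_1 using that by auto
    then have "c [U, V] = s' V ?x - s' U ?x" unfolding c_def by simp
    also have "\<dots> = s' V x - s' U x" using s' that x unfolding primitives_def by blast
    finally show ?thesis .
  qed
  have "represents X \<U> c C" unfolding represents_def using U(1) s' c by fastforce
  moreover have "c \<in> cocycles \<U> A 1"
    unfolding cocycles_def coboundary_1_eq cochains_def
  proof (intro CollectI conjI allI ballI impI)
    fix \<sigma> assume "\<sigma> \<notin> nerve \<U> 1 \<or> A \<inter> \<Inter>(set \<sigma>) \<noteq> {}"
    then consider "\<sigma> \<notin> nerve \<U> 1" | "\<sigma> \<in> nerve \<U> 1" "A \<inter> \<Inter>(set \<sigma>) \<noteq> {}" by auto
    then show "c \<sigma> = 0"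
    proof cases
      case 2
      then obtain U V where *: "\<sigma> = [U, V]" "U \<in> \<U>" "V \<in> \<U>" unfolding nerve_1 by auto
      from 2 A obtain a where a: "A = {a}" unfolding pointlike_def by auto
      have "a \<in> U" "a \<in> V" using 2 a * by auto
      then show ?thesis using c[of U V a] * a by (simp add: s'_def)
    qed (simp add: c_def)
  next
    fix U V W assume "U \<in> \<U>" "V \<in> \<U>" "W \<in> \<U>" "U \<inter> V \<inter> W \<noteq> {}"
    then obtain x where "x \<in> U" "x \<in> V" "x \<in> W" "U \<in> \<U>" "V \<in> \<U>" "W \<in> \<U>" by auto
    then show "c [V, W] - c [U, W] + c [U, V] = 0" using c[of _ _ x] by simp
  qed
  ultimately show ?thesis by (rule that)
qed

text \<open>Given a cochain \<open>b\<close> with the right coboundary on a common refinement, the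
  functions \<open>s - t - b\<close> agree on overlaps and patch to minus a potential of
  \<open>C - D\<close>. Conversely a potential makes \<open>s - t + \<alpha>\<close> constant on
  small members of a cover, and these constants form the cochain.\<close>

lemma cohomologous_iff:
  fixes c d :: "'x set list \<Rightarrow> 'k::field"
  assumes C: "represents X \<U> c C" and D: "represents X \<V> d D"
    and A: "pointlike A" and c: "c \<in> cocycles \<U> A 1" and d: "d \<in> cocycles \<V> A 1"
  shows "(\<exists>\<W> p r. open_cover X \<W> \<and> refinement id \<W> \<U> p \<and> refinement id \<W> \<V> r \<and>
        (\<lambda>\<sigma>. pullback_cochain \<W> 1 p c \<sigma> - pullback_cochain \<W> 1 r d \<sigma>) \<in> coboundaries \<W> A 1) \<longleftrightarrow>
     cobounds X (\<lambda>w. C w - D w)"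
proof -
  obtain s where U: "open_cover X \<U>" and s: "primitives \<U> s C"
    "\<And>U V x. U \<in> \<U> \<Longrightarrow> V \<in> \<U> \<Longrightarrow> x \<in> U \<Longrightarrow> x \<in> V \<Longrightarrow> s V x - s U x = c [U, V]"
    using C unfolding represents_def by auto
  obtain t where V: "open_cover X \<V>" and t: "primitives \<V> t D"
    "\<And>U V x. U \<in> \<V> \<Longrightarrow> V \<in> \<V> \<Longrightarrow> x \<in> U \<Longrightarrow> x \<in> V \<Longrightarrow> t V x - t U x = d [U, V]"
    using D unfolding represents_def by auto
  have sC: "C (x, y) = s U x - s U y" if "U \<in> \<U>" "x \<in> U" "y \<in> U" for U x y
    using s(1) that unfolding primitives_def by auto
  have tD: "D (x, y) = t U x - t U y" if "U \<in> \<V>" "x \<in> U" "y \<in> U" for U x y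
    using t(1) that unfolding primitives_def by auto
  show ?thesis
  proof
    assume "\<exists>\<W> p r. open_cover X \<W> \<and> refinement id \<W> \<U> p \<and> refinement id \<W> \<V> r \<and>
        (\<lambda>\<sigma>. pullback_cochain \<W> 1 p c \<sigma> - pullback_cochain \<W> 1 r d \<sigma>) \<in> coboundaries \<W> A 1"
    then obtain \<W> p r b where W: "open_cover X \<W>" "refinement id \<W> \<U> p" "refinement id \<W> \<V> r"
        and b: "(\<lambda>\<sigma>. pullback_cochain \<W> 1 p c \<sigma> - pullback_cochain \<W> 1 r d \<sigma>) = coboundary \<W> 0 b"
      unfolding coboundaries_def by auto
    have pr: "p U \<in> \<U>" "x \<in> p U" "r U \<in> \<V>" "x \<in> r U" if "U \<in> \<W>" "x \<in> U" for U x
      using W that unfolding refinement_def by auto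
    define h where "h U x = s (p U) x - t (r U) x - b [U]" for U x
    have h: "h V x = h U x" if *: "U \<in> \<W>" "V \<in> \<W>" "x \<in> U" "x \<in> V" for U V x
    proof -
      have n: "[U, V] \<in> nerve \<W> 1" unfolding nerve_1 using * by auto
      have "c [p U, p V] - d [r U, r V] = b [V] - b [U]"
        using fun_cong[OF b, of "[U, V]"] n coboundary_0[OF n, of b] by (simp add: pullback_cochain_def)
      moreover have "s (p V) x - s (p U) x = c [p U, p V]" "t (r V) x - t (r U) x = d [r U, r V]"
        using s(2) t(2) pr * by auto
      ultimately show ?thesis unfolding h_def by (simp add: algebra_simps)
    qed
    define \<alpha> where "\<alpha> x = - h (SOME U. U \<in> \<W> \<and> x \<in> U) x" for x
    have \<alpha>: "\<alpha> x = - h U x" if "U \<in> \<W>" "x \<in> U" for U x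
    proof -
      have "(SOME U. U \<in> \<W> \<and> x \<in> U) \<in> \<W> \<and> x \<in> (SOME U. U \<in> \<W> \<and> x \<in> U)"
        by (rule someI[of _ U]) (use that in auto)
      then show ?thesis unfolding \<alpha>_def using h[OF that(1) _ that(2)] by auto
    qed
    show "cobounds X (\<lambda>w. C w - D w)"
      unfolding cobounds_def near_def
    proof (intro exI[of _ \<alpha>] ballI)
      fix x assume "x \<in> topspace X"
      then obtain G where G: "G \<in> \<W>" "x \<in> G" "openin X G" using W(1) unfolding open_cover_def by auto
      have "C (y, z) - D (y, z) = \<alpha> z - \<alpha> y" if "y \<in> G" "z \<in> G" for y z
      proof -
        have "C (y, z) = s (p G) y - s (p G) z" by (rule sC) (use pr[OF G(1)] that in auto)
        moreover have "D (y, z) = t (r G) y - t (r G) z" by (rule tD) (use pr[OF G(1)] that in auto)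
        ultimately show ?thesis using \<alpha>[OF G(1)] that unfolding h_def by simp
      qed
      then show "\<exists>U. openin X U \<and> x \<in> U \<and> (\<forall>y\<in>U. \<forall>z\<in>U. C (y, z) - D (y, z) = \<alpha> z - \<alpha> y)"
        using G by blast
    qed
  next
    assume "cobounds X (\<lambda>w. C w - D w)"
    then obtain \<alpha> where \<alpha>: "near X (\<lambda>y z. C (y, z) - D (y, z) = \<alpha> z - \<alpha> y)" unfolding cobounds_def by auto
    define \<W> where "\<W> = {G. openin X G \<and> (\<exists>U\<in>\<U>. G \<subseteq> U) \<and> (\<exists>V\<in>\<V>. G \<subseteq> V) \<and>
      (\<forall>y\<in>G. \<forall>z\<in>G. C (y, z) - D (y, z) = \<alpha> z - \<alpha> y)}"
    have W: "open_cover X \<W>" unfolding open_cover_def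
    proof
      show "\<forall>G\<in>\<W>. openin X G" unfolding \<W>_def by auto
      show "\<Union>\<W> = topspace X"
      proof
        show "\<Union>\<W> \<subseteq> topspace X" unfolding \<W>_def using openin_subset by fastforce
        show "topspace X \<subseteq> \<Union>\<W>"
        proof
          fix x assume x: "x \<in> topspace X"
          obtain O1 where O1: "openin X O1" "x \<in> O1" "\<And>y z. y \<in> O1 \<Longrightarrow> z \<in> O1 \<Longrightarrow> C (y, z) - D (y, z) = \<alpha> z - \<alpha> y"
            by (rule nearE[OF \<alpha> x]) (rule that)
          have "x \<in> \<Union>\<U>" "x \<in> \<Union>\<V>" using U V x unfolding open_cover_def by auto
          then obtain O2 O3 where O23: "O2 \<in> \<U>" "x \<in> O2" "O3 \<in> \<V>" "x \<in> O3" by auto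
          then have o: "openin X O2" "openin X O3" using U V unfolding open_cover_def by auto
          have "openin X (O1 \<inter> O2 \<inter> O3)" using O1(1) o by blast
          moreover have "\<exists>U\<in>\<U>. O1 \<inter> O2 \<inter> O3 \<subseteq> U" by (rule bexI[OF _ O23(1)]) auto
          moreover have "\<exists>V\<in>\<V>. O1 \<inter> O2 \<inter> O3 \<subseteq> V" by (rule bexI[OF _ O23(3)]) auto
          ultimately have "O1 \<inter> O2 \<inter> O3 \<in> \<W>" unfolding \<W>_def using O1(3) by simp
          then show "x \<in> \<Union>\<W>" using O1(2) O23 by blast
        qed
      qed
    qed
    have "\<forall>G\<in>\<W>. \<exists>U V. U \<in> \<U> \<and> G \<subseteq> U \<and> V \<in> \<V> \<and> G \<subseteq> V" unfolding \<W>_def by blast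
    then obtain p r where pr: "\<And>G. G \<in> \<W> \<Longrightarrow> p G \<in> \<U> \<and> G \<subseteq> p G \<and> r G \<in> \<V> \<and> G \<subseteq> r G" by metis
    define \<beta> where "\<beta> G x = s (p G) x - t (r G) x + \<alpha> x" for G x
    have \<beta>: "\<beta> G x = \<beta> G y" if "G \<in> \<W>" "x \<in> G" "y \<in> G" for G x y
    proof -
      have "C (x, y) - D (x, y) = \<alpha> y - \<alpha> x" using that unfolding \<W>_def by auto
      moreover have "C (x, y) = s (p G) x - s (p G) y" by (rule sC) (use pr[OF that(1)] that in auto)
      moreover have "D (x, y) = t (r G) x - t (r G) y" by (rule tD) (use pr[OF that(1)] that in auto)
      ultimately have "s (p G) x - s (p G) y - (t (r G) x - t (r G) y) = \<alpha> y - \<alpha> x" by simp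
      then show ?thesis unfolding \<beta>_def by (simp add: algebra_simps)
    qed
    \<comment> \<open>In the relative case the cochain must vanish on members containing the point
      \<open>a\<close>. The value \<open>\<beta> G a\<close> is one constant \<open>k\<close> for
      all of them, because \<open>c\<close> and \<open>d\<close> vanish on simplices meeting
      \<open>A\<close>; subtracting \<open>k\<close> everywhere leaves the coboundary
      unchanged.\<close>
    define a where "a = (SOME a. a \<in> A)"
    define k where "k = \<beta> (SOME G. G \<in> \<W> \<and> a \<in> G) a"
    have k: "\<beta> G a = k" if G: "G \<in> \<W>" "a \<in> G" and Aa: "A = {a}" for G
    proof -
      let ?G = "SOME G. G \<in> \<W> \<and> a \<in> G"
      have G': "?G \<in> \<W> \<and> a \<in> ?G" by (rule someI[of _ G]) (use G in auto)
      have "c [p G, p ?G] = 0"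
      proof -
        have "A \<inter> \<Inter>(set [p G, p ?G]) \<noteq> {}" using Aa pr[of G] pr[of ?G] G G' by auto
        then show ?thesis using c unfolding cocycles_def cochains_def by blast
      qed
      moreover have "d [r G, r ?G] = 0"
      proof -
        have "A \<inter> \<Inter>(set [r G, r ?G]) \<noteq> {}" using Aa pr[of G] pr[of ?G] G G' by auto
        then show ?thesis using d unfolding cocycles_def cochains_def by blast
      qed
      ultimately show ?thesis
        using s(2)[of "p G" "p ?G" a] t(2)[of "r G" "r ?G" a] pr[of G] pr[of ?G] G G'
        unfolding k_def \<beta>_def by (auto simp: subset_iff)
    qed
    define b where "b \<sigma> = (if \<sigma> \<in> nerve \<W> 0 then \<beta> (hd \<sigma>) (SOME x. x \<in> hd \<sigma>) - (if A = {} then 0 else k) else 0)" for \<sigma>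
    have b: "b [G] = \<beta> G x - (if A = {} then 0 else k)" if "G \<in> \<W>" "x \<in> G" for G x
    proof -
      have "(SOME x. x \<in> G) \<in> G" by (rule someI[of _ x]) (use that in auto)
      then have "\<beta> G (SOME x. x \<in> G) = \<beta> G x" by (rule \<beta>[OF that(1) _ that(2)])
      moreover have "[G] \<in> nerve \<W> 0" unfolding nerve_0 using that by auto
      ultimately show ?thesis unfolding b_def by simp
    qed
    have "b \<in> cochains \<W> A 0"
      unfolding cochains_def
    proof (intro CollectI allI impI)
      fix \<sigma> assume *: "\<sigma> \<notin> nerve \<W> 0 \<or> A \<inter> \<Inter>(set \<sigma>) \<noteq> {}"
      show "b \<sigma> = 0"
      proof (cases "\<sigma> \<in> nerve \<W> 0")
        case True
        then obtain G where G: "\<sigma> = [G]" "G \<in> \<W>" unfolding nerve_0 by auto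
        have "A \<noteq> {}" using True * by auto
        then have Aa: "A = {a}" using A unfolding pointlike_def a_def by auto
        have "a \<in> G" using * True Aa G by auto
        then show ?thesis using b[of G a] k[of G] G Aa by auto
      qed (simp add: b_def)
    qed
    moreover have "(\<lambda>\<sigma>. pullback_cochain \<W> 1 p c \<sigma> - pullback_cochain \<W> 1 r d \<sigma>) = coboundary \<W> 0 b"
    proof
      fix \<sigma>
      show "pullback_cochain \<W> 1 p c \<sigma> - pullback_cochain \<W> 1 r d \<sigma> = coboundary \<W> 0 b \<sigma>"
      proof (cases "\<sigma> \<in> nerve \<W> 1")
        case True
        then obtain G G' x where *: "\<sigma> = [G, G']" "G \<in> \<W>" "G' \<in> \<W>" "x \<in> G" "x \<in> G'" unfolding nerve_1 by auto
        have "s (p G') x - s (p G) x = c [p G, p G']" "t (r G') x - t (r G) x = d [r G, r G']"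
          using s(2) t(2) pr[of G] pr[of G'] * by (auto simp: subset_iff)
        moreover have "coboundary \<W> 0 b \<sigma> = \<beta> G' x - \<beta> G x"
          using coboundary_0[of G G' \<W> b] True * b by simp
        ultimately show ?thesis using True * unfolding pullback_cochain_def \<beta>_def by (simp add: algebra_simps)
      next
        case False
        then show ?thesis by (simp add: pullback_cochain_def coboundary_def)
      qed
    qed
    ultimately have "(\<lambda>\<sigma>. pullback_cochain \<W> 1 p c \<sigma> - pullback_cochain \<W> 1 r d \<sigma>) \<in> coboundaries \<W> A 1"
      unfolding coboundaries_def by auto
    moreover have "refinement id \<W> \<U> p" "refinement id \<W> \<V> r" using pr unfolding refinement_def by auto
    ultimately show "\<exists>\<W> p r. open_cover X \<W> \<and> refinement id \<W> \<U> p \<and> refinement id \<W> \<V> r \<and>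
        (\<lambda>\<sigma>. pullback_cochain \<W> 1 p c \<sigma> - pullback_cochain \<W> 1 r d \<sigma>) \<in> coboundaries \<W> A 1"
      using W by blast
  qed
qed

lemma represents_unique:
  fixes c :: "'x set list \<Rightarrow> 'k::field"
  assumes C: "represents X \<U> c C" and D: "represents X \<U> c D"
    and A: "pointlike A" and c: "c \<in> cocycles \<U> A 1"
  shows "cobounds X (\<lambda>w. C w - D w)"
proof (rule cohomologous_iff[OF C D A c c, THEN iffD1], intro exI conjI)
  show "open_cover X \<U>" using C unfolding represents_def by auto
  show "refinement id \<U> \<U> id" "refinement id \<U> \<U> id" unfolding refinement_def by auto
  have "(\<lambda>_. 0) \<in> cochains \<U> A 0" unfolding cochains_def by auto
  moreover have "coboundary \<U> 0 (\<lambda>_. 0) = (\<lambda>_. 0 :: 'k)" unfolding coboundary_0_eq by auto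
  ultimately show "(\<lambda>\<sigma>. pullback_cochain \<U> 1 id c \<sigma> - pullback_cochain \<U> 1 id c \<sigma>) \<in> coboundaries \<U> A 1"
    unfolding coboundaries_def by (auto simp: image_iff intro!: bexI[of _ "\<lambda>_. 0"])
qed

text \<open>The bridge from nerves to Alexander-Spanier cocycles: with it degree one is computed
  modulo \<open>cobounds\<close>, without refinements.\<close>

lemma cech_class_as_class:
  assumes C: "represents X \<U> c C" and A: "pointlike A" and c: "c \<in> cocycles \<U> A 1"
  shows "cech_class X A 1 \<U> c = as_class X A C"
proof -
  have "(\<V>, d) \<in> cech_class X A 1 \<U> c \<longleftrightarrow> (\<V>, d) \<in> as_class X A C" for \<V> d
  proof (cases "open_cover X \<V> \<and> d \<in> cocycles \<V> A 1")
    case True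
    then obtain D where D: "represents X \<V> d D" using cocycle_represents by metis
    have u: "cobounds X (\<lambda>w. C w - D' w) \<longleftrightarrow> cobounds X (\<lambda>w. C w - D w)" if "represents X \<V> d D'" for D'
      using represents_unique[OF D that A] represents_unique[OF that D A] True
        cobounds_diff_trans[of X C D D'] cobounds_diff_trans[of X C D' D] by blast
    have "(\<V>, d) \<in> cech_class X A 1 \<U> c \<longleftrightarrow> cobounds X (\<lambda>w. C w - D w)"
      unfolding cech_class_def using cohomologous_iff[OF C D A c] True by simp
    also have "\<dots> \<longleftrightarrow> (\<V>, d) \<in> as_class X A C"
    proof
      assume "cobounds X (\<lambda>w. C w - D w)"
      then show "(\<V>, d) \<in> as_class X A C" unfolding as_class_def using True D by blast
    next
      assume "(\<V>, d) \<in> as_class X A C"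
      then obtain D' where "represents X \<V> d D'" "cobounds X (\<lambda>w. C w - D' w)" unfolding as_class_def by blast
      then show "cobounds X (\<lambda>w. C w - D w)" using u by blast
    qed
    finally show ?thesis .
  next
    case False
    then show ?thesis unfolding cech_class_def as_class_def by auto
  qed
  then show ?thesis by auto
qed

lemma as_class_eq_iff:
  assumes C: "C \<in> asc X" and D: "D \<in> asc X" and A: "pointlike A"
  shows "as_class X A C = as_class X A D \<longleftrightarrow> cobounds X (\<lambda>w. C w - D w)"
proof
  assume eq: "as_class X A C = as_class X A D"
  obtain \<U> c where c: "represents X \<U> c C" "c \<in> cocycles \<U> A 1" using asc_represents[OF C A] .
  have "(\<U>, c) \<in> as_class X A C"
    unfolding as_class_def using c cobounds_0[of X] unfolding represents_def by fastforce
  then have "(\<U>, c) \<in> as_class X A D" using eq by simp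
  then obtain C' where C': "represents X \<U> c C'" "cobounds X (\<lambda>w. D w - C' w)" unfolding as_class_def by auto
  have "cobounds X (\<lambda>w. C w - C' w)" by (rule represents_unique[OF c(1) C'(1) A c(2)])
  then show "cobounds X (\<lambda>w. C w - D w)"
    using C'(2) cobounds_diff_trans cobounds_diff_sym by blast
next
  assume "cobounds X (\<lambda>w. C w - D w)"
  then show "as_class X A C = as_class X A D"
    unfolding as_class_def using cobounds_diff_trans cobounds_diff_sym by blast
qed

lemma represents_asc: "represents X \<U> c C \<Longrightarrow> C \<in> asc X"
  unfolding represents_def asc_def by auto

lemma represents_pullback:
  assumes C: "represents Y \<U> c C" and V: "open_cover X \<V>" "refinement g \<V> \<U> p"
  shows "represents X \<V> (pullback_cochain \<V> 1 p c) (\<lambda>(x, y). C (g x, g y))"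
proof -
  obtain s where s: "primitives \<U> s C"
    "\<And>U V x. U \<in> \<U> \<Longrightarrow> V \<in> \<U> \<Longrightarrow> x \<in> U \<Longrightarrow> x \<in> V \<Longrightarrow> s V x - s U x = c [U, V]"
    using C unfolding represents_def by auto
  have "s (p V) (g x) - s (p U) (g x) = pullback_cochain \<V> 1 p c [U, V]"
    if "U \<in> \<V>" "V \<in> \<V>" "x \<in> U" "x \<in> V" for U V x
  proof -
    have "[U, V] \<in> nerve \<V> 1" unfolding nerve_1 using that by auto
    then have "pullback_cochain \<V> 1 p c [U, V] = c [p U, p V]" unfolding pullback_cochain_def by simp
    moreover have "p U \<in> \<U>" "p V \<in> \<U>" "g x \<in> p U" "g x \<in> p V" using V(2) that unfolding refinement_def by auto
    ultimately show ?thesis using s(2) by simp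
  qed
  then show ?thesis unfolding represents_def
    using V(1) primitives_pullback[OF s(1) V(2)] by (auto intro!: exI[of _ "\<lambda>V x. s (p V) (g x)"])
qed

lemma cocycles_pullback:
  assumes c: "c \<in> cocycles \<U> B 1" and V: "refinement g \<V> \<U> p" and g: "g ` A \<subseteq> B"
  shows "pullback_cochain \<V> 1 p c \<in> cocycles \<V> A 1"
  unfolding cocycles_def coboundary_1_eq cochains_def
proof (intro CollectI conjI allI ballI impI)
  have p: "p U \<in> \<U>" "\<And>x. x \<in> U \<Longrightarrow> g x \<in> p U" if "U \<in> \<V>" for U
    using V that unfolding refinement_def by auto
  have pc: "pullback_cochain \<V> 1 p c [U, V] = c [p U, p V]" if "U \<in> \<V>" "V \<in> \<V>" "x \<in> U" "x \<in> V" for U V x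
  proof -
    have "[U, V] \<in> nerve \<V> 1" unfolding nerve_1 using that by auto
    then show ?thesis unfolding pullback_cochain_def by simp
  qed
  show "pullback_cochain \<V> 1 p c \<sigma> = 0" if "\<sigma> \<notin> nerve \<V> 1 \<or> A \<inter> \<Inter> (set \<sigma>) \<noteq> {}" for \<sigma>
  proof (cases "\<sigma> \<in> nerve \<V> 1")
    case True
    then obtain U V where *: "\<sigma> = [U, V]" "U \<in> \<V>" "V \<in> \<V>" unfolding nerve_1 by auto
    have "A \<inter> \<Inter> (set \<sigma>) \<noteq> {}" using that True by blast
    then obtain a where a: "a \<in> A" "a \<in> U" "a \<in> V" using * by auto
    have "B \<inter> \<Inter>(set [p U, p V]) \<noteq> {}" using a g p[of U] p[of V] * by auto
    then have "c [p U, p V] = 0" using c unfolding cocycles_def cochains_def by blast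
    then show ?thesis using pc * a by simp
  qed (simp add: pullback_cochain_def)
  fix U V W assume *: "U \<in> \<V>" "V \<in> \<V>" "W \<in> \<V>" "U \<inter> V \<inter> W \<noteq> {}"
  then obtain x where x: "x \<in> U" "x \<in> V" "x \<in> W" by auto
  have "c [p U, p W] = c [p U, p V] + c [p V, p W]"
    by (rule cocycle_1D[OF c, of _ _ _ "g x"]) (use * x p in auto)
  then show "pullback_cochain \<V> 1 p c [V, W] - pullback_cochain \<V> 1 p c [U, W] + pullback_cochain \<V> 1 p c [U, V] = 0"
    using pc[of _ _ x] * x by simp
qed

lemma Union_all_equal: "\<S> \<noteq> {} \<Longrightarrow> (\<And>S. S \<in> \<S> \<Longrightarrow> S = K) \<Longrightarrow> \<Union>\<S> = K"
  by auto

lemma as_class_mem: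
  assumes "(\<U>, c) \<in> as_class X A C" and "C \<in> asc X" and A: "pointlike A"
  obtains C' where "represents X \<U> c C'" "c \<in> cocycles \<U> A 1" "open_cover X \<U>" "C' \<in> asc X"
    "cobounds X (\<lambda>w. C w - C' w)"
proof -
  obtain C' where "represents X \<U> c C'" "cobounds X (\<lambda>w. C w - C' w)" "c \<in> cocycles \<U> A 1" "open_cover X \<U>"
    using assms unfolding as_class_def by blast
  then show ?thesis using that represents_asc by blast
qed

lemma as_class_memI:
  "represents X \<U> c C \<Longrightarrow> c \<in> cocycles \<U> A 1 \<Longrightarrow> (\<U>, c) \<in> as_class X A C"
  unfolding as_class_def represents_def using cobounds_0[of X] by fastforce

text \<open>Every choice of cover, cocycle and refinement in the union represents the pulled back
  cocycle, up to \<open>cobounds\<close>.\<close>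

lemma cech_map_as_class:
  assumes g: "continuous_map X Y g" "g ` A \<subseteq> B" and A: "pointlike A" "pointlike B" and C: "C \<in> asc Y"
  shows "cech_map X A 1 g (as_class Y B C) = as_class X A (\<lambda>(x, y). C (g x, g y))"
  unfolding cech_map_def
proof (rule Union_all_equal)
  obtain \<U> c where U: "represents Y \<U> c C" "c \<in> cocycles \<U> B 1" using asc_represents[OF C A(2)] .
  moreover obtain \<V> p where "open_cover X \<V>" "refinement g \<V> \<U> p"
    using continuous_refinement[OF g(1)] U(1) unfolding represents_def by metis
  ultimately show "{cech_class X A 1 \<V> (pullback_cochain \<V> 1 p c) |\<U> c \<V> p.
     (\<U>, c) \<in> as_class Y B C \<and> open_cover X \<V> \<and> refinement g \<V> \<U> p} \<noteq> {}"
    using as_class_memI by blast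
next
  fix S assume "S \<in> {cech_class X A 1 \<V> (pullback_cochain \<V> 1 p c) |\<U> c \<V> p.
     (\<U>, c) \<in> as_class Y B C \<and> open_cover X \<V> \<and> refinement g \<V> \<U> p}"
  then obtain \<U> c \<V> p where S: "S = cech_class X A 1 \<V> (pullback_cochain \<V> 1 p c)"
    and m: "(\<U>, c) \<in> as_class Y B C" and V: "open_cover X \<V>" "refinement g \<V> \<U> p" by auto
  obtain C' where C': "represents Y \<U> c C'" "c \<in> cocycles \<U> B 1" "C' \<in> asc Y" "cobounds Y (\<lambda>w. C w - C' w)"
    using as_class_mem[OF m C A(2)] by metis
  have "S = as_class X A (\<lambda>(x, y). C' (g x, g y))"
    unfolding S by (rule cech_class_as_class[OF represents_pullback[OF C'(1) V] A(1) cocycles_pullback[OF C'(2) V(2) g(2)]])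
  also have "\<dots> = as_class X A (\<lambda>(x, y). C (g x, g y))"
  proof (subst as_class_eq_iff[OF asc_continuous[OF C'(3) g(1)] asc_continuous[OF C g(1)] A(1)])
    have "cobounds X (\<lambda>(x, y). C' (g x, g y) - C (g x, g y))"
      by (rule cobounds_continuous[OF cobounds_diff_sym[OF C'(4)] g(1)])
    then show "cobounds X (\<lambda>w. (\<lambda>(x, y). C' (g x, g y)) w - (\<lambda>(x, y). C (g x, g y)) w)"
      by (simp add: case_prod_unfold)
  qed
  finally show "S = as_class X A (\<lambda>(x, y). C (g x, g y))" .
qed

lemma carrier_cech_1:
  assumes A: "pointlike A"
  shows "carrier (cech_cohomology X A 1) = as_class X A ` (asc X :: ('x \<times> 'x \<Rightarrow> 'k::field) set)"
proof (rule Set.set_eqI)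
  fix v :: "('x, 'k) cech"
  show "v \<in> carrier (cech_cohomology X A 1) \<longleftrightarrow> v \<in> as_class X A ` asc X"
  proof
    assume "v \<in> carrier (cech_cohomology X A 1)"
    then obtain \<U> c where *: "v = cech_class X A 1 \<U> c" "open_cover X \<U>" "c \<in> cocycles \<U> A 1"
      unfolding cech_cohomology_def by auto
    obtain C where C: "represents X \<U> c C" using cocycle_represents[OF *(2,3)] .
    show "v \<in> as_class X A ` asc X"
      using cech_class_as_class[OF C A *(3)] represents_asc[OF C] *(1) by auto
  next
    assume "v \<in> as_class X A ` asc X"
    then obtain C where C: "C \<in> asc X" "v = as_class X A C" by auto
    obtain \<U> c where U: "represents X \<U> c C" "c \<in> cocycles \<U> A 1" using asc_represents[OF C(1) A] .
    show "v \<in> carrier (cech_cohomology X A 1)"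
      using cech_class_as_class[OF U(1) A U(2)] C(2) U unfolding cech_cohomology_def represents_def by auto
  qed
qed

lemma zero_cech_1:
  assumes A: "pointlike A"
  shows "\<zero>\<^bsub>cech_cohomology X A 1\<^esub> = as_class X A (\<lambda>_. 0)"
proof -
  have "represents X {topspace X} (\<lambda>_. 0) (\<lambda>_. 0)"
    unfolding represents_def primitives_def using open_cover_topspace[of X]
    by (auto intro!: exI[of _ "\<lambda>_ _. 0"])
  moreover have "(\<lambda>_. 0) \<in> cocycles {topspace X} A 1"
    unfolding cocycles_def coboundary_1_eq cochains_def by auto
  ultimately show ?thesis using cech_class_as_class[OF _ A] unfolding cech_cohomology_def by fastforce
qed

lemma add_cech_1:
  assumes A: "pointlike A" and C: "C \<in> asc X" and D: "D \<in> asc X"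
  shows "as_class X A C \<oplus>\<^bsub>cech_cohomology X A 1\<^esub> as_class X A D = as_class X A (\<lambda>w. C w + D w)"
proof -
  have "\<Union>{cech_class X A 1 \<U> (\<lambda>\<sigma>. c \<sigma> + d \<sigma>) | \<U> c d. (\<U>, c) \<in> as_class X A C \<and> (\<U>, d) \<in> as_class X A D}
      = as_class X A (\<lambda>w. C w + D w)"
  proof (rule Union_all_equal)
    obtain \<U> c where U: "represents X \<U> c C" "c \<in> cocycles \<U> A 1" using asc_represents[OF C A] .
    obtain \<V> d where V: "represents X \<V> d D" "d \<in> cocycles \<V> A 1" using asc_represents[OF D A] .
    obtain \<W> p r where W: "open_cover X \<W>" "refinement id \<W> \<U> p" "refinement id \<W> \<V> r"
      using common_refinement U(1) V(1) unfolding represents_def by metis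
    have "(\<W>, pullback_cochain \<W> 1 p c) \<in> as_class X A C" "(\<W>, pullback_cochain \<W> 1 r d) \<in> as_class X A D"
      using as_class_memI[OF represents_pullback[OF U(1) W(1,2)] cocycles_pullback[OF U(2) W(2)]]
        as_class_memI[OF represents_pullback[OF V(1) W(1,3)] cocycles_pullback[OF V(2) W(3)]] by auto
    then show "{cech_class X A 1 \<U> (\<lambda>\<sigma>. c \<sigma> + d \<sigma>) | \<U> c d.
        (\<U>, c) \<in> as_class X A C \<and> (\<U>, d) \<in> as_class X A D} \<noteq> {}" by blast
  next
    fix S assume "S \<in> {cech_class X A 1 \<U> (\<lambda>\<sigma>. c \<sigma> + d \<sigma>) | \<U> c d.
        (\<U>, c) \<in> as_class X A C \<and> (\<U>, d) \<in> as_class X A D}"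
    then obtain \<U> c d where S: "S = cech_class X A 1 \<U> (\<lambda>\<sigma>. c \<sigma> + d \<sigma>)"
      and m: "(\<U>, c) \<in> as_class X A C" "(\<U>, d) \<in> as_class X A D" by auto
    obtain C' where C': "represents X \<U> c C'" "c \<in> cocycles \<U> A 1" "C' \<in> asc X" "cobounds X (\<lambda>w. C w - C' w)"
      using as_class_mem[OF m(1) C A] by metis
    obtain D' where D': "represents X \<U> d D'" "d \<in> cocycles \<U> A 1" "D' \<in> asc X" "cobounds X (\<lambda>w. D w - D' w)"
      using as_class_mem[OF m(2) D A] by metis
    obtain s where s: "primitives \<U> s C'" "\<forall>U\<in>\<U>. \<forall>V\<in>\<U>. \<forall>x\<in>U \<inter> V. s V x - s U x = c [U, V]"
      using C'(1) unfolding represents_def by auto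
    obtain t where t: "primitives \<U> t D'" "\<forall>U\<in>\<U>. \<forall>V\<in>\<U>. \<forall>x\<in>U \<inter> V. t V x - t U x = d [U, V]"
      using D'(1) unfolding represents_def by auto
    have "primitives \<U> (\<lambda>U x. s U x + t U x) (\<lambda>w. C' w + D' w)"
      by (rule primitivesI)
        (auto simp: primitivesD(1)[OF s(1)] primitivesD(1)[OF t(1)] s(2) t(2) add_diff_add)
    then have R: "represents X \<U> (\<lambda>\<sigma>. c \<sigma> + d \<sigma>) (\<lambda>w. C' w + D' w)"
      unfolding represents_def using C'(1) s(2) t(2)
      by (auto simp: represents_def add_diff_add intro!: exI[of _ "\<lambda>U x. s U x + t U x"])
    have "(\<lambda>\<sigma>. c \<sigma> + d \<sigma>) \<in> cocycles \<U> A 1"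
      unfolding cocycles_def coboundary_1_eq
    proof (intro CollectI conjI ballI impI)
      show "(\<lambda>\<sigma>. c \<sigma> + d \<sigma>) \<in> cochains \<U> A 1" using C'(2) D'(2) unfolding cocycles_def cochains_def by auto
      fix U V W assume *: "U \<in> \<U>" "V \<in> \<U>" "W \<in> \<U>" "U \<inter> V \<inter> W \<noteq> {}"
      then obtain x where x: "x \<in> U" "x \<in> V" "x \<in> W" by auto
      show "c [V, W] + d [V, W] - (c [U, W] + d [U, W]) + (c [U, V] + d [U, V]) = 0"
        using cocycle_1D[OF C'(2) *(1-3) x] cocycle_1D[OF D'(2) *(1-3) x] by simp
    qed
    then have "S = as_class X A (\<lambda>w. C' w + D' w)" unfolding S by (rule cech_class_as_class[OF R A])
    also have "\<dots> = as_class X A (\<lambda>w. C w + D w)"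
      using cobounds_add[OF cobounds_diff_sym[OF C'(4)] cobounds_diff_sym[OF D'(4)]]
      by (subst as_class_eq_iff[OF asc_add[OF C'(3) D'(3)] asc_add[OF C D] A]) (simp add: add_diff_add)
    finally show "S = as_class X A (\<lambda>w. C w + D w)" .
  qed
  then show ?thesis unfolding cech_cohomology_def by simp
qed

lemma smult_cech_1:
  assumes A: "pointlike A" and C: "C \<in> asc X"
  shows "a \<odot>\<^bsub>cech_cohomology X A 1\<^esub> as_class X A C = as_class X A (\<lambda>w. a * C w)"
proof -
  have "\<Union>{cech_class X A 1 \<U> (\<lambda>\<sigma>. a * c \<sigma>) | \<U> c. (\<U>, c) \<in> as_class X A C} = as_class X A (\<lambda>w. a * C w)"
  proof (rule Union_all_equal)
    obtain \<U> c where U: "represents X \<U> c C" "c \<in> cocycles \<U> A 1" using asc_represents[OF C A] .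
    then show "{cech_class X A 1 \<U> (\<lambda>\<sigma>. a * c \<sigma>) | \<U> c. (\<U>, c) \<in> as_class X A C} \<noteq> {}"
      using as_class_memI by blast
  next
    fix S assume "S \<in> {cech_class X A 1 \<U> (\<lambda>\<sigma>. a * c \<sigma>) | \<U> c. (\<U>, c) \<in> as_class X A C}"
    then obtain \<U> c where S: "S = cech_class X A 1 \<U> (\<lambda>\<sigma>. a * c \<sigma>)"
      and m: "(\<U>, c) \<in> as_class X A C" by auto
    obtain C' where C': "represents X \<U> c C'" "c \<in> cocycles \<U> A 1" "C' \<in> asc X" "cobounds X (\<lambda>w. C w - C' w)"
      using as_class_mem[OF m(1) C A] by metis
    obtain s where s: "primitives \<U> s C'" "\<forall>U\<in>\<U>. \<forall>V\<in>\<U>. \<forall>x\<in>U \<inter> V. s V x - s U x = c [U, V]"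
      using C'(1) unfolding represents_def by auto
    have "primitives \<U> (\<lambda>U x. a * s U x) (\<lambda>w. a * C' w)"
      by (rule primitivesI) (auto simp: primitivesD(1)[OF s(1)] s(2) right_diff_distrib[symmetric])
    then have R: "represents X \<U> (\<lambda>\<sigma>. a * c \<sigma>) (\<lambda>w. a * C' w)"
      unfolding represents_def using C'(1) s(2)
      by (auto simp: represents_def right_diff_distrib[symmetric] intro!: exI[of _ "\<lambda>U x. a * s U x"])
    have "(\<lambda>\<sigma>. a * c \<sigma>) \<in> cocycles \<U> A 1"
      unfolding cocycles_def coboundary_1_eq
    proof (intro CollectI conjI ballI impI)
      show "(\<lambda>\<sigma>. a * c \<sigma>) \<in> cochains \<U> A 1" using C'(2) unfolding cocycles_def cochains_def by auto
      fix U V W assume *: "U \<in> \<U>" "V \<in> \<U>" "W \<in> \<U>" "U \<inter> V \<inter> W \<noteq> {}"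
      then obtain x where x: "x \<in> U" "x \<in> V" "x \<in> W" by auto
      show "a * c [V, W] - a * c [U, W] + a * c [U, V] = 0"
        using cocycle_1D[OF C'(2) *(1-3) x] by (simp add: algebra_simps)
    qed
    then have "S = as_class X A (\<lambda>w. a * C' w)" unfolding S by (rule cech_class_as_class[OF R A])
    also have "\<dots> = as_class X A (\<lambda>w. a * C w)"
      using cobounds_smult[OF cobounds_diff_sym[OF C'(4)], of a]
      by (subst as_class_eq_iff[OF asc_smult[OF C'(3)] asc_smult[OF C] A]) (simp add: right_diff_distrib)
    finally show "S = as_class X A (\<lambda>w. a * C w)" .
  qed
  then show ?thesis unfolding cech_cohomology_def by simp
qed

lemma vs_cech_1: "pointlike A \<Longrightarrow> is_vs (cech_cohomology X A 1)"
  by (rule vs_of_functions[OF carrier_cech_1 zero_cech_1 add_cech_1 smult_cech_1])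
    (auto intro: asc_0 asc_add asc_smult)

lemma cech_map_lin_map:
  fixes X :: "'a topology" and Y :: "'b topology"
  assumes g: "continuous_map X Y g" "g ` A \<subseteq> B" and A: "pointlike A" "pointlike B"
  shows "lin_map (cech_cohomology Y B 1 :: ('c::field, ('b, 'c) cech) module) (cech_cohomology X A 1) (cech_map X A 1 g)"
proof -
  note m = cech_map_as_class[OF g A]
  show ?thesis
    unfolding lin_map_def carrier_cech_1[OF A(1)] carrier_cech_1[OF A(2)] ball_simps
  proof (intro conjI ballI allI)
    fix C :: "'b \<times> 'b \<Rightarrow> 'c" assume C: "C \<in> asc Y"
    show "cech_map X A 1 g (as_class Y B C) \<in> as_class X A ` asc X"
      using m[OF C] asc_continuous[OF C g(1)] by auto
    have gC: "(\<lambda>(x, y). C (g x, g y)) \<in> asc X" by (rule asc_continuous[OF C g(1)])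
    show "cech_map X A 1 g (a \<odot>\<^bsub>cech_cohomology Y B 1\<^esub> as_class Y B C) =
      a \<odot>\<^bsub>cech_cohomology X A 1\<^esub> cech_map X A 1 g (as_class Y B C)" for a
      unfolding smult_cech_1[OF A(2) C] m[OF C] m[OF asc_smult[OF C]] smult_cech_1[OF A(1) gC]
      by (simp add: case_prod_unfold)
    fix D :: "'b \<times> 'b \<Rightarrow> 'c" assume D: "D \<in> asc Y"
    have gD: "(\<lambda>(x, y). D (g x, g y)) \<in> asc X" by (rule asc_continuous[OF D g(1)])
    show "cech_map X A 1 g (as_class Y B C \<oplus>\<^bsub>cech_cohomology Y B 1\<^esub> as_class Y B D) =
      cech_map X A 1 g (as_class Y B C) \<oplus>\<^bsub>cech_cohomology X A 1\<^esub> cech_map X A 1 g (as_class Y B D)"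
      unfolding add_cech_1[OF A(2) C D] m[OF C] m[OF D] m[OF asc_add[OF C D]] add_cech_1[OF A(1) gC gD]
      by (simp add: case_prod_unfold)
  qed
qed

lemma cech_map_comp:
  assumes g: "continuous_map X Y g" "g ` A \<subseteq> B" and h: "continuous_map Y Z h" "h ` B \<subseteq> E"
    and A: "pointlike A" "pointlike B" "pointlike E" and v: "v \<in> carrier (cech_cohomology Z E 1)"
  shows "cech_map X A 1 g (cech_map Y B 1 h v) = cech_map X A 1 (h \<circ> g) v"
proof -
  obtain C where C: "C \<in> asc Z" "v = as_class Z E C" using v unfolding carrier_cech_1[OF A(3)] by auto
  have hg: "continuous_map X Z (h \<circ> g)" "(h \<circ> g) ` A \<subseteq> E"
    using continuous_map_compose[OF g(1) h(1)] g(2) h(2) by auto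
  show ?thesis
    unfolding C(2) cech_map_as_class[OF h A(2,3) C(1)] cech_map_as_class[OF hg A(1,3) C(1)]
      cech_map_as_class[OF g A(1,2) asc_continuous[OF C(1) h(1)]] by simp
qed

lemma pointlike_simps [simp]: "pointlike {}" "pointlike {a}"
  unfolding pointlike_def by auto

text \<open>The finiteness assumption concerns absolute cohomology, while the index is relative to
  the base point. In degree one the identity on cocycles induces a linear surjection from the former
  onto the latter.\<close>

lemma fin_dim_cech_1_rel:
  assumes "vectorspace.fin_dim class_ring (cech_cohomology X {} 1 :: ('k::field, ('x, 'k) cech) module)"
  shows "fin_dim_vs (cech_cohomology X {a} 1 :: ('k, ('x, 'k) cech) module)"
proof -
  let ?V = "cech_cohomology X {} 1 :: ('k, ('x, 'k) cech) module"
  let ?W = "cech_cohomology X {a} 1 :: ('k, ('x, 'k) cech) module"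
  define p where "p v = as_class X {a} (SOME C. C \<in> asc X \<and> v = as_class X {} C)" for v :: "('x, 'k) cech"
  have p: "p (as_class X {} C) = as_class X {a} C" if C: "C \<in> asc X" for C :: "'x \<times> 'x \<Rightarrow> 'k"
  proof -
    let ?C = "SOME D. D \<in> asc X \<and> as_class X {} C = as_class X {} D"
    have *: "?C \<in> asc X \<and> as_class X {} C = as_class X {} ?C" by (rule someI[of _ C]) (use C in auto)
    then have "cobounds X (\<lambda>w. C w - ?C w)" using as_class_eq_iff[OF C] by auto
    then have "as_class X {a} C = as_class X {a} ?C" using as_class_eq_iff[OF C] * by auto
    then show ?thesis unfolding p_def by simp
  qed
  have "lin_map ?V ?W p"
    unfolding lin_map_def carrier_cech_1[OF pointlike_simps(1)] carrier_cech_1[OF pointlike_simps(2)] ball_simps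
    by (simp add: p add_cech_1 smult_cech_1 asc_add asc_smult del: One_nat_def)
  then have "fin_dim_vs (?W\<lparr>carrier := p ` carrier ?V\<rparr>)"
    by (rule fin_dim_image[of ?V ?W p "\<lambda>v. v" "\<lambda>v. v", rotated 2])
      (use assms vs_cech_1[of "{}" X] vs_cech_1[of "{a}" X] in \<open>simp_all add: fin_dim_vs_iff lin_map_def del: One_nat_def\<close>)
  moreover have "p ` carrier ?V = carrier ?W"
    unfolding carrier_cech_1[OF pointlike_simps(1)] carrier_cech_1[OF pointlike_simps(2)]
    using p by (auto simp: image_iff)
  ultimately show ?thesis by simp
qed

section \<open>Cech cohomology in degree zero\<close>

definition locally_constant :: "'x topology \<Rightarrow> ('x \<Rightarrow> 'k) \<Rightarrow> bool" where
  "locally_constant X F \<longleftrightarrow> near X (\<lambda>x y. F x = F y)"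

text \<open>The absolute degree zero class that corresponds to a locally constant function.\<close>

definition lc_class :: "'x topology \<Rightarrow> ('x \<Rightarrow> 'k::field) \<Rightarrow> ('x, 'k) cech" where
  "lc_class X F = {(\<U>, c). open_cover X \<U> \<and> c \<in> cocycles \<U> {} 0 \<and> (\<forall>U\<in>\<U>. \<forall>x\<in>U. c [U] = F x)}"

lemma lc_class_ex:
  assumes "locally_constant X F"
  obtains \<U> c where "(\<U>, c) \<in> lc_class X F"
proof -
  define \<U> where "\<U> = {U. openin X U \<and> (\<forall>y\<in>U. \<forall>z\<in>U. F y = F z)}"
  have "x \<in> \<Union>\<U>" if x: "x \<in> topspace X" for x
  proof -
    obtain U where "openin X U" "x \<in> U" "\<And>y z. y \<in> U \<Longrightarrow> z \<in> U \<Longrightarrow> F y = F z"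
      by (rule nearE[OF assms[unfolded locally_constant_def] x]) (rule that)
    then show ?thesis unfolding \<U>_def by blast
  qed
  then have U: "open_cover X \<U>" unfolding open_cover_def \<U>_def using openin_subset by blast
  define c where "c \<sigma> = (if \<sigma> \<in> nerve \<U> 0 then F (SOME x. x \<in> hd \<sigma>) else 0)" for \<sigma>
  have c: "c [U] = F x" if "U \<in> \<U>" "x \<in> U" for U x
  proof -
    have "[U] \<in> nerve \<U> 0" unfolding nerve_0 using that by auto
    moreover have "(SOME x. x \<in> U) \<in> U" by (rule someI[of _ x]) (use that in auto)
    then have "F (SOME x. x \<in> U) = F x" using that unfolding \<U>_def by blast
    ultimately show ?thesis unfolding c_def by simp
  qed
  have "c \<in> cocycles \<U> {} 0"
    unfolding cocycles_def coboundary_0_eq cochains_def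
  proof (intro CollectI conjI allI impI ballI)
    show "c \<sigma> = 0" if "\<sigma> \<notin> nerve \<U> 0 \<or> {} \<inter> \<Inter> (set \<sigma>) \<noteq> {}" for \<sigma> using that unfolding c_def by auto
    show "c [V] = c [U]" if UV: "U \<in> \<U>" "V \<in> \<U>" "U \<inter> V \<noteq> {}" for U V
    proof -
      obtain x where "x \<in> U" "x \<in> V" using UV(3) by auto
      then show ?thesis using c[OF UV(1)] c[OF UV(2)] by simp
    qed
  qed
  then show ?thesis using that U c unfolding lc_class_def by auto
qed

lemma cech_class_lc_class:
  assumes m: "(\<U>, c) \<in> lc_class X F" shows "cech_class X {} 0 \<U> c = lc_class X F"
proof -
  have U: "open_cover X \<U>" and c: "\<And>U x. U \<in> \<U> \<Longrightarrow> x \<in> U \<Longrightarrow> c [U] = F x"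
    using m unfolding lc_class_def by auto
  have "(\<V>, d) \<in> cech_class X {} 0 \<U> c \<longleftrightarrow> (\<V>, d) \<in> lc_class X F" for \<V> d
  proof
    assume "(\<V>, d) \<in> cech_class X {} 0 \<U> c"
    then obtain \<W> p r where V: "open_cover X \<V>" "d \<in> cocycles \<V> {} 0" and W: "open_cover X \<W>"
      "refinement id \<W> \<U> p" "refinement id \<W> \<V> r"
      and eq: "(\<lambda>\<sigma>. pullback_cochain \<W> 0 p c \<sigma> - pullback_cochain \<W> 0 r d \<sigma>) = (\<lambda>_. 0)"
      unfolding cech_class_def coboundaries_def by auto
    have "d [V] = F x" if Vx: "V \<in> \<V>" "x \<in> V" for V x
    proof -
      have "x \<in> topspace X" using Vx V unfolding open_cover_def by auto
      then obtain G where G: "G \<in> \<W>" "x \<in> G" using W(1) unfolding open_cover_def by auto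
      then have g: "p G \<in> \<U>" "x \<in> p G" "r G \<in> \<V>" "x \<in> r G" using W(2,3) unfolding refinement_def by auto
      have "[G] \<in> nerve \<W> 0" unfolding nerve_0 using G by auto
      then have "c [p G] = d [r G]" using fun_cong[OF eq, of "[G]"] unfolding pullback_cochain_def by simp
      moreover have "r G \<inter> V \<noteq> {}" using g Vx by auto
      then have "d [V] = d [r G]" using V(2) g(3) Vx(1) unfolding cocycles_def coboundary_0_eq by blast
      ultimately show ?thesis using c[OF g(1,2)] by simp
    qed
    then show "(\<V>, d) \<in> lc_class X F" unfolding lc_class_def using V by auto
  next
    assume "(\<V>, d) \<in> lc_class X F"
    then have V: "open_cover X \<V>" "d \<in> cocycles \<V> {} 0" and d: "\<And>U x. U \<in> \<V> \<Longrightarrow> x \<in> U \<Longrightarrow> d [U] = F x"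
      unfolding lc_class_def by auto
    obtain \<W> p r where W: "open_cover X \<W>" "refinement id \<W> \<U> p" "refinement id \<W> \<V> r"
      using common_refinement[OF U V(1)] .
    have "pullback_cochain \<W> 0 p c \<sigma> - pullback_cochain \<W> 0 r d \<sigma> = 0" for \<sigma>
    proof (cases "\<sigma> \<in> nerve \<W> 0")
      case True
      then obtain G x where G: "\<sigma> = [G]" "G \<in> \<W>" "x \<in> G" unfolding nerve_0 by auto
      then have g: "p G \<in> \<U>" "x \<in> p G" "r G \<in> \<V>" "x \<in> r G" using W(2,3) unfolding refinement_def by auto
      show ?thesis using c[OF g(1,2)] d[OF g(3,4)] G(1) unfolding pullback_cochain_def by simp
    qed (simp add: pullback_cochain_def)
    then have "(\<lambda>\<sigma>. pullback_cochain \<W> 0 p c \<sigma> - pullback_cochain \<W> 0 r d \<sigma>) \<in> coboundaries \<W> {} 0"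
      unfolding coboundaries_def by simp
    then show "(\<V>, d) \<in> cech_class X {} 0 \<U> c" unfolding cech_class_def using V W by blast
  qed
  then show ?thesis by auto
qed

lemma lc_class_locally_constant: "(\<U>, c) \<in> lc_class X F \<Longrightarrow> locally_constant X F"
  unfolding locally_constant_def
proof (rule nearI)
  fix x assume "(\<U>, c) \<in> lc_class X F" "x \<in> topspace X"
  then obtain U where "U \<in> \<U>" "x \<in> U" "openin X U" "\<forall>x\<in>U. c [U] = F x"
    unfolding lc_class_def open_cover_def by blast
  then show "\<exists>U. openin X U \<and> x \<in> U \<and> (\<forall>y\<in>U. \<forall>z\<in>U. F y = F z)" by metis
qed

lemma vs_cech_0:
  fixes X :: "'x topology"
  defines "V \<equiv> cech_cohomology X {} 0 :: ('k::field, ('x, 'k) cech) module"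
  shows carrier_cech_0: "carrier V = lc_class X ` {F. locally_constant X F}"
    and zero_cech_0: "\<zero>\<^bsub>V\<^esub> = lc_class X (\<lambda>_. 0)"
    and add_cech_0: "locally_constant X F \<Longrightarrow> locally_constant X G \<Longrightarrow>
      lc_class X F \<oplus>\<^bsub>V\<^esub> lc_class X G = lc_class X (\<lambda>x. F x + G x)"
    and smult_cech_0: "locally_constant X F \<Longrightarrow> a \<odot>\<^bsub>V\<^esub> lc_class X F = lc_class X (\<lambda>x. a * F x)"
    and is_vs_cech_0: "is_vs V"
proof -
  have lcI: "(\<U>, c) \<in> lc_class X (\<lambda>x. c [SOME U. U \<in> \<U> \<and> x \<in> U])"
    if "open_cover X \<U>" "c \<in> cocycles \<U> {} 0" for \<U> and c :: "'x set list \<Rightarrow> 'k"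
  proof -
    have "c [U] = c [SOME U. U \<in> \<U> \<and> x \<in> U]" if x: "U \<in> \<U>" "x \<in> U" for U x
    proof -
      have "(SOME U. U \<in> \<U> \<and> x \<in> U) \<in> \<U> \<and> x \<in> (SOME U. U \<in> \<U> \<and> x \<in> U)"
        by (rule someI[of _ U]) (use x in auto)
      then have "(SOME U. U \<in> \<U> \<and> x \<in> U) \<in> \<U>" "(SOME U. U \<in> \<U> \<and> x \<in> U) \<inter> U \<noteq> {}" using x by auto
      then show ?thesis using \<open>c \<in> _\<close> x(1) unfolding cocycles_def coboundary_0_eq by blast
    qed
    then show ?thesis using that unfolding lc_class_def by auto
  qed
  show car: "carrier V = lc_class X ` {F. locally_constant X F}"
  proof (rule Set.set_eqI)
    fix v :: "('x, 'k) cech"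
    show "v \<in> carrier V \<longleftrightarrow> v \<in> lc_class X ` {F. locally_constant X F}"
    proof
      assume "v \<in> carrier V"
      then obtain \<U> c where *: "v = cech_class X {} 0 \<U> c" "open_cover X \<U>" "c \<in> cocycles \<U> {} 0"
        unfolding V_def cech_cohomology_def by auto
      show "v \<in> lc_class X ` {F. locally_constant X F}"
        using cech_class_lc_class[OF lcI[OF *(2,3)]] lc_class_locally_constant[OF lcI[OF *(2,3)]] *(1) by blast
    next
      assume "v \<in> lc_class X ` {F. locally_constant X F}"
      then obtain F where F: "locally_constant X F" "v = lc_class X F" by auto
      obtain \<U> c where "(\<U>, c) \<in> lc_class X F" using lc_class_ex[OF F(1)] .
      moreover from this have "cech_class X {} 0 \<U> c = lc_class X F" by (rule cech_class_lc_class)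
      ultimately show "v \<in> carrier V"
        unfolding V_def cech_cohomology_def using F \<open>(\<U>, c) \<in> lc_class X F\<close>
        unfolding lc_class_def[of X F] by fastforce
    qed
  qed
  show z: "\<zero>\<^bsub>V\<^esub> = lc_class X (\<lambda>_. 0)"
  proof -
    have "({topspace X}, \<lambda>_. 0) \<in> lc_class X (\<lambda>_. 0 :: 'k)"
      unfolding lc_class_def cocycles_def coboundary_0_eq cochains_def using open_cover_topspace[of X] by auto
    from cech_class_lc_class[OF this] show ?thesis unfolding V_def cech_cohomology_def by simp
  qed
  have lc_add: "locally_constant X (\<lambda>x. F x + G x)" if "locally_constant X F" "locally_constant X G" for F G :: "'x \<Rightarrow> 'k"
    using near_mono[OF near_conj[OF that[unfolded locally_constant_def]]] unfolding locally_constant_def by simp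
  have lc_smult: "locally_constant X (\<lambda>x. a * F x)" if "locally_constant X F" for a and F :: "'x \<Rightarrow> 'k"
    using near_mono[OF that[unfolded locally_constant_def]] unfolding locally_constant_def by simp
  show ad: "lc_class X F \<oplus>\<^bsub>V\<^esub> lc_class X G = lc_class X (\<lambda>x. F x + G x)"
    if F: "locally_constant X F" and G: "locally_constant X G" for F G
  proof -
    have "\<Union>{cech_class X {} 0 \<U> (\<lambda>\<sigma>. c \<sigma> + d \<sigma>) | \<U> c d. (\<U>, c) \<in> lc_class X F \<and> (\<U>, d) \<in> lc_class X G}
      = lc_class X (\<lambda>x. F x + G x)"
    proof (rule Union_all_equal)
      obtain \<U> c where U: "(\<U>, c) \<in> lc_class X F" using lc_class_ex[OF F] .
      obtain \<V> d where V: "(\<V>, d) \<in> lc_class X G" using lc_class_ex[OF G] .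
      obtain \<W> p r where W: "open_cover X \<W>" "refinement id \<W> \<U> p" "refinement id \<W> \<V> r"
      proof -
        have "open_cover X \<U>" "open_cover X \<V>" using U V unfolding lc_class_def by auto
        then show ?thesis using common_refinement that by metis
      qed
      have pb: "(\<W>, pullback_cochain \<W> 0 q b) \<in> lc_class X H"
        if "refinement id \<W> \<A> q" "(\<A>, b) \<in> lc_class X H" for \<A> q b and H :: "'x \<Rightarrow> 'k"
      proof -
        have b: "pullback_cochain \<W> 0 q b [U] = H x" if "U \<in> \<W>" "x \<in> U" for U x
        proof -
          have "[U] \<in> nerve \<W> 0" unfolding nerve_0 using that by auto
          then show ?thesis
            using that \<open>refinement id \<W> \<A> q\<close> \<open>(\<A>, b) \<in> _\<close>
            unfolding pullback_cochain_def lc_class_def refinement_def by auto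
        qed
        have "pullback_cochain \<W> 0 q b [V'] = pullback_cochain \<W> 0 q b [U']"
          if UV: "U' \<in> \<W>" "V' \<in> \<W>" "U' \<inter> V' \<noteq> {}" for U' V'
        proof -
          obtain x where "x \<in> U'" "x \<in> V'" using UV(3) by auto
          then show ?thesis using b[OF UV(1)] b[OF UV(2)] by simp
        qed
        moreover have "pullback_cochain \<W> 0 q b \<in> cochains \<W> {} 0"
          unfolding cochains_def pullback_cochain_def by simp
        ultimately show ?thesis
          unfolding lc_class_def cocycles_def coboundary_0_eq using W(1) b by simp
      qed
      show "{cech_class X {} 0 \<U> (\<lambda>\<sigma>. c \<sigma> + d \<sigma>) | \<U> c d.
          (\<U>, c) \<in> lc_class X F \<and> (\<U>, d) \<in> lc_class X G} \<noteq> {}"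
        using pb[OF W(2) U] pb[OF W(3) V] by blast
    next
      fix S assume "S \<in> {cech_class X {} 0 \<U> (\<lambda>\<sigma>. c \<sigma> + d \<sigma>) | \<U> c d.
          (\<U>, c) \<in> lc_class X F \<and> (\<U>, d) \<in> lc_class X G}"
      then obtain \<U> c d where S: "S = cech_class X {} 0 \<U> (\<lambda>\<sigma>. c \<sigma> + d \<sigma>)"
        and m: "(\<U>, c) \<in> lc_class X F" "(\<U>, d) \<in> lc_class X G" by auto
      have "(\<U>, \<lambda>\<sigma>. c \<sigma> + d \<sigma>) \<in> lc_class X (\<lambda>x. F x + G x)"
        using m unfolding lc_class_def cocycles_def coboundary_0_eq cochains_def by auto
      then show "S = lc_class X (\<lambda>x. F x + G x)" unfolding S by (rule cech_class_lc_class)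
    qed
    then show ?thesis unfolding V_def cech_cohomology_def by simp
  qed
  show sm: "a \<odot>\<^bsub>V\<^esub> lc_class X F = lc_class X (\<lambda>x. a * F x)" if F: "locally_constant X F" for a F
  proof -
    have "\<Union>{cech_class X {} 0 \<U> (\<lambda>\<sigma>. a * c \<sigma>) | \<U> c. (\<U>, c) \<in> lc_class X F} = lc_class X (\<lambda>x. a * F x)"
    proof (rule Union_all_equal)
      obtain \<U> c where U: "(\<U>, c) \<in> lc_class X F" using lc_class_ex[OF F] .
      then show "{cech_class X {} 0 \<U> (\<lambda>\<sigma>. a * c \<sigma>) | \<U> c. (\<U>, c) \<in> lc_class X F} \<noteq> {}" by blast
    next
      fix S assume "S \<in> {cech_class X {} 0 \<U> (\<lambda>\<sigma>. a * c \<sigma>) | \<U> c. (\<U>, c) \<in> lc_class X F}"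
      then obtain \<U> c where S: "S = cech_class X {} 0 \<U> (\<lambda>\<sigma>. a * c \<sigma>)" and m: "(\<U>, c) \<in> lc_class X F" by auto
      have "(\<U>, \<lambda>\<sigma>. a * c \<sigma>) \<in> lc_class X (\<lambda>x. a * F x)"
        using m unfolding lc_class_def cocycles_def coboundary_0_eq cochains_def by auto
      then show "S = lc_class X (\<lambda>x. a * F x)" unfolding S by (rule cech_class_lc_class)
    qed
    then show ?thesis unfolding V_def cech_cohomology_def by simp
  qed
  show "is_vs V"
  proof (rule vs_of_functions[OF car z])
    show "(\<lambda>_. 0) \<in> {F :: 'x \<Rightarrow> 'k. locally_constant X F}"
      unfolding locally_constant_def by (auto intro: nearI)
  qed (simp_all add: ad sm lc_add lc_smult)
qed

lemma lc_class_eqD: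
  assumes "lc_class X F = lc_class X G" "locally_constant X F" "x \<in> topspace X" shows "F x = G x"
proof -
  obtain \<U> c where m: "(\<U>, c) \<in> lc_class X F" using lc_class_ex[OF assms(2)] .
  have "x \<in> \<Union>\<U>" using m assms(3) unfolding lc_class_def open_cover_def by auto
  then obtain U where U: "U \<in> \<U>" "x \<in> U" by auto
  have "(\<U>, c) \<in> lc_class X G" using m assms(1) by simp
  with m U show ?thesis unfolding lc_class_def by fastforce
qed

text \<open>To be applied to indicators of clopen sets. A linear relation between the classes is one
  between the functions, since a class determines its function.\<close>

lemma locally_constant_dependent:
  fixes F :: "nat \<Rightarrow> 'x \<Rightarrow> 'k::field"
  assumes fd: "vectorspace.fin_dim class_ring (cech_cohomology X {} 0 :: ('k, ('x, 'k) cech) module)"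
    and F: "\<And>k. locally_constant X (F k)"
  obtains n a where "\<exists>k\<le>n. a k \<noteq> 0" "\<And>x. x \<in> topspace X \<Longrightarrow> (\<Sum>k\<le>n. a k * F k x) = 0"
proof -
  let ?V = "cech_cohomology X {} 0 :: ('k, ('x, 'k) cech) module"
  have V: "is_vs ?V" by (rule is_vs_cech_0)
  interpret V: vectorspace "class_ring :: 'k ring" ?V by fact
  define v where "v k = lc_class X (F k)" for k
  have vV: "v k \<in> carrier ?V" for k unfolding carrier_cech_0 v_def using F by auto
  have lc: "locally_constant X (\<lambda>x. \<Sum>k\<in>I. a k * F k x)" "finite I \<Longrightarrow>
      finsum ?V (\<lambda>k. a k \<odot>\<^bsub>?V\<^esub> v k) I = lc_class X (\<lambda>x. \<Sum>k\<in>I. a k * F k x)" for I a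
  proof -
    have 1: "locally_constant X (\<lambda>x. \<Sum>k\<in>I. a k * F k x)" if "finite I" for I
      using that
    proof (induction I)
      case empty then show ?case unfolding locally_constant_def near_def by auto
    next
      case (insert i I)
      from near_mono[OF near_conj[OF F[of i, unfolded locally_constant_def] insert.IH[unfolded locally_constant_def]]]
      show ?case using insert.hyps unfolding locally_constant_def by simp
    qed
    show "locally_constant X (\<lambda>x. \<Sum>k\<in>I. a k * F k x)"
    proof (cases "finite I")
      case False then show ?thesis unfolding locally_constant_def near_def by auto
    qed (rule 1)
    have ls: "locally_constant X (\<lambda>x. c * F i x)" for c i
      using near_mono[OF F[of i, unfolded locally_constant_def]] unfolding locally_constant_def by simp
    assume "finite I"
    then show "finsum ?V (\<lambda>k. a k \<odot>\<^bsub>?V\<^esub> v k) I = lc_class X (\<lambda>x. \<Sum>k\<in>I. a k * F k x)"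
    proof (induction I)
      case empty then show ?case by (simp add: zero_cech_0)
    next
      case (insert i I)
      have "finsum ?V (\<lambda>k. a k \<odot>\<^bsub>?V\<^esub> v k) (insert i I) = a i \<odot>\<^bsub>?V\<^esub> v i \<oplus>\<^bsub>?V\<^esub> finsum ?V (\<lambda>k. a k \<odot>\<^bsub>?V\<^esub> v k) I"
        by (rule V.M.finsum_insert) (use insert vV in auto)
      then show ?case
        using insert by (simp add: v_def smult_cech_0[OF F] add_cech_0[OF ls 1])
    qed
  qed
  show ?thesis
  proof (cases "inj v")
    case True
    let ?S = "v ` {..V.dim}"
    have "card ?S = Suc V.dim" using card_image[OF inj_on_subset[OF True subset_UNIV]] by simp
    then have "V.lin_dep ?S" using V.li_le_dim(2)[OF fd, of ?S] vV by auto
    then obtain b w where b: "V.lincomb b ?S = \<zero>\<^bsub>?V\<^esub>" "w \<in> ?S" "b w \<noteq> 0"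
      using V.finite_lin_dep[of ?S] vV by auto
    have "V.lincomb b ?S = finsum ?V (\<lambda>k. b (v k) \<odot>\<^bsub>?V\<^esub> v k) {..V.dim}"
      unfolding V.lincomb_def
      by (rule V.M.add.finprod_reindex) (use vV inj_on_subset[OF True subset_UNIV] in auto)
    also have "\<dots> = lc_class X (\<lambda>x. \<Sum>k\<le>V.dim. b (v k) * F k x)" by (rule lc(2)) simp
    finally have "lc_class X (\<lambda>x. \<Sum>k\<le>V.dim. b (v k) * F k x) = lc_class X (\<lambda>_. 0)"
      using b(1) by (simp add: zero_cech_0)
    from lc_class_eqD[OF this lc(1)] show ?thesis using b(2,3) by (intro that[of V.dim "\<lambda>k. b (v k)"]) auto
  next
    \<comment> \<open>Linear dependence of a set of vectors does not see repetitions; a class that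
      occurs twice gives a relation between two terms of the sequence.\<close>
    case False
    then obtain i j where ij: "i \<noteq> j" "v i = v j" unfolding inj_def by auto
    have eq: "F i x = F j x" if "x \<in> topspace X" for x
      using lc_class_eqD[OF ij(2)[unfolded v_def] F that] .
    define a where "a k = (if k = i then 1 else if k = j then -1 else (0::'k))" for k
    have "(\<Sum>k\<le>i + j. a k * F k x) = 0" if "x \<in> topspace X" for x
    proof -
      have "(\<Sum>k\<le>i + j. a k * F k x) = (\<Sum>k\<in>{i, j}. a k * F k x)"
        by (rule sum.mono_neutral_right) (auto simp: a_def)
      also have "\<dots> = 0" using ij(1) eq[OF that] by (simp add: a_def)
      finally show ?thesis .
    qed
    moreover have "\<exists>k\<le>i + j. a k \<noteq> 0" by (rule exI[of _ i]) (simp add: a_def)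
    ultimately show ?thesis using that by blast
  qed
qed

section \<open>Extension of potentials from closed sets\<close>

lemma compact_Hausdorff_shrink:
  assumes "compact_space W" "Hausdorff_space W" "openin W O'" "x \<in> O'"
  obtains G where "openin W G" "x \<in> G" "W closure_of G \<subseteq> O'"
proof -
  have r: "regular_space W" by (rule compact_Hausdorff_imp_regular_space[OF assms(1,2)])
  have "closedin W (topspace W - O')" "x \<in> topspace W - (topspace W - O')"
    using assms(3,4) openin_subset by auto
  then obtain U V where UV: "openin W U" "openin W V" "x \<in> U" "topspace W - O' \<subseteq> V" "disjnt U V"
    using r[unfolded regular_space_def, rule_format, of "topspace W - O'" x] by auto
  have "U \<subseteq> topspace W - V" using UV(5) openin_subset[OF UV(1)] by (auto simp: disjnt_def)
  then have "W closure_of U \<subseteq> topspace W - V"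
    by (rule closure_of_minimal) (use UV(2) in auto)
  then show ?thesis using that UV by blast
qed

lemma finite_point_cover:
  assumes "compactin W K" "\<And>x. x \<in> K \<Longrightarrow> openin W (G x) \<and> x \<in> G x"
  obtains F where "finite F" "F \<subseteq> K" "K \<subseteq> (\<Union>x\<in>F. G x)"
proof -
  have "\<exists>\<F>. finite \<F> \<and> \<F> \<subseteq> G ` K \<and> K \<subseteq> \<Union>\<F>"
    by (rule compactinD[OF assms(1)]) (use assms(2) in auto)
  then show ?thesis using that by (metis finite_subset_image)
qed

text \<open>Around \<open>x\<close> in \<open>K\<close> the potential is a constant
  \<open>b x\<close> minus a primitive of \<open>C\<close>, and this expression makes sense off
  \<open>K\<close>. Two such local extensions agree on their overlap as soon as their neighbourhoods
  share a point of \<open>K\<close>.\<close>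

lemma tautness:
  fixes C :: "'x \<times> 'x \<Rightarrow> 'k::field"
  assumes W: "compact_space W" "Hausdorff_space W" and C: "C \<in> asc W" and K: "closedin W K"
    and \<alpha>: "near (subtopology W K) (\<lambda>y z. C (y, z) = \<alpha> z - \<alpha> y)"
  obtains A \<alpha>' where "openin W A" "K \<subseteq> A" "\<And>x. x \<in> K \<Longrightarrow> \<alpha>' x = \<alpha> x"
    "near (subtopology W A) (\<lambda>y z. C (y, z) = \<alpha>' z - \<alpha>' y)"
proof -
  obtain \<U> s where U: "open_cover W \<U>" "primitives \<U> s C" using C unfolding asc_def by auto
  have Kt: "K \<subseteq> topspace W" using K by (rule closedin_subset)
  have "\<exists>U N G. U \<in> \<U> \<and> openin W N \<and> x \<in> N \<and> N \<subseteq> U \<and> (\<forall>y\<in>N \<inter> K. \<forall>z\<in>N \<inter> K. C (y, z) = \<alpha> z - \<alpha> y) \<and>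
      openin W G \<and> x \<in> G \<and> W closure_of G \<subseteq> N" if x: "x \<in> K" for x
  proof -
    have "x \<in> \<Union>\<U>" using x Kt U(1) unfolding open_cover_def by auto
    then obtain U where U': "U \<in> \<U>" "x \<in> U" "openin W U" using U(1) unfolding open_cover_def by auto
    have "x \<in> topspace (subtopology W K)" using x Kt by auto
    then obtain V where V: "openin (subtopology W K) V" "x \<in> V" "\<And>y z. y \<in> V \<Longrightarrow> z \<in> V \<Longrightarrow> C (y, z) = \<alpha> z - \<alpha> y"
      using nearE[OF \<alpha>] by metis
    then obtain T where T: "openin W T" "V = T \<inter> K" unfolding openin_subtopology by auto
    have o: "openin W (U \<inter> T)" "x \<in> U \<inter> T" using T U' V by auto
    obtain G where "openin W G" "x \<in> G" "W closure_of G \<subseteq> U \<inter> T"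
      using compact_Hausdorff_shrink[OF W o] by metis
    then show ?thesis using o U'(1) V(3) T(2) by (intro exI[of _ U] exI[of _ "U \<inter> T"] exI[of _ G]) auto
  qed
  then obtain u N G where N: "\<And>x. x \<in> K \<Longrightarrow> u x \<in> \<U> \<and> openin W (N x) \<and> x \<in> N x \<and> N x \<subseteq> u x \<and>
      (\<forall>y\<in>N x \<inter> K. \<forall>z\<in>N x \<inter> K. C (y, z) = \<alpha> z - \<alpha> y) \<and> openin W (G x) \<and> x \<in> G x \<and> W closure_of (G x) \<subseteq> N x"
    by metis
  have GN: "G x \<subseteq> W closure_of (G x)" if "x \<in> K" for x
    using N[OF that] closure_of_subset openin_subset by metis
  define b where "b x = \<alpha> x + s (u x) x" for x
  have b: "b x = \<alpha> z + s (u x) z" if xz: "x \<in> K" "z \<in> N x" "z \<in> K" for x z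
  proof -
    have "C (x, z) = \<alpha> z - \<alpha> x" using N[OF xz(1)] xz by auto
    moreover have "C (x, z) = s (u x) x - s (u x) z"
      by (rule primitivesD(1)[OF U(2)]) (use N[OF xz(1)] xz in auto)
    ultimately have "s (u x) x - s (u x) z = \<alpha> z - \<alpha> x" by simp
    then show ?thesis unfolding b_def by (simp add: algebra_simps)
  qed
  have Kc: "compactin W K" by (rule closedin_compact_space[OF W(1) K])
  obtain F where F: "finite F" "F \<subseteq> K" "K \<subseteq> (\<Union>x\<in>F. G x)"
    by (rule finite_point_cover[OF Kc, of G]) (use N in auto)
  \<comment> \<open>The pairs of neighbourhoods that share no point of \<open>K\<close>. By
    compactness there are finitely many, and the closures lie in the larger sets \<open>N\<close>,
    so the overlaps to be removed form a closed set disjoint from \<open>K\<close>.\<close>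
  define bad where "bad = {(x, y) \<in> F \<times> F. N x \<inter> N y \<inter> K = {}}"
  define B where "B = (\<Union>(x, y)\<in>bad. W closure_of (G x) \<inter> W closure_of (G y))"
  have "finite bad" unfolding bad_def using F(1) by (auto intro: finite_subset[of _ "F \<times> F"])
  then have Bcl: "closedin W B" unfolding B_def by (intro closedin_Union) auto
  have BK: "B \<inter> K = {}"
  proof -
    have "W closure_of (G x) \<inter> W closure_of (G y) \<inter> K = {}" if "(x, y) \<in> bad" for x y
    proof -
      have "x \<in> K" "y \<in> K" "N x \<inter> N y \<inter> K = {}" using that F(2) unfolding bad_def by auto
      then show ?thesis using N[of x] N[of y] by blast
    qed
    then show ?thesis unfolding B_def by blast
  qed
  define A where "A = (\<Union>x\<in>F. G x) - B"
  have A: "openin W A" unfolding A_def using N F(2) Bcl by (intro openin_diff openin_Union) auto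
  have KA: "K \<subseteq> A" unfolding A_def using F(3) BK by auto
  define i where "i z = (SOME x. x \<in> F \<and> z \<in> G x)" for z
  define \<alpha>' where "\<alpha>' z = b (i z) - s (u (i z)) z" for z
  have i: "i z \<in> F" "z \<in> G (i z)" if "z \<in> A" for z
    using someI_ex[of "\<lambda>x. x \<in> F \<and> z \<in> G x"] that unfolding i_def A_def by auto
  have \<alpha>': "\<alpha>' z = b x - s (u x) z" if z: "z \<in> A" "x \<in> F" "z \<in> G x" for x z
  proof -
    let ?y = "i z"
    have y: "?y \<in> F" "z \<in> G ?y" using i z by auto
    have xK: "x \<in> K" "?y \<in> K" using z y F by auto
    have "(x, ?y) \<notin> bad"
      using z y GN[OF xK(1)] GN[OF xK(2)] unfolding A_def B_def by fastforce
    then obtain w where w: "w \<in> N x" "w \<in> N ?y" "w \<in> K" using z y unfolding bad_def by auto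
    have zN: "z \<in> N x" "z \<in> N ?y" using z y GN[OF xK(1)] GN[OF xK(2)] N[OF xK(1)] N[OF xK(2)] by auto
    have "s (u ?y) w - s (u x) w = s (u ?y) z - s (u x) z"
      by (rule primitivesD(2)[OF U(2)]) (use N[OF xK(1)] N[OF xK(2)] w zN in auto)
    moreover have "b x - b ?y = s (u x) w - s (u ?y) w"
      using b[OF xK(1) w(1,3)] b[OF xK(2) w(2,3)] by simp
    moreover have "s (u x) w - s (u ?y) w = - (s (u ?y) w - s (u x) w)" by simp
    ultimately have "b x - b ?y = s (u x) z - s (u ?y) z" by simp
    then show ?thesis unfolding \<alpha>'_def by (simp add: algebra_simps)
  qed
  show ?thesis
  proof (rule that[OF A KA])
    fix z assume z: "z \<in> K"
    then have zA: "z \<in> A" using KA by auto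
    have iK: "i z \<in> K" using i[OF zA] F by auto
    have "z \<in> N (i z)" using i[OF zA] GN[OF iK] N[OF iK] by auto
    from b[OF iK this z] show "\<alpha>' z = \<alpha> z" unfolding \<alpha>'_def by simp
  next
    show "near (subtopology W A) (\<lambda>y z. C (y, z) = \<alpha>' z - \<alpha>' y)"
    proof (rule nearI)
      fix x assume "x \<in> topspace (subtopology W A)"
      then have x: "x \<in> A" by auto
      have iK: "i x \<in> K" using i[OF x] F by auto
      show "\<exists>U. openin (subtopology W A) U \<and> x \<in> U \<and> (\<forall>y\<in>U. \<forall>z\<in>U. C (y, z) = \<alpha>' z - \<alpha>' y)"
      proof (intro exI[of _ "G (i x) \<inter> A"] conjI ballI)
        show "openin (subtopology W A) (G (i x) \<inter> A)" using N[OF iK] by (auto simp: openin_subtopology)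
        show "x \<in> G (i x) \<inter> A" using i[OF x] x by auto
        fix y z assume yz: "y \<in> G (i x) \<inter> A" "z \<in> G (i x) \<inter> A"
        have "C (y, z) = s (u (i x)) y - s (u (i x)) z"
          by (rule primitivesD(1)[OF U(2)]) (use N[OF iK] GN[OF iK] yz in auto)
        then show "C (y, z) = \<alpha>' z - \<alpha>' y" using \<alpha>'[of y "i x"] \<alpha>'[of z "i x"] yz i[OF x] by simp
      qed
    qed
  qed
qed

lemma asc_diag: "C \<in> asc X \<Longrightarrow> x \<in> topspace X \<Longrightarrow> C (x, x) = 0"
proof -
  assume "C \<in> asc X" "x \<in> topspace X"
  then obtain \<U> s where U: "open_cover X \<U>" "primitives \<U> s C" "x \<in> \<Union>\<U>"
    unfolding asc_def open_cover_def by auto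
  then obtain U where "U \<in> \<U>" "x \<in> U" by auto
  from primitivesD(1)[OF U(2) this this(2)] show ?thesis by simp
qed

section \<open>Inverse limits of a single map\<close>

locale inverse_limit =
  fixes Z :: "'z topology" and f :: "'z \<Rightarrow> 'z"
  assumes compact: "compact_space Z" and Hausdorff: "Hausdorff_space Z" and cont: "continuous_map Z Z f"
begin

definition W :: "(nat \<Rightarrow> 'z) topology" where
  "W = subtopology (product_topology (\<lambda>_. Z) UNIV) {\<xi>. \<forall>i. f (\<xi> (Suc i)) = \<xi> i}"

definition F :: "(nat \<Rightarrow> 'z) \<Rightarrow> nat \<Rightarrow> 'z" where
  "F \<xi> = case_nat (f (\<xi> 0)) \<xi>"

text \<open>The inverse of \<open>F\<close> on the limit (\<open>FG\<close>,
  \<open>GF\<close>).\<close>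

definition G :: "(nat \<Rightarrow> 'z) \<Rightarrow> nat \<Rightarrow> 'z" where
  "G \<xi> i = \<xi> (Suc i)"

lemma topspace_W: "topspace W = {\<xi>. (\<forall>i. \<xi> i \<in> topspace Z) \<and> (\<forall>i. f (\<xi> (Suc i)) = \<xi> i)}"
  unfolding W_def by (auto simp: PiE_UNIV_domain)

lemma proj_cont: "continuous_map W Z (\<lambda>\<xi>. \<xi> i)"
  unfolding W_def by (intro continuous_map_from_subtopology continuous_map_product_projection) auto

lemma fpow_cont: "continuous_map Z Z (f ^^ n)"
proof (induction n)
  case (Suc n) then show ?case using continuous_map_compose[OF Suc cont] by (simp add: comp_def)
qed (simp add: id_def[symmetric])

lemma fpow_proj: "\<xi> \<in> topspace W \<Longrightarrow> (f ^^ k) (\<xi> (i + k)) = \<xi> i"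
  by (induction k arbitrary: i) (auto simp: topspace_W funpow_swap1)

lemma f_in: "z \<in> topspace Z \<Longrightarrow> f z \<in> topspace Z" "z \<in> topspace Z \<Longrightarrow> (f ^^ n) z \<in> topspace Z"
  using cont fpow_cont[of n] by (auto simp: continuous_map_def)

lemma F_in: "\<xi> \<in> topspace W \<Longrightarrow> F \<xi> \<in> topspace W"
  unfolding topspace_W F_def using f_in by (auto split: nat.splits)

lemma G_in: "\<xi> \<in> topspace W \<Longrightarrow> G \<xi> \<in> topspace W"
  unfolding topspace_W G_def by auto

lemma FG: "\<xi> \<in> topspace W \<Longrightarrow> F (G \<xi>) = \<xi>"
  unfolding topspace_W F_def G_def by (auto simp: fun_eq_iff split: nat.splits)

lemma GF: "G (F \<xi>) = \<xi>"
  unfolding F_def G_def by auto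

lemma F_cont: "continuous_map W W F"
proof -
  have "continuous_map W Z (\<lambda>\<xi>. F \<xi> i)" for i
  proof (cases i)
    case 0
    then show ?thesis using continuous_map_compose[OF proj_cont[of 0] cont] by (simp add: F_def comp_def)
  next
    case (Suc j)
    then show ?thesis using proj_cont[of j] by (simp add: F_def)
  qed
  moreover have "F ` topspace W \<subseteq> {\<xi>. \<forall>i. f (\<xi> (Suc i)) = \<xi> i}" using F_in unfolding topspace_W by auto
  ultimately show ?thesis
    by (subst (2) W_def) (auto simp: continuous_map_in_subtopology continuous_map_componentwise_UNIV)
qed

lemma G_cont: "continuous_map W W G"
proof -
  have "continuous_map W Z (\<lambda>\<xi>. G \<xi> i)" for i unfolding G_def by (rule proj_cont)
  moreover have "G ` topspace W \<subseteq> {\<xi>. \<forall>i. f (\<xi> (Suc i)) = \<xi> i}" using G_in unfolding topspace_W by auto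
  ultimately show ?thesis
    by (subst (2) W_def) (auto simp: continuous_map_in_subtopology continuous_map_componentwise_UNIV)
qed

lemma Hausdorff_W: "Hausdorff_space W"
  unfolding W_def using Hausdorff
  by (intro Hausdorff_space_subtopology) (simp add: Hausdorff_space_product_topology)

lemma compact_W: "compact_space W"
proof -
  let ?P = "product_topology (\<lambda>_::nat. Z) UNIV"
  have P: "compact_space ?P" using compact by (simp add: compact_space_product_topology)
  have "closedin ?P {\<xi> \<in> topspace ?P. f (\<xi> (Suc i)) = \<xi> i}" for i
  proof (rule closedin_continuous_maps_eq[OF Hausdorff])
    show "continuous_map ?P Z (\<lambda>\<xi>. f (\<xi> (Suc i)))"
      using continuous_map_compose[OF continuous_map_product_projection[of "Suc i" UNIV "\<lambda>_. Z"] cont] by (simp add: comp_def)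
    show "continuous_map ?P Z (\<lambda>\<xi>. \<xi> i)" by (rule continuous_map_product_projection) simp
  qed
  then have "closedin ?P (\<Inter>i. {\<xi> \<in> topspace ?P. f (\<xi> (Suc i)) = \<xi> i})" by (intro closedin_Inter) auto
  then have "compactin ?P (\<Inter>i. {\<xi> \<in> topspace ?P. f (\<xi> (Suc i)) = \<xi> i})"
    by (rule closedin_compact_space[OF P])
  moreover have "W = subtopology ?P (\<Inter>i. {\<xi> \<in> topspace ?P. f (\<xi> (Suc i)) = \<xi> i})"
  proof -
    have "(\<Inter>i. {\<xi> \<in> topspace ?P. f (\<xi> (Suc i)) = \<xi> i}) = topspace ?P \<inter> {\<xi>. \<forall>i. f (\<xi> (Suc i)) = \<xi> i}" by auto
    then show ?thesis unfolding W_def by (metis subtopology_restrict)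
  qed
  ultimately show ?thesis by (simp add: compact_space_subtopology)
qed

text \<open>The stable image of \<open>f\<close>. Every projection maps the limit onto it
  (\<open>\<Omega>_proj\<close>), so conditions on one coordinate of the limit are conditions on
  this set.\<close>

definition \<Omega> :: "'z set" where "\<Omega> = (\<Inter>m. (f ^^ m) ` topspace Z)"

lemma image_closed: "closedin Z ((f ^^ m) ` topspace Z)"
  using image_compactin[OF _ fpow_cont] compact Hausdorff compactin_imp_closedin
  unfolding compact_space_def by blast

lemma image_dec: "(f ^^ (m + n)) ` topspace Z \<subseteq> (f ^^ m) ` topspace Z"
  using f_in by (auto simp: funpow_add)

lemma \<Omega>_closed: "closedin Z \<Omega>"
  unfolding \<Omega>_def using image_closed by (intro closedin_Inter) auto

text \<open>The fibre over \<open>z\<close> meets every iterated image, and these intersections are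
  nested compact sets.\<close>

lemma \<Omega>_lift:
  assumes "z \<in> \<Omega>" obtains y where "y \<in> \<Omega>" "f y = z"
proof -
  define S where "S m = {y \<in> topspace Z. f y = z} \<inter> (f ^^ m) ` topspace Z" for m
  have zt: "z \<in> topspace Z" using assms unfolding \<Omega>_def by (auto dest: spec[of _ "0::nat"])
  have "closedin Z {y \<in> topspace Z. f y \<in> {z}}"
    using closedin_continuous_map_preimage[OF cont, of "{z}"] closedin_Hausdorff_sing_eq[OF Hausdorff] zt by auto
  then have 1: "closedin Z (S m)" for m unfolding S_def using image_closed by auto
  have 2: "S m \<noteq> {}" for m
  proof -
    have "z \<in> (f ^^ Suc m) ` topspace Z" using assms unfolding \<Omega>_def by blast
    then obtain x where "x \<in> topspace Z" "z = f ((f ^^ m) x)" by auto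
    then have "(f ^^ m) x \<in> S m" unfolding S_def using f_in by auto
    then show ?thesis by auto
  qed
  have 3: "decseq S" unfolding S_def decseq_def using image_dec by (auto simp: le_iff_add) blast
  have "(\<Inter>m. S m) \<noteq> {}" by (rule compact_space_imp_nest[OF compact 1 2 3])
  then show ?thesis using that unfolding S_def \<Omega>_def by auto
qed

lemma \<Omega>_proj: "(\<lambda>\<xi>. \<xi> k) ` topspace W = \<Omega>"
proof
  show "(\<lambda>\<xi>. \<xi> k) ` topspace W \<subseteq> \<Omega>"
  proof safe
    fix \<xi> assume x: "\<xi> \<in> topspace W"
    show "\<xi> k \<in> \<Omega>" unfolding \<Omega>_def
    proof
      fix m
      have "\<xi> (k + m) \<in> topspace Z" using x unfolding topspace_W by auto
      then show "\<xi> k \<in> (f ^^ m) ` topspace Z" using fpow_proj[OF x, of m k] by (metis imageI)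
    qed
  qed
  show "\<Omega> \<subseteq> (\<lambda>\<xi>. \<xi> k) ` topspace W"
  proof
    fix z assume z: "z \<in> \<Omega>"
    have "\<forall>y\<in>\<Omega>. \<exists>x. x \<in> \<Omega> \<and> f x = y" using \<Omega>_lift by metis
    then obtain g where g: "\<And>y. y \<in> \<Omega> \<Longrightarrow> g y \<in> \<Omega> \<and> f (g y) = y" by metis
    define \<xi> where "\<xi> i = (g ^^ i) z" for i
    have in\<Omega>: "\<xi> i \<in> \<Omega>" for i unfolding \<xi>_def using g z by (induction i) auto
    have \<Omega>Z: "\<Omega> \<subseteq> topspace Z" using \<Omega>_closed by (rule closedin_subset)
    have \<xi>: "\<xi> \<in> topspace W" unfolding topspace_W using in\<Omega> g \<Omega>Z by (auto simp: \<xi>_def)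
    \<comment> \<open>Applying \<open>F\<close> a total of \<open>k\<close> times moves the
      coordinate at index 0 to index \<open>k\<close>.\<close>
    have "(F ^^ k) \<xi> \<in> topspace W" using F_in \<xi> by (induction k) auto
    moreover have "(F ^^ k) \<xi> k = z"
    proof -
      have "(F ^^ n) \<xi> (n + i) = \<xi> i" for n i by (induction n arbitrary: i) (auto simp: F_def)
      from this[of k 0] show ?thesis by (simp add: \<xi>_def)
    qed
    ultimately show "z \<in> (\<lambda>\<xi>. \<xi> k) ` topspace W" by force
  qed
qed

text \<open>The iterated images are decreasing compact sets with intersection
  \<open>\<Omega>\<close>.\<close>

lemma eventually_in:
  assumes "openin Z A" "\<Omega> \<subseteq> A"
  obtains m where "(f ^^ m) ` topspace Z \<subseteq> A"
proof (rule ccontr)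
  assume "\<not> thesis"
  then have n: "\<not> (f ^^ m) ` topspace Z \<subseteq> A" for m using that by blast
  define S where "S m = (f ^^ m) ` topspace Z - A" for m
  have 1: "closedin Z (S m)" for m unfolding S_def using image_closed assms(1) by (intro closedin_diff) auto
  have 2: "S m \<noteq> {}" for m using n unfolding S_def by auto
  have 3: "decseq S" unfolding S_def decseq_def using image_dec by (auto simp: le_iff_add) blast
  have "(\<Inter>m. S m) \<noteq> {}" by (rule compact_space_imp_nest[OF compact 1 2 3])
  then show False using assms(2) unfolding S_def \<Omega>_def by auto
qed

text \<open>A basic neighbourhood constrains finitely many coordinates, and all of these are
  continuous functions of one coordinate of large index.\<close>

lemma basis:
  assumes "openin W U" "\<xi> \<in> U"
  obtains k V where "openin Z V" "\<xi> k \<in> V" "\<And>\<eta>. \<eta> \<in> topspace W \<Longrightarrow> \<eta> k \<in> V \<Longrightarrow> \<eta> \<in> U"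
proof -
  obtain T where T: "openin (product_topology (\<lambda>_::nat. Z) UNIV) T" "U = T \<inter> {\<xi>. \<forall>i. f (\<xi> (Suc i)) = \<xi> i}"
    using assms(1) unfolding W_def openin_subtopology by auto
  obtain Y where Y: "finite {i. Y i \<noteq> topspace Z}" "\<And>i. openin Z (Y i)" "\<xi> \<in> Pi\<^sub>E UNIV Y" "Pi\<^sub>E UNIV Y \<subseteq> T"
    using T assms(2) unfolding openin_product_topology_alt by auto
  have \<xi>: "\<xi> \<in> topspace W" using assms openin_subset by auto
  obtain k where k: "\<And>i. Y i \<noteq> topspace Z \<Longrightarrow> i \<le> k" using Y(1) by (auto simp: finite_nat_set_iff_bounded_le)
  define V where "V = {z \<in> topspace Z. \<forall>i\<in>{..k}. (f ^^ (k - i)) z \<in> Y i}"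
  have "V = (\<Inter>i\<in>{..k}. {z \<in> topspace Z. (f ^^ (k - i)) z \<in> Y i})" unfolding V_def by auto
  then have V: "openin Z V"
    using openin_continuous_map_preimage[OF fpow_cont Y(2)] by (auto intro!: openin_Inter)
  have fp: "(f ^^ (k - i)) (\<eta> k) = \<eta> i" if "\<eta> \<in> topspace W" "i \<le> k" for \<eta> i
    using fpow_proj[OF that(1), of "k - i" i] that(2) by simp
  have 1: "\<xi> k \<in> V" unfolding V_def using fp[OF \<xi>] Y(3) \<xi> by (auto simp: topspace_W PiE_UNIV_domain)
  have 2: "\<eta> \<in> U" if \<eta>: "\<eta> \<in> topspace W" "\<eta> k \<in> V" for \<eta>
  proof -
    have "\<eta> i \<in> Y i" for i
    proof (cases "i \<le> k")
      case True
      then have "(f ^^ (k - i)) (\<eta> k) \<in> Y i" using \<eta>(2) unfolding V_def by auto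
      then show ?thesis using fp[OF \<eta>(1) True] by simp
    next
      case False then have "Y i = topspace Z" using k by auto
      then show ?thesis using \<eta>(1) unfolding topspace_W by auto
    qed
    then have "\<eta> \<in> T" using Y(4) by (auto simp: PiE_UNIV_domain)
    then show ?thesis using T(2) \<eta>(1) unfolding topspace_W by auto
  qed
  show ?thesis using that[OF V 1 2] .
qed

text \<open>Compactness of the limit makes the level uniform: neighbourhoods at lower levels are
  pulled up to the maximum by powers of \<open>f\<close>.\<close>

lemma cover_level:
  assumes \<U>: "open_cover W \<U>"
  obtains k V U where "\<And>\<xi>. \<xi> \<in> topspace W \<Longrightarrow> openin Z (V \<xi>)" "\<And>\<xi>. \<xi> \<in> topspace W \<Longrightarrow> \<xi> k \<in> V \<xi>"
    "\<And>\<xi>. \<xi> \<in> topspace W \<Longrightarrow> U \<xi> \<in> \<U>"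
    "\<And>\<xi> \<eta>. \<xi> \<in> topspace W \<Longrightarrow> \<eta> \<in> topspace W \<Longrightarrow> \<eta> k \<in> V \<xi> \<Longrightarrow> \<eta> \<in> U \<xi>"
proof -
  have "\<exists>k V U. openin Z V \<and> \<xi> k \<in> V \<and> U \<in> \<U> \<and> (\<forall>\<eta>\<in>topspace W. \<eta> k \<in> V \<longrightarrow> \<eta> \<in> U)"
    if \<xi>: "\<xi> \<in> topspace W" for \<xi>
  proof -
    have "\<xi> \<in> \<Union>\<U>" using \<U> \<xi> unfolding open_cover_def by auto
    then obtain U where U: "openin W U" "\<xi> \<in> U" "U \<in> \<U>" using \<U> unfolding open_cover_def by auto
    obtain k V where V: "openin Z V" "\<xi> k \<in> V" "\<And>\<eta>. \<eta> \<in> topspace W \<Longrightarrow> \<eta> k \<in> V \<Longrightarrow> \<eta> \<in> U"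
      by (rule basis[OF U(1,2)]) (rule that)
    then show ?thesis using U(3) by blast
  qed
  then obtain k V U where kV: "\<And>\<xi>. \<xi> \<in> topspace W \<Longrightarrow> openin Z (V \<xi>) \<and> \<xi> (k \<xi>) \<in> V \<xi> \<and> U \<xi> \<in> \<U> \<and>
    (\<forall>\<eta>\<in>topspace W. \<eta> (k \<xi>) \<in> V \<xi> \<longrightarrow> \<eta> \<in> U \<xi>)" by metis
  have cW: "compactin W (topspace W)" using compact_W unfolding compact_space_def .
  obtain B where B: "finite B" "B \<subseteq> topspace W" "topspace W \<subseteq> (\<Union>\<xi>\<in>B. {\<eta> \<in> topspace W. \<eta> (k \<xi>) \<in> V \<xi>})"
    by (rule finite_point_cover[OF cW, of "\<lambda>\<xi>. {\<eta> \<in> topspace W. \<eta> (k \<xi>) \<in> V \<xi>}"])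
      (use kV openin_continuous_map_preimage[OF proj_cont] in auto)
  define m where "m = Max (insert 0 (k ` B))"
  have km: "k \<xi> \<le> m" if "\<xi> \<in> B" for \<xi> unfolding m_def by (rule Max_ge) (use that B(1) in auto)
  have "\<forall>\<xi>\<in>topspace W. \<exists>\<beta>\<in>B. \<xi> (k \<beta>) \<in> V \<beta>" using B(3) by auto
  then obtain b where b: "\<And>\<xi>. \<xi> \<in> topspace W \<Longrightarrow> b \<xi> \<in> B \<and> \<xi> (k (b \<xi>)) \<in> V (b \<xi>)" by metis
  have fp: "(f ^^ (m - k \<beta>)) (\<eta> m) = \<eta> (k \<beta>)" if "\<eta> \<in> topspace W" "\<beta> \<in> B" for \<eta> \<beta>
    using fpow_proj[OF that(1), of "m - k \<beta>" "k \<beta>"] km[OF that(2)] by simp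
  have bW: "b \<xi> \<in> topspace W" if "\<xi> \<in> topspace W" for \<xi> using b[OF that] B(2) by auto
  show ?thesis
  proof (rule that[of "\<lambda>\<xi>. {z \<in> topspace Z. (f ^^ (m - k (b \<xi>))) z \<in> V (b \<xi>)}" m "\<lambda>\<xi>. U (b \<xi>)"])
    fix \<xi> assume \<xi>: "\<xi> \<in> topspace W"
    show "openin Z {z \<in> topspace Z. (f ^^ (m - k (b \<xi>))) z \<in> V (b \<xi>)}"
      using openin_continuous_map_preimage[OF fpow_cont] kV[OF bW[OF \<xi>]] by blast
    show "\<xi> m \<in> {z \<in> topspace Z. (f ^^ (m - k (b \<xi>))) z \<in> V (b \<xi>)}"
      using \<xi> b[OF \<xi>] fp[OF \<xi>] unfolding topspace_W by auto
    show "U (b \<xi>) \<in> \<U>" using kV[OF bW[OF \<xi>]] by auto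
    fix \<eta> assume *: "\<eta> \<in> topspace W" "\<eta> m \<in> {z \<in> topspace Z. (f ^^ (m - k (b \<xi>))) z \<in> V (b \<xi>)}"
    show "\<eta> \<in> U (b \<xi>)" using kV[OF bW[OF \<xi>]] * b[OF \<xi>] fp[of \<eta> "b \<xi>"] by auto
  qed
qed

lemma near_level:
  assumes P: "near W P"
  obtains k V where "\<And>\<xi>. \<xi> \<in> topspace W \<Longrightarrow> openin Z (V \<xi>)" "\<And>\<xi>. \<xi> \<in> topspace W \<Longrightarrow> \<xi> k \<in> V \<xi>"
    "\<And>\<xi> \<eta> \<zeta>. \<xi> \<in> topspace W \<Longrightarrow> \<eta> \<in> topspace W \<Longrightarrow> \<zeta> \<in> topspace W \<Longrightarrow> \<eta> k \<in> V \<xi> \<Longrightarrow> \<zeta> k \<in> V \<xi> \<Longrightarrow> P \<eta> \<zeta>"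
proof -
  define \<U> where "\<U> = {U. openin W U \<and> (\<forall>y\<in>U. \<forall>z\<in>U. P y z)}"
  have "\<xi> \<in> \<Union>\<U>" if \<xi>: "\<xi> \<in> topspace W" for \<xi>
  proof -
    obtain U where "openin W U" "\<xi> \<in> U" "\<And>y z. y \<in> U \<Longrightarrow> z \<in> U \<Longrightarrow> P y z"
      by (rule nearE[OF P \<xi>]) (rule that)
    then show ?thesis unfolding \<U>_def by blast
  qed
  then have "open_cover W \<U>" unfolding open_cover_def \<U>_def using openin_subset by blast
  then obtain k V U where *: "\<And>\<xi>. \<xi> \<in> topspace W \<Longrightarrow> openin Z (V \<xi>)" "\<And>\<xi>. \<xi> \<in> topspace W \<Longrightarrow> \<xi> k \<in> V \<xi>"
    "\<And>\<xi>. \<xi> \<in> topspace W \<Longrightarrow> U \<xi> \<in> \<U>"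
    "\<And>\<xi> \<eta>. \<xi> \<in> topspace W \<Longrightarrow> \<eta> \<in> topspace W \<Longrightarrow> \<eta> k \<in> V \<xi> \<Longrightarrow> \<eta> \<in> U \<xi>"
    by (rule cover_level) (rule that)
  show ?thesis
  proof (rule that[OF *(1,2)])
    fix \<xi> \<eta> \<zeta> assume "\<xi> \<in> topspace W" "\<eta> \<in> topspace W" "\<zeta> \<in> topspace W" "\<eta> k \<in> V \<xi>" "\<zeta> k \<in> V \<xi>"
    then have "U \<xi> \<in> \<U>" "\<eta> \<in> U \<xi>" "\<zeta> \<in> U \<xi>" using *(3,4) by auto
    then show "P \<eta> \<zeta>" unfolding \<U>_def by blast
  qed
qed

text \<open>At a suitable level the images of \<open>P\<close> and of its complement are disjoint
  compact sets. Open sets separating them cover \<open>\<Omega>\<close>, hence a whole iterated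
  image of \<open>Z\<close>, so the preimage of one of them is clopen.\<close>

lemma clopen_level:
  assumes "openin W P" "closedin W P"
  obtains k E where "openin Z E" "closedin Z E" "P = {\<xi> \<in> topspace W. \<xi> k \<in> E}"
proof -
  have PW: "P \<subseteq> topspace W" using assms(1) by (rule openin_subset)
  have "near W (\<lambda>x y. x \<in> P \<longleftrightarrow> y \<in> P)"
  proof (rule nearI)
    fix x assume "x \<in> topspace W"
    then show "\<exists>U. openin W U \<and> x \<in> U \<and> (\<forall>y\<in>U. \<forall>z\<in>U. (y \<in> P) = (z \<in> P))"
      using assms by (cases "x \<in> P") (auto intro: exI[of _ P] exI[of _ "topspace W - P"])
  qed
  then obtain k V where V: "\<And>\<xi>. \<xi> \<in> topspace W \<Longrightarrow> openin Z (V \<xi>)" "\<And>\<xi>. \<xi> \<in> topspace W \<Longrightarrow> \<xi> k \<in> V \<xi>"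
    "\<And>\<xi> \<eta> \<zeta>. \<xi> \<in> topspace W \<Longrightarrow> \<eta> \<in> topspace W \<Longrightarrow> \<zeta> \<in> topspace W \<Longrightarrow> \<eta> k \<in> V \<xi> \<Longrightarrow> \<zeta> k \<in> V \<xi> \<Longrightarrow> (\<eta> \<in> P) = (\<zeta> \<in> P)"
    by (rule near_level) (rule that)
  let ?A = "(\<lambda>\<xi>. \<xi> k) ` P" and ?B = "(\<lambda>\<xi>. \<xi> k) ` (topspace W - P)"
  have cl: "closedin Z ((\<lambda>\<xi>. \<xi> k) ` S)" if "closedin W S" for S
    using image_compactin[OF closedin_compact_space[OF compact_W that] proj_cont] compactin_imp_closedin[OF Hausdorff] by auto
  have "\<xi> k \<noteq> \<eta> k" if "\<xi> \<in> P" "\<eta> \<in> topspace W - P" for \<xi> \<eta>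
    using V(2)[of \<xi>] V(3)[of \<xi> \<xi> \<eta>] that PW by auto
  then have "disjnt ?A ?B" unfolding disjnt_def by blast
  moreover have "closedin Z ?A" "closedin Z ?B" using cl assms by auto
  moreover have "normal_space Z" by (rule compact_Hausdorff_or_regular_imp_normal_space) (use compact Hausdorff in auto)
  ultimately have "\<exists>U V. openin Z U \<and> openin Z V \<and> ?A \<subseteq> U \<and> ?B \<subseteq> V \<and> disjnt U V"
    unfolding normal_space_def by blast
  then obtain U1 U2 where U: "openin Z U1" "openin Z U2" "?A \<subseteq> U1" "?B \<subseteq> U2" "disjnt U1 U2" by blast
  have "\<Omega> \<subseteq> U1 \<union> U2" unfolding \<Omega>_proj[of k, symmetric] using U by auto
  then obtain m where m: "(f ^^ m) ` topspace Z \<subseteq> U1 \<union> U2"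
    using eventually_in[of "U1 \<union> U2"] U(1,2) by auto
  let ?E = "{z \<in> topspace Z. (f ^^ m) z \<in> U1}"
  have o: "openin Z ?E" "openin Z {z \<in> topspace Z. (f ^^ m) z \<in> U2}"
    using openin_continuous_map_preimage[OF fpow_cont] U by auto
  have "?E = topspace Z - {z \<in> topspace Z. (f ^^ m) z \<in> U2}" using m U(5) unfolding disjnt_def by blast
  then have "closedin Z ?E" using o(2) by auto
  moreover have "P = {\<xi> \<in> topspace W. \<xi> (k + m) \<in> ?E}"
  proof -
    have "\<xi> (k + m) \<in> topspace Z" "(f ^^ m) (\<xi> (k + m)) = \<xi> k" if "\<xi> \<in> topspace W" for \<xi>
      using fpow_proj[OF that] that unfolding topspace_W by auto
    then have "\<xi> (k + m) \<in> ?E \<longleftrightarrow> \<xi> k \<in> U1" if "\<xi> \<in> topspace W" for \<xi> using that by simp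
    moreover have "\<xi> k \<in> U1 \<longleftrightarrow> \<xi> \<in> P" if "\<xi> \<in> topspace W" for \<xi>
      using U(3-5) that unfolding disjnt_def by blast
    ultimately show ?thesis using PW by blast
  qed
  ultimately show ?thesis using that[OF o(1)] by blast
qed

text \<open>A potential on the limit descends to \<open>\<Omega>\<close> at some level and extends
  to a neighbourhood by tautness; this neighbourhood contains an iterated image of
  \<open>Z\<close>.\<close>

lemma pullback_kernel:
  fixes C :: "'z \<times> 'z \<Rightarrow> 'k::field"
  assumes C: "C \<in> asc Z" and tr: "cobounds W (\<lambda>(\<xi>, \<eta>). C (\<xi> 0, \<eta> 0))"
  obtains k where "cobounds Z (\<lambda>(x, y). C ((f ^^ k) x, (f ^^ k) y))"
proof -
  obtain \<alpha> where "near W (\<lambda>\<xi> \<eta>. C (\<xi> 0, \<eta> 0) = \<alpha> \<eta> - \<alpha> \<xi>)" using tr unfolding cobounds_def by auto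
  then obtain k V where V: "\<And>\<xi>. \<xi> \<in> topspace W \<Longrightarrow> openin Z (V \<xi>)" "\<And>\<xi>. \<xi> \<in> topspace W \<Longrightarrow> \<xi> k \<in> V \<xi>"
    "\<And>\<xi> \<eta> \<zeta>. \<xi> \<in> topspace W \<Longrightarrow> \<eta> \<in> topspace W \<Longrightarrow> \<zeta> \<in> topspace W \<Longrightarrow> \<eta> k \<in> V \<xi> \<Longrightarrow> \<zeta> k \<in> V \<xi> \<Longrightarrow>
      C (\<eta> 0, \<zeta> 0) = \<alpha> \<zeta> - \<alpha> \<eta>"
    by (rule near_level) (rule that)
  have C0: "C (x, x) = 0" if "x \<in> topspace Z" for x
    using asc_diag[OF C that] .
  define a where "a z = \<alpha> (SOME \<xi>. \<xi> \<in> topspace W \<and> \<xi> k = z)" for z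
  \<comment> \<open>Points with equal coordinate \<open>k\<close> have equal coordinate 0, and
    \<open>C\<close> vanishes on the diagonal; hence \<open>\<alpha>\<close> depends on coordinate
    \<open>k\<close> only.\<close>
  have a: "a (\<xi> k) = \<alpha> \<xi>" if \<xi>: "\<xi> \<in> topspace W" for \<xi>
  proof -
    let ?\<eta> = "SOME \<eta>. \<eta> \<in> topspace W \<and> \<eta> k = \<xi> k"
    have \<eta>: "?\<eta> \<in> topspace W \<and> ?\<eta> k = \<xi> k" by (rule someI[of _ \<xi>]) (use \<xi> in auto)
    have 0: "?\<eta> 0 = \<xi> 0" using \<eta> fpow_proj[OF \<xi>, of k 0] fpow_proj[of ?\<eta> k 0] by simp
    have "C (\<xi> 0, ?\<eta> 0) = \<alpha> ?\<eta> - \<alpha> \<xi>" by (rule V(3)[OF \<xi> \<xi>]) (use \<eta> V(2)[OF \<xi>] in auto)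
    moreover have "C (\<xi> 0, ?\<eta> 0) = 0" using C0[of "\<xi> 0"] 0 \<xi> unfolding topspace_W by simp
    ultimately show ?thesis unfolding a_def by simp
  qed
  let ?C = "\<lambda>(x, y). C ((f ^^ k) x, (f ^^ k) y)"
  have "near (subtopology Z \<Omega>) (\<lambda>y z. ?C (y, z) = a z - a y)"
  proof (rule nearI)
    fix x assume "x \<in> topspace (subtopology Z \<Omega>)"
    then have "x \<in> (\<lambda>\<xi>. \<xi> k) ` topspace W" using \<Omega>_proj[of k] by auto
    then obtain \<xi> where \<xi>: "\<xi> \<in> topspace W" "x = \<xi> k" by auto
    have "?C (y, z) = a z - a y" if yz: "y \<in> V \<xi> \<inter> \<Omega>" "z \<in> V \<xi> \<inter> \<Omega>" for y z
    proof -
      obtain \<eta> \<zeta> where *: "\<eta> \<in> topspace W" "\<eta> k = y" "\<zeta> \<in> topspace W" "\<zeta> k = z"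
        using yz unfolding \<Omega>_proj[of k, symmetric] by auto
      show ?thesis using V(3)[OF \<xi>(1) *(1,3)] * yz a[OF *(1)] a[OF *(3)] fpow_proj[OF *(1), of k 0] fpow_proj[OF *(3), of k 0]
        by simp
    qed
    then show "\<exists>U. openin (subtopology Z \<Omega>) U \<and> x \<in> U \<and> (\<forall>y\<in>U. \<forall>z\<in>U. ?C (y, z) = a z - a y)"
      using V(1,2)[OF \<xi>(1)] \<xi> \<Omega>_proj[of k] by (intro exI[of _ "V \<xi> \<inter> \<Omega>"]) (auto simp: openin_subtopology)
  qed
  then obtain A a' where A: "openin Z A" "\<Omega> \<subseteq> A" "near (subtopology Z A) (\<lambda>y z. ?C (y, z) = a' z - a' y)"
    by (rule tautness[OF compact Hausdorff asc_continuous[OF C fpow_cont] \<Omega>_closed]) (rule that)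
  obtain m where m: "(f ^^ m) ` topspace Z \<subseteq> A" using eventually_in[OF A(1,2)] by metis
  have "continuous_map Z (subtopology Z A) (f ^^ m)" using fpow_cont m by (auto simp: continuous_map_in_subtopology)
  from near_continuous[OF A(3) this]
  have "cobounds Z (\<lambda>(x, y). C ((f ^^ (k + m)) x, (f ^^ (k + m)) y))"
    unfolding cobounds_def by (intro exI[of _ "\<lambda>x. a' ((f ^^ m) x)"]) (simp add: funpow_add)
  then show ?thesis by (rule that)
qed

text \<open>The transition constants between primitives on the limit are recorded at level
  \<open>k\<close> on a finite cover of \<open>\<Omega>\<close>. They satisfy the cocycle identity
  only near \<open>\<Omega>\<close>; precomposition with \<open>f ^^ m\<close> moves all of
  \<open>Z\<close> there, at the cost of raising the level by \<open>m\<close>.\<close>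

lemma pullback_surj:
  fixes C :: "(nat \<Rightarrow> 'z) \<times> (nat \<Rightarrow> 'z) \<Rightarrow> 'k::field"
  assumes C: "C \<in> asc W"
  obtains m D where "D \<in> asc Z" "cobounds W (\<lambda>w. C w - (\<lambda>(\<xi>, \<eta>). D (\<xi> m, \<eta> m)) w)"
proof -
  obtain \<U> s where \<U>: "open_cover W \<U>" "primitives \<U> s C" using C unfolding asc_def by auto
  obtain k V U where V: "\<And>\<xi>. \<xi> \<in> topspace W \<Longrightarrow> openin Z (V \<xi>)" "\<And>\<xi>. \<xi> \<in> topspace W \<Longrightarrow> \<xi> k \<in> V \<xi>"
    "\<And>\<xi>. \<xi> \<in> topspace W \<Longrightarrow> U \<xi> \<in> \<U>"
    "\<And>\<xi> \<eta>. \<xi> \<in> topspace W \<Longrightarrow> \<eta> \<in> topspace W \<Longrightarrow> \<eta> k \<in> V \<xi> \<Longrightarrow> \<eta> \<in> U \<xi>"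
    by (rule cover_level[OF \<U>(1)]) (rule that)
  have "\<forall>z\<in>\<Omega>. \<exists>N u G. u \<in> \<U> \<and> z \<in> G \<and> openin Z G \<and> openin Z N \<and> Z closure_of G \<subseteq> N \<and>
      (\<forall>\<eta>\<in>topspace W. \<eta> k \<in> N \<longrightarrow> \<eta> \<in> u)"
  proof
    fix z assume "z \<in> \<Omega>"
    then obtain \<xi> where \<xi>: "\<xi> \<in> topspace W" "z = \<xi> k" unfolding \<Omega>_proj[of k, symmetric] by auto
    obtain G where G: "openin Z G" "z \<in> G" "Z closure_of G \<subseteq> V \<xi>"
      using compact_Hausdorff_shrink[OF compact Hausdorff V(1)[OF \<xi>(1)]] V(2)[OF \<xi>(1)] \<xi>(2) by metis
    show "\<exists>N u G. u \<in> \<U> \<and> z \<in> G \<and> openin Z G \<and> openin Z N \<and> Z closure_of G \<subseteq> N \<and>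
      (\<forall>\<eta>\<in>topspace W. \<eta> k \<in> N \<longrightarrow> \<eta> \<in> u)"
      by (intro exI[of _ "V \<xi>"] exI[of _ "U \<xi>"] exI[of _ G]) (use G V \<xi> in auto)
  qed
  then obtain N u G where N0: "\<forall>z\<in>\<Omega>. u z \<in> \<U> \<and> z \<in> G z \<and> openin Z (G z) \<and> openin Z (N z) \<and> Z closure_of (G z) \<subseteq> N z \<and>
      (\<forall>\<eta>\<in>topspace W. \<eta> k \<in> N z \<longrightarrow> \<eta> \<in> u z)" by metis
  have N: "u z \<in> \<U>" "z \<in> G z" "openin Z (G z)" "Z closure_of (G z) \<subseteq> N z" "G z \<subseteq> Z closure_of (G z)"
    "\<And>\<eta>. \<eta> \<in> topspace W \<Longrightarrow> \<eta> k \<in> N z \<Longrightarrow> \<eta> \<in> u z" if "z \<in> \<Omega>" for z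
    using N0 that by (auto simp: closure_of_subset openin_subset)
  obtain B where B: "finite B" "B \<subseteq> \<Omega>" "\<Omega> \<subseteq> (\<Union>x\<in>B. G x)"
    by (rule finite_point_cover[OF closedin_compact_space[OF compact \<Omega>_closed], of G]) (use N in auto)
  define c where "c x y = (let \<eta> = SOME \<eta>. \<eta> \<in> topspace W \<and> \<eta> k \<in> N x \<inter> N y in s (u y) \<eta> - s (u x) \<eta>)" for x y
  have c: "c x y = s (u y) \<eta> - s (u x) \<eta>"
    if xy: "x \<in> B" "y \<in> B" and \<eta>: "\<eta> \<in> topspace W" "\<eta> k \<in> N x" "\<eta> k \<in> N y" for x y \<eta>
  proof -
    let ?\<eta> = "SOME \<eta>. \<eta> \<in> topspace W \<and> \<eta> k \<in> N x \<inter> N y"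
    have e: "?\<eta> \<in> topspace W \<and> ?\<eta> k \<in> N x \<inter> N y" by (rule someI[of _ \<eta>]) (use \<eta> in auto)
    have xy': "x \<in> \<Omega>" "y \<in> \<Omega>" using xy B by auto
    have "s (u y) ?\<eta> - s (u x) ?\<eta> = s (u y) \<eta> - s (u x) \<eta>"
      by (rule primitivesD(2)[OF \<U>(2)]) (use N[OF xy'(1)] N[OF xy'(2)] e \<eta> in auto)
    then show ?thesis unfolding c_def by simp
  qed
  \<comment> \<open>Triples without a common point of \<open>\<Omega>\<close> carry no cocycle
    identity. The closed set \<open>S\<close> of their overlaps misses \<open>\<Omega>\<close> and
    is cut away.\<close>
  define bad where "bad = {(x, y, w) \<in> B \<times> B \<times> B. N x \<inter> N y \<inter> N w \<inter> \<Omega> = {}}"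
  define S where "S = (\<Union>(x, y, w)\<in>bad. Z closure_of (G x) \<inter> Z closure_of (G y) \<inter> Z closure_of (G w))"
  have "finite bad" unfolding bad_def using B(1) by (auto intro: finite_subset[of _ "B \<times> B \<times> B"])
  then have Scl: "closedin Z S" unfolding S_def by (intro closedin_Union) (auto intro!: closedin_Int)
  have S\<Omega>: "S \<inter> \<Omega> = {}"
  proof -
    have "Z closure_of (G x) \<inter> Z closure_of (G y) \<inter> Z closure_of (G w) \<inter> \<Omega> = {}" if "(x, y, w) \<in> bad" for x y w
    proof -
      have "x \<in> \<Omega>" "y \<in> \<Omega>" "w \<in> \<Omega>" "N x \<inter> N y \<inter> N w \<inter> \<Omega> = {}" using that B(2) unfolding bad_def by auto
      then show ?thesis using N(4)[of x] N(4)[of y] N(4)[of w] by blast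
    qed
    then show ?thesis unfolding S_def by blast
  qed
  define A where "A = (\<Union>x\<in>B. G x) - S"
  have A: "openin Z A" "\<Omega> \<subseteq> A"
    unfolding A_def using N B Scl S\<Omega> by (auto intro!: openin_diff openin_Union)
  obtain m where m: "(f ^^ m) ` topspace Z \<subseteq> A" using eventually_in[OF A] by metis
  have cc: "c x w = c x y + c y w"
    if xyw: "x \<in> B" "y \<in> B" "w \<in> B" and z: "z \<in> A" "z \<in> G x" "z \<in> G y" "z \<in> G w" for x y w z
  proof -
    have "(x, y, w) \<notin> bad"
    proof
      assume "(x, y, w) \<in> bad"
      then have "z \<in> S" unfolding S_def using z N(5) xyw B(2) by (auto intro!: bexI[of _ "(x, y, w)"])
      then show False using z unfolding A_def by auto
    qed
    then obtain v where v: "v \<in> N x" "v \<in> N y" "v \<in> N w" "v \<in> \<Omega>" using xyw unfolding bad_def by auto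
    then obtain \<eta> where \<eta>: "\<eta> \<in> topspace W" "v = \<eta> k" unfolding \<Omega>_proj[of k, symmetric] by auto
    show ?thesis using c[OF xyw(1,3) \<eta>(1)] c[OF xyw(1,2) \<eta>(1)] c[OF xyw(2,3) \<eta>(1)] v \<eta>(2) by simp
  qed
  define i where "i z = (SOME x. x \<in> B \<and> (f ^^ m) z \<in> G x)" for z
  have i: "i z \<in> B" "(f ^^ m) z \<in> G (i z)" "(f ^^ m) z \<in> A" if "z \<in> topspace Z" for z
  proof -
    show 1: "(f ^^ m) z \<in> A" using m that by auto
    then have "\<exists>x. x \<in> B \<and> (f ^^ m) z \<in> G x" unfolding A_def by auto
    from someI_ex[OF this] show "i z \<in> B" "(f ^^ m) z \<in> G (i z)" unfolding i_def by auto
  qed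
  define E where "E x = {z \<in> topspace Z. (f ^^ m) z \<in> G x}" for x
  have Eo: "openin Z (E x)" if "x \<in> B" for x
    unfolding E_def using N(3)[of x] that B(2) openin_continuous_map_preimage[OF fpow_cont] by blast
  define D where "D = (\<lambda>(z, w). let x = SOME x. x \<in> B \<and> z \<in> E x \<and> w \<in> E x in c (i z) x - c (i w) x)"
  have ci: "c (i z) y = c (i z) x + c x y" if "x \<in> B" "y \<in> B" "z \<in> E x" "z \<in> E y" for x y z
    using cc[OF i(1) that(1,2) i(3) i(2)] that unfolding E_def by auto
  have D: "D (z, w) = c (i z) x - c (i w) x" if x: "x \<in> B" "z \<in> E x" "w \<in> E x" for x z w
  proof -
    let ?x = "SOME x. x \<in> B \<and> z \<in> E x \<and> w \<in> E x"
    have "?x \<in> B \<and> z \<in> E ?x \<and> w \<in> E ?x" by (rule someI[of _ x]) (use x in auto)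
    then have e: "?x \<in> B" "z \<in> E ?x" "w \<in> E ?x" by auto
    have "c (i z) ?x - c (i w) ?x = c (i z) x - c (i w) x"
      unfolding ci[OF x(1) e(1) x(2) e(2)] ci[OF x(1) e(1) x(3) e(3)] by simp
    then show ?thesis unfolding D_def by simp
  qed
  \<comment> \<open>Different \<open>x\<close> may give the same set \<open>E x\<close>, and
    primitives are indexed by sets, so one index is selected for each set.\<close>
  define j where "j e = (SOME x. x \<in> B \<and> E x = e)" for e
  have j: "j e \<in> B" "E (j e) = e" if "e \<in> E ` B" for e
  proof -
    have "\<exists>x. x \<in> B \<and> E x = e" using that by auto
    from someI_ex[OF this] show "j e \<in> B" "E (j e) = e" unfolding j_def by auto
  qed
  have "primitives (E ` B) (\<lambda>e z. c (i z) (j e)) D"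
  proof (rule primitivesI)
    fix e z w assume "e \<in> E ` B" "z \<in> e" "w \<in> e"
    then show "D (z, w) = c (i z) (j e) - c (i w) (j e)" using D[OF j(1), of e z w] j(2)[of e] by simp
  next
    fix e e' z w assume *: "e \<in> E ` B" "e' \<in> E ` B" "z \<in> e" "z \<in> e'" "w \<in> e" "w \<in> e'"
    have "c (i z) (j e') = c (i z) (j e) + c (j e) (j e')"
      by (rule ci) (use * j in auto)
    moreover have "c (i w) (j e') = c (i w) (j e) + c (j e) (j e')"
      by (rule ci) (use * j in auto)
    ultimately show "c (i z) (j e') - c (i z) (j e) = c (i w) (j e') - c (i w) (j e)" by simp
  qed
  moreover have "open_cover Z (E ` B)"
  proof -
    have "z \<in> \<Union>(E ` B)" if "z \<in> topspace Z" for z using i[OF that] that unfolding E_def by auto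
    moreover have "z \<in> topspace Z" if "z \<in> \<Union>(E ` B)" for z using that unfolding E_def by auto
    ultimately show ?thesis unfolding open_cover_def using Eo by (auto simp del: Union_iff)
  qed
  ultimately have "D \<in> asc Z" unfolding asc_def by auto
  moreover have "cobounds W (\<lambda>w. C w - (\<lambda>(\<xi>, \<eta>). D (\<xi> (k + m), \<eta> (k + m))) w)"
    unfolding cobounds_def
  proof (intro exI[of _ "\<lambda>\<eta>. - s (u (i (\<eta> (k + m)))) \<eta>"] nearI)
    fix \<xi> assume \<xi>: "\<xi> \<in> topspace W"
    have t: "\<eta> (k + m) \<in> topspace Z" "(f ^^ m) (\<eta> (k + m)) = \<eta> k" if "\<eta> \<in> topspace W" for \<eta>
      using fpow_proj[OF that] that unfolding topspace_W by auto
    let ?x = "i (\<xi> (k + m))"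
    have x: "?x \<in> B" "\<xi> k \<in> G ?x" using i[OF t(1)[OF \<xi>]] t(2)[OF \<xi>] by auto
    have x\<Omega>: "?x \<in> \<Omega>" using x B by auto
    have eq: "C (\<eta>, \<zeta>) - D (\<eta> (k + m), \<zeta> (k + m)) =
        - s (u (i (\<zeta> (k + m)))) \<zeta> - - s (u (i (\<eta> (k + m)))) \<eta>"
      if e: "\<eta> \<in> topspace W" "\<eta> k \<in> G ?x" "\<zeta> \<in> topspace W" "\<zeta> k \<in> G ?x" for \<eta> \<zeta>
    proof -
      have N': "\<theta> k \<in> N ?x" "\<theta> \<in> u ?x" "\<theta> k \<in> N (i (\<theta> (k + m)))" "i (\<theta> (k + m)) \<in> B"
        if "\<theta> \<in> topspace W" "\<theta> k \<in> G ?x" for \<theta>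
      proof -
        show 1: "\<theta> k \<in> N ?x" using N(4,5)[OF x\<Omega>] that(2) by blast
        show "\<theta> \<in> u ?x" by (rule N(6)[OF x\<Omega> that(1) 1])
        show "i (\<theta> (k + m)) \<in> B" using i[OF t(1)[OF that(1)]] by auto
        then have "i (\<theta> (k + m)) \<in> \<Omega>" using B(2) by auto
        then show "\<theta> k \<in> N (i (\<theta> (k + m)))"
          using i(2)[OF t(1)[OF that(1)]] t(2)[OF that(1)] N(4,5)[of "i (\<theta> (k + m))"] by auto
      qed
      have "C (\<eta>, \<zeta>) = s (u ?x) \<eta> - s (u ?x) \<zeta>"
        by (rule primitivesD(1)[OF \<U>(2)]) (use N(1)[OF x\<Omega>] N'(2) e in auto)
      moreover have "D (\<eta> (k + m), \<zeta> (k + m)) = c (i (\<eta> (k + m))) ?x - c (i (\<zeta> (k + m))) ?x"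
        by (rule D[OF x(1)]) (use e t in \<open>auto simp: E_def\<close>)
      moreover have "c (i (\<theta> (k + m))) ?x = s (u ?x) \<theta> - s (u (i (\<theta> (k + m)))) \<theta>"
        if "\<theta> \<in> topspace W" "\<theta> k \<in> G ?x" for \<theta>
        by (rule c[OF N'(4)[OF that] x(1) that(1)]) (use N' that in auto)
      ultimately show ?thesis using e by simp
    qed
    show "\<exists>T. openin W T \<and> \<xi> \<in> T \<and> (\<forall>\<eta>\<in>T. \<forall>\<zeta>\<in>T. C (\<eta>, \<zeta>) - (case (\<eta>, \<zeta>) of (\<xi>, \<eta>) \<Rightarrow>
        D (\<xi> (k + m), \<eta> (k + m))) = - s (u (i (\<zeta> (k + m)))) \<zeta> - - s (u (i (\<eta> (k + m)))) \<eta>)"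
      by (intro exI[of _ "{\<eta> \<in> topspace W. \<eta> k \<in> G ?x}"])
        (use \<xi> x(2) eq openin_continuous_map_preimage[OF proj_cont N(3)[OF x\<Omega>]] in auto)
  qed
  ultimately show ?thesis by (rule that)
qed

lemma Fk_proj: "(F ^^ k) \<xi> i = (if i < k then (f ^^ (k - i)) (\<xi> 0) else \<xi> (i - k))"
proof (induction k arbitrary: i)
  case (Suc k)
  then show ?case by (cases i) (auto simp: F_def split: nat.split)
qed simp

lemma Fk_0: "(F ^^ k) \<xi> 0 = (f ^^ k) (\<xi> 0)"
  by (simp add: Fk_proj)

lemma Gk_proj: "(G ^^ k) \<xi> i = \<xi> (i + k)"
  by (induction k arbitrary: i) (auto simp: G_def)

end

section \<open>Propagation of potentials along orbits\<close>

lemma near_finite: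
  assumes "finite I" "\<And>i. i \<in> I \<Longrightarrow> near X (P i)" shows "near X (\<lambda>y z. \<forall>i\<in>I. P i y z)"
  using assms
proof (induction I)
  case empty then show ?case by (auto intro: nearI)
next
  case (insert i I)
  have "near X (\<lambda>y z. P i y z \<and> (\<forall>i\<in>I. P i y z))" by (rule near_conj) (use insert in auto)
  then show ?case by simp
qed

lemma near_subset:
  assumes "near (subtopology W A) P" "B \<subseteq> A" shows "near (subtopology W B) P"
proof -
  have "subtopology W B = subtopology (subtopology W A) B" using assms(2) by (simp add: subtopology_subtopology Int_absorb1)
  then show ?thesis using near_subtopology[OF assms(1)] by metis
qed

lemma near_open_subtopologyE:
  assumes "near (subtopology W A) P" "openin W A" "x \<in> A"
  obtains U where "openin W U" "x \<in> U" "U \<subseteq> A" "\<And>y z. y \<in> U \<Longrightarrow> z \<in> U \<Longrightarrow> P y z"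
proof -
  have "x \<in> topspace (subtopology W A)" using assms openin_subset by auto
  then obtain U where U: "openin (subtopology W A) U" "x \<in> U" "\<And>y z. y \<in> U \<Longrightarrow> z \<in> U \<Longrightarrow> P y z"
    by (rule nearE[OF assms(1)]) (rule that)
  have "openin W U" "U \<subseteq> A" using U(1) assms(2) by (auto simp: openin_open_subtopology)
  then show ?thesis using that U by blast
qed

lemma near_open_subtopologyI:
  assumes "openin W A" "\<And>x. x \<in> A \<Longrightarrow> \<exists>U. openin W U \<and> x \<in> U \<and> U \<subseteq> A \<and> (\<forall>y\<in>U. \<forall>z\<in>U. P y z)"
  shows "near (subtopology W A) P"
proof (rule nearI)
  fix x assume "x \<in> topspace (subtopology W A)"
  then have "x \<in> A" by auto
  then obtain U where "openin W U" "x \<in> U" "U \<subseteq> A" "\<forall>y\<in>U. \<forall>z\<in>U. P y z" using assms(2) by meson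
  then show "\<exists>U. openin (subtopology W A) U \<and> x \<in> U \<and> (\<forall>y\<in>U. \<forall>z\<in>U. P y z)"
    using assms(1) by (intro exI[of _ U]) (simp add: openin_open_subtopology)
qed

lemma near_eq_clopen:
  assumes "near X (\<lambda>y z. u y = u z)"
  shows "openin X {x \<in> topspace X. u x \<in> S}" "closedin X {x \<in> topspace X. u x \<in> S}"
proof -
  have *: "openin X {x \<in> topspace X. u x \<in> S}" for S
  proof (subst openin_subopen, intro ballI)
    fix x assume x: "x \<in> {x \<in> topspace X. u x \<in> S}"
    then have xt: "x \<in> topspace X" by auto
    obtain U where U: "openin X U" "x \<in> U" "\<And>y z. y \<in> U \<Longrightarrow> z \<in> U \<Longrightarrow> u y = u z"
      by (rule nearE[OF assms xt]) (rule that)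
    have "U \<subseteq> {x \<in> topspace X. u x \<in> S}"
    proof
      fix y assume y: "y \<in> U"
      show "y \<in> {x \<in> topspace X. u x \<in> S}" using U(3)[OF y U(2)] openin_subset[OF U(1)] x y by auto
    qed
    then show "\<exists>T. openin X T \<and> x \<in> T \<and> T \<subseteq> {x \<in> topspace X. u x \<in> S}" using U by blast
  qed
  show "openin X {x \<in> topspace X. u x \<in> S}" by (rule *)
  have "topspace X - {x \<in> topspace X. u x \<in> S} = {x \<in> topspace X. u x \<in> - S}" by auto
  then show "closedin X {x \<in> topspace X. u x \<in> S}" unfolding closedin_def using *[of "- S"] by auto
qed

lemma locally_constant_connected:
  assumes "near (subtopology W K) (\<lambda>y z. u y = u z)" "connectedin W K" "x \<in> K" "y \<in> K"
  shows "u x = u y"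
proof -
  let ?X = "subtopology W K"
  have K: "topspace ?X = K" using connectedin_subset_topspace[OF assms(2)] by auto
  have "connected_space ?X" using assms(2) by (simp add: connectedin_def)
  then have "{z \<in> topspace ?X. u z \<in> {u x}} = {} \<or> {z \<in> topspace ?X. u z \<in> {u x}} = topspace ?X"
    using near_eq_clopen[OF assms(1), of "{u x}"] unfolding connected_space_clopen_in by blast
  then have "y \<in> {z \<in> K. u z = u x}" using assms(3,4) unfolding K by auto
  then show ?thesis by auto
qed

text \<open>\<open>K\<close> repels under \<open>h\<close>, and \<open>R\<close> consists of points
  whose orbits under the inverse \<open>h'\<close> enter every neighbourhood of \<open>K\<close>.
  Potentials exist near \<open>K\<close> by tautness. As \<open>h\<close> transforms the cocycles
  linearly up to coboundaries, the potentials satisfy \<open>\<alpha> i (h x) = (\<Sum>j\<in>I. M i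
  j * \<alpha> j x) + \<gamma> i x\<close> up to a locally constant error; once the error is a
  constant \<open>t i\<close>, this equation extends them along orbits.\<close>

lemma equivariant_trivialization:
  fixes C :: "'i \<Rightarrow> 'w \<times> 'w \<Rightarrow> 'k::field"
  assumes W: "compact_space W" "Hausdorff_space W"
    and h: "continuous_map W W h" "continuous_map W W h'"
      "\<And>x. x \<in> topspace W \<Longrightarrow> h (h' x) = x" "\<And>x. x \<in> topspace W \<Longrightarrow> h' (h x) = x"
    and K: "closedin W K" "connectedin W K" "K \<noteq> {}" "h ` K \<subseteq> K"
    and basis: "\<And>A. openin W A \<Longrightarrow> K \<subseteq> A \<Longrightarrow> \<exists>B. openin W B \<and> K \<subseteq> B \<and> B \<subseteq> A \<and> h' ` B \<subseteq> B"
    and R: "R \<subseteq> topspace W" "\<And>B y. openin W B \<Longrightarrow> K \<subseteq> B \<Longrightarrow> y \<in> R \<Longrightarrow> \<exists>k. (h' ^^ k) y \<in> B"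
    and I: "finite I" and C: "\<And>i. i \<in> I \<Longrightarrow> C i \<in> asc W"
    and M: "\<And>i. i \<in> I \<Longrightarrow> near W (\<lambda>y z. C i (h y, h z) - (\<Sum>j\<in>I. M i j * C j (y, z)) = \<gamma> i z - \<gamma> i y)"
    and CK: "\<And>i. i \<in> I \<Longrightarrow> cobounds (subtopology W K) (C i)"
    and i: "i \<in> I"
  shows "cobounds (subtopology W R) (C i)"
proof -
  have Kt: "K \<subseteq> topspace W" using K(1) by (rule closedin_subset)
  have ht: "h x \<in> topspace W" "h' x \<in> topspace W" if "x \<in> topspace W" for x
    using h(1,2) that by (auto simp: continuous_map_def)
  define ext where "ext i A \<alpha> \<longleftrightarrow> openin W A \<and> K \<subseteq> A \<and>
      near (subtopology W A) (\<lambda>y z. C i (y, z) = \<alpha> z - \<alpha> y)" for i A \<alpha>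
  have "\<exists>A \<alpha>. ext i A \<alpha>" if iI: "i \<in> I" for i
  proof -
    obtain \<alpha> where \<alpha>: "near (subtopology W K) (\<lambda>y z. C i (y, z) = \<alpha> z - \<alpha> y)"
      using CK[OF iI] unfolding cobounds_def by auto
    obtain A \<alpha>' where "openin W A" "K \<subseteq> A" "near (subtopology W A) (\<lambda>y z. C i (y, z) = \<alpha>' z - \<alpha>' y)"
      by (rule tautness[OF W C[OF iI] K(1) \<alpha>]) (rule that)
    then have "ext i A \<alpha>'" unfolding ext_def by simp
    then show ?thesis by blast
  qed
  then obtain A0 \<alpha> where "\<And>i. i \<in> I \<Longrightarrow> ext i (A0 i) (\<alpha> i)" by metis
  then have A0: "\<And>i. i \<in> I \<Longrightarrow> openin W (A0 i) \<and> K \<subseteq> A0 i \<and>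
      near (subtopology W (A0 i)) (\<lambda>y z. C i (y, z) = \<alpha> i z - \<alpha> i y)" unfolding ext_def .
  define A where "A = topspace W \<inter> (\<Inter>i\<in>I. A0 i)"
  have A: "openin W A" "K \<subseteq> A"
  proof -
    have "openin W (\<Inter>i\<in>I. A0 i)" using A0 I i by (intro openin_Inter) auto
    then show "openin W A" unfolding A_def by auto
    show "K \<subseteq> A" unfolding A_def using A0 Kt by auto
  qed
  have \<alpha>: "near (subtopology W A) (\<lambda>y z. \<forall>i\<in>I. C i (y, z) = \<alpha> i z - \<alpha> i y)"
    by (rule near_finite[OF I], rule near_subset[where A = "A0 _"]) (use A0 in \<open>auto simp: A_def\<close>)
  define A1 where "A1 = A \<inter> {x \<in> topspace W. h x \<in> A}"
  have A1: "openin W A1" "K \<subseteq> A1"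
    unfolding A1_def using A K(4) Kt openin_continuous_map_preimage[OF h(1) A(1)] by auto
  \<comment> \<open>The error in the equivariance of the potentials.\<close>
  define \<theta> where "\<theta> i x = \<alpha> i (h x) - (\<Sum>j\<in>I. M i j * \<alpha> j x) - \<gamma> i x" for i x
  have M': "near W (\<lambda>y z. \<forall>i\<in>I. C i (h y, h z) - (\<Sum>j\<in>I. M i j * C j (y, z)) = \<gamma> i z - \<gamma> i y)"
    by (rule near_finite[OF I M])
  have \<theta>: "near (subtopology W A1) (\<lambda>y z. \<forall>i\<in>I. \<theta> i y = \<theta> i z)"
  proof (rule near_open_subtopologyI[OF A1(1)])
    fix x assume x: "x \<in> A1"
    obtain U where U: "openin W U" "x \<in> U" "U \<subseteq> A" "\<And>y z. y \<in> U \<Longrightarrow> z \<in> U \<Longrightarrow> \<forall>i\<in>I. C i (y, z) = \<alpha> i z - \<alpha> i y"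
      by (rule near_open_subtopologyE[OF \<alpha> A(1), of x]) (use x in \<open>auto simp: A1_def\<close>)
    obtain U' where U': "openin W U'" "h x \<in> U'" "U' \<subseteq> A" "\<And>y z. y \<in> U' \<Longrightarrow> z \<in> U' \<Longrightarrow> \<forall>i\<in>I. C i (y, z) = \<alpha> i z - \<alpha> i y"
      by (rule near_open_subtopologyE[OF \<alpha> A(1), of "h x"]) (use x in \<open>auto simp: A1_def\<close>)
    have xt: "x \<in> topspace W" using x unfolding A1_def by auto
    obtain V where V: "openin W V" "x \<in> V" "\<And>y z. y \<in> V \<Longrightarrow> z \<in> V \<Longrightarrow>
        \<forall>i\<in>I. C i (h y, h z) - (\<Sum>j\<in>I. M i j * C j (y, z)) = \<gamma> i z - \<gamma> i y"
      by (rule nearE[OF M' xt]) (rule that)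
    let ?G = "U \<inter> V \<inter> {x \<in> topspace W. h x \<in> U'}"
    have "\<theta> i y = \<theta> i z" if yz: "y \<in> ?G" "z \<in> ?G" and i: "i \<in> I" for y z i
    proof -
      have "(\<Sum>j\<in>I. M i j * C j (y, z)) = (\<Sum>j\<in>I. M i j * (\<alpha> j z - \<alpha> j y))"
        by (rule sum.cong) (use U(4)[of y z] yz in auto)
      also have "\<dots> = (\<Sum>j\<in>I. M i j * \<alpha> j z) - (\<Sum>j\<in>I. M i j * \<alpha> j y)"
        by (simp add: right_diff_distrib sum_subtractf)
      finally have 1: "(\<Sum>j\<in>I. M i j * C j (y, z)) = (\<Sum>j\<in>I. M i j * \<alpha> j z) - (\<Sum>j\<in>I. M i j * \<alpha> j y)" .
      have 2: "C i (h y, h z) = \<alpha> i (h z) - \<alpha> i (h y)" using U'(4)[of "h y" "h z"] yz i by auto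
      have "C i (h y, h z) - (\<Sum>j\<in>I. M i j * C j (y, z)) = \<gamma> i z - \<gamma> i y" using V(3)[of y z] yz i by auto
      then have "\<alpha> i (h z) - \<alpha> i (h y) - ((\<Sum>j\<in>I. M i j * \<alpha> j z) - (\<Sum>j\<in>I. M i j * \<alpha> j y)) = \<gamma> i z - \<gamma> i y"
        unfolding 1 2 .
      then show ?thesis unfolding \<theta>_def by (simp add: algebra_simps)
    qed
    moreover have "openin W ?G" using U V openin_continuous_map_preimage[OF h(1) U'(1)] by blast
    moreover have "?G \<subseteq> A1" unfolding A1_def using U(3) U'(3) by auto
    moreover have "x \<in> ?G" using U(2) V(2) U'(2) xt by simp
    ultimately show "\<exists>U. openin W U \<and> x \<in> U \<and> U \<subseteq> A1 \<and> (\<forall>y\<in>U. \<forall>z\<in>U. \<forall>i\<in>I. \<theta> i y = \<theta> i z)"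
      by (intro exI[of _ ?G] conjI ballI) assumption+
  qed
  obtain x0 where x0: "x0 \<in> K" using K(3) by auto
  define t where "t i = \<theta> i x0" for i
  \<comment> \<open>Connectedness of \<open>K\<close> turns the locally constant error into a single
    constant on \<open>K\<close>, hence on the neighbourhood \<open>A2\<close>.\<close>
  have tK: "\<theta> i x = t i" if "x \<in> K" "i \<in> I" for x i
  proof -
    have "near (subtopology W A1) (\<lambda>y z. \<theta> i y = \<theta> i z)" by (rule near_mono[OF \<theta>]) (use that in auto)
    then show ?thesis unfolding t_def
      by (intro locally_constant_connected[OF _ K(2) that(1) x0] near_subset[OF _ A1(2)])
  qed
  \<comment> \<open>All indices are treated at once by one function-valued locally constant map,
    with default 0 outside \<open>I\<close>, so that \<open>near_eq_clopen\<close> gives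
    openness.\<close>
  define A2 where "A2 = {x \<in> topspace (subtopology W A1). (\<lambda>i. if i \<in> I then \<theta> i x else 0) \<in> {\<lambda>i. if i \<in> I then t i else 0}}"
  have A2_iff: "x \<in> A2 \<longleftrightarrow> x \<in> A1 \<and> (\<forall>i\<in>I. \<theta> i x = t i)" for x
  proof -
    have "topspace (subtopology W A1) = A1" using openin_subset[OF A1(1)] by auto
    then have "x \<in> A2 \<longleftrightarrow> x \<in> A1 \<and> (\<lambda>i. if i \<in> I then \<theta> i x else 0) = (\<lambda>i. if i \<in> I then t i else 0)"
      unfolding A2_def by simp
    also have "\<dots> \<longleftrightarrow> x \<in> A1 \<and> (\<forall>i\<in>I. \<theta> i x = t i)" by (auto simp: fun_eq_iff)
    finally show ?thesis .
  qed
  have "openin (subtopology W A1) A2" unfolding A2_def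
    by (rule near_eq_clopen(1), rule near_mono[OF \<theta>]) (auto simp: fun_eq_iff)
  then have A2: "openin W A2" "K \<subseteq> A2" using A1 tK A2_iff by (auto simp: openin_open_subtopology)
  obtain B where B: "openin W B" "K \<subseteq> B" "B \<subseteq> A2" "h' ` B \<subseteq> B" using basis[OF A2] by auto
  \<comment> \<open>The extension equation solved backwards: \<open>h' y\<close> is the predecessor
    of \<open>y\<close>, and \<open>k\<close> counts the steps until \<open>B\<close> is
    reached.\<close>
  define val where "val k = rec_nat (\<lambda>y i. \<alpha> i y) (\<lambda>_ v y i. (\<Sum>j\<in>I. M i j * v (h' y) j) + (\<gamma> i (h' y) + t i)) k" for k
  have val: "val 0 y i = \<alpha> i y" "val (Suc k) y i = (\<Sum>j\<in>I. M i j * val k (h' y) j) + (\<gamma> i (h' y) + t i)" for k y i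
    unfolding val_def by auto
  \<comment> \<open>The first entrance time. The equation holds inside \<open>B\<close> as well,
    since \<open>B\<close> lies in \<open>A2\<close>, so recursive values and the original
    potentials fit together where the recursion stops.\<close>
  define \<kappa> where "\<kappa> y = (LEAST k. (h' ^^ k) y \<in> B)" for y
  define a where "a i y = val (\<kappa> y) y i" for i y
  have aB: "a i y = \<alpha> i y" if "y \<in> B" for y i
    unfolding a_def \<kappa>_def using that by (simp add: Least_eq_0 val)
  have eq: "a i (h y) = (\<Sum>j\<in>I. M i j * a j y) + (\<gamma> i y + t i)"
    if y: "y \<in> topspace W" "(h' ^^ k) y \<in> B" and i: "i \<in> I" for y k i
  proof (cases "h y \<in> B")
    case True
    then have yB: "y \<in> B" using B(4) h(4)[OF y(1)] by (metis imageI subsetD)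
    then have "\<theta> i y = t i" using A2_iff B(3) i by auto
    then show ?thesis using aB[OF True] aB[OF yB] unfolding \<theta>_def by (simp add: algebra_simps)
  next
    case False
    have s: "(h' ^^ Suc k) (h y) = (h' ^^ k) y" for k using h(4)[OF y(1)] by (simp only: funpow_Suc_right comp_apply)
    have "\<kappa> (h y) = Suc (LEAST k. (h' ^^ Suc k) (h y) \<in> B)"
      unfolding \<kappa>_def by (rule Least_Suc[of _ "Suc k"]) (use y(2) s False in auto)
    also have "(LEAST k. (h' ^^ Suc k) (h y) \<in> B) = \<kappa> y" unfolding s \<kappa>_def ..
    finally show ?thesis unfolding a_def by (simp add: val h(4)[OF y(1)])
  qed
  \<comment> \<open>This local form of the claim passes from \<open>y\<close> to \<open>h y\<close>.
    Reaching \<open>B\<close> is part of it because \<open>eq\<close> needs this at every point of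
    the neighbourhood.\<close>
  define P where "P y \<longleftrightarrow> (\<exists>U. openin W U \<and> y \<in> U \<and> (\<forall>u\<in>U. \<exists>k. (h' ^^ k) u \<in> B) \<and>
      (\<forall>u\<in>U. \<forall>v\<in>U. \<forall>i\<in>I. C i (u, v) = a i v - a i u))" for y
  have P0: "P y" if "y \<in> B" for y
  proof -
    have yA: "y \<in> A" using that B(3) A2_iff unfolding A1_def by auto
    obtain U where U: "openin W U" "y \<in> U" "U \<subseteq> A" "\<And>u v. u \<in> U \<Longrightarrow> v \<in> U \<Longrightarrow> \<forall>i\<in>I. C i (u, v) = \<alpha> i v - \<alpha> i u"
      by (rule near_open_subtopologyE[OF \<alpha> A(1) yA]) (rule that)
    have "\<exists>k. (h' ^^ k) u \<in> B" if "u \<in> B" for u using that by (intro exI[of _ 0]) auto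
    then show ?thesis unfolding P_def using U aB B(1) that by (intro exI[of _ "U \<inter> B"]) auto
  qed
  have PS: "P (h y)" if y: "P y" "y \<in> topspace W" for y
  proof -
    obtain U where U: "openin W U" "y \<in> U" "\<And>u. u \<in> U \<Longrightarrow> \<exists>k. (h' ^^ k) u \<in> B"
      "\<And>u v i. u \<in> U \<Longrightarrow> v \<in> U \<Longrightarrow> i \<in> I \<Longrightarrow> C i (u, v) = a i v - a i u" using y(1) unfolding P_def by blast
    obtain V where V: "openin W V" "y \<in> V" "\<And>u v. u \<in> V \<Longrightarrow> v \<in> V \<Longrightarrow>
        \<forall>i\<in>I. C i (h u, h v) - (\<Sum>j\<in>I. M i j * C j (u, v)) = \<gamma> i v - \<gamma> i u"
      by (rule nearE[OF M' y(2)]) (rule that)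
    let ?G = "{w \<in> topspace W. h' w \<in> U \<inter> V}"
    have "C i (w, v) = a i v - a i w" if wv: "w \<in> ?G" "v \<in> ?G" and i: "i \<in> I" for w v i
    proof -
      have ww: "h' w \<in> topspace W" "h' v \<in> topspace W" using ht wv by auto
      obtain k l where kl: "(h' ^^ k) (h' w) \<in> B" "(h' ^^ l) (h' v) \<in> B" using U(3) wv by blast
      have aw: "a i w = (\<Sum>j\<in>I. M i j * a j (h' w)) + (\<gamma> i (h' w) + t i)"
        using eq[OF ww(1) kl(1) i] h(3) wv by simp
      have av: "a i v = (\<Sum>j\<in>I. M i j * a j (h' v)) + (\<gamma> i (h' v) + t i)"
        using eq[OF ww(2) kl(2) i] h(3) wv by simp
      have "(\<Sum>j\<in>I. M i j * C j (h' w, h' v)) = (\<Sum>j\<in>I. M i j * (a j (h' v) - a j (h' w)))"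
        by (rule sum.cong) (use U(4)[of "h' w" "h' v"] wv in auto)
      also have "\<dots> = (\<Sum>j\<in>I. M i j * a j (h' v)) - (\<Sum>j\<in>I. M i j * a j (h' w))"
        by (simp add: right_diff_distrib sum_subtractf)
      finally have 1: "(\<Sum>j\<in>I. M i j * C j (h' w, h' v)) = \<dots>" .
      have "C i (h (h' w), h (h' v)) - (\<Sum>j\<in>I. M i j * C j (h' w, h' v)) = \<gamma> i (h' v) - \<gamma> i (h' w)"
        using V(3)[of "h' w" "h' v"] wv i by auto
      then show ?thesis unfolding 1 aw av using h(3) wv by (simp add: algebra_simps)
    qed
    moreover have "\<exists>k. (h' ^^ k) w \<in> B" if "w \<in> ?G" for w
    proof -
      obtain k where "(h' ^^ k) (h' w) \<in> B" using U(3) \<open>w \<in> ?G\<close> by blast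
      then have "(h' ^^ Suc k) w \<in> B" by (simp only: funpow_Suc_right comp_apply)
      then show ?thesis by blast
    qed
    moreover have "openin W ?G" by (rule openin_continuous_map_preimage[OF h(2)]) (use U V in auto)
    moreover have "h y \<in> ?G" using ht y U V h(4) by auto
    ultimately show ?thesis unfolding P_def by (intro exI[of _ ?G] conjI ballI) assumption+
  qed
  have Pk: "P y" if "y \<in> topspace W" "(h' ^^ k) y \<in> B" for y k
    using that
  proof (induction k arbitrary: y)
    case (Suc k)
    then have "(h' ^^ k) (h' y) \<in> B" by (simp only: funpow_Suc_right comp_apply)
    then have "P (h' y)" using Suc ht by blast
    then show ?case using PS[of "h' y"] ht(2)[OF Suc.prems(1)] h(3)[OF Suc.prems(1)] by simp
  qed (use P0 in auto)
  have "near (subtopology W R) (\<lambda>y z. C i (y, z) = a i z - a i y)"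
  proof (rule nearI)
    fix y assume "y \<in> topspace (subtopology W R)"
    then have y: "y \<in> R" "y \<in> topspace W" by auto
    obtain k where "(h' ^^ k) y \<in> B" using R(2)[OF B(1,2) y(1)] by auto
    then have "P y" by (rule Pk[OF y(2)])
    then obtain U where "openin W U" "y \<in> U" "\<forall>u\<in>U. \<forall>v\<in>U. \<forall>i\<in>I. C i (u, v) = a i v - a i u"
      unfolding P_def by (elim exE conjE) (rule that)
    then show "\<exists>U. openin (subtopology W R) U \<and> y \<in> U \<and> (\<forall>u\<in>U. \<forall>v\<in>U. C i (u, v) = a i v - a i u)"
      using i y by (intro exI[of _ "U \<inter> R"]) (auto simp: openin_subtopology)
  qed
  then show ?thesis unfolding cobounds_def by blast
qed

section \<open>An attracting fixed point and its dual repeller\<close>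

text \<open>In the application \<open>Q\<close> consists of the sequences whose coordinate at index
  0 is not the base point. It is open but need not be closed, so that \<open>K\<close> is closed
  rests on the condition \<open>K_cl\<close> on closures.\<close>

locale attractor_repeller =
  fixes W :: "'w topology" and g g' :: "'w \<Rightarrow> 'w" and Q K :: "'w set" and p :: 'w
  assumes compact: "compact_space W" and Hausdorff: "Hausdorff_space W"
    and g_cont: "continuous_map W W g" and g'_cont: "continuous_map W W g'"
    and gg': "\<And>x. x \<in> topspace W \<Longrightarrow> g (g' x) = x" and g'g: "\<And>x. x \<in> topspace W \<Longrightarrow> g' (g x) = x"
    and Q_open: "openin W Q" and g'_Q: "\<And>x. x \<in> Q \<Longrightarrow> g' x \<in> Q"
    and p: "p \<in> topspace W" "g p = p" "p \<notin> Q"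
    and K_def: "K = (\<Inter>k. {x \<in> topspace W. (g ^^ k) x \<in> Q})"
    and K_cl: "(\<Inter>k. W closure_of {x \<in> topspace W. (g ^^ k) x \<in> Q}) \<subseteq> K"
    and exhaust: "\<And>y. y \<in> topspace W \<Longrightarrow> y \<noteq> p \<Longrightarrow> \<exists>k. (g' ^^ k) y \<in> Q"
    and K_connected: "connectedin W K" and K_nonempty: "K \<noteq> {}"
begin

text \<open>As \<open>g'\<close> preserves \<open>Q\<close>, these sets decrease with
  \<open>k\<close>; they form a neighbourhood basis of \<open>K\<close>
  (\<open>K_basis\<close>).\<close>

definition Qk :: "nat \<Rightarrow> 'w set" where "Qk k = {x \<in> topspace W. (g ^^ k) x \<in> Q}"

lemma g_in: "x \<in> topspace W \<Longrightarrow> g x \<in> topspace W" "x \<in> topspace W \<Longrightarrow> g' x \<in> topspace W"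
  using g_cont g'_cont by (auto simp: continuous_map_def)

lemma gk_cont: "continuous_map W W (g ^^ k)" "continuous_map W W (g' ^^ k)"
proof -
  show "continuous_map W W (g ^^ k)"
  proof (induction k)
    case (Suc k) then show ?case using continuous_map_compose[OF Suc g_cont] by (simp add: comp_def)
  qed (simp add: id_def[symmetric])
  show "continuous_map W W (g' ^^ k)"
  proof (induction k)
    case (Suc k) then show ?case using continuous_map_compose[OF Suc g'_cont] by (simp add: comp_def)
  qed (simp add: id_def[symmetric])
qed

lemma gk_in: "x \<in> topspace W \<Longrightarrow> (g ^^ k) x \<in> topspace W" "x \<in> topspace W \<Longrightarrow> (g' ^^ k) x \<in> topspace W"
  using gk_cont[of k] by (auto simp: continuous_map_def)

lemma ggk: "x \<in> topspace W \<Longrightarrow> (g ^^ k) ((g' ^^ k) x) = x" "x \<in> topspace W \<Longrightarrow> (g' ^^ k) ((g ^^ k) x) = x"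
proof -
  show "x \<in> topspace W \<Longrightarrow> (g ^^ k) ((g' ^^ k) x) = x" for x
  proof (induction k arbitrary: x)
    case (Suc k)
    have "(g ^^ Suc k) ((g' ^^ Suc k) x) = (g ^^ k) (g (g' ((g' ^^ k) x)))" by (simp add: funpow_swap1)
    then show ?case using Suc gg' gk_in by simp
  qed simp
  show "x \<in> topspace W \<Longrightarrow> (g' ^^ k) ((g ^^ k) x) = x" for x
  proof (induction k arbitrary: x)
    case (Suc k)
    have "(g' ^^ Suc k) ((g ^^ Suc k) x) = (g' ^^ k) (g' (g ((g ^^ k) x)))" by (simp add: funpow_swap1)
    then show ?case using Suc g'g gk_in by simp
  qed simp
qed

lemma Qk_open: "openin W (Qk k)"
  unfolding Qk_def by (rule openin_continuous_map_preimage[OF gk_cont(1) Q_open])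

lemma Qk_dec: "Qk (k + l) \<subseteq> Qk k"
proof (induction l)
  case (Suc l)
  have "x \<in> Qk (k + l)" if x: "x \<in> Qk (k + Suc l)" for x
  proof -
    have "g' (g ((g ^^ (k + l)) x)) \<in> Q" using x g'_Q unfolding Qk_def by auto
    then show ?thesis using g'g gk_in(1) x unfolding Qk_def by auto
  qed
  then show ?case using Suc by auto
qed simp

lemma K_subset: "K \<subseteq> Qk k" "K \<subseteq> topspace W"
  unfolding K_def Qk_def by auto

lemma K_closure: "K = (\<Inter>k. W closure_of (Qk k))"
proof
  show "K \<subseteq> (\<Inter>k. W closure_of (Qk k))"
    using K_subset closure_of_subset[OF openin_subset[OF Qk_open]] by blast
qed (use K_cl in \<open>simp add: Qk_def\<close>)

lemma K_closed: "closedin W K"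
  unfolding K_closure by (intro closedin_Inter) auto

lemma K_basis:
  assumes "openin W A" "K \<subseteq> A" obtains k where "W closure_of (Qk k) \<subseteq> A"
proof (rule ccontr)
  assume n: "\<not> thesis"
  define S where "S k = W closure_of (Qk k) - A" for k
  have 1: "closedin W (S k)" for k unfolding S_def using assms(1) by (intro closedin_diff) auto
  have 2: "S k \<noteq> {}" for k unfolding S_def using n that by blast
  have "W closure_of (Qk (k + l)) \<subseteq> W closure_of (Qk k)" for k l by (rule closure_of_mono[OF Qk_dec])
  then have 3: "decseq S" unfolding S_def decseq_def by (auto simp: le_iff_add)
  have "(\<Inter>k. S k) \<noteq> {}" by (rule compact_space_imp_nest[OF compact 1 2 3])
  then show False using assms(2) unfolding S_def K_closure by auto
qed

lemma g_K: "x \<in> K \<Longrightarrow> g x \<in> K" "x \<in> K \<Longrightarrow> g' x \<in> K"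
proof -
  assume x: "x \<in> K"
  then have xt: "x \<in> topspace W" using K_subset by auto
  have *: "(g ^^ k) x \<in> Q" for k using x unfolding K_def by auto
  show "g x \<in> K" unfolding K_def using g_in xt *[of "Suc _"] by (auto simp: funpow_swap1)
  have "(g ^^ k) (g' x) \<in> Q" for k
  proof (cases k)
    case 0 then show ?thesis using *[of 0] g'_Q by simp
  next
    case (Suc l) then show ?thesis using *[of l] gg'[OF xt] by (simp only: funpow_Suc_right comp_apply)
  qed
  then show "g' x \<in> K" unfolding K_def using g_in xt by auto
qed

lemma p_notin_K: "p \<notin> K"
  using p(3) K_subset(1)[of 0] unfolding Qk_def by auto

lemma gk_p: "(g ^^ k) p = p" "(g' ^^ k) p = p"
proof -
  show "(g ^^ k) p = p" using p(2) by (induction k) auto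
  then show "(g' ^^ k) p = p" using ggk(2)[OF p(1), of k] by simp
qed

lemma closure_Qk: "x \<in> topspace W \<Longrightarrow> (g ^^ k) x \<in> W closure_of Q \<Longrightarrow> x \<in> W closure_of (Qk k)"
proof -
  assume x: "x \<in> topspace W" "(g ^^ k) x \<in> W closure_of Q"
  have "(g' ^^ k) ` Q \<subseteq> Qk k"
    unfolding Qk_def using openin_subset[OF Q_open] gk_in ggk by auto
  moreover have "(g' ^^ k) ` (W closure_of Q) \<subseteq> W closure_of ((g' ^^ k) ` Q)"
    using gk_cont(2) unfolding continuous_map_eq_image_closure_subset by blast
  ultimately have "(g' ^^ k) ((g ^^ k) x) \<in> W closure_of (Qk k)"
    using x(2) closure_of_mono by blast
  then show ?thesis using ggk(2)[OF x(1)] by simp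
qed

text \<open>As a fixed point, \<open>p\<close> would lie in the closures of all \<open>Qk k\<close>,
  whose intersection is \<open>K\<close>.\<close>

lemma p_notin_closure_Q: "p \<notin> W closure_of Q"
proof
  assume "p \<in> W closure_of Q"
  then have "p \<in> W closure_of (Qk k)" for k using closure_Qk[OF p(1), of k] gk_p by simp
  then show False using p_notin_K unfolding K_closure by auto
qed

text \<open>The counterpart of \<open>Qk\<close> at \<open>p\<close>: a neighbourhood basis of sets
  that \<open>g\<close> preserves.\<close>

definition Rk :: "nat \<Rightarrow> 'w set" where "Rk k = {x \<in> topspace W. (g' ^^ k) x \<in> topspace W - W closure_of Q}"

lemma Rk_open: "openin W (Rk k)"
  unfolding Rk_def by (rule openin_continuous_map_preimage[OF gk_cont(2)]) auto

lemma p_Rk: "p \<in> Rk k"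
  unfolding Rk_def using p gk_p p_notin_closure_Q by auto

lemma g_Rk: "x \<in> Rk k \<Longrightarrow> g x \<in> Rk k"
proof -
  assume x: "x \<in> Rk k"
  then have xt: "x \<in> topspace W" unfolding Rk_def by auto
  let ?y = "(g' ^^ k) x"
  have yt: "?y \<in> topspace W" using gk_in xt by auto
  have "(g' ^^ k) (g x) = g ?y"
  proof -
    have "g ?y = (g' ^^ k) ((g ^^ k) (g ?y))" using ggk(2) g_in yt by simp
    also have "(g ^^ k) (g ?y) = g ((g ^^ k) ?y)" by (simp add: funpow_swap1)
    also have "\<dots> = g x" using ggk(1)[OF xt] by simp
    finally show ?thesis by simp
  qed
  moreover have "g ?y \<notin> W closure_of Q"
  proof
    assume "g ?y \<in> W closure_of Q"
    then have "(g ^^ 1) ?y \<in> W closure_of Q" by simp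
    then have "?y \<in> W closure_of (Qk 1)" by (rule closure_Qk[OF yt])
    moreover have "Qk 1 \<subseteq> Q" using Qk_dec[of 0 1] unfolding Qk_def by auto
    ultimately have "?y \<in> W closure_of Q" using closure_of_mono by blast
    then show False using x unfolding Rk_def by auto
  qed
  ultimately show ?thesis unfolding Rk_def using g_in xt yt by auto
qed

text \<open>The complement of \<open>B\<close> is compact and is covered by the sets of points that
  are in \<open>Q\<close> after \<open>k\<close> backward steps. These sets increase with
  \<open>k\<close>, so one of them suffices.\<close>

lemma p_basis:
  assumes "openin W B" "p \<in> B" obtains k where "Rk k \<subseteq> B"
proof -
  define O' where "O' k = {x \<in> topspace W. (g' ^^ k) x \<in> Q}" for k
  have O': "openin W (O' k)" for k unfolding O'_def by (rule openin_continuous_map_preimage[OF gk_cont(2) Q_open])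
  have inc: "O' k \<subseteq> O' (k + l)" for k l
  proof (induction l)
    case (Suc l) then show ?case unfolding O'_def using g'_Q by auto
  qed simp
  have "compactin W (topspace W - B)" by (rule closedin_compact_space[OF compact]) (use assms(1) in auto)
  moreover have "topspace W - B \<subseteq> \<Union>(range O')" using exhaust assms(2) unfolding O'_def by blast
  ultimately have "\<exists>\<F>. finite \<F> \<and> \<F> \<subseteq> range O' \<and> topspace W - B \<subseteq> \<Union>\<F>"
    by (intro compactinD) (use O' in auto)
  then obtain I where I: "finite I" "topspace W - B \<subseteq> (\<Union>k\<in>I. O' k)" by (metis finite_subset_image)
  define m where "m = Max (insert 0 I)"
  have "O' k \<subseteq> O' m" if "k \<in> I" for k
  proof -
    have "k \<le> m" unfolding m_def by (rule Max_ge) (use that I in auto)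
    then show ?thesis using inc[of k "m - k"] by simp
  qed
  then have "topspace W - B \<subseteq> O' m" using I by blast
  then have "Rk m \<subseteq> B"
    unfolding Rk_def O'_def using closure_of_subset[OF openin_subset[OF Q_open]] by blast
  then show ?thesis by (rule that)
qed

lemma eventually_Rk:
  assumes "y \<in> topspace W" "y \<notin> K" obtains j where "(g ^^ j) y \<in> Rk k"
proof -
  obtain m where "y \<notin> W closure_of (Qk m)" using assms(2) unfolding K_closure by auto
  then have m: "(g ^^ m) y \<notin> W closure_of Q" using closure_Qk[OF assms(1)] by blast
  have "(g' ^^ k) ((g ^^ (k + m)) y) = (g ^^ m) y"
    using ggk(2)[OF gk_in(1)[OF assms(1)]] by (simp add: funpow_add)
  then have "(g ^^ (k + m)) y \<in> Rk k" unfolding Rk_def using m gk_in assms(1) by auto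
  then show ?thesis by (rule that)
qed

lemma eventually_Qk:
  assumes "y \<in> topspace W" "y \<noteq> p" obtains j where "(g' ^^ j) y \<in> Qk k"
proof -
  obtain m where m: "(g' ^^ m) y \<in> Q" using exhaust[OF assms] by auto
  have "(g ^^ k) ((g' ^^ (k + m)) y) = (g' ^^ m) y"
    using ggk(1)[OF gk_in(2)[OF assms(1)]] by (simp add: funpow_add)
  then have "(g' ^^ (k + m)) y \<in> Qk k" unfolding Qk_def using m gk_in assms(1) by auto
  then show ?thesis by (rule that)
qed

text \<open>Mayer-Vietoris data for the open cover by \<open>W - {p}\<close> and
  \<open>W - K\<close>: up to sign, the class of \<open>C\<close> is the image under the connecting
  map of the locally constant function \<open>\<alpha> - \<beta>\<close> on the overlap.\<close>

definition trivialized :: "('w \<times> 'w \<Rightarrow> 'k::field) \<Rightarrow> ('w \<Rightarrow> 'k) \<Rightarrow> ('w \<Rightarrow> 'k) \<Rightarrow> bool" where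
  "trivialized C \<alpha> \<beta> \<longleftrightarrow> C \<in> asc W \<and>
     near (subtopology W (topspace W - {p})) (\<lambda>y z. C (y, z) = \<alpha> z - \<alpha> y) \<and>
     near (subtopology W (topspace W - K)) (\<lambda>y z. C (y, z) = \<beta> z - \<beta> y)"

lemma open_p: "openin W (topspace W - {p})"
  using closedin_Hausdorff_sing_eq[OF Hausdorff] p(1) by auto

lemma open_K: "openin W (topspace W - K)"
  using K_closed by auto

text \<open>The same propagation is used twice, from \<open>K\<close> under \<open>g\<close> and
  from \<open>p\<close> under \<open>g'\<close>. At the single point \<open>p\<close> the initial
  potential is zero; at \<open>K\<close> it comes from the vanishing of the restrictions.\<close>

lemma kernel_trivialized:
  fixes C :: "'i \<Rightarrow> 'w \<times> 'w \<Rightarrow> 'k::field"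
  assumes I: "finite I" and C: "\<And>i. i \<in> I \<Longrightarrow> C i \<in> asc W"
    and M: "\<And>i. i \<in> I \<Longrightarrow> cobounds W (\<lambda>(y, z). C i (g y, g z) - (\<Sum>j\<in>I. M i j * C j (y, z)))"
    and M': "\<And>i. i \<in> I \<Longrightarrow> cobounds W (\<lambda>(y, z). C i (g' y, g' z) - (\<Sum>j\<in>I. M' i j * C j (y, z)))"
    and CK: "\<And>i. i \<in> I \<Longrightarrow> cobounds (subtopology W K) (C i)"
    and i: "i \<in> I"
  obtains \<alpha> \<beta> where "trivialized (C i) \<alpha> \<beta>"
proof -
  have "\<forall>i\<in>I. \<exists>\<gamma>. near W (\<lambda>y z. C i (g y, g z) - (\<Sum>j\<in>I. M i j * C j (y, z)) = \<gamma> z - \<gamma> y)"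
    using M unfolding cobounds_def by auto
  from bchoice[OF this] obtain \<gamma> where "\<forall>i\<in>I. near W (\<lambda>y z. C i (g y, g z) - (\<Sum>j\<in>I. M i j * C j (y, z)) = \<gamma> i z - \<gamma> i y)"
    by (elim exE) (rule that)
  note \<gamma> = this[rule_format]
  have "\<forall>i\<in>I. \<exists>\<gamma>. near W (\<lambda>y z. C i (g' y, g' z) - (\<Sum>j\<in>I. M' i j * C j (y, z)) = \<gamma> z - \<gamma> y)"
    using M' unfolding cobounds_def by auto
  from bchoice[OF this] obtain \<gamma>' where "\<forall>i\<in>I. near W (\<lambda>y z. C i (g' y, g' z) - (\<Sum>j\<in>I. M' i j * C j (y, z)) = \<gamma>' i z - \<gamma>' i y)"
    by (elim exE) (rule that)
  note \<gamma>' = this[rule_format]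
  have "cobounds (subtopology W (topspace W - {p})) (C i)"
  proof (rule equivariant_trivialization[OF compact Hausdorff g_cont g'_cont gg' g'g K_closed K_connected K_nonempty _ _ _ _ I C \<gamma> CK i])
    show "g ` K \<subseteq> K" using g_K by auto
    show "\<exists>B. openin W B \<and> K \<subseteq> B \<and> B \<subseteq> A \<and> g' ` B \<subseteq> B" if A: "openin W A" "K \<subseteq> A" for A
    proof -
      obtain k where k: "W closure_of (Qk k) \<subseteq> A" using K_basis[OF A] .
      have "g' x \<in> Qk k" if "x \<in> Qk k" for x
      proof -
        have "x \<in> topspace W" "(g ^^ Suc k) (g' x) \<in> Q"
          using that gg' unfolding Qk_def by (simp_all only: funpow_Suc_right comp_apply) auto
        then have "g' x \<in> Qk (k + 1)" unfolding Qk_def using g_in by auto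
        then show ?thesis using Qk_dec[of k 1] by auto
      qed
      then show ?thesis
        using k Qk_open K_subset(1) closure_of_subset[OF openin_subset[OF Qk_open[of k]]] by (intro exI[of _ "Qk k"]) auto
    qed
    show "\<exists>k. (g' ^^ k) y \<in> B" if B: "openin W B" "K \<subseteq> B" "y \<in> topspace W - {p}" for B y
    proof -
      obtain k where k: "W closure_of (Qk k) \<subseteq> B" using K_basis[OF B(1,2)] .
      obtain j where "(g' ^^ j) y \<in> Qk k" using eventually_Qk[of y k] B(3) by auto
      then show ?thesis using k closure_of_subset[OF openin_subset[OF Qk_open[of k]]] by blast
    qed
  qed auto
  moreover have "cobounds (subtopology W (topspace W - K)) (C i)"
  proof (rule equivariant_trivialization[OF compact Hausdorff g'_cont g_cont g'g gg' _ _ _ _ _ _ _ I C \<gamma>' _ i])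
    show "closedin W {p}" using closedin_Hausdorff_sing_eq[OF Hausdorff] p(1) by auto
    show "connectedin W {p}" using p(1) by simp
    show "g' ` {p} \<subseteq> {p}" using gk_p(2)[of 1] by auto
    show "\<exists>B'. openin W B' \<and> {p} \<subseteq> B' \<and> B' \<subseteq> A \<and> g ` B' \<subseteq> B'" if A: "openin W A" "{p} \<subseteq> A" for A
    proof -
      obtain k where "Rk k \<subseteq> A" using p_basis[OF A(1)] A(2) by auto
      then show ?thesis using Rk_open p_Rk g_Rk by (intro exI[of _ "Rk k"]) auto
    qed
    show "\<exists>k. (g ^^ k) y \<in> B" if B: "openin W B" "{p} \<subseteq> B" "y \<in> topspace W - K" for B y
    proof -
      obtain k where k: "Rk k \<subseteq> B" using p_basis[OF B(1)] B(2) by auto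
      obtain j where "(g ^^ j) y \<in> Rk k" using eventually_Rk[of y k] B(3) by auto
      then show ?thesis using k by blast
    qed
    show "cobounds (subtopology W {p}) (C i)" if "i \<in> I" for i
      unfolding cobounds_def
    proof (intro exI[of _ "\<lambda>_. 0"] nearI exI conjI)
      fix x assume "x \<in> topspace (subtopology W {p})"
      then show "openin (subtopology W {p}) {p}" "x \<in> {p}"
        using p(1) by (auto simp: openin_subtopology intro!: exI[of _ "topspace W"])
      show "\<forall>y\<in>{p}. \<forall>z\<in>{p}. C i (y, z) = 0 - 0" using asc_diag[OF C[OF that] p(1)] by auto
    qed
  qed auto
  ultimately show ?thesis using that C[OF i] unfolding trivialized_def cobounds_def by blast
qed

end

section \<open>Essential quasicomponents and the jump between the two potentials\<close>

lemma near_potentials_diff: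
  fixes C :: "'x \<times> 'x \<Rightarrow> 'k::field"
  assumes "near X (\<lambda>y z. C (y, z) = a z - a y)" "near X (\<lambda>y z. C (y, z) = b z - b y)"
  shows "near X (\<lambda>y z. a y - b y = a z - b z)"
proof (rule near_mono[OF near_conj[OF assms]])
  fix x y assume "C (x, y) = a y - a x \<and> C (x, y) = b y - b x"
  then have "a y - a x = b y - b x" by metis
  then show "a x - b x = a y - b y" by (simp add: algebra_simps)
qed

context attractor_repeller
begin

definition Y :: "'w set" where "Y = topspace W - (K \<union> {p})"

definition J :: "'w set set" where
  "J = {F \<in> quasi_components_of (subtopology W Y). p \<in> W closure_of F \<and> W closure_of F \<inter> K \<noteq> {}}"

definition clopenY :: "'w set \<Rightarrow> bool" where
  "clopenY T \<longleftrightarrow> openin (subtopology W Y) T \<and> closedin (subtopology W Y) T"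

lemma Y_open: "openin W Y"
proof -
  have "Y = (topspace W - {p}) \<inter> (topspace W - K)" unfolding Y_def by auto
  then show ?thesis using open_p open_K by auto
qed

lemma topspace_Y: "topspace (subtopology W Y) = Y"
  using openin_subset[OF Y_open] by auto

lemma clopenY_subset: "clopenY T \<Longrightarrow> T \<subseteq> Y"
  unfolding clopenY_def using openin_subset topspace_Y by metis

lemma clopenY_open: "clopenY T \<Longrightarrow> openin W T"
  unfolding clopenY_def using Y_open by (auto simp: openin_open_subtopology)

lemma clopenY_ops:
  assumes "clopenY S" "clopenY T"
  shows "clopenY (S \<inter> T)" "clopenY (S \<union> T)" "clopenY (S - T)"
  using assms unfolding clopenY_def by (auto intro: openin_Int closedin_Int openin_Un closedin_Un openin_diff closedin_diff)

lemma clopenY_Y: "clopenY Y" "clopenY {}"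
  unfolding clopenY_def using openin_topspace[of "subtopology W Y"] closedin_topspace[of "subtopology W Y"]
  unfolding topspace_Y by simp_all

lemma clopenY_Union: "finite \<T> \<Longrightarrow> (\<And>T. T \<in> \<T> \<Longrightarrow> clopenY T) \<Longrightarrow> clopenY (\<Union>\<T>)"
  by (induction \<T> rule: finite_induct) (auto simp: clopenY_Y clopenY_ops)

text \<open>A clopen set that misses the frontier of \<open>P\<close> meets \<open>P\<close> and its
  closure in the same points, so \<open>P\<close> cuts it into two clopen pieces. The inner piece
  stays away from \<open>p\<close>, the outer one away from \<open>K\<close>.\<close>

lemma clopenY_split:
  assumes T: "clopenY T" and P: "openin W P" "K \<subseteq> P" "p \<notin> W closure_of P" and fr: "T \<inter> (W closure_of P - P) = {}"
  shows "clopenY (T \<inter> P)" "p \<notin> W closure_of (T \<inter> P)" "clopenY (T - P)" "W closure_of (T - P) \<inter> K = {}"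
proof -
  have TY: "T \<subseteq> Y" by (rule clopenY_subset[OF T])
  have Pc: "P \<subseteq> W closure_of P" using closure_of_subset[OF openin_subset[OF P(1)]] .
  have 1: "T \<inter> P = T \<inter> (Y \<inter> P)" "T \<inter> P = T \<inter> (Y \<inter> W closure_of P)" using TY Pc fr by auto
  have "openin (subtopology W Y) (Y \<inter> P)" using P(1) by (auto simp: openin_subtopology)
  moreover have "closedin (subtopology W Y) (Y \<inter> W closure_of P)" by (auto simp: closedin_subtopology intro!: exI[of _ "W closure_of P"])
  ultimately show c: "clopenY (T \<inter> P)"
    using T 1 unfolding clopenY_def by (metis openin_Int closedin_Int)
  show "p \<notin> W closure_of (T \<inter> P)" using P(3) closure_of_mono[of "T \<inter> P" P W] by auto
  have "T - P = T - (T \<inter> P)" by auto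
  then show "clopenY (T - P)" using clopenY_ops(3)[OF T c] by simp
  have "T - P \<subseteq> topspace W - P" using TY unfolding Y_def by auto
  then have "W closure_of (T - P) \<subseteq> topspace W - P" by (rule closure_of_minimal) (use P(1) in auto)
  then show "W closure_of (T - P) \<inter> K = {}" using P(2) by auto
qed

lemma frontier_compactin:
  assumes P: "openin W P" "K \<subseteq> P" "p \<notin> W closure_of P"
  shows "compactin (subtopology W Y) (W closure_of P - P)"
proof -
  have "closedin W (W closure_of P - P)" using P(1) by (intro closedin_diff) auto
  moreover have "W closure_of P - P \<subseteq> Y"
    using P closure_of_subset_topspace[of W P] unfolding Y_def by auto
  ultimately show ?thesis using closedin_compact_space[OF compact] by (simp add: compactin_subtopology)
qed

text \<open>Locally, a quasicomponent that is not essential misses some frontier between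
  \<open>K\<close> and \<open>p\<close>. The frontier is compact, so a clopen set contains the
  quasicomponent and misses the frontier. Globally, finitely many of these clopen sets cover the
  part of \<open>T\<close> on the frontier of \<open>Q\<close>, and \<open>Q\<close> itself cuts the
  rest.\<close>

lemma inessential_split:
  assumes T: "clopenY T" and ne: "\<And>F. F \<in> J \<Longrightarrow> \<not> F \<subseteq> T"
  obtains T1 T2 where "clopenY T1" "clopenY T2" "T = T1 \<union> T2" "T1 \<inter> T2 = {}"
    "p \<notin> W closure_of T1" "W closure_of T2 \<inter> K = {}"
proof -
  let ?S = "W closure_of Q - Q"
  have KQ: "K \<subseteq> Q" using K_subset(1)[of 0] unfolding Qk_def by auto
  have QP: "openin W Q" "K \<subseteq> Q" "p \<notin> W closure_of Q" using Q_open KQ p_notin_closure_Q by auto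
  have TY: "T \<subseteq> Y" by (rule clopenY_subset[OF T])
  have normal: "normal_space W"
    by (rule compact_Hausdorff_or_regular_imp_normal_space) (use compact Hausdorff in auto)
  define small where "small R \<longleftrightarrow> clopenY R \<and> R \<subseteq> T \<and> (p \<notin> W closure_of R \<or> W closure_of R \<inter> K = {})" for R
  have "\<exists>R. y \<in> R \<and> small R" if y: "y \<in> T" for y
  proof -
    define F where "F = quasi_component_of_set (subtopology W Y) y"
    have yY: "y \<in> Y" using y TY by auto
    have F: "F \<in> quasi_components_of (subtopology W Y)" "y \<in> F"
      using yY topspace_Y unfolding F_def quasi_components_of_def by auto
    have FT: "F \<subseteq> T" unfolding F_def using y T unfolding clopenY_def quasi_component_of_def by blast
    have FY: "F \<subseteq> Y" using FT TY by auto
    have "F \<notin> J" using ne FT by auto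
    then have dis: "p \<notin> W closure_of F \<or> W closure_of F \<inter> K = {}" using F(1) unfolding J_def by auto
    \<comment> \<open>If the closure of \<open>F\<close> misses \<open>p\<close>, the frontier is
      placed around \<open>p\<close>; if it misses \<open>K\<close>, around
      \<open>K\<close>.\<close>
    have "\<exists>P. openin W P \<and> K \<subseteq> P \<and> p \<notin> W closure_of P \<and> F \<inter> (W closure_of P - P) = {}"
    proof (cases "p \<in> W closure_of F")
      case False
      define N where "N = topspace W - (W closure_of F \<union> K)"
      have N: "openin W N" "p \<in> N" unfolding N_def using False p(1) p_notin_K K_closed by (auto intro!: openin_diff closedin_Un)
      obtain B where B: "openin W B" "p \<in> B" "W closure_of B \<subseteq> N"
        using compact_Hausdorff_shrink[OF compact Hausdorff N] by metis
      let ?P = "topspace W - W closure_of B"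
      have PB: "?P \<subseteq> topspace W - B" using closure_of_subset[OF openin_subset[OF B(1)]] by auto
      have cP: "W closure_of ?P \<subseteq> topspace W - B" by (rule closure_of_minimal[OF PB]) (use B(1) in auto)
      have "F \<inter> N = {}" unfolding N_def using closure_of_subset[of F W] FY openin_subset[OF Y_open] by auto
      moreover have "W closure_of ?P - ?P \<subseteq> W closure_of B" using closure_of_subset_topspace[of W ?P] by auto
      ultimately have "F \<inter> (W closure_of ?P - ?P) = {}" using B(3) by auto
      moreover have "K \<subseteq> ?P" using B(3) K_subset(2) unfolding N_def by auto
      moreover have "p \<notin> W closure_of ?P" using cP B(2) by auto
      ultimately show ?thesis by (intro exI[of _ ?P]) auto
    next
      case True
      then have "disjnt (W closure_of F) K" using dis unfolding disjnt_def by auto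
      then obtain U V where UV: "openin W U" "openin W V" "W closure_of F \<subseteq> U" "K \<subseteq> V" "disjnt U V"
        using normal K_closed unfolding normal_space_def by (meson closedin_closure_of)
      have "V \<subseteq> topspace W - U" using UV(5) openin_subset[OF UV(2)] unfolding disjnt_def by auto
      then have "W closure_of V \<subseteq> topspace W - U" by (rule closure_of_minimal) (use UV(1) in auto)
      moreover have "F \<subseteq> U" "p \<in> U" using True UV(3) closure_of_subset[of F W] FY openin_subset[OF Y_open] by auto
      ultimately show ?thesis using UV by (intro exI[of _ V]) auto
    qed
    then obtain P where P: "openin W P" "K \<subseteq> P" "p \<notin> W closure_of P" "F \<inter> (W closure_of P - P) = {}" by auto
    have "separated_between (subtopology W Y) F (W closure_of P - P)"
      using separated_between_quasi_component_compact[OF F(1) frontier_compactin[OF P(1-3)]] P(4) unfolding disjnt_def by auto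
    then obtain R where R: "clopenY R" "F \<subseteq> R" "R \<inter> (W closure_of P - P) = {}"
      unfolding separated_between clopenY_def by blast
    have RT: "clopenY (R \<inter> T)" by (rule clopenY_ops(1)[OF R(1) T])
    note sp = clopenY_split[OF RT P(1-3)]
    have fr: "R \<inter> T \<inter> (W closure_of P - P) = {}" using R(3) by auto
    have yRT: "y \<in> R \<inter> T" using F(2) R(2) y by auto
    show ?thesis
    proof (cases "y \<in> P")
      case True
      then have "y \<in> R \<inter> T \<inter> P" "small (R \<inter> T \<inter> P)" unfolding small_def using sp(1,2)[OF fr] yRT by auto
      then show ?thesis by (intro exI conjI)
    next
      case False
      then have "y \<in> R \<inter> T - P" "small (R \<inter> T - P)" unfolding small_def using sp(3,4)[OF fr] yRT by auto
      then show ?thesis by (intro exI conjI)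
    qed
  qed
  then obtain R where R: "\<And>y. y \<in> T \<Longrightarrow> y \<in> R y \<and> small (R y)" by metis
  have "compactin W ?S" using frontier_compactin[OF QP] by (simp add: compactin_subtopology)
  moreover have "closedin (subtopology W Y) (T \<inter> ?S)"
  proof (rule closedin_Int)
    show "closedin (subtopology W Y) T" using T unfolding clopenY_def by auto
    show "closedin (subtopology W Y) ?S"
      using compactin_imp_closedin[OF Hausdorff_space_subtopology[OF Hausdorff] frontier_compactin[OF QP]] .
  qed
  ultimately have "compactin (subtopology W Y) (T \<inter> ?S)"
    using closed_compactin[OF frontier_compactin[OF QP]] by auto
  then have "compactin W (T \<inter> ?S)" by (simp add: compactin_subtopology)
  then obtain D where D: "finite D" "D \<subseteq> T \<inter> ?S" "T \<inter> ?S \<subseteq> (\<Union>y\<in>D. R y)"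
    by (rule finite_point_cover[of W _ R]) (use R clopenY_open in \<open>auto simp: small_def\<close>)
  define U where "U = (\<Union>y\<in>D. R y)"
  have DR: "small (R y)" if "y \<in> D" for y using R D(2) that by auto
  have U: "clopenY U" unfolding U_def by (rule clopenY_Union) (use D(1) DR in \<open>auto simp: small_def\<close>)
  have T0: "clopenY (T - U)" by (rule clopenY_ops(3)[OF T U])
  have fr0: "(T - U) \<inter> ?S = {}" using D(3) unfolding U_def by auto
  note s0 = clopenY_split[OF T0 QP fr0]
  \<comment> \<open>Some pieces may be away from both \<open>p\<close> and \<open>K\<close>; they
    are counted in \<open>T1\<close>, and \<open>T2\<close> will be the remainder of
    \<open>T\<close>.\<close>
  define \<T>1 where "\<T>1 = insert ((T - U) \<inter> Q) (R ` {y \<in> D. p \<notin> W closure_of (R y)})"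
  define T1 where "T1 = \<Union>\<T>1"
  have 1: "finite \<T>1" "\<And>S. S \<in> \<T>1 \<Longrightarrow> clopenY S \<and> p \<notin> W closure_of S"
    unfolding \<T>1_def using D(1) DR s0 by (auto simp: small_def)
  have T1: "clopenY T1" unfolding T1_def by (rule clopenY_Union) (use 1 in auto)
  have pT1: "p \<notin> W closure_of T1" unfolding T1_def closure_of_Union[OF 1(1)] using 1(2) by auto
  have T1T: "T1 \<subseteq> T" unfolding T1_def \<T>1_def using DR by (auto simp: small_def)
  define \<T>2 where "\<T>2 = insert (T - U - Q) (R ` {y \<in> D. W closure_of (R y) \<inter> K = {}})"
  have 2: "finite \<T>2" "\<And>S. S \<in> \<T>2 \<Longrightarrow> W closure_of S \<inter> K = {}"
    unfolding \<T>2_def using D(1) DR s0 by auto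
  have "T - T1 \<subseteq> \<Union>\<T>2"
    unfolding T1_def \<T>1_def \<T>2_def U_def using DR by (auto simp: small_def)
  then have "W closure_of (T - T1) \<subseteq> W closure_of (\<Union>\<T>2)" by (rule closure_of_mono)
  also have "\<dots> = \<Union>((closure_of) W ` \<T>2)" using closure_of_Union[OF 2(1)] by simp
  finally have "W closure_of (T - T1) \<inter> K = {}" using 2(2) by auto
  then show ?thesis using that[OF T1 clopenY_ops(3)[OF T T1]] pT1 T1T by auto
qed

text \<open>With \<open>Y\<close> split into \<open>T1\<close> and \<open>T2\<close>, both
  \<open>K \<union> T1\<close> and its complement \<open>T2 \<union> {p}\<close> are closed: limit
  points of \<open>T1\<close> outside \<open>T1\<close> lie in \<open>K\<close>, and those of
  \<open>T2\<close> outside \<open>T2\<close> can only be \<open>p\<close>.\<close>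

lemma J_empty_clopen:
  assumes "J = {}"
  obtains P where "openin W P" "closedin W P" "K \<subseteq> P" "p \<notin> P"
proof -
  obtain T1 T2 where T: "clopenY T1" "clopenY T2" "Y = T1 \<union> T2" "T1 \<inter> T2 = {}"
    "p \<notin> W closure_of T1" "W closure_of T2 \<inter> K = {}"
    by (rule inessential_split[OF clopenY_Y(1)]) (use assms in auto)
  have sub: "T1 \<subseteq> Y" "T2 \<subseteq> Y" using T clopenY_subset by auto
  have top: "topspace W = K \<union> T1 \<union> T2 \<union> {p}" using T(3) K_subset(2) p(1) unfolding Y_def by auto
  have dj: "K \<inter> T1 = {}" "K \<inter> T2 = {}" "p \<notin> T1" "p \<notin> T2" using sub unfolding Y_def by auto
  have cl: "T1 \<subseteq> W closure_of T1" "T2 \<subseteq> W closure_of T2"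
    using sub openin_subset[OF Y_open] by (auto intro!: closure_of_subset)
  have "W closure_of T1 \<inter> T2 = {}" if "clopenY T1" "clopenY T2" "T1 \<inter> T2 = {}" for T1 T2
    using that openin_Int_closure_of_eq_empty[OF clopenY_open[OF that(2)], of T1] by auto
  then have c12: "W closure_of T1 \<inter> T2 = {}" "W closure_of T2 \<inter> T1 = {}" using T by auto
  have tp: "W closure_of T1 \<subseteq> topspace W" "W closure_of T2 \<subseteq> topspace W" by (auto simp: closure_of_subset_topspace)
  have e1: "K \<union> T1 = K \<union> W closure_of T1" using c12(1) T(5) cl(1) tp(1) top by blast
  have "closedin W (K \<union> W closure_of T1)" using K_closed by auto
  then have 1: "closedin W (K \<union> T1)" using e1 by simp
  have e2: "T2 \<union> {p} = W closure_of T2 \<union> {p}" using c12(2) T(6) cl(2) tp(2) top by blast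
  have "closedin W (W closure_of T2 \<union> {p})"
    using closedin_Hausdorff_sing_eq[OF Hausdorff] p(1) by (intro closedin_Un) auto
  then have "closedin W (T2 \<union> {p})" using e2 by simp
  moreover have "topspace W - (T2 \<union> {p}) = K \<union> T1" using top dj T(4) p_notin_K by auto
  ultimately have "openin W (K \<union> T1)" by (metis openin_diff openin_topspace)
  then show ?thesis using that[of "K \<union> T1"] 1 dj p_notin_K by auto
qed

lemma J_D:
  assumes "F \<in> J"
  shows "F \<subseteq> Y" "F \<noteq> {}" "p \<in> W closure_of F" "W closure_of F \<inter> K \<noteq> {}"
    "\<And>T. clopenY T \<Longrightarrow> x \<in> F \<Longrightarrow> y \<in> F \<Longrightarrow> x \<in> T \<Longrightarrow> y \<in> T"
proof -
  have F: "F \<in> quasi_components_of (subtopology W Y)" using assms unfolding J_def by auto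
  show "F \<subseteq> Y" using quasi_components_of_subset[OF F] topspace_Y by auto
  show "F \<noteq> {}" using nonempty_quasi_components_of[OF F] .
  show "p \<in> W closure_of F" "W closure_of F \<inter> K \<noteq> {}" using assms unfolding J_def by auto
  obtain z where "F = quasi_component_of_set (subtopology W Y) z" using F unfolding quasi_components_of_def by auto
  then show "\<And>T. clopenY T \<Longrightarrow> x \<in> F \<Longrightarrow> y \<in> F \<Longrightarrow> x \<in> T \<Longrightarrow> y \<in> T"
    unfolding clopenY_def by (auto simp: quasi_component_of_def)
qed

lemma J_separate:
  assumes "F \<in> J" "F' \<in> J" "F \<noteq> F'"
  obtains T where "clopenY T" "F \<subseteq> T" "F' \<inter> T = {}"
proof -
  have F: "F \<in> quasi_components_of (subtopology W Y)" "F' \<in> quasi_components_of (subtopology W Y)"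
    using assms unfolding J_def by auto
  have "disjnt F F'" using quasi_components_of_disjoint[OF F] assms(3) by auto
  obtain x where x: "x \<in> F'" using J_D(2)[OF assms(2)] by auto
  then have "x \<in> topspace (subtopology W Y) - F"
    using \<open>disjnt F F'\<close> J_D(1)[OF assms(2)] topspace_Y unfolding disjnt_def by auto
  then have "separated_between (subtopology W Y) F {x}"
    using separated_between_quasi_component_point[OF F(1)] by auto
  then obtain T where T: "clopenY T" "F \<subseteq> T" "x \<notin> T" unfolding separated_between clopenY_def by blast
  have "F' \<inter> T = {}" using J_D(5)[OF assms(2) T(1) _ x] T(3) by blast
  then show ?thesis using that T by auto
qed

lemma lc_on_J:
  assumes u: "near (subtopology W Y) (\<lambda>y z. u y = u z)" and F: "F \<in> J" "x \<in> F" "y \<in> F"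
  shows "u x = u y"
proof -
  have "clopenY {z \<in> topspace (subtopology W Y). u z \<in> {u x}}"
    unfolding clopenY_def using near_eq_clopen[OF u] by blast
  from J_D(5)[OF F(1) this F(2,3)] show ?thesis using F J_D(1)[OF F(1)] unfolding topspace_Y by auto
qed

lemma trivialized_lc:
  assumes "trivialized C \<alpha> \<beta>"
  shows "near (subtopology W Y) (\<lambda>y z. \<alpha> y - \<beta> y = \<alpha> z - \<beta> z)"
proof -
  have "near (subtopology W Y) (\<lambda>y z. C (y, z) = \<alpha> z - \<alpha> y)" "near (subtopology W Y) (\<lambda>y z. C (y, z) = \<beta> z - \<beta> y)"
    using assms unfolding trivialized_def Y_def by (auto elim!: near_subset)
  then show ?thesis by (rule near_potentials_diff)
qed

text \<open>Let \<open>\<eta>\<close> be a global potential. Then \<open>\<alpha> - \<eta>\<close>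
  is constant on the connected set \<open>K\<close> and has the same value on essential
  quasicomponents, whose closures meet \<open>K\<close>. As \<open>p\<close> is also in their
  closures, \<open>\<beta> - \<eta>\<close> has on them its value at \<open>p\<close>.\<close>

lemma trivialized_cobounds:
  assumes t: "trivialized C \<alpha> \<beta>" and cob: "cobounds W C"
  obtains c where "\<And>F x. F \<in> J \<Longrightarrow> x \<in> F \<Longrightarrow> \<alpha> x - \<beta> x = c"
proof -
  obtain \<eta> where \<eta>: "near W (\<lambda>y z. C (y, z) = \<eta> z - \<eta> y)" using cob unfolding cobounds_def by auto
  define a where "a x = \<alpha> x - \<eta> x" for x
  define b where "b x = \<beta> x - \<eta> x" for x
  have a: "near (subtopology W (topspace W - {p})) (\<lambda>y z. a y = a z)"
    unfolding a_def by (rule near_potentials_diff[OF _ near_subtopology[OF \<eta>]]) (use t in \<open>simp add: trivialized_def\<close>)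
  have b: "near (subtopology W (topspace W - K)) (\<lambda>y z. b y = b z)"
    unfolding b_def by (rule near_potentials_diff[OF _ near_subtopology[OF \<eta>]]) (use t in \<open>simp add: trivialized_def\<close>)
  have aY: "near (subtopology W Y) (\<lambda>y z. a y = a z)" and bY: "near (subtopology W Y) (\<lambda>y z. b y = b z)"
    using near_subset[OF a, of Y] near_subset[OF b, of Y] unfolding Y_def by auto
  obtain x0 where x0: "x0 \<in> K" using K_nonempty by auto
  have aK: "a x = a x0" if "x \<in> K" for x
    by (rule locally_constant_connected[OF near_subset[OF a] K_connected that x0])
      (use K_subset(2) p_notin_K in auto)
  have "a x = a x0" if F: "F \<in> J" "x \<in> F" for F x
  proof -
    obtain k where k: "k \<in> W closure_of F" "k \<in> K" using J_D(4)[OF F(1)] by auto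
    then have kp: "k \<in> topspace W - {p}" using K_subset(2) p_notin_K by auto
    obtain U where U: "openin W U" "k \<in> U" "U \<subseteq> topspace W - {p}" "\<And>y z. y \<in> U \<Longrightarrow> z \<in> U \<Longrightarrow> a y = a z"
      by (rule near_open_subtopologyE[OF a open_p kp]) (rule that)
    obtain y where y: "y \<in> F" "y \<in> U" using k(1) U(1,2) unfolding in_closure_of by blast
    show ?thesis using lc_on_J[OF aY F(1,2) y(1)] U(4)[OF y(2) U(2)] aK[OF k(2)] by simp
  qed
  moreover have "b x = b p" if F: "F \<in> J" "x \<in> F" for F x
  proof -
    have pK: "p \<in> topspace W - K" using p(1) p_notin_K by auto
    obtain U where U: "openin W U" "p \<in> U" "U \<subseteq> topspace W - K" "\<And>y z. y \<in> U \<Longrightarrow> z \<in> U \<Longrightarrow> b y = b z"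
      by (rule near_open_subtopologyE[OF b open_K pK]) (rule that)
    obtain y where y: "y \<in> F" "y \<in> U" using J_D(3)[OF F(1)] U(1,2) unfolding in_closure_of by blast
    show ?thesis using lc_on_J[OF bY F(1,2) y(1)] U(4)[OF y(2) U(2)] by simp
  qed
  ultimately have "\<alpha> x - \<beta> x = a x0 - b p" if "F \<in> J" "x \<in> F" for F x
  proof -
    have "\<alpha> x - \<beta> x = a x - b x" unfolding a_def b_def by simp
    then show ?thesis using \<open>\<And>F x. F \<in> J \<Longrightarrow> x \<in> F \<Longrightarrow> a x = a x0\<close>[OF that]
        \<open>\<And>F x. F \<in> J \<Longrightarrow> x \<in> F \<Longrightarrow> b x = b p\<close>[OF that] by simp
  qed
  then show ?thesis by (rule that)
qed

text \<open>The support of \<open>\<alpha> - \<beta> - c\<close> contains no essential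
  quasicomponent, so it splits into a part away from \<open>p\<close> and a part away from
  \<open>K\<close>. Correcting \<open>\<alpha>\<close> on the latter makes it match
  \<open>\<beta> + c\<close> near \<open>p\<close>.\<close>

lemma trivialized_constant:
  assumes t: "trivialized C \<alpha> \<beta>" and c: "\<And>F x. F \<in> J \<Longrightarrow> x \<in> F \<Longrightarrow> \<alpha> x - \<beta> x = c"
  shows "cobounds W C"
proof -
  define u where "u x = \<alpha> x - \<beta> x - c" for x
  have u: "near (subtopology W Y) (\<lambda>y z. u y = u z)"
    by (rule near_mono[OF trivialized_lc[OF t]]) (simp add: u_def)
  define T where "T = {x \<in> topspace (subtopology W Y). u x \<in> - {0}}"
  have T: "clopenY T" unfolding clopenY_def T_def using near_eq_clopen[OF u] by blast
  have ne: "\<not> F \<subseteq> T" if F: "F \<in> J" for F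
  proof -
    obtain x where "x \<in> F" using J_D(2)[OF F] by auto
    then show ?thesis using c[OF F] unfolding T_def u_def by auto
  qed
  obtain T1 T2 where T12: "clopenY T1" "clopenY T2" "T = T1 \<union> T2" "T1 \<inter> T2 = {}"
    "p \<notin> W closure_of T1" "W closure_of T2 \<inter> K = {}"
    by (rule inessential_split[OF T], erule ne) (rule that)
  \<comment> \<open>The summand of \<open>u\<close> supported in \<open>T2\<close> vanishes near \<open>K\<close>, the one supported in \<open>T1\<close> near \<open>p\<close>.\<close>
  define b where "b x = (if x \<in> T2 then u x else 0)" for x
  define \<eta> where "\<eta> x = (if x = p then \<beta> p + c else \<alpha> x - b x)" for x
  have uT: "u x = 0" if "x \<in> Y" "x \<notin> T" for x using that topspace_Y unfolding T_def by auto
  have sub: "T1 \<subseteq> Y" "T2 \<subseteq> Y" using T12 clopenY_subset by auto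
  have cl: "T2 \<subseteq> W closure_of T2" "T1 \<subseteq> W closure_of T1" using sub openin_subset[OF Y_open] by (auto intro!: closure_of_subset)
  have "near W (\<lambda>y z. C (y, z) = \<eta> z - \<eta> y)"
  proof (rule nearI)
    fix x assume xt: "x \<in> topspace W"
    consider "x = p" | "x \<in> K" | "x \<in> Y" using xt unfolding Y_def by auto
    then show "\<exists>U. openin W U \<and> x \<in> U \<and> (\<forall>y\<in>U. \<forall>z\<in>U. C (y, z) = \<eta> z - \<eta> y)"
    proof cases
      case 1
      have xp: "x \<in> topspace W - K" using xt 1 p_notin_K by auto
      obtain U where U: "openin W U" "x \<in> U" "U \<subseteq> topspace W - K" "\<And>y z. y \<in> U \<Longrightarrow> z \<in> U \<Longrightarrow> C (y, z) = \<beta> z - \<beta> y"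
        by (rule near_open_subtopologyE[of W "topspace W - K" "\<lambda>y z. C (y, z) = \<beta> z - \<beta> y" x])
          (use t open_K xp in \<open>auto simp: trivialized_def\<close>)
      let ?U = "U - W closure_of T1"
      have \<eta>U: "\<eta> y = \<beta> y + c" if y: "y \<in> ?U" for y
      proof (cases "y = p")
        case False
        have yY: "y \<in> Y" using y U(3) False unfolding Y_def by auto
        have "b y = u y" unfolding b_def using uT[OF yY] T12(3) y cl(2) by auto
        then show ?thesis unfolding \<eta>_def using False by (simp add: u_def)
      qed (simp add: \<eta>_def)
      have "openin W ?U" "x \<in> ?U" using U 1 T12(5) by (auto intro: openin_diff)
      moreover have "C (y, z) = \<eta> z - \<eta> y" if "y \<in> ?U" "z \<in> ?U" for y z
        using U(4)[of y z] \<eta>U[OF that(1)] \<eta>U[OF that(2)] that by simp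
      ultimately show ?thesis by blast
    next
      case 2
      have xp: "x \<in> topspace W - {p}" using xt 2 p_notin_K by auto
      obtain U where U: "openin W U" "x \<in> U" "U \<subseteq> topspace W - {p}" "\<And>y z. y \<in> U \<Longrightarrow> z \<in> U \<Longrightarrow> C (y, z) = \<alpha> z - \<alpha> y"
        by (rule near_open_subtopologyE[of W "topspace W - {p}" "\<lambda>y z. C (y, z) = \<alpha> z - \<alpha> y" x])
          (use t open_p xp in \<open>auto simp: trivialized_def\<close>)
      let ?U = "U - W closure_of T2"
      have "openin W ?U" "x \<in> ?U" using U 2 T12(6) by (auto intro: openin_diff)
      moreover have "\<eta> y = \<alpha> y" if "y \<in> ?U" for y using that U(3) cl(1) unfolding \<eta>_def b_def by auto
      then have "C (y, z) = \<eta> z - \<eta> y" if "y \<in> ?U" "z \<in> ?U" for y z using U(4)[of y z] that by simp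
      ultimately show ?thesis by blast
    next
      case 3
      have xp: "x \<in> topspace W - {p}" using 3 unfolding Y_def by auto
      obtain U where U: "openin W U" "x \<in> U" "U \<subseteq> topspace W - {p}" "\<And>y z. y \<in> U \<Longrightarrow> z \<in> U \<Longrightarrow> C (y, z) = \<alpha> z - \<alpha> y"
        by (rule near_open_subtopologyE[of W "topspace W - {p}" "\<lambda>y z. C (y, z) = \<alpha> z - \<alpha> y" x])
          (use t open_p xp in \<open>auto simp: trivialized_def\<close>)
      obtain U' where U': "openin W U'" "x \<in> U'" "U' \<subseteq> Y" "\<And>y z. y \<in> U' \<Longrightarrow> z \<in> U' \<Longrightarrow> u y = u z"
        by (rule near_open_subtopologyE[OF u Y_open 3]) (rule that)
      define S where "S = (if x \<in> T2 then T2 else Y - T2)"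
      have S: "openin W S" "x \<in> S"
        unfolding S_def using clopenY_open[OF T12(2)] clopenY_open[OF clopenY_ops(3)[OF clopenY_Y(1) T12(2)]] 3 by auto
      let ?U = "U \<inter> U' \<inter> S"
      have bU: "b y = b z" if "y \<in> ?U" "z \<in> ?U" for y z
      proof -
        have "y \<in> T2 \<longleftrightarrow> z \<in> T2" using that unfolding S_def by (auto split: if_splits)
        then show ?thesis unfolding b_def using U'(4)[of y z] that by auto
      qed
      have "C (y, z) = \<eta> z - \<eta> y" if "y \<in> ?U" "z \<in> ?U" for y z
      proof -
        have "y \<noteq> p" "z \<noteq> p" using that U(3) by auto
        then show ?thesis using U(4)[of y z] bU[OF that] that unfolding \<eta>_def by simp
      qed
      moreover have "openin W ?U" "x \<in> ?U" using U U' S by auto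
      ultimately show ?thesis by blast
    qed
  qed
  then show ?thesis unfolding cobounds_def by blast
qed

lemma trivialized_restrict: "trivialized C \<alpha> \<beta> \<Longrightarrow> cobounds (subtopology W K) C"
proof -
  assume "trivialized C \<alpha> \<beta>"
  then have "near (subtopology W (topspace W - {p})) (\<lambda>y z. C (y, z) = \<alpha> z - \<alpha> y)" unfolding trivialized_def by auto
  from near_subset[OF this, of K] show ?thesis using K_subset(2) p_notin_K unfolding cobounds_def by auto
qed

text \<open>The connecting map on an indicator: cutting \<open>u\<close> off to the neighbourhood
  \<open>B\<close> of \<open>p\<close> gives \<open>\<alpha>\<close>, and
  \<open>\<beta> = \<alpha> - u\<close> vanishes on \<open>B\<close>. The cocycle is the difference
  of \<open>\<alpha>\<close> away from \<open>p\<close> and zero near \<open>p\<close>.\<close>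

lemma trivialized_of_clopen:
  assumes T: "clopenY T"
  obtains C \<alpha> and \<beta> :: "'w \<Rightarrow> 'k::field" where "trivialized C \<alpha> \<beta>"
    "\<And>x. x \<in> Y \<Longrightarrow> \<alpha> x - \<beta> x = (if x \<in> T then 1 else 0)"
proof -
  define u :: "'w \<Rightarrow> 'k" where "u x = (if x \<in> T then 1 else 0)" for x
  have TY: "T \<subseteq> Y" by (rule clopenY_subset[OF T])
  have To: "openin W T" "openin W (Y - T)" using clopenY_open T clopenY_ops(3)[OF clopenY_Y(1) T] by auto
  define B where "B = topspace W - W closure_of Q"
  have KQ: "K \<subseteq> Q" using K_subset(1)[of 0] unfolding Qk_def by auto
  have QB: "Q \<inter> B = {}" unfolding B_def using closure_of_subset[OF openin_subset[OF Q_open]] by auto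
  have B: "openin W B" "p \<in> B" "B \<inter> K = {}" unfolding B_def using p(1) p_notin_closure_Q KQ QB by (auto simp: B_def)
  define \<alpha> where "\<alpha> x = (if x \<in> B then u x else 0)" for x
  define \<beta> where "\<beta> x = \<alpha> x - u x" for x
  define C where "C = (\<lambda>(x, y). if x \<in> B \<and> y \<in> B then 0 else \<alpha> y - \<alpha> x)"
  have uB: "u x = \<alpha> x" if "x \<in> B" for x using that unfolding \<alpha>_def by simp
  define \<U> where "\<U> = {Q, B, T, Y - T}"
  define s where "s U x = (if U = B then 0 else - \<alpha> x)" for U x
  have oc: "open_cover W \<U>"
  proof -
    have "topspace W \<subseteq> \<Union>\<U>" unfolding \<U>_def using KQ B(2) unfolding Y_def by auto
    moreover have "\<forall>U\<in>\<U>. openin W U" unfolding \<U>_def using Q_open B To by auto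
    ultimately show ?thesis unfolding open_cover_def using openin_subset by blast
  qed
  \<comment> \<open>The two prescriptions for \<open>C\<close> agree: within \<open>B\<close>, each
    other member of the cover sees only one value of \<open>\<alpha>\<close>.\<close>
  have \<alpha>U: "\<alpha> x = \<alpha> y" if "U \<in> \<U>" "U \<noteq> B" "x \<in> U \<inter> B" "y \<in> U \<inter> B" for U x y
    using that QB unfolding \<U>_def \<alpha>_def u_def by auto
  have "primitives \<U> s C"
  proof (rule primitivesI)
    fix U x y assume *: "U \<in> \<U>" "x \<in> U" "y \<in> U"
    show "C (x, y) = s U x - s U y"
      using * \<alpha>U[OF *(1), of x y] unfolding C_def s_def by auto
  next
    fix U V x y assume *: "U \<in> \<U>" "V \<in> \<U>" "x \<in> U" "x \<in> V" "y \<in> U" "y \<in> V"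
    show "s V x - s U x = s V y - s U y"
      using * \<alpha>U[OF *(1), of x y] \<alpha>U[OF *(2), of x y] unfolding s_def by auto
  qed
  then have "C \<in> asc W" using oc unfolding asc_def by auto
  moreover have "near (subtopology W (topspace W - {p})) (\<lambda>y z. C (y, z) = \<alpha> z - \<alpha> y)"
  proof (rule near_open_subtopologyI[OF open_p])
    fix x assume x: "x \<in> topspace W - {p}"
    consider "x \<in> K" | "x \<in> T" | "x \<in> Y - T" using x unfolding Y_def by auto
    then obtain U where U: "U \<in> {Q, T, Y - T}" "x \<in> U" using KQ by cases auto
    have "openin W U" "U \<subseteq> topspace W - {p}"
      using U(1) Q_open To TY p(3) openin_subset[OF Q_open] unfolding Y_def by auto
    moreover have "C (y, z) = \<alpha> z - \<alpha> y" if "y \<in> U" "z \<in> U" for y z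
      using U(1) that QB unfolding C_def \<alpha>_def u_def by auto
    ultimately show "\<exists>U. openin W U \<and> x \<in> U \<and> U \<subseteq> topspace W - {p} \<and> (\<forall>y\<in>U. \<forall>z\<in>U. C (y, z) = \<alpha> z - \<alpha> y)"
      using U(2) by blast
  qed
  moreover have "near (subtopology W (topspace W - K)) (\<lambda>y z. C (y, z) = \<beta> z - \<beta> y)"
  proof (rule near_open_subtopologyI[OF open_K])
    fix x assume x: "x \<in> topspace W - K"
    consider "x = p" | "x \<in> T" | "x \<in> Y - T" using x unfolding Y_def by auto
    then obtain U where U: "U \<in> {B, T, Y - T}" "x \<in> U" using B(2) by cases auto
    have "openin W U" "U \<subseteq> topspace W - K"
      using U(1) B To TY openin_subset[OF B(1)] unfolding Y_def by auto
    moreover have "C (y, z) = \<beta> z - \<beta> y" if "y \<in> U" "z \<in> U" for y z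
      using U(1) that uB[of y] uB[of z] unfolding C_def \<beta>_def by (auto simp: u_def \<alpha>_def)
    ultimately show "\<exists>U. openin W U \<and> x \<in> U \<and> U \<subseteq> topspace W - K \<and> (\<forall>y\<in>U. \<forall>z\<in>U. C (y, z) = \<beta> z - \<beta> y)"
      using U(2) by blast
  qed
  ultimately have "trivialized C \<alpha> \<beta>" unfolding trivialized_def by auto
  moreover have "\<alpha> x - \<beta> x = (if x \<in> T then 1 else 0)" for x unfolding \<beta>_def u_def by simp
  ultimately show ?thesis using that by blast
qed

lemma trivialized_add:
  assumes "trivialized C \<alpha> \<beta>" "trivialized C' \<alpha>' \<beta>'"
  shows "trivialized (\<lambda>w. C w + a * C' w) (\<lambda>x. \<alpha> x + a * \<alpha>' x) (\<lambda>x. \<beta> x + a * \<beta>' x)"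
  unfolding trivialized_def
proof (intro conjI)
  show "(\<lambda>w. C w + a * C' w) \<in> asc W"
    using assms unfolding trivialized_def by (intro asc_add asc_smult) auto
  show "near (subtopology W (topspace W - {p})) (\<lambda>y z. C (y, z) + a * C' (y, z) = \<alpha> z + a * \<alpha>' z - (\<alpha> y + a * \<alpha>' y))"
    by (rule near_mono[OF near_conj[of _ "\<lambda>y z. C (y, z) = \<alpha> z - \<alpha> y" "\<lambda>y z. C' (y, z) = \<alpha>' z - \<alpha>' y"]])
      (use assms in \<open>auto simp: trivialized_def right_diff_distrib\<close>)
  show "near (subtopology W (topspace W - K)) (\<lambda>y z. C (y, z) + a * C' (y, z) = \<beta> z + a * \<beta>' z - (\<beta> y + a * \<beta>' y))"
    by (rule near_mono[OF near_conj[of _ "\<lambda>y z. C (y, z) = \<beta> z - \<beta> y" "\<lambda>y z. C' (y, z) = \<beta>' z - \<beta>' y"]])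
      (use assms in \<open>auto simp: trivialized_def right_diff_distrib\<close>)
qed

lemma Y_invariant: "x \<in> Y \<Longrightarrow> g x \<in> Y" "x \<in> Y \<Longrightarrow> g' x \<in> Y"
proof -
  assume x: "x \<in> Y"
  then have xt: "x \<in> topspace W" "x \<notin> K" "x \<noteq> p" unfolding Y_def by auto
  show "g x \<in> Y" using xt g_in g_K(2)[of "g x"] g'g[OF xt(1)] gk_p(2)[of 1] unfolding Y_def by auto
  show "g' x \<in> Y" using xt g_in g_K(1)[of "g' x"] gg'[OF xt(1)] p(2) unfolding Y_def by auto
qed

lemma trivialized_g:
  assumes "trivialized C \<alpha> \<beta>"
  shows "trivialized (\<lambda>(x, y). C (g x, g y)) (\<lambda>x. \<alpha> (g x)) (\<lambda>x. \<beta> (g x))"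
  unfolding trivialized_def
proof (intro conjI)
  show "(\<lambda>(x, y). C (g x, g y)) \<in> asc W"
    using assms unfolding trivialized_def by (intro asc_continuous[OF _ g_cont]) auto
  have 1: "continuous_map (subtopology W A) (subtopology W A) g" if "\<And>x. x \<in> A \<Longrightarrow> x \<in> topspace W \<Longrightarrow> g x \<in> A" for A
    using that g_cont by (auto simp: continuous_map_in_subtopology continuous_map_from_subtopology)
  have "g x \<noteq> p" if "x \<in> topspace W - {p}" for x using that g'g[of x] gk_p(2)[of 1] by auto
  then have "continuous_map (subtopology W (topspace W - {p})) (subtopology W (topspace W - {p})) g"
    by (intro 1) (auto simp: g_in)
  from near_continuous[OF _ this, of "\<lambda>y z. C (y, z) = \<alpha> z - \<alpha> y"]
  show "near (subtopology W (topspace W - {p})) (\<lambda>y z. (\<lambda>(x, y). C (g x, g y)) (y, z) = \<alpha> (g z) - \<alpha> (g y))"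
    using assms unfolding trivialized_def by simp
  have "g x \<notin> K" if "x \<in> topspace W - K" for x using that g'g[of x] g_K(2)[of "g x"] by auto
  then have "continuous_map (subtopology W (topspace W - K)) (subtopology W (topspace W - K)) g"
    by (intro 1) (auto simp: g_in)
  from near_continuous[OF _ this, of "\<lambda>y z. C (y, z) = \<beta> z - \<beta> y"]
  show "near (subtopology W (topspace W - K)) (\<lambda>y z. (\<lambda>(x, y). C (g x, g y)) (y, z) = \<beta> (g z) - \<beta> (g y))"
    using assms unfolding trivialized_def by simp
qed

lemma image_J:
  assumes "F \<in> J" shows "g ` F \<in> J" "g' ` F \<in> J"
proof -
  \<comment> \<open>Stated for a homeomorphism together with its inverse, so that one argument
    covers \<open>g\<close> and \<open>g'\<close>.\<close>
  have *: "h ` F \<in> J" if h: "continuous_map W W h" "continuous_map W W h'" and hh: "\<And>x. x \<in> topspace W \<Longrightarrow> h (h' x) = x"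
      "\<And>x. x \<in> topspace W \<Longrightarrow> h' (h x) = x" and Yi: "\<And>x. x \<in> Y \<Longrightarrow> h x \<in> Y" "\<And>x. x \<in> Y \<Longrightarrow> h' x \<in> Y"
      and hK: "h p = p" "\<And>x. x \<in> K \<Longrightarrow> h x \<in> K" for h h'
  proof -
    have F: "F \<in> quasi_components_of (subtopology W Y)" using assms unfolding J_def by auto
    then obtain x where x: "x \<in> Y" "F = quasi_component_of_set (subtopology W Y) x"
      unfolding quasi_components_of_def topspace_Y by auto
    have cont: "continuous_map (subtopology W Y) (subtopology W Y) h" "continuous_map (subtopology W Y) (subtopology W Y) h'"
      using Yi h by (auto simp: continuous_map_in_subtopology continuous_map_from_subtopology)
    have tY: "y \<in> topspace W" if "y \<in> Y" for y using that openin_subset[OF Y_open] by auto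
    have qc: "quasi_component_of (subtopology W Y) (k y) (k z)"
      if "quasi_component_of (subtopology W Y) y z" "continuous_map (subtopology W Y) (subtopology W Y) k" for y z k
      unfolding quasi_component_of_def
    proof (intro conjI allI impI)
      have yz: "y \<in> Y" "z \<in> Y" using that(1) topspace_Y unfolding quasi_component_of_def by auto
      show "k y \<in> topspace (subtopology W Y)" "k z \<in> topspace (subtopology W Y)"
        using that(2) yz topspace_Y unfolding continuous_map_def by auto
      fix T assume T: "closedin (subtopology W Y) T \<and> openin (subtopology W Y) T"
      have "openin (subtopology W Y) {x \<in> topspace (subtopology W Y). k x \<in> T}"
        "closedin (subtopology W Y) {x \<in> topspace (subtopology W Y). k x \<in> T}"
        using openin_continuous_map_preimage[OF that(2)] closedin_continuous_map_preimage[OF that(2)] T by auto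
      then have "y \<in> {x \<in> topspace (subtopology W Y). k x \<in> T} \<longleftrightarrow> z \<in> {x \<in> topspace (subtopology W Y). k x \<in> T}"
        using that(1) unfolding quasi_component_of_def by blast
      then show "k y \<in> T \<longleftrightarrow> k z \<in> T" using yz topspace_Y by auto
    qed
    have "h ` F = quasi_component_of_set (subtopology W Y) (h x)"
    proof
      show "h ` F \<subseteq> quasi_component_of_set (subtopology W Y) (h x)" using x(2) qc[OF _ cont(1)] by auto
      show "quasi_component_of_set (subtopology W Y) (h x) \<subseteq> h ` F"
      proof
        fix y assume y: "y \<in> quasi_component_of_set (subtopology W Y) (h x)"
        then have "quasi_component_of (subtopology W Y) (h' (h x)) (h' y)" using qc[OF _ cont(2)] by auto
        then have "h' y \<in> F" using x hh(2)[OF tY[OF x(1)]] by auto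
        moreover have "y \<in> Y" using y topspace_Y unfolding quasi_component_of_def by auto
        ultimately show "y \<in> h ` F" using hh(1)[OF tY, of y] by (metis imageI)
      qed
    qed
    then have "h ` F \<in> quasi_components_of (subtopology W Y)"
      unfolding quasi_components_of_def topspace_Y using Yi(1)[OF x(1)] by auto
    moreover have cl: "h ` (W closure_of F) \<subseteq> W closure_of (h ` F)"
      using h(1) unfolding continuous_map_eq_image_closure_subset by blast
    have "p \<in> W closure_of (h ` F)" using cl J_D(3)[OF assms] hK(1) by (metis imageI subsetD)
    moreover obtain k where "k \<in> W closure_of F" "k \<in> K" using J_D(4)[OF assms] by auto
    then have "h k \<in> W closure_of (h ` F) \<inter> K" using cl hK(2) by auto
    ultimately show ?thesis unfolding J_def by auto
  qed
  show "g ` F \<in> J" by (rule *[OF g_cont g'_cont gg' g'g Y_invariant p(2) g_K(1)])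
  show "g' ` F \<in> J" by (rule *[OF g'_cont g_cont g'g gg' Y_invariant(2,1) gk_p(2)[of 1, simplified] g_K(2)])
qed

end

section \<open>The kernel of the restriction to \<open>K\<close> and its trace\<close>

lemma delta_card_le:
  fixes V :: "('k::field, 'v) module"
  assumes V: "fin_dim_vs V" and I: "finite I" and b: "\<And>i. i \<in> I \<Longrightarrow> b i \<in> carrier V"
    and e: "\<And>i. i \<in> I \<Longrightarrow> functional V (e i)"
    and d: "\<And>i j. i \<in> I \<Longrightarrow> j \<in> I \<Longrightarrow> e i (b j) = (if i = j then 1 else 0)"
  shows "card I \<le> vectorspace.dim class_ring V"
proof -
  have vs: "is_vs V" and fd: "vectorspace.fin_dim class_ring V" using V fin_dim_vs_iff by auto
  interpret V: vectorspace "class_ring :: 'k ring" V by fact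
  have inj: "inj_on b I" using d by (metis inj_onI one_neq_zero)
  have bV: "b ` I \<subseteq> carrier V" using b by auto
  have "V.lin_indpt (b ` I)"
  proof (rule V.finite_lin_indpt2[OF finite_imageI[OF I] bV])
    fix a assume a: "V.lincomb a (b ` I) = \<zero>\<^bsub>V\<^esub>"
    show "\<forall>v\<in>b ` I. a v = \<zero>\<^bsub>class_ring\<^esub>"
    proof safe
      fix i assume i: "i \<in> I"
      have "0 = e i (V.lincomb a (b ` I))" using functional_zero[OF vs e[OF i]] a by simp
      also have "\<dots> = (\<Sum>w\<in>b ` I. a w * e i w)" by (rule functional_lincomb[OF vs finite_imageI[OF I] bV e[OF i]])
      also have "\<dots> = (\<Sum>j\<in>I. a (b j) * e i (b j))" by (rule sum.reindex_cong[OF inj]) auto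
      also have "\<dots> = (\<Sum>j\<in>I. a (b j) * (if i = j then 1 else 0))" by (rule sum.cong) (use d i in auto)
      also have "\<dots> = a (b i)" using I i by (simp add: if_distrib cong: if_cong)
      finally show "a (b i) = \<zero>\<^bsub>class_ring\<^esub>" by simp
    qed
  qed
  then show ?thesis using V.li_le_dim(2)[OF fd bV] card_image[OF inj] by simp
qed

lemma finsum_as_class:
  fixes C :: "'i \<Rightarrow> 'x \<times> 'x \<Rightarrow> 'k::field"
  assumes A: "pointlike A" and U: "is_sub (cech_cohomology X A 1) U" and I: "finite I"
    and C: "\<And>i. i \<in> I \<Longrightarrow> C i \<in> asc X" "\<And>i. i \<in> I \<Longrightarrow> as_class X A (C i) \<in> U"
  defines "V \<equiv> (cech_cohomology X A 1 :: ('k, ('x, 'k) cech) module)\<lparr>carrier := U\<rparr>"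
  shows "finsum V (\<lambda>i. a i \<odot>\<^bsub>V\<^esub> as_class X A (C i)) I = as_class X A (\<lambda>w. \<Sum>i\<in>I. a i * C i w)"
proof -
  interpret V: vectorspace "class_ring :: 'k ring" V unfolding V_def by (rule is_sub_vs[OF vs_cech_1[OF A] U])
  show ?thesis using I C
  proof (induction I)
    case empty
    have "finsum V (\<lambda>i. a i \<odot>\<^bsub>V\<^esub> as_class X A (C i)) {} = \<zero>\<^bsub>V\<^esub>" by (rule V.M.finsum_empty)
    also have "\<dots> = as_class X A (\<lambda>_. 0)" unfolding V_def using zero_cech_1[OF A] by simp
    finally show ?case by simp
  next
    case (insert i I)
    have c: "a j \<odot>\<^bsub>V\<^esub> as_class X A (C j) \<in> carrier V" if "j \<in> insert i I" for j
      using insert.prems(2)[OF that] by (intro V.smult_closed) (auto simp: V_def)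
    have "finsum V (\<lambda>i. a i \<odot>\<^bsub>V\<^esub> as_class X A (C i)) (insert i I) =
        a i \<odot>\<^bsub>V\<^esub> as_class X A (C i) \<oplus>\<^bsub>V\<^esub> finsum V (\<lambda>i. a i \<odot>\<^bsub>V\<^esub> as_class X A (C i)) I"
      by (rule V.M.finsum_insert) (use insert c in auto)
    also have "finsum V (\<lambda>i. a i \<odot>\<^bsub>V\<^esub> as_class X A (C i)) I = as_class X A (\<lambda>w. \<Sum>i\<in>I. a i * C i w)"
      by (rule insert.IH) (use insert.prems in auto)
    also have "a i \<odot>\<^bsub>V\<^esub> as_class X A (C i) = as_class X A (\<lambda>w. a i * C i w)"
      using smult_cech_1[OF A insert.prems(1)[of i]] by (simp add: V_def)
    also have "as_class X A (\<lambda>w. a i * C i w) \<oplus>\<^bsub>V\<^esub> as_class X A (\<lambda>w. \<Sum>i\<in>I. a i * C i w) =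
        as_class X A (\<lambda>w. a i * C i w + (\<Sum>i\<in>I. a i * C i w))"
    proof -
      have "(\<lambda>w. \<Sum>i\<in>I. a i * C i w) \<in> asc X" by (rule asc_sum) (use insert.prems in \<open>auto intro: asc_smult\<close>)
      from add_cech_1[OF A asc_smult[OF insert.prems(1)[of i]] this] show ?thesis by (simp add: V_def)
    qed
    finally show ?case using insert.hyps by simp
  qed
qed

lemma cech_map_funpow:
  assumes g: "continuous_map X X g" "g ` A \<subseteq> A" and A: "pointlike A" and C: "C \<in> asc X"
  shows "(cech_map X A 1 g ^^ n) (as_class X A C) = as_class X A (\<lambda>(x, y). C ((g ^^ n) x, (g ^^ n) y))"
    and "(\<lambda>(x, y). C ((g ^^ n) x, (g ^^ n) y)) \<in> asc X"
proof -
  have "(cech_map X A 1 g ^^ n) (as_class X A C) = as_class X A (\<lambda>(x, y). C ((g ^^ n) x, (g ^^ n) y)) \<and>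
    (\<lambda>(x, y). C ((g ^^ n) x, (g ^^ n) y)) \<in> asc X"
  proof (induction n)
    case 0 then show ?case using C by simp
  next
    case (Suc n)
    let ?C = "\<lambda>(x, y). C ((g ^^ n) x, (g ^^ n) y)"
    have "cech_map X A 1 g (as_class X A ?C) = as_class X A (\<lambda>(x, y). ?C (g x, g y))"
      by (rule cech_map_as_class[OF g A A]) (use Suc in auto)
    moreover have "(\<lambda>(x, y). ?C (g x, g y)) \<in> asc X" by (rule asc_continuous[OF _ g(1)]) (use Suc in auto)
    ultimately show ?case using Suc by (simp add: funpow_swap1)
  qed
  then show "(cech_map X A 1 g ^^ n) (as_class X A C) = as_class X A (\<lambda>(x, y). C ((g ^^ n) x, (g ^^ n) y))"
    "(\<lambda>(x, y). C ((g ^^ n) x, (g ^^ n) y)) \<in> asc X" by auto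
qed

context attractor_repeller
begin

definition ker_restrict :: "('w, 'k::field) cech set" where
  "ker_restrict = {v \<in> carrier (cech_cohomology W {} 1).
     cech_map (subtopology W K) {} 1 id v = \<zero>\<^bsub>cech_cohomology (subtopology W K) {} 1 :: ('k, ('w, 'k) cech) module\<^esub>}"

lemma restrict_as_class:
  assumes "C \<in> asc W"
  shows "cech_map (subtopology W K) {} 1 id (as_class W {} C) = as_class (subtopology W K) {} C"
    "C \<in> asc (subtopology W K)"
proof -
  have c: "continuous_map (subtopology W K) W id" by (simp add: continuous_map_from_subtopology)
  show "cech_map (subtopology W K) {} 1 id (as_class W {} C) = as_class (subtopology W K) {} C"
    using cech_map_as_class[OF c _ _ _ assms, of "{}" "{}"] by simp
  show "C \<in> asc (subtopology W K)" using asc_continuous[OF assms c] by simp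
qed

lemma ker_restrict_iff:
  assumes "C \<in> asc W" shows "as_class W {} C \<in> ker_restrict \<longleftrightarrow> cobounds (subtopology W K) C"
proof -
  have "as_class W {} C \<in> carrier (cech_cohomology W {} 1)"
    using assms unfolding carrier_cech_1[OF pointlike_simps(1)] by auto
  then have "as_class W {} C \<in> ker_restrict \<longleftrightarrow>
      as_class (subtopology W K) {} C = as_class (subtopology W K) {} (\<lambda>_. 0)"
    unfolding ker_restrict_def zero_cech_1[OF pointlike_simps(1)] restrict_as_class(1)[OF assms, symmetric]
    by (simp del: One_nat_def)
  also have "\<dots> \<longleftrightarrow> cobounds (subtopology W K) C"
    using as_class_eq_iff[OF restrict_as_class(2)[OF assms] asc_0 pointlike_simps(1)] by simp
  finally show ?thesis .
qed

lemma restrict_lin_map: "lin_map (cech_cohomology W {} 1 :: ('k::field, ('w, 'k) cech) module)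
    (cech_cohomology (subtopology W K) {} 1) (cech_map (subtopology W K) {} 1 id)"
  by (rule cech_map_lin_map) (simp_all add: continuous_map_from_subtopology)

lemma ker_restrict_sub: "is_sub (cech_cohomology W {} 1 :: ('k::field, ('w, 'k) cech) module) ker_restrict"
  unfolding ker_restrict_def by (rule is_sub_ker[OF vs_cech_1 vs_cech_1 restrict_lin_map]) auto

lemma ker_restrict_invariant:
  fixes v :: "('w, 'k::field) cech"
  assumes "v \<in> ker_restrict" and h: "continuous_map W W h" "\<And>x. x \<in> K \<Longrightarrow> h x \<in> K"
  shows "cech_map W {} 1 h v \<in> ker_restrict"
proof -
  obtain C where C: "C \<in> asc W" "v = as_class W {} C"
    using assms(1) unfolding ker_restrict_def carrier_cech_1[OF pointlike_simps(1)] by auto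
  have "cobounds (subtopology W K) C" using assms(1) ker_restrict_iff[OF C(1)] C(2) by simp
  moreover have "continuous_map (subtopology W K) (subtopology W K) h"
    using h by (auto simp: continuous_map_in_subtopology continuous_map_from_subtopology)
  ultimately have "cobounds (subtopology W K) (\<lambda>(x, y). C (h x, h y))" by (rule cobounds_continuous)
  then show ?thesis unfolding C(2)
    using cech_map_as_class[OF h(1) _ _ _ C(1), of "{}" "{}"] ker_restrict_iff[OF asc_continuous[OF C(1) h(1)]] by simp
qed

text \<open>The kernel is finite dimensional and invariant under the maps induced by
  \<open>g\<close> and \<open>g'\<close>, so a basis supplies the two matrices for
  \<open>kernel_trivialized\<close>. A general element is a combination of the basis cocycles, and
  the same combination of potentials trivializes it.\<close>

lemma ker_restrict_trivialized:
  fixes v :: "('w, 'k::field) cech"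
  assumes fd: "fin_dim_vs (cech_cohomology W {} 1 :: ('k, ('w, 'k) cech) module)" and v: "v \<in> ker_restrict"
  obtains C :: "'w \<times> 'w \<Rightarrow> 'k" and \<alpha> \<beta> where "trivialized C \<alpha> \<beta>" "v = as_class W {} C"
proof -
  let ?H = "cech_cohomology W {} 1 :: ('k, ('w, 'k) cech) module"
  let ?V = "?H\<lparr>carrier := ker_restrict\<rparr>"
  have fV: "fin_dim_vs ?V" by (rule fin_dim_sub[OF fd ker_restrict_sub])
  then have V: "is_vs ?V" unfolding fin_dim_vs_def by auto
  obtain B e where d: "dual_system ?V B (\<lambda>b. b) e" using fV unfolding fin_dim_vs_def by auto
  have B: "finite B" by (rule dual_system_finite[OF d])
  have BV: "b \<in> ker_restrict" if "b \<in> B" for b using dual_system_carrier[OF d that] by simp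
  have "\<exists>C. C \<in> asc W \<and> b = as_class W {} C" if "b \<in> B" for b
    using BV[OF that] unfolding ker_restrict_def carrier_cech_1[OF pointlike_simps(1)] by auto
  then obtain C where C: "\<And>b. b \<in> B \<Longrightarrow> C b \<in> asc W" "\<And>b. b \<in> B \<Longrightarrow> as_class W {} (C b) = b" by metis
  have expand: "w = as_class W {} (\<lambda>x. \<Sum>b\<in>B. e b w * C b x)" if w: "w \<in> ker_restrict" for w
  proof -
    interpret V: vectorspace "class_ring :: 'k ring" ?V by fact
    have "w = finsum ?V (\<lambda>b. e b w \<odot>\<^bsub>?V\<^esub> b) B" using dual_system_expand(1)[OF V d] w by simp
    also have "\<dots> = finsum ?V (\<lambda>b. e b w \<odot>\<^bsub>?V\<^esub> as_class W {} (C b)) B"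
    proof (rule V.M.finsum_cong')
      show "(\<lambda>b. e b w \<odot>\<^bsub>?V\<^esub> as_class W {} (C b)) \<in> B \<rightarrow> carrier ?V"
      proof
        fix b assume b: "b \<in> B"
        have "e b w \<odot>\<^bsub>?V\<^esub> b \<in> carrier ?V" by (rule V.smult_closed) (use BV[OF b] in auto)
        then show "e b w \<odot>\<^bsub>?V\<^esub> as_class W {} (C b) \<in> carrier ?V" using C(2)[OF b] by simp
      qed
    qed (use C(2) in auto)
    also have "\<dots> = as_class W {} (\<lambda>x. \<Sum>b\<in>B. e b w * C b x)"
      by (rule finsum_as_class[OF pointlike_simps(1) ker_restrict_sub B C(1)]) (use C(2) BV in auto)
    finally show ?thesis .
  qed
  have act: "cobounds W (\<lambda>(y, z). C b (h y, h z) - (\<Sum>j\<in>B. e j (cech_map W {} 1 h b) * C j (y, z)))"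
    if b: "b \<in> B" and h: "continuous_map W W h" "\<And>x. x \<in> K \<Longrightarrow> h x \<in> K" for b h
  proof -
    have 1: "cech_map W {} 1 h b = as_class W {} (\<lambda>(x, y). C b (h x, h y))"
      using cech_map_as_class[OF h(1) _ _ _ C(1)[OF b], of "{}" "{}"] C(2)[OF b] by simp
    have 2: "cech_map W {} 1 h b = as_class W {} (\<lambda>x. \<Sum>j\<in>B. e j (cech_map W {} 1 h b) * C j x)"
      by (rule expand[OF ker_restrict_invariant[OF BV[OF b] h]])
    have 3: "(\<lambda>x. \<Sum>j\<in>B. e j (cech_map W {} 1 h b) * C j x) \<in> asc W"
      by (rule asc_sum) (use C(1) in \<open>auto intro: asc_smult\<close>)
    have "cobounds W (\<lambda>w. (\<lambda>(x, y). C b (h x, h y)) w - (\<Sum>j\<in>B. e j (cech_map W {} 1 h b) * C j w))"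
      by (rule iffD1[OF as_class_eq_iff[OF asc_continuous[OF C(1)[OF b] h(1)] 3 pointlike_simps(1)]])
        (rule trans[OF 1[symmetric] 2])
    then show ?thesis by (simp add: case_prod_unfold)
  qed
  have "\<exists>\<alpha> \<beta>. trivialized (C b) \<alpha> \<beta>" if b: "b \<in> B" for b
  proof -
    obtain \<alpha> \<beta> where "trivialized (C b) \<alpha> \<beta>"
    proof (rule kernel_trivialized[OF B C(1) act[OF _ g_cont g_K(1)] act[OF _ g'_cont g_K(2)] _ b])
      show "cobounds (subtopology W K) (C i)" if "i \<in> B" for i
        using ker_restrict_iff[OF C(1)[OF that]] C(2)[OF that] BV[OF that] by simp
    qed (use that in auto)
    then show ?thesis by blast
  qed
  then obtain \<alpha> \<beta> where ab: "\<And>b. b \<in> B \<Longrightarrow> trivialized (C b) (\<alpha> b) (\<beta> b)" by metis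
  have "trivialized (\<lambda>x. \<Sum>b\<in>B. c b * C b x) (\<lambda>x. \<Sum>b\<in>B. c b * \<alpha> b x) (\<lambda>x. \<Sum>b\<in>B. c b * \<beta> b x)" for c
    using B ab
  proof (induction B rule: finite_induct)
    case empty
    then show ?case unfolding trivialized_def by (auto simp: asc_0 intro!: nearI)
  next
    case (insert b B)
    have "trivialized (\<lambda>x. (\<Sum>b\<in>B. c b * C b x) + c b * C b x) (\<lambda>x. (\<Sum>b\<in>B. c b * \<alpha> b x) + c b * \<alpha> b x)
        (\<lambda>x. (\<Sum>b\<in>B. c b * \<beta> b x) + c b * \<beta> b x)"
      by (rule trivialized_add) (use insert in auto)
    then show ?case using insert.hyps by (simp add: add.commute)
  qed
  from that[OF this expand[OF v]] show ?thesis .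
qed

text \<open>The coordinates of a kernel class are its jumps \<open>\<alpha> - \<beta>\<close> on the
  members of \<open>J\<close>, measured against a reference \<open>F0\<close> to remove a common
  constant. Classes with jump 1 on one member and 0 on the others form the dual basis, and pullback
  along \<open>g\<close> permutes the jumps.\<close>

theorem kernel_trace:
  fixes HW :: "('k::field, ('w, 'k) cech) module"
  defines "HW \<equiv> cech_cohomology W {} 1"
  assumes fd: "fin_dim_vs HW"
  shows "finite J"
    and "J \<noteq> {} \<Longrightarrow> linear_trace (HW\<lparr>carrier := ker_restrict\<rparr>) (cech_map W {} 1 g ^^ n) =
      of_nat (card {F \<in> J. (g ^^ n) ` F = F}) - 1"
proof -
  let ?V = "HW\<lparr>carrier := ker_restrict\<rparr>"
  have sub: "is_sub HW ker_restrict" unfolding HW_def by (rule ker_restrict_sub)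
  have fV: "fin_dim_vs ?V" by (rule fin_dim_sub[OF fd sub])
  then have V: "is_vs ?V" unfolding fin_dim_vs_def by auto
  have "\<exists>C \<alpha> \<beta>. trivialized C \<alpha> \<beta> \<and> v = as_class W {} C" if "v \<in> ker_restrict" for v :: "('w, 'k) cech"
    using ker_restrict_trivialized[OF fd[unfolded HW_def] that] by metis
  then obtain cc ca cb where ch: "\<And>v :: ('w, 'k) cech. v \<in> ker_restrict \<Longrightarrow> trivialized (cc v) (ca v) (cb v) \<and> v = as_class W {} (cc v)"
    by metis
  define pt where "pt F = (SOME x. x \<in> F)" for F :: "'w set"
  have pt: "pt F \<in> F" if "F \<in> J" for F
    using J_D(2)[OF that] unfolding pt_def by (metis all_not_in_conv someI_ex)
  \<comment> \<open>\<open>ca\<close> and \<open>cb\<close> come from an arbitrary choice of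
    potentials for each class; the fact \<open>e\<close> below shows that any other choice gives the
    same value.\<close>
  define e where "e F0 F v = ca v (pt F) - cb v (pt F) - (ca v (pt F0) - cb v (pt F0))" for F0 F and v :: "('w, 'k) cech"
  have tC: "C \<in> asc W" if "trivialized C \<alpha> \<beta>" for C \<alpha> and \<beta> :: "'w \<Rightarrow> 'k" using that unfolding trivialized_def by auto
  have mem: "as_class W {} C \<in> ker_restrict" if "trivialized C \<alpha> \<beta>" for C \<alpha> and \<beta> :: "'w \<Rightarrow> 'k"
    using ker_restrict_iff[OF tC[OF that]] trivialized_restrict[OF that] by simp
  have e: "e F0 F (as_class W {} C) = \<alpha> (pt F) - \<beta> (pt F) - (\<alpha> (pt F0) - \<beta> (pt F0))"
    if F: "F0 \<in> J" "F \<in> J" and t: "trivialized C \<alpha> \<beta>" for F0 F C \<alpha> \<beta>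
  proof -
    let ?v = "as_class W {} C"
    have ch': "trivialized (cc ?v) (ca ?v) (cb ?v)" "?v = as_class W {} (cc ?v)" using ch[OF mem[OF t]] by auto
    have "cobounds W (\<lambda>w. C w - cc ?v w)" using as_class_eq_iff[OF tC[OF t] tC[OF ch'(1)] pointlike_simps(1)] ch'(2) by simp
    moreover have "trivialized (\<lambda>w. C w + (-1) * cc ?v w) (\<lambda>x. \<alpha> x + (-1) * ca ?v x) (\<lambda>x. \<beta> x + (-1) * cb ?v x)"
      by (rule trivialized_add[OF t ch'(1)])
    ultimately obtain c where "\<And>F x. F \<in> J \<Longrightarrow> x \<in> F \<Longrightarrow> \<alpha> x + (-1) * ca ?v x - (\<beta> x + (-1) * cb ?v x) = c"
      by (elim trivialized_cobounds) simp_all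
    from this[OF F(1) pt[OF F(1)]] this[OF F(2) pt[OF F(2)]]
    have "\<alpha> (pt F) - ca ?v (pt F) - (\<beta> (pt F) - cb ?v (pt F)) = \<alpha> (pt F0) - ca ?v (pt F0) - (\<beta> (pt F0) - cb ?v (pt F0))" by simp
    then show ?thesis unfolding e_def by (simp add: algebra_simps)
  qed
  have ef: "functional ?V (e F0 F)" if F: "F0 \<in> J" "F \<in> J" for F0 F
    unfolding functional_def
  proof (intro conjI ballI allI)
    fix v w assume "v \<in> carrier ?V" "w \<in> carrier ?V"
    then have vw: "v \<in> ker_restrict" "w \<in> ker_restrict" by auto
    note v = ch[OF vw(1)] and w = ch[OF vw(2)]
    have "v \<oplus>\<^bsub>HW\<^esub> w = as_class W {} (\<lambda>x. cc v x + 1 * cc w x)"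
      using add_cech_1[OF pointlike_simps(1) tC[OF conjunct1[OF v]] tC[OF conjunct1[OF w]]] v w unfolding HW_def by simp
    then show "e F0 F (v \<oplus>\<^bsub>?V\<^esub> w) = e F0 F v + e F0 F w"
      using e[OF F trivialized_add[OF conjunct1[OF v] conjunct1[OF w], of 1]] by (simp add: e_def)
    have z: "trivialized (\<lambda>_. 0) (\<lambda>_. 0) (\<lambda>_. 0 :: 'k)" unfolding trivialized_def by (auto simp: asc_0 intro!: nearI)
    have "a \<odot>\<^bsub>HW\<^esub> v = as_class W {} (\<lambda>x. 0 + a * cc v x)" for a
      using smult_cech_1[OF pointlike_simps(1) tC[OF conjunct1[OF v]], of a] v unfolding HW_def by simp
    then show "e F0 F (a \<odot>\<^bsub>?V\<^esub> v) = a * e F0 F v" for a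
      using e[OF F trivialized_add[OF z conjunct1[OF v], of a]] by (simp add: e_def right_diff_distrib)
  qed
  have ez: "v = \<zero>\<^bsub>?V\<^esub>" if v: "v \<in> ker_restrict" and F0: "F0 \<in> J" and 0: "\<And>F. F \<in> J \<Longrightarrow> e F0 F v = 0" for v F0
  proof -
    note t = conjunct1[OF ch[OF v]]
    have "ca v x - cb v x = ca v (pt F0) - cb v (pt F0)" if "F \<in> J" "x \<in> F" for F x
      using lc_on_J[OF trivialized_lc[OF t] that pt[OF that(1)]] 0[OF that(1)] unfolding e_def by simp
    then have "cobounds W (cc v)" by (rule trivialized_constant[OF t])
    then have "as_class W {} (cc v) = as_class W {} (\<lambda>_. 0)"
      using as_class_eq_iff[OF tC[OF t] asc_0 pointlike_simps(1)] by simp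
    then show ?thesis using conjunct2[OF ch[OF v]] zero_cech_1[OF pointlike_simps(1), of W, where 'b = 'k]
      unfolding HW_def by (simp del: One_nat_def)
  qed
  have sep: "\<exists>T. clopenY T \<and> F \<subseteq> T \<and> (\<forall>F'\<in>J0 - {F}. F' \<inter> T = {})" if J0: "finite J0" "J0 \<subseteq> J" "F \<in> J" for J0 F
  proof -
    have "\<exists>T. clopenY T \<and> F \<subseteq> T \<and> F' \<inter> T = {}" if "F' \<in> J0 - {F}" for F'
      using J_separate[of F F'] that J0 by (metis DiffE singletonI subsetD)
    then obtain T where T: "\<And>F'. F' \<in> J0 - {F} \<Longrightarrow> clopenY (T F') \<and> F \<subseteq> T F' \<and> F' \<inter> T F' = {}" by metis
    have "clopenY (Y - T F')" if "F' \<in> J0 - {F}" for F' by (rule clopenY_ops(3)[OF clopenY_Y(1)]) (use T[OF that] in auto)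
    then have "clopenY (Y - \<Union>((\<lambda>F'. Y - T F') ` (J0 - {F})))"
      by (intro clopenY_ops(3) clopenY_Y clopenY_Union) (use J0 in auto)
    moreover have "F \<subseteq> Y - \<Union>((\<lambda>F'. Y - T F') ` (J0 - {F}))" using T J_D(1)[OF J0(3)] by auto
    moreover have "F' \<inter> (Y - \<Union>((\<lambda>F'. Y - T F') ` (J0 - {F}))) = {}" if "F' \<in> J0 - {F}" for F' using T[OF that] that by auto
    ultimately show ?thesis by blast
  qed
  \<comment> \<open>Jumps are prescribed on a subfamily \<open>J0\<close> that will be finite: one
    clopen set can separate finitely many quasicomponents, and \<open>J\<close> is not known to be
    finite at this stage.\<close>
  define good where "good J0 F w \<longleftrightarrow> (\<exists>C \<alpha> \<beta> T. trivialized C \<alpha> \<beta> \<and> w = as_class W {} C \<and> clopenY T \<and> F \<subseteq> T \<and>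
      (\<forall>F'\<in>J0 - {F}. F' \<inter> T = {}) \<and> (\<forall>x\<in>Y. \<alpha> x - \<beta> x = (if x \<in> T then 1 else 0 :: 'k)))" for J0 F and w :: "('w, 'k) cech"
  have good_ex: "\<exists>w. good J0 F w" if J0: "finite J0" "J0 \<subseteq> J" "F \<in> J" for J0 F
  proof -
    obtain T where T: "clopenY T" "F \<subseteq> T" "\<forall>F'\<in>J0 - {F}. F' \<inter> T = {}" using sep[OF J0] by auto
    obtain C \<alpha> and \<beta> :: "'w \<Rightarrow> 'k" where "trivialized C \<alpha> \<beta>" "\<And>x. x \<in> Y \<Longrightarrow> \<alpha> x - \<beta> x = (if x \<in> T then 1 else 0)"
      using trivialized_of_clopen[OF T(1)] by metis
    then show ?thesis unfolding good_def using T by blast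
  qed
  have good_e: "w \<in> ker_restrict \<and> e F0 F' ((cech_map W {} 1 g ^^ m) w) =
      (if (g ^^ m) ` F' = F then 1 else 0) - (if (g ^^ m) ` F0 = F then 1 else 0)"
    if J0: "J0 \<subseteq> J" "F \<in> J0" "F' \<in> J" "F0 \<in> J" "(g ^^ m) ` F' \<in> J0" "(g ^^ m) ` F0 \<in> J0" and w: "good J0 F w" for J0 F F' F0 w m
  proof -
    obtain C \<alpha> \<beta> T where t: "trivialized C \<alpha> \<beta>" "w = as_class W {} C" and T: "F \<subseteq> T" "\<forall>F'\<in>J0 - {F}. F' \<inter> T = {}"
      and ab: "\<forall>x\<in>Y. \<alpha> x - \<beta> x = (if x \<in> T then 1 else 0)"
      using w unfolding good_def by (elim exE conjE) (rule that)
    have tm: "trivialized (\<lambda>(x, y). C ((g ^^ m) x, (g ^^ m) y)) (\<lambda>x. \<alpha> ((g ^^ m) x)) (\<lambda>x. \<beta> ((g ^^ m) x))"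
    proof (induction m)
      case 0 then show ?case using t by simp
    next
      case (Suc m) from trivialized_g[OF Suc] show ?case by (simp add: funpow_swap1)
    qed
    have wm: "(cech_map W {} 1 g ^^ m) w = as_class W {} (\<lambda>(x, y). C ((g ^^ m) x, (g ^^ m) y))"
      unfolding t(2) by (rule cech_map_funpow(1)[OF g_cont _ _ tC[OF t(1)]]) auto
    have val: "\<alpha> ((g ^^ m) (pt G)) - \<beta> ((g ^^ m) (pt G)) = (if (g ^^ m) ` G = F then 1 else 0)"
      if G: "G \<in> J" "(g ^^ m) ` G \<in> J0" for G
    proof -
      have x: "(g ^^ m) (pt G) \<in> (g ^^ m) ` G" using pt[OF G(1)] by auto
      have "(g ^^ m) (pt G) \<in> Y" using x J_D(1)[of "(g ^^ m) ` G"] G(2) J0(1) by auto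
      moreover have "(g ^^ m) (pt G) \<in> T \<longleftrightarrow> (g ^^ m) ` G = F"
      proof (cases "(g ^^ m) ` G = F")
        case True then show ?thesis using x T(1) by auto
      next
        case False
        then have "(g ^^ m) ` G \<inter> T = {}" using T(2) G(2) by auto
        then show ?thesis using x False by auto
      qed
      ultimately show ?thesis using ab by auto
    qed
    show ?thesis unfolding wm e[OF J0(4,3) tm] val[OF J0(3,5)] val[OF J0(4,6)] using mem[OF t(1)] t(2) by simp
  qed
  show finJ: "finite J"
  proof (rule ccontr)
    \<comment> \<open>Too many quasicomponents besides \<open>F0\<close> would yield more
      independent classes than the dimension allows.\<close>
    assume inf: "infinite J"
    then obtain F0 where F0: "F0 \<in> J" by (metis finite.emptyI ex_in_conv)
    have "infinite (J - {F0})" using inf by simp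
    then obtain I where I: "finite I" "card I = Suc (vectorspace.dim class_ring ?V)" "I \<subseteq> J - {F0}"
      using infinite_arbitrarily_large by blast
    let ?J0 = "insert F0 I"
    have J0: "finite ?J0" "?J0 \<subseteq> J" using I F0 by auto
    obtain b where b: "\<And>F. F \<in> I \<Longrightarrow> good ?J0 F (b F)" using good_ex[OF J0] J0(2) by (metis insertI2 subsetD)
    have be: "b F \<in> ker_restrict \<and> e F0 F' (b F) = (if F' = F then 1 else 0)" if "F \<in> I" "F' \<in> I" for F F'
    proof -
      have FF: "F \<in> J" "F' \<in> J" "F \<noteq> F0" using that I(3) by auto
      show ?thesis using good_e[OF J0(2) _ FF(2) F0 _ _ b[OF that(1)], of 0] that FF(3) by simp
    qed
    have "card I \<le> vectorspace.dim class_ring ?V"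
      by (rule delta_card_le[OF fV I(1), of b "e F0"]) (use be ef F0 I(3) in auto)
    then show False using I(2) by simp
  qed
  assume "J \<noteq> {}"
  then obtain F0 where F0: "F0 \<in> J" by auto
  obtain b where b: "\<And>F. F \<in> J \<Longrightarrow> good J F (b F)" using good_ex[OF finJ order_refl] by metis
  have gm: "(g ^^ m) ` F \<in> J" if "F \<in> J" for F m
  proof (induction m)
    case (Suc m)
    have "(g ^^ Suc m) ` F = g ` ((g ^^ m) ` F)" by (simp add: image_comp comp_def)
    then show ?case using image_J(1)[OF Suc] by simp
  qed (use that in simp)
  have be: "b F \<in> ker_restrict" "e F0 F' ((cech_map W {} 1 g ^^ m) (b F)) =
      (if (g ^^ m) ` F' = F then 1 else 0) - (if (g ^^ m) ` F0 = F then 1 else 0)"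
    if "F \<in> J" "F' \<in> J" for F F' m
    using good_e[OF order_refl that F0 gm[OF that(2)] gm[OF F0] b[OF that(1)]] by auto
  have d: "dual_system ?V (J - {F0}) b (e F0)"
    unfolding dual_system_def
  proof (intro conjI ballI impI)
    show "finite (J - {F0})" using finJ by simp
    show "b i \<in> carrier ?V" if "i \<in> J - {F0}" for i using be(1)[of i F0] that F0 by simp
    show "functional ?V (e F0 i)" if "i \<in> J - {F0}" for i using ef F0 that by auto
    show "e F0 i (b j) = (if i = j then 1 else 0)" if "i \<in> J - {F0}" "j \<in> J - {F0}" for i j
      using be(2)[of j i 0] that by auto
    fix v assume v: "v \<in> carrier ?V" "\<forall>i\<in>J - {F0}. e F0 i v = 0"
    have "e F0 F v = 0" if "F \<in> J" for F using v(2) that by (cases "F = F0") (auto simp: e_def)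
    then show "v = \<zero>\<^bsub>?V\<^esub>" using ez[OF _ F0] v(1) by simp
  qed
  have lm: "lin_map ?V ?V (cech_map W {} 1 g ^^ n)"
  proof (rule lin_map_funpow, rule lin_map_sub(2)[OF sub])
    show "lin_map HW HW (cech_map W {} 1 g)" unfolding HW_def by (rule cech_map_lin_map[OF g_cont]) auto
    show "cech_map W {} 1 g u \<in> ker_restrict" if "u \<in> ker_restrict" for u
      by (rule ker_restrict_invariant[OF that g_cont g_K(1)])
  qed
  have "linear_trace ?V (cech_map W {} 1 g ^^ n) = (\<Sum>F\<in>J - {F0}. e F0 F ((cech_map W {} 1 g ^^ n) (b F)))"
    by (rule linear_trace_dual_system[OF V d lm])
  also have "\<dots> = (\<Sum>F\<in>J - {F0}. (if (g ^^ n) ` F = F then 1 else 0) - (if (g ^^ n) ` F0 = F then 1 else 0))"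
    by (rule sum.cong) (use be(2) in auto)
  \<comment> \<open>The summand for \<open>F0\<close> is zero and may be added. Then the subtracted
    indicators sum to 1, since exactly one member of \<open>J\<close> is the image of
    \<open>F0\<close>.\<close>
  also have "\<dots> = (\<Sum>F\<in>J. (if (g ^^ n) ` F = F then 1 else 0) - (if (g ^^ n) ` F0 = F then 1 else 0))"
    by (simp add: sum.remove[OF finJ F0])
  also have "\<dots> = of_nat (card {F \<in> J. (g ^^ n) ` F = F}) - 1"
    using finJ gm[OF F0] by (simp add: sum_subtractf sum.If_cases Int_def)
  finally show "linear_trace ?V (cech_map W {} 1 g ^^ n) = of_nat (card {F \<in> J. (g ^^ n) ` F = F}) - 1" .
qed

end

section \<open>Isolated invariant sets and index pairs\<close>

locale partial_system =
  fixes M :: "'a topology" and f :: "'a \<Rightarrow> 'a" and D :: "'a set"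
  assumes Hausdorff_M: "Hausdorff_space M" and D_open: "openin M D"
    and f_cont: "continuous_map (subtopology M D) M f"
begin

lemma preimage_open: "openin M T \<Longrightarrow> openin M {x \<in> D. f x \<in> T}"
proof -
  assume T: "openin M T"
  have "topspace (subtopology M D) = D" using openin_subset[OF D_open] by auto
  then have "openin (subtopology M D) {x \<in> D. f x \<in> T}" using openin_continuous_map_preimage[OF f_cont T] by simp
  then show ?thesis using D_open by (simp add: openin_open_subtopology)
qed

lemma f_in: "x \<in> D \<Longrightarrow> f x \<in> topspace M"
  using f_cont openin_subset[OF D_open] by (auto simp: continuous_map_def)

lemma preimage_closed:
  assumes E: "compactin M E" "E \<subseteq> D" and C: "closedin M C"
  shows "compactin M {x \<in> E. f x \<in> C}"
proof -
  have "openin M {x \<in> D. f x \<in> topspace M - C}" by (rule preimage_open) (use C in auto)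
  then have "closedin M (topspace M - {x \<in> D. f x \<in> topspace M - C})" by auto
  moreover have "E \<inter> (topspace M - {x \<in> D. f x \<in> topspace M - C}) = {x \<in> E. f x \<in> C}"
    using E(2) f_in compactin_subset_topspace[OF E(1)] by blast
  ultimately show ?thesis using compact_Int_closedin[OF E(1), of "topspace M - {x \<in> D. f x \<in> topspace M - C}"] by simp
qed

lemma image_compact: "compactin M S \<Longrightarrow> S \<subseteq> D \<Longrightarrow> compactin M (f ` S)"
  using image_compactin[OF _ f_cont, of S] by (simp add: compactin_subtopology)

lemma compact_nest:
  fixes S :: "nat \<Rightarrow> 'a set"
  assumes "\<And>k. compactin M (S k)" "\<And>k. S k \<noteq> {}" "\<And>k. S (Suc k) \<subseteq> S k"
  shows "(\<Inter>k. S k) \<noteq> {}"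
proof -
  have dec: "decseq S" using assms(3) by (simp add: decseq_Suc_iff)
  have "compact_space (subtopology M (S 0))" using assms(1) by (simp add: compact_space_subtopology)
  moreover have "closedin (subtopology M (S 0)) (S k)" for k
    using compactin_imp_closedin[OF Hausdorff_M assms(1)] dec
    by (auto simp: closedin_subtopology decseq_def intro!: exI[of _ "S k"])
  ultimately show ?thesis using compact_space_imp_nest[of "subtopology M (S 0)" S] assms(2) dec by blast
qed

text \<open>Points with \<open>k\<close> further iterates in \<open>E\<close> and points with
  \<open>k\<close> predecessors in \<open>E\<close> form decreasing compact sets. Their common
  intersection consists of full orbits in \<open>E\<close>, so it lies in \<open>A\<close>.
  Compactness yields one \<open>m\<close>, and the middle of an orbit segment of
  \<open>2 * m\<close> steps is in the \<open>m\<close>-th set.\<close>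

lemma isolating_shrink:
  assumes E: "compactin M E" "E \<subseteq> D" and A: "openin M A" "Inv f E \<subseteq> A"
  obtains m where "\<And>x. (\<forall>i\<le>2 * m. (f ^^ i) x \<in> E) \<Longrightarrow> (f ^^ m) x \<in> A"
proof -
  have Ecl: "closedin M E" using compactin_imp_closedin[OF Hausdorff_M E(1)] .
  \<comment> \<open>Both families are built recursively, so that \<open>f\<close> is evaluated only
    at points of \<open>E\<close>, which lies in its domain.\<close>
  define P where "P k = rec_nat E (\<lambda>_ S. {x \<in> E. f x \<in> S}) k" for k
  have P: "P 0 = E" "P (Suc k) = {x \<in> E. f x \<in> P k}" for k unfolding P_def by auto
  define R where "R k = rec_nat E (\<lambda>_ S. f ` S \<inter> E) k" for k
  have R: "R 0 = E" "R (Suc k) = f ` R k \<inter> E" for k unfolding R_def by auto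
  have PE: "P k \<subseteq> E" "R k \<subseteq> E" for k by (cases k; auto simp: P R)+
  have Pc: "compactin M (P k)" for k
  proof (induction k)
    case (Suc k) show ?case unfolding P by (rule preimage_closed[OF E compactin_imp_closedin[OF Hausdorff_M Suc]])
  qed (use E P in auto)
  have Rc: "compactin M (R k)" for k
  proof (induction k)
    case (Suc k)
    have "compactin M (f ` R k)" by (rule image_compact[OF Suc]) (use PE(2)[of k] E(2) in blast)
    then show ?case unfolding R using Ecl compact_Int_closedin by blast
  qed (use E R in auto)
  have Pd: "P (Suc k) \<subseteq> P k" for k
  proof (induction k)
    case (Suc k) show ?case unfolding P(2)[of "Suc k"] using Suc by (subst P(2)) auto
  qed (auto simp: P)
  have Rd: "R (Suc k) \<subseteq> R k" for k
  proof (induction k)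
    case (Suc k) show ?case unfolding R(2)[of "Suc k"] using Suc by (subst (2) R(2)) auto
  qed (auto simp: R)
  define S where "S k = P k \<inter> R k" for k
  have Sc: "compactin M (S k)" for k
    unfolding S_def using compact_Int_closedin[OF Pc compactin_imp_closedin[OF Hausdorff_M Rc]] .
  have Sd: "S (Suc k) \<subseteq> S k" for k unfolding S_def using Pd Rd by blast
  define I where "I = (\<Inter>k. S k)"
  have f_I: "f x \<in> I" if "x \<in> I" for x
  proof -
    have "f x \<in> S k" for k
    proof -
      have "x \<in> P (Suc (Suc k))" "x \<in> R k" using that unfolding I_def S_def by blast+
      then have "f x \<in> P (Suc k)" "f x \<in> f ` R k" using P by auto
      then have "f x \<in> P k" "f x \<in> R (Suc k)" using Pd PE(1)[of "Suc k"] R by auto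
      then show ?thesis unfolding S_def using Rd by blast
    qed
    then show ?thesis unfolding I_def by auto
  qed
  \<comment> \<open>By compactness a point of the intersection has a preimage in the intersection;
    this provides the negative half of a full orbit.\<close>
  have lift: "\<exists>y\<in>I. f y = x" if x: "x \<in> I" for x
  proof -
    define T where "T k = {y \<in> S k. f y = x}" for k
    have xM: "x \<in> topspace M" using x PE(1)[of 0] compactin_subset_topspace[OF E(1)] unfolding I_def S_def by blast
    have "compactin M (T k)" for k
    proof -
      have "compactin M {y \<in> S k. f y \<in> {x}}"
      proof (rule preimage_closed[OF Sc])
        show "S k \<subseteq> D" unfolding S_def using PE(1)[of k] E(2) by blast
        show "closedin M {x}" using xM closedin_Hausdorff_sing_eq[OF Hausdorff_M] by blast
      qed
      then show ?thesis unfolding T_def by simp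
    qed
    moreover have "T k \<noteq> {}" for k
    proof -
      have "x \<in> P k" "x \<in> R (Suc k)" using x unfolding I_def S_def by blast+
      then obtain y where y: "y \<in> R k" "x = f y" using R by auto
      then have "y \<in> P (Suc k)" using \<open>x \<in> P k\<close> PE(2)[of k] P by auto
      then show ?thesis unfolding T_def S_def using y Pd by blast
    qed
    moreover have "T (Suc k) \<subseteq> T k" for k unfolding T_def using Sd by blast
    ultimately have "(\<Inter>k. T k) \<noteq> {}" by (rule compact_nest)
    then show ?thesis unfolding T_def I_def by auto
  qed
  then obtain b where b: "\<And>x. x \<in> I \<Longrightarrow> b x \<in> I \<and> f (b x) = x" by metis
  have "I \<subseteq> Inv f E"
  proof
    fix x assume x: "x \<in> I"
    define q where "q i = (if i \<ge> 0 then (f ^^ nat i) x else (b ^^ nat (- i)) x)" for i :: int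
    have fi: "(f ^^ k) x \<in> I" "(b ^^ k) x \<in> I" for k using f_I b x by (induction k) auto
    have IE: "I \<subseteq> E" using PE(1)[of 0] unfolding I_def S_def by blast
    have "q i \<in> E" for i unfolding q_def using fi IE by auto
    moreover have "f (q i) = q (i + 1)" for i
    proof (cases "i \<ge> 0")
      case True then show ?thesis unfolding q_def by (simp add: nat_add_distrib)
    next
      case False
      then have "nat (- i) = Suc (nat (- (i + 1)))" by simp
      then have "q i = b ((b ^^ nat (- (i + 1))) x)" using False unfolding q_def by simp
      then have "f (q i) = (b ^^ nat (- (i + 1))) x" using b fi by simp
      also have "\<dots> = q (i + 1)" using False unfolding q_def by (cases "i = -1") auto
      finally show ?thesis .
    qed
    moreover have "q 0 = x" unfolding q_def by simp
    ultimately show "x \<in> Inv f E" unfolding Inv_def using IE x by blast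
  qed
  then have IA: "I \<subseteq> A" using A by auto
  have "\<exists>m. S m \<subseteq> A"
  proof (rule ccontr)
    assume n: "\<nexists>m. S m \<subseteq> A"
    define T where "T k = S k \<inter> (topspace M - A)" for k
    have "compactin M (T k)" for k unfolding T_def using compact_Int_closedin[OF Sc] A(1) by blast
    moreover have "T k \<noteq> {}" for k using n compactin_subset_topspace[OF Sc[of k]] unfolding T_def by blast
    moreover have "T (Suc k) \<subseteq> T k" for k unfolding T_def using Sd by blast
    ultimately have "(\<Inter>k. T k) \<noteq> {}" by (rule compact_nest)
    then show False using IA unfolding T_def I_def by auto
  qed
  then obtain m where m: "S m \<subseteq> A" by auto
  show ?thesis
  proof (rule that[of m])
    fix x assume x: "\<forall>i\<le>2 * m. (f ^^ i) x \<in> E"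
    have "(f ^^ k) x \<in> R k" if "k \<le> 2 * m" for k
      using that x by (induction k) (auto simp: R)
    moreover have "(f ^^ (2 * m - k)) x \<in> P k" if "k \<le> 2 * m" for k
      using that
    proof (induction k)
      case (Suc k)
      have "2 * m - k = Suc (2 * m - Suc k)" using Suc.prems by simp
      then have "f ((f ^^ (2 * m - Suc k)) x) \<in> P k" using Suc by simp
      then show ?case using x by (auto simp: P)
    qed (use x P in auto)
    from this[of m] have "(f ^^ m) x \<in> P m" by (simp add: mult_2)
    ultimately show "(f ^^ m) x \<in> A" using m unfolding S_def by auto
  qed
qed

lemma iterate_domain_Suc: "iterate_domain f D (Suc n) = {x \<in> D. f x \<in> iterate_domain f D n}"
proof -
  have "(\<forall>i<Suc n. (f ^^ i) x \<in> D) \<longleftrightarrow> x \<in> D \<and> (\<forall>i<n. (f ^^ i) (f x) \<in> D)" for x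
    unfolding All_less_Suc2 by (simp add: funpow_swap1)
  then show ?thesis unfolding iterate_domain_def by auto
qed

lemma iterate_system: "n \<ge> 1 \<Longrightarrow> partial_system M (f ^^ n) (iterate_domain f D n)"
proof (induction n rule: dec_induct)
  case base
  have "iterate_domain f D 1 = D" unfolding iterate_domain_def by auto
  then show ?case using partial_system_axioms by simp
next
  case (step n)
  interpret n: partial_system M "f ^^ n" "iterate_domain f D n" by fact
  have eq: "iterate_domain f D (Suc n) = {x \<in> D. f x \<in> iterate_domain f D n}" by (rule iterate_domain_Suc)
  show ?case
  proof
    show "Hausdorff_space M" by (rule Hausdorff_M)
    show "openin M (iterate_domain f D (Suc n))" unfolding eq by (rule preimage_open[OF n.D_open])
    have "continuous_map (subtopology M (iterate_domain f D (Suc n))) (subtopology M (iterate_domain f D n)) f"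
      using continuous_map_from_subtopology_mono[OF f_cont, of "iterate_domain f D (Suc n)"]
      by (auto simp: continuous_map_in_subtopology eq)
    from continuous_map_compose[OF this n.f_cont]
    show "continuous_map (subtopology M (iterate_domain f D (Suc n))) M (f ^^ Suc n)"
      by (simp only: funpow_Suc_right)
  qed
qed

end

section \<open>The quotient by the exit set and its index map\<close>

lemma compact_space_quotient:
  assumes "compactin M N"
  shows "compact_space (quotient_space M N L)"
proof -
  let ?Z = "quotient_space M N L"
  have N: "N \<subseteq> topspace M" using compactin_subset_topspace[OF assms] .
  note top = topspace_quotient_space[OF N, of L]
  have "continuous_map (subtopology M N) ?Z (collapse L)"
    unfolding continuous_map_def
  proof (intro conjI allI impI)
    show "collapse L \<in> topspace (subtopology M N) \<rightarrow> topspace ?Z" unfolding top using N by (auto simp: collapse_def)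
  qed (auto simp: openin_quotient_space)
  then have "compactin ?Z (collapse L ` N)"
    using image_compactin[of "subtopology M N" N] assms by (simp add: compactin_subtopology)
  \<comment> \<open>If \<open>L\<close> is empty, the base point is not the image of any point of
    \<open>N\<close>, so it is added separately.\<close>
  moreover have "compactin ?Z {None}" unfolding compactin_sing top by simp
  ultimately have "compactin ?Z (collapse L ` N \<union> {None})" by (rule compactin_Un)
  moreover have "collapse L ` N \<union> {None} = topspace ?Z" unfolding top by (auto simp: collapse_def image_iff)
  ultimately show ?thesis unfolding compact_space_def by simp
qed

lemma quotient_openI:
  assumes "openin M O'" "N \<subseteq> topspace M"
  shows "O' \<inter> L = {} \<Longrightarrow> openin (quotient_space M N L) (Some ` (O' \<inter> N))"
    "L \<subseteq> O' \<Longrightarrow> openin (quotient_space M N L) (insert None (Some ` (O' \<inter> N - L)))"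
proof -
  assume d: "O' \<inter> L = {}"
  have "{x \<in> topspace (subtopology M N). collapse L x \<in> Some ` (O' \<inter> N)} = O' \<inter> N"
    using assms(2) d by (auto simp: collapse_def)
  then show "openin (quotient_space M N L) (Some ` (O' \<inter> N))"
    unfolding openin_quotient_space using assms(1) d by (auto simp: openin_subtopology)
next
  assume d: "L \<subseteq> O'"
  have "{x \<in> topspace (subtopology M N). collapse L x \<in> insert None (Some ` (O' \<inter> N - L))} = O' \<inter> N"
    using assms(2) d by (auto simp: collapse_def split: if_splits)
  then show "openin (quotient_space M N L) (insert None (Some ` (O' \<inter> N - L)))"
    unfolding openin_quotient_space using assms(1) d by (auto simp: openin_subtopology)
qed

lemma Hausdorff_space_quotient:
  assumes M: "Hausdorff_space M" and N: "compactin M N" and L: "compactin M L"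
  shows "Hausdorff_space (quotient_space M N L)"
proof -
  let ?Z = "quotient_space M N L"
  have Nt: "N \<subseteq> topspace M" using compactin_subset_topspace[OF N] .
  note top = topspace_quotient_space[OF Nt, of L]
  note op = quotient_openI[OF _ Nt]
  have sN: "\<exists>U V. openin ?Z U \<and> openin ?Z V \<and> Some x \<in> U \<and> None \<in> V \<and> disjnt U V" if x: "x \<in> N - L" for x
  proof -
    have "compactin M {x}" "disjnt {x} L" using x Nt by auto
    then obtain U V where UV: "openin M U" "openin M V" "x \<in> U" "L \<subseteq> V" "disjnt U V"
      using Hausdorff_space_compact_separation[OF M _ L, of "{x}"] by auto
    have "openin ?Z (Some ` (U \<inter> N))" "openin ?Z (insert None (Some ` (V \<inter> N - L)))"
      using op(1)[OF UV(1)] op(2)[OF UV(2)] UV unfolding disjnt_def by auto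
    moreover have "disjnt (Some ` (U \<inter> N)) (insert None (Some ` (V \<inter> N - L)))" using UV(5) unfolding disjnt_def by auto
    ultimately show ?thesis using x UV(3) by (intro exI[of _ "Some ` (U \<inter> N)"] exI[of _ "insert None (Some ` (V \<inter> N - L))"]) auto
  qed
  have ss: "\<exists>U V. openin ?Z U \<and> openin ?Z V \<and> Some x \<in> U \<and> Some y \<in> V \<and> disjnt U V"
    if x: "x \<in> N - L" and y: "y \<in> N - L" and xy: "x \<noteq> y" for x y
  proof -
    obtain U V where UV: "openin M U" "openin M V" "x \<in> U" "y \<in> V" "disjnt U V"
    proof -
      have "x \<in> topspace M \<and> y \<in> topspace M \<and> x \<noteq> y" using x y xy Nt by blast
      then show thesis using M that unfolding Hausdorff_space_def by blast
    qed
    have Lcl: "closedin M L" using compactin_imp_closedin[OF M L] .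
    have "openin ?Z (Some ` ((U - L) \<inter> N))" "openin ?Z (Some ` ((V - L) \<inter> N))"
      using op(1)[OF openin_diff[OF UV(1) Lcl]] op(1)[OF openin_diff[OF UV(2) Lcl]] by auto
    moreover have "disjnt (Some ` ((U - L) \<inter> N)) (Some ` ((V - L) \<inter> N))" using UV(5) unfolding disjnt_def by auto
    ultimately show ?thesis using x y UV by (intro exI[of _ "Some ` ((U - L) \<inter> N)"] exI[of _ "Some ` ((V - L) \<inter> N)"]) auto
  qed
  show ?thesis unfolding Hausdorff_space_def
  proof (intro allI impI)
    fix z w assume "z \<in> topspace ?Z \<and> w \<in> topspace ?Z \<and> z \<noteq> w"
    then consider x y where "z = Some x" "w = Some y" "x \<in> N - L" "y \<in> N - L" "x \<noteq> y"
      | x where "z = Some x" "w = None" "x \<in> N - L" | x where "z = None" "w = Some x" "x \<in> N - L"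
      unfolding top by auto
    then show "\<exists>U V. openin ?Z U \<and> openin ?Z V \<and> z \<in> U \<and> w \<in> V \<and> disjnt U V"
    proof cases
      case 1 then show ?thesis using ss by simp
    next
      case 2 then show ?thesis using sN by simp
    next
      case 3 then show ?thesis using sN[of x] by (metis disjnt_sym)
    qed
  qed
qed

locale index_system = partial_system +
  fixes X N L :: "'a set"
  assumes ip: "index_pair M f D X N L" and X_compact: "compactin M X" and fX: "f ` X = X"
begin

abbreviation Z :: "'a option topology" where "Z \<equiv> quotient_space M N L"
abbreviation T :: "'a option \<Rightarrow> 'a option" where "T \<equiv> index_map f N L"
definition E :: "'a set" where "E = M closure_of (N - L)"

lemma N_compact: "compactin M N" and L_compact: "compactin M L" and LN: "L \<subseteq> N" and ND: "N \<subseteq> D"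
  and E_isolating: "isolating_neighbourhood M f D X E" and XL: "X \<inter> L = {}"
  and f_NL: "x \<in> N \<Longrightarrow> x \<notin> L \<Longrightarrow> f x \<in> N" and f_L: "x \<in> L \<Longrightarrow> f x \<in> N \<Longrightarrow> f x \<in> L"
  using ip unfolding index_pair_def E_def by auto

lemma N_top: "N \<subseteq> topspace M" using compactin_subset_topspace[OF N_compact] .
lemma N_closed: "closedin M N" by (rule compactin_imp_closedin[OF Hausdorff_M N_compact])
lemma L_closed: "closedin M L" by (rule compactin_imp_closedin[OF Hausdorff_M L_compact])
lemma top_Z: "topspace Z = insert None (Some ` (N - L))" by (rule topspace_quotient_space[OF N_top])
lemma Z_compact: "compact_space Z" by (rule compact_space_quotient[OF N_compact])
lemma Z_Hausdorff: "Hausdorff_space Z" by (rule Hausdorff_space_quotient[OF Hausdorff_M N_compact L_compact])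

lemma E_subset: "N - L \<subseteq> E" "E \<subseteq> N" "E \<subseteq> D" "compactin M E" "X = Inv f E"
proof -
  show "N - L \<subseteq> E" unfolding E_def using N_top by (intro closure_of_subset) auto
  show "E \<subseteq> N" unfolding E_def using N_closed by (intro closure_of_minimal) auto
  show "E \<subseteq> D" "compactin M E" "X = Inv f E" using E_isolating unfolding isolating_neighbourhood_def by auto
qed

text \<open>An open neighbourhood of \<open>X\<close> inside \<open>N - L\<close>, where the
  quotient has the topology of \<open>M\<close>.\<close>

definition A0 :: "'a set" where "A0 = M interior_of E - L"

lemma A0: "openin M A0" "X \<subseteq> A0" "A0 \<subseteq> N - L"
proof -
  show "openin M A0" unfolding A0_def using L_closed by (intro openin_diff) auto
  show "X \<subseteq> A0" using E_isolating XL unfolding A0_def isolating_neighbourhood_def neighbourhood_of_def by auto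
  show "A0 \<subseteq> N - L" unfolding A0_def using interior_of_subset[of M E] E_subset(2) by auto
qed

lemma T_None [simp]: "T None = None" by (simp add: index_map_def)

lemma T_Some: "T (Some x) = (if x \<in> N - L \<and> f x \<in> N - L then Some (f x) else None)"
  by (simp add: index_map_def)

lemma T_in: "z \<in> topspace Z \<Longrightarrow> T z \<in> topspace Z"
  unfolding top_Z by (cases z) (auto simp: T_Some)

lemma T_cont: "continuous_map Z Z T"
  unfolding continuous_map_def
proof (intro conjI allI impI)
  show "T \<in> topspace Z \<rightarrow> topspace Z" using T_in by auto
  fix U assume U: "openin Z U"
  have topN: "topspace (subtopology M N) = N" using N_top by auto
  obtain S where S: "openin M S" "{x \<in> N. collapse L x \<in> U} = S \<inter> N"
    using U unfolding openin_quotient_space topN openin_subtopology by auto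
  have SU: "Some x \<in> U \<longleftrightarrow> x \<in> S" if "x \<in> N - L" for x
  proof -
    have "x \<in> {x \<in> N. collapse L x \<in> U} \<longleftrightarrow> x \<in> S \<inter> N" by (simp only: S(2))
    then show ?thesis using that by (simp add: collapse_def)
  qed
  \<comment> \<open>Without the base point in \<open>U\<close>, the preimage is an open condition on
    \<open>f x\<close>. With the base point the complement is used: it consists of the points mapped
    into \<open>N - S\<close>, a closed condition that no point of \<open>L\<close> satisfies by
    \<open>f_L\<close>.\<close>
  have "openin (subtopology M N) {x \<in> N. collapse L x \<in> {z \<in> topspace Z. T z \<in> U}}"
  proof (cases "None \<in> U")
    case False
    have NS: "x \<in> N - L" if "x \<in> N" "x \<in> S" for x
    proof -
      have "collapse L x \<in> U" using S(2) that by blast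
      then show ?thesis using False that(1) by (cases "x \<in> L") (auto simp: collapse_def)
    qed
    have "collapse L x \<in> {z \<in> topspace Z. T z \<in> U} \<longleftrightarrow> x \<in> {x \<in> D. f x \<in> S} - L" if x: "x \<in> N" for x
    proof (cases "x \<in> L")
      case True then show ?thesis using False by (simp add: collapse_def)
    next
      case xL: False
      have fN: "f x \<in> N" using f_NL x xL .
      have "f x \<in> N - L \<and> Some (f x) \<in> U \<longleftrightarrow> f x \<in> S" using SU NS fN by blast
      moreover have "x \<in> D" using ND x by blast
      moreover have "collapse L x = Some x" using xL by (simp add: collapse_def)
      moreover have "Some x \<in> topspace Z" using x xL by (simp add: top_Z)
      moreover have "x \<in> N - L" using x xL by blast
      ultimately show ?thesis using False xL by (simp add: T_Some) blast
    qed
    then have "{x \<in> N. collapse L x \<in> {z \<in> topspace Z. T z \<in> U}} = (({x \<in> D. f x \<in> S}) - L) \<inter> N"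
      by blast
    moreover have "openin M ({x \<in> D. f x \<in> S} - L)" using preimage_open[OF S(1)] L_closed by (intro openin_diff) auto
    ultimately show ?thesis by (auto simp: openin_subtopology)
  next
    case True
    have LS: "L \<subseteq> S"
    proof
      fix x assume "x \<in> L"
      then have "x \<in> N" "collapse L x \<in> U" using LN True by (auto simp: collapse_def)
      then show "x \<in> S" using S(2) by blast
    qed
    have C: "closedin M (N - S)" using N_closed S(1) by (intro closedin_diff) auto
    have "collapse L x \<in> {z \<in> topspace Z. T z \<in> U} \<longleftrightarrow> f x \<notin> N - S" if x: "x \<in> N" for x
    proof (cases "x \<in> L")
      case xL: True
      have "f x \<notin> N - S" using f_L[OF xL] LS by blast
      then show ?thesis using True xL by (simp add: collapse_def top_Z)
    next
      case xL: False
      have fN: "f x \<in> N" using f_NL x xL .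
      have "f x \<in> N - L \<and> Some (f x) \<notin> U \<longleftrightarrow> f x \<notin> S" using SU LS fN by blast
      then show ?thesis using True x xL fN by (auto simp: collapse_def top_Z T_Some)
    qed
    then have "{x \<in> N. collapse L x \<in> {z \<in> topspace Z. T z \<in> U}} = (topspace M - {x \<in> N. f x \<in> N - S}) \<inter> N"
      using N_top by blast
    moreover have "closedin M {x \<in> N. f x \<in> N - S}"
      by (rule compactin_imp_closedin[OF Hausdorff_M preimage_closed[OF N_compact ND C]])
    ultimately show ?thesis by (auto simp: openin_subtopology)
  qed
  then show "openin Z {z \<in> topspace Z. T z \<in> U}"
    unfolding openin_quotient_space[where U = "{z \<in> topspace Z. T z \<in> U}"] topN using top_Z by auto
qed

lemma Tk_None [simp]: "(T ^^ k) None = None"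
  by (induction k) auto

text \<open>The index map tests a point only when it is applied, so the zeroth power accepts points
  outside \<open>N - L\<close>; hence the separate case \<open>k = 0\<close>.\<close>

lemma Tk_Some: "(T ^^ k) (Some x) \<noteq> None \<longleftrightarrow> k = 0 \<or> (\<forall>i\<le>k. (f ^^ i) x \<in> N - L)"
  "(T ^^ k) (Some x) \<noteq> None \<Longrightarrow> (T ^^ k) (Some x) = Some ((f ^^ k) x)"
proof -
  have "((T ^^ k) (Some x) \<noteq> None \<longleftrightarrow> k = 0 \<or> (\<forall>i\<le>k. (f ^^ i) x \<in> N - L)) \<and>
    ((T ^^ k) (Some x) \<noteq> None \<longrightarrow> (T ^^ k) (Some x) = Some ((f ^^ k) x))"
  proof (induction k)
    case (Suc k)
    show ?case
    proof (cases "(T ^^ k) (Some x) = None")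
      case True
      then have "\<not> (\<forall>i\<le>k. (f ^^ i) x \<in> N - L)" using Suc by blast
      then show ?thesis using True by (auto simp: le_Suc_eq)
    next
      case False
      then have *: "(T ^^ k) (Some x) = Some ((f ^^ k) x)" "k = 0 \<or> (\<forall>i\<le>k. (f ^^ i) x \<in> N - L)" using Suc by auto
      then show ?thesis by (auto simp: T_Some le_Suc_eq)
    qed
  qed auto
  then show "(T ^^ k) (Some x) \<noteq> None \<longleftrightarrow> k = 0 \<or> (\<forall>i\<le>k. (f ^^ i) x \<in> N - L)"
    "(T ^^ k) (Some x) \<noteq> None \<Longrightarrow> (T ^^ k) (Some x) = Some ((f ^^ k) x)" by auto
qed

text \<open>\<open>isolating_shrink\<close> for orbits in the quotient. It is given for all
  \<open>k \<ge> m\<close>, so that one exponent can serve two index pairs.\<close>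

lemma T_core:
  assumes "openin M A" "X \<subseteq> A"
  obtains m where "\<And>k z. z \<in> topspace Z \<Longrightarrow> k \<ge> m \<Longrightarrow> (T ^^ (2 * k)) z \<noteq> None \<Longrightarrow> (T ^^ k) z \<in> Some ` A"
proof -
  obtain m where m: "\<And>x. (\<forall>i\<le>2 * m. (f ^^ i) x \<in> E) \<Longrightarrow> (f ^^ m) x \<in> A"
    by (rule isolating_shrink[OF E_subset(4,3) assms(1)]) (use assms(2) E_subset(5) in auto)
  show ?thesis
  proof (rule that[of m])
    fix k z assume z: "z \<in> topspace Z" "k \<ge> m" "(T ^^ (2 * k)) z \<noteq> None"
    then obtain x where x: "z = Some x" "x \<in> N - L" unfolding top_Z by auto
    have "2 * k = 0 \<or> (\<forall>i\<le>2 * k. (f ^^ i) x \<in> N - L)" using Tk_Some(1)[of "2 * k" x] z(3) x(1) by blast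
    then have orb: "\<forall>i\<le>2 * k. (f ^^ i) x \<in> N - L" using x(2) by auto
    have "\<forall>i\<le>2 * m. (f ^^ i) ((f ^^ (k - m)) x) \<in> E"
    proof (intro allI impI)
      fix i assume "i \<le> 2 * m"
      then have "(f ^^ (i + (k - m))) x \<in> N - L" using orb z(2) by auto
      then show "(f ^^ i) ((f ^^ (k - m)) x) \<in> E" using E_subset(1) by (auto simp: funpow_add)
    qed
    from m[OF this] have "(f ^^ (m + (k - m))) x \<in> A" by (simp add: funpow_add)
    then have "(f ^^ k) x \<in> A" using z(2) by simp
    moreover have "(T ^^ k) z \<noteq> None" using Tk_Some(1)[of k x] orb x(1) by auto
    ultimately show "(T ^^ k) z \<in> Some ` A" using Tk_Some(2)[of k x] x(1) by auto
  qed
qed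

end

section \<open>Shift equivalence of index maps\<close>

text \<open>Survival of an orbit is expressed by \<open>\<noteq> None\<close> throughout, and the
  existential form produced by this rule is unwanted.\<close>

declare not_None_eq [iff del]

lemma continuous_map_funpow: "continuous_map X X g \<Longrightarrow> continuous_map X X (g ^^ k)"
proof (induction k)
  case (Suc k)
  then show ?case using continuous_map_compose[of X X "g ^^ k" X g] by (simp add: o_def)
qed (simp add: id_def[symmetric])

lemma funpow_image_subset: "g ` A \<subseteq> A \<Longrightarrow> (g ^^ k) ` A \<subseteq> A"
  by (induction k) auto

lemma cech_map_cong:
  assumes g: "continuous_map X Y g" "g ` A \<subseteq> B" "h ` A \<subseteq> B" and eq: "\<And>x. x \<in> topspace X \<Longrightarrow> g x = h x"
    and A: "pointlike A" "pointlike B" and v: "v \<in> carrier (cech_cohomology Y B 1 :: ('k::field, ('y, 'k) cech) module)"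
  shows "cech_map X A 1 g v = cech_map X A 1 h v"
proof -
  have h: "continuous_map X Y h" using continuous_map_eq[OF g(1)] eq by blast
  obtain C where C: "C \<in> asc Y" "v = as_class Y B C" using v unfolding carrier_cech_1[OF A(2)] by auto
  have "near X (\<lambda>y z. C (g y, g z) - C (h y, h z) = 0 - (0::'k))"
    by (rule nearI) (use eq openin_topspace in \<open>auto intro!: exI[of _ "topspace X"]\<close>)
  then have "cobounds X (\<lambda>w. (\<lambda>(x, y). C (g x, g y)) w - (\<lambda>(x, y). C (h x, h y)) w)"
    unfolding cobounds_def by (intro exI[of _ "\<lambda>_. 0"]) simp
  then show ?thesis
    unfolding C(2) cech_map_as_class[OF g(1,2) A C(1)] cech_map_as_class[OF h g(3) A C(1)]
    using as_class_eq_iff[OF asc_continuous[OF C(1) g(1)] asc_continuous[OF C(1) h] A(1)] by blast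
qed

lemma cech_map_id:
  assumes A: "pointlike A" and v: "v \<in> carrier (cech_cohomology X A 1 :: ('k::field, ('x, 'k) cech) module)"
  shows "cech_map X A 1 id v = v"
proof -
  obtain C where C: "C \<in> asc X" "v = as_class X A C" using v unfolding carrier_cech_1[OF A] by auto
  show ?thesis unfolding C(2) using cech_map_as_class[OF continuous_map_id _ A A C(1)] by simp
qed

lemma cech_map_funpow_eq:
  assumes g: "continuous_map X X g" "g ` A \<subseteq> A" and A: "pointlike A"
    and v: "v \<in> carrier (cech_cohomology X A 1 :: ('k::field, ('x, 'k) cech) module)"
  shows "(cech_map X A 1 g ^^ n) v = cech_map X A 1 (g ^^ n) v"
proof -
  obtain C where C: "C \<in> asc X" "v = as_class X A C" using v unfolding carrier_cech_1[OF A] by auto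
  show ?thesis
    unfolding C(2) cech_map_funpow(1)[OF g A C(1)] using cech_map_as_class[OF continuous_map_funpow[OF g(1)] funpow_image_subset[OF g(2)] A A C(1)] by simp
qed

text \<open>Two systems that agree on a common open core \<open>A\<close>, which every orbit
  surviving \<open>2 * m\<close> steps visits at time \<open>m\<close>. The closed sets
  \<open>B\<close> and \<open>B'\<close> separate the core from the base points; this gives
  continuity of the comparison map where it becomes trivial.\<close>

locale shift_pair =
  fixes Z Z' :: "'a option topology" and T T' :: "'a option \<Rightarrow> 'a option" and g :: "'a \<Rightarrow> 'a"
    and A :: "'a set" and m :: nat and B B' :: "'a option set"
  assumes cont: "continuous_map Z Z T" "continuous_map Z' Z' T'"
    and base: "None \<in> topspace Z" "None \<in> topspace Z'" "T None = None" "T' None = None"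
    and base_closed: "closedin Z {None}" "closedin Z' {None}"
    and A_open: "openin Z (Some ` A)" "openin Z' (Some ` A)"
    and A_eq: "subtopology Z (Some ` A) = subtopology Z' (Some ` A)"
    and T_A: "x \<in> A \<Longrightarrow> T (Some x) = Some (g x)" "x \<in> A \<Longrightarrow> T' (Some x) = Some (g x)"
    and T_some: "T (Some x) \<noteq> None \<Longrightarrow> T (Some x) = Some (g x)" "T' (Some x) \<noteq> None \<Longrightarrow> T' (Some x) = Some (g x)"
    and core: "z \<in> topspace Z \<Longrightarrow> (T ^^ (2 * m)) z \<noteq> None \<Longrightarrow> (T ^^ m) z \<in> Some ` A"
      "z \<in> topspace Z' \<Longrightarrow> (T' ^^ (2 * m)) z \<noteq> None \<Longrightarrow> (T' ^^ m) z \<in> Some ` A"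
    and B: "closedin Z B" "Some ` A \<subseteq> B" "None \<notin> B" "closedin Z' B'" "Some ` A \<subseteq> B'" "None \<notin> B'"
begin

lemma swap: "shift_pair Z' Z T' T g A m B' B"
  by (rule shift_pair.intro) (rule cont base base_closed A_open A_eq[symmetric] T_A T_some core B; assumption)+

text \<open>The \<open>2 m\<close> steps of \<open>T\<close> make sure that \<open>(T ^^ m) z\<close> lies in the common core \<open>A\<close>, where
  the two systems agree.\<close>

definition r :: "'a option \<Rightarrow> 'a option" where
  "r z = (if (T ^^ (2 * m)) z = None then None else (T' ^^ (2 * m)) ((T ^^ m) z))"

lemma pow_None: "(T ^^ k) None = None" "(T' ^^ k) None = None"
  using base by (induction k) auto

lemma pow_None_le:
  "(T ^^ k) z = None \<Longrightarrow> k \<le> l \<Longrightarrow> (T ^^ l) z = None"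
  "(T' ^^ k) z = None \<Longrightarrow> k \<le> l \<Longrightarrow> (T' ^^ l) z = None"
  using pow_None[of "l - k"] funpow_add[of "l - k" k T] funpow_add[of "l - k" k T'] by auto

lemma pow_cont: "continuous_map Z Z (T ^^ k)" "continuous_map Z' Z' (T' ^^ k)"
  by (rule continuous_map_funpow[OF cont(1)] continuous_map_funpow[OF cont(2)])+

lemma pow_in: "z \<in> topspace Z \<Longrightarrow> (T ^^ k) z \<in> topspace Z" "z \<in> topspace Z' \<Longrightarrow> (T' ^^ k) z \<in> topspace Z'"
  using pow_cont[of k] by (auto simp: continuous_map_def)

lemma A_in: "Some ` A \<subseteq> topspace Z" "Some ` A \<subseteq> topspace Z'"
  using A_open openin_subset by auto

lemma pow_some:
  "(T ^^ k) (Some x) \<noteq> None \<Longrightarrow> (T ^^ k) (Some x) = Some ((g ^^ k) x)"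
  "(T' ^^ k) (Some x) \<noteq> None \<Longrightarrow> (T' ^^ k) (Some x) = Some ((g ^^ k) x)"
proof -
  show "(T ^^ k) (Some x) \<noteq> None \<Longrightarrow> (T ^^ k) (Some x) = Some ((g ^^ k) x)"
  proof (induction k)
    case (Suc k)
    have "(T ^^ k) (Some x) \<noteq> None" using Suc.prems base by auto
    then have "(T ^^ k) (Some x) = Some ((g ^^ k) x)" by (rule Suc.IH)
    then show ?case using Suc.prems T_some by simp
  qed simp
  show "(T' ^^ k) (Some x) \<noteq> None \<Longrightarrow> (T' ^^ k) (Some x) = Some ((g ^^ k) x)"
  proof (induction k)
    case (Suc k)
    have "(T' ^^ k) (Some x) \<noteq> None" using Suc.prems base by auto
    then have "(T' ^^ k) (Some x) = Some ((g ^^ k) x)" by (rule Suc.IH)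
    then show ?case using Suc.prems T_some by simp
  qed simp
qed

lemma agree: "(\<And>j. j < k \<Longrightarrow> (T ^^ j) z \<in> Some ` A) \<Longrightarrow> (T' ^^ k) z = (T ^^ k) z"
proof (induction k)
  case (Suc k)
  then have "(T' ^^ k) z = (T ^^ k) z" by simp
  moreover obtain x where "x \<in> A" "(T ^^ k) z = Some x" using Suc.prems by blast
  ultimately show ?case using T_A by simp
qed simp

lemma r_None: "r None = None"
  unfolding r_def by (simp add: pow_None)

lemma core_range:
  assumes "z \<in> topspace Z" "(T ^^ (2 * m + k)) z \<noteq> None" "j \<le> k"
  shows "(T ^^ (m + j)) z \<in> Some ` A"
proof -
  have "(T ^^ (2 * m + j)) z \<noteq> None" using pow_None_le(1)[of "2 * m + j" z "2 * m + k"] assms by auto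
  then have "(T ^^ m) ((T ^^ j) z) \<in> Some ` A"
    using core(1)[OF pow_in(1)[OF assms(1), of j]] by (simp add: funpow_add)
  then show ?thesis by (simp add: funpow_add)
qed

lemma r_in: "z \<in> topspace Z \<Longrightarrow> r z \<in> topspace Z'"
  unfolding r_def using core(1) A_in(2) pow_in(2) base by auto

lemma r_cont: "continuous_map Z Z' r"
  unfolding continuous_map_def
proof (intro conjI allI impI)
  show "r \<in> topspace Z \<rightarrow> topspace Z'" using r_in by auto
  fix U assume U: "openin Z' U"
  \<comment> \<open>\<open>O1\<close> and \<open>O2\<close> cover \<open>Z\<close>, as
    \<open>B\<close> avoids the base point. On \<open>O1\<close> the comparison map factors through
    the core; on \<open>O2\<close> it is constantly the base point.\<close>
  define O1 where "O1 = {z \<in> topspace Z. (T ^^ (2 * m)) z \<in> topspace Z - {None}}"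
  define O2 where "O2 = {z \<in> topspace Z. (T ^^ (2 * m)) z \<in> topspace Z - B}"
  have O1: "openin Z O1" unfolding O1_def
    by (rule openin_continuous_map_preimage[OF pow_cont(1)]) (use base_closed in auto)
  have O2: "openin Z O2" unfolding O2_def
    by (rule openin_continuous_map_preimage[OF pow_cont(1)]) (use B in auto)
  define V where "V = {z \<in> topspace Z'. (T' ^^ (2 * m)) z \<in> U} \<inter> Some ` A"
  have "openin Z' V" unfolding V_def
    using openin_continuous_map_preimage[OF pow_cont(2) U] A_open by auto
  then have "openin (subtopology Z (Some ` A)) V"
    unfolding A_eq openin_subtopology V_def by blast
  then have V: "openin Z V" using openin_trans_full A_open(1) by blast
  have e1: "O1 \<inter> {z \<in> topspace Z. r z \<in> U} = O1 \<inter> {z \<in> topspace Z. (T ^^ m) z \<in> V}"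
  proof -
    have "r z \<in> U \<longleftrightarrow> (T ^^ m) z \<in> V" if "z \<in> O1" for z
    proof -
      have "z \<in> topspace Z" "(T ^^ (2 * m)) z \<noteq> None" using that unfolding O1_def by auto
      moreover from core(1)[OF this] have "(T ^^ m) z \<in> Some ` A" .
      ultimately show ?thesis unfolding V_def r_def using A_in(2) by auto
    qed
    then show ?thesis by blast
  qed
  \<comment> \<open>A value other than the base point would put the core point back into the core
    after \<open>m\<close> steps of \<open>T'\<close>, where it agrees with
    \<open>(T ^^ (2 * m)) z\<close>; but that point is outside \<open>B\<close>.\<close>
  have r2: "r z = None" if "z \<in> O2" for z
  proof (rule ccontr)
    assume n: "r z \<noteq> None"
    have z: "z \<in> topspace Z" "(T ^^ (2 * m)) z \<noteq> None" "(T ^^ (2 * m)) z \<notin> B"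
      using that n unfolding O2_def r_def by (auto split: if_splits)
    from core(1)[OF z(1,2)] obtain y where y: "y \<in> A" "(T ^^ m) z = Some y" by blast
    have "(T' ^^ (2 * m)) (Some y) \<noteq> None" using n y z unfolding r_def by auto
    from core(2)[OF _ this] have c: "(T' ^^ m) (Some y) \<in> Some ` A" using y A_in by auto
    have "(T ^^ m) (Some y) = (T ^^ (2 * m)) z" using y by (simp add: mult_2 funpow_add)
    then have "(T ^^ (2 * m)) z = (T' ^^ m) (Some y)"
      using pow_some(1)[of m y] pow_some(2)[of m y] z(2) c by auto
    then show False using z(3) c B by auto
  qed
  have e2: "O2 \<inter> {z \<in> topspace Z. r z \<in> U} = (if None \<in> U then O2 else {})"
    using r2 O2_def by auto
  have "topspace Z = O1 \<union> O2" unfolding O1_def O2_def using pow_in(1) B by auto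
  then have "{z \<in> topspace Z. r z \<in> U} = (O1 \<inter> {z \<in> topspace Z. r z \<in> U}) \<union> (O2 \<inter> {z \<in> topspace Z. r z \<in> U})" by blast
  then show "openin Z {z \<in> topspace Z. r z \<in> U}"
    unfolding e1 e2 using O1 O2 openin_continuous_map_preimage[OF pow_cont(1) V] by auto
qed

lemma r_T:
  assumes z: "z \<in> topspace Z" shows "r (T z) = T' (r z)"
proof (cases "(T ^^ (2 * m)) z = None")
  case True
  then have "(T ^^ (2 * m)) (T z) = None" using base by (simp add: funpow_swap1[symmetric])
  then show ?thesis unfolding r_def using True base by simp
next
  case False
  obtain y where y: "y \<in> A" "(T ^^ m) z = Some y" using core(1)[OF z False] by blast
  have sw: "(T ^^ m) (T z) = T (Some y)" "(T ^^ (2 * m)) (T z) = T ((T ^^ (2 * m)) z)"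
    using y by (simp_all add: funpow_swap1[symmetric])
  have rz: "r z = (T' ^^ (2 * m)) (Some y)" unfolding r_def using False y by simp
  have e: "T' (r z) = (T' ^^ (2 * m)) (T (Some y))" unfolding rz using T_A[OF y(1)] by (simp add: funpow_swap1)
  show ?thesis
  proof (cases "(T ^^ (2 * m)) (T z) = None")
    \<comment> \<open>Here \<open>z\<close> survives but \<open>T z\<close> does not. Survival of
      \<open>T' (r z)\<close> would put \<open>(T ^^ (2 * m)) z\<close> into the core, where
      \<open>T\<close> does not lead to the base point.\<close>
    case True
    have "T' (r z) = None"
    proof (rule ccontr)
      assume "T' (r z) \<noteq> None"
      then have "(T' ^^ (2 * m)) (Some y) \<noteq> None" using rz base by auto
      from core(2)[OF _ this] have c: "(T' ^^ m) (Some y) \<in> Some ` A" using y A_in by auto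
      have "(T ^^ m) (Some y) = (T ^^ (2 * m)) z" using y by (simp add: mult_2 funpow_add)
      then have "(T ^^ (2 * m)) z = (T' ^^ m) (Some y)"
        using pow_some(1)[of m y] pow_some(2)[of m y] False c by auto
      then show False using c T_A True sw(2) by auto
    qed
    then show ?thesis unfolding r_def[of "T z"] using True by simp
  next
    case F: False
    then show ?thesis unfolding r_def[of "T z"] e using sw by simp
  qed
qed

end

context shift_pair
begin

interpretation sw: shift_pair Z' Z T' T g A m B' B by (rule swap)

text \<open>Each of the two maps advances an orbit by \<open>3 * m\<close> steps, \<open>m\<close>
  into the core and \<open>2 * m\<close> in the other system, whence the exponent. Both sides reach
  the base point together: a survivor on either side stays in the core long enough for the two
  systems to agree.\<close>

lemma sr:
  assumes z: "z \<in> topspace Z" shows "sw.r (r z) = (T ^^ (6 * m)) z"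
proof (cases "(T ^^ (2 * m)) z = None")
  case True
  then show ?thesis using pow_None_le(1)[OF True, of "6 * m"] sw.r_None unfolding r_def by simp
next
  case False
  obtain y where y: "y \<in> A" "(T ^^ m) z = Some y" using core(1)[OF z False] by blast
  have yt: "Some y \<in> topspace Z" "Some y \<in> topspace Z'" using y A_in by auto
  have rz: "r z = (T' ^^ (2 * m)) (Some y)" unfolding r_def using False y by simp
  have Tz: "(T ^^ (k + m)) z = (T ^^ k) (Some y)" for k using y by (simp add: funpow_add)
  have srz: "sw.r (r z) = (if (T' ^^ (4 * m)) (Some y) = None then None else (T ^^ (2 * m)) ((T' ^^ (3 * m)) (Some y)))"
    unfolding sw.r_def rz by (simp add: funpow_add[THEN fun_cong, simplified, symmetric])
  show ?thesis
  proof (cases "(T ^^ (6 * m)) z = None")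
    case True
    have "sw.r (r z) = None"
    proof (rule ccontr)
      assume n: "sw.r (r z) \<noteq> None"
      then have n4: "(T' ^^ (4 * m)) (Some y) \<noteq> None" using srz by auto
      define u where "u = (T' ^^ m) (Some y)"
      have c: "(T' ^^ j) u \<in> Some ` A" if "j \<le> 2 * m" for j
        using sw.core_range[OF yt(2), of "2 * m" j] n4 that unfolding u_def
        by (simp add: funpow_add[THEN fun_cong, simplified, symmetric] add.commute)
      have "(T ^^ m) (Some y) = (T ^^ (2 * m)) z" using Tz[of m] by (simp add: mult_2)
      then have u: "(T ^^ m) (Some y) = u"
        using pow_some(1)[of m y] pow_some(2)[of m y] False c[of 0] unfolding u_def by auto
      have "(T ^^ (2 * m)) u = (T' ^^ (2 * m)) u" by (rule sw.agree) (use c in auto)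
      then have "(T ^^ (3 * m)) (Some y) = (T' ^^ (3 * m)) (Some y)"
        using u funpow_add[of "2 * m" m T] funpow_add[of "2 * m" m T'] unfolding u_def by simp
      then have "sw.r (r z) = (T ^^ (6 * m)) z"
        using srz n4 Tz[of "5 * m"] funpow_add[of "2 * m" "3 * m" T] by simp
      then show False using True n by simp
    qed
    then show ?thesis using True by simp
  next
    case F: False
    have c: "(T ^^ j) (Some y) \<in> Some ` A" if "j \<le> 4 * m" for j
      using core_range[OF z, of "4 * m" j] F that Tz[of j] by (simp add: add.commute)
    have a: "(T' ^^ k) (Some y) = (T ^^ k) (Some y)" if "k \<le> 4 * m" for k
      by (rule agree) (use c that in auto)
    have "(T' ^^ (4 * m)) (Some y) \<noteq> None" using a[of "4 * m"] c[of "4 * m"] by auto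
    then show ?thesis using srz a[of "3 * m"] Tz[of "5 * m"] funpow_add[of "2 * m" "3 * m" T] by simp
  qed
qed

lemma s_exists:
  obtains s where "continuous_map Z' Z s" "s None = None" "\<And>z. z \<in> topspace Z' \<Longrightarrow> s (T' z) = T (s z)"
    "\<And>z. z \<in> topspace Z \<Longrightarrow> s (r z) = (T ^^ (6 * m)) z" "\<And>z. z \<in> topspace Z' \<Longrightarrow> r (s z) = (T' ^^ (6 * m)) z"
proof (rule that)
  show "r (sw.r z) = (T' ^^ (6 * m)) z" if "z \<in> topspace Z'" for z
    using shift_pair.sr[OF swap that] .
qed (use sw.r_cont sw.r_None sw.r_T sr in auto)

end

text \<open>Functoriality. The roles are exchanged by contravariance: the map induced by
  \<open>s\<close> leaves the cohomology of \<open>Z\<close>, the one induced by \<open>r\<close>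
  returns to it.\<close>

lemma shift_equivalent_cech:
  fixes Z :: "'z topology" and Z' :: "'y topology"
  assumes T: "continuous_map Z Z T" "T a = a" and T': "continuous_map Z' Z' T'" "T' b = b"
    and r: "continuous_map Z Z' r" "r a = b" "\<And>z. z \<in> topspace Z \<Longrightarrow> r (T z) = T' (r z)"
    and s: "continuous_map Z' Z s" "s b = a" "\<And>z. z \<in> topspace Z' \<Longrightarrow> s (T' z) = T (s z)"
    and sr: "\<And>z. z \<in> topspace Z \<Longrightarrow> s (r z) = (T ^^ m) z" and rs: "\<And>z. z \<in> topspace Z' \<Longrightarrow> r (s z) = (T' ^^ m) z"
  shows "shift_equivalent (cech_cohomology Z {a} 1 :: ('k::field, ('z, 'k) cech) module, cech_map Z {a} 1 T)
    (cech_cohomology Z' {b} 1 :: ('k, ('y, 'k) cech) module, cech_map Z' {b} 1 T')"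
proof -
  let ?V = "cech_cohomology Z {a} 1 :: ('k, ('z, 'k) cech) module"
  let ?W = "cech_cohomology Z' {b} 1 :: ('k, ('y, 'k) cech) module"
  have ba: "r ` {a} \<subseteq> {b}" "s ` {b} \<subseteq> {a}" "T ` {a} \<subseteq> {a}" "T' ` {b} \<subseteq> {b}" using r s T T' by auto
  note pl = pointlike_simps(2)
  have powT: "continuous_map Z Z (T ^^ k) \<and> (T ^^ k) ` {a} \<subseteq> {a}" for k
    using continuous_map_funpow[OF T(1)] funpow_image_subset[OF ba(3)] by blast
  have powT': "continuous_map Z' Z' (T' ^^ k) \<and> (T' ^^ k) ` {b} \<subseteq> {b}" for k
    using continuous_map_funpow[OF T'(1)] funpow_image_subset[OF ba(4)] by blast
  have lin: "lin_map ?V ?V (cech_map Z {a} 1 T)" "lin_map ?W ?W (cech_map Z' {b} 1 T')"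
    "lin_map ?W ?V (cech_map Z {a} 1 r)" "lin_map ?V ?W (cech_map Z' {b} 1 s)"
    by (rule cech_map_lin_map[OF T(1) ba(3) pl pl] cech_map_lin_map[OF T'(1) ba(4) pl pl]
      cech_map_lin_map[OF r(1) ba(1) pl pl] cech_map_lin_map[OF s(1) ba(2) pl pl])+
  show ?thesis unfolding shift_equivalent_def prod.case linear_map_iff
  proof (intro conjI exI[of _ "cech_map Z' {b} 1 s"] exI[of _ "cech_map Z {a} 1 r"] exI[of _ m] ballI lin vs_cech_1 pl)
    fix v assume v: "v \<in> carrier ?V"
    have "cech_map Z' {b} 1 s (cech_map Z {a} 1 T v) = cech_map Z' {b} 1 (T \<circ> s) v"
      by (rule cech_map_comp[OF s(1) ba(2) T(1) ba(3) pl pl pl v])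
    also have "\<dots> = cech_map Z' {b} 1 (s \<circ> T') v"
      by (rule cech_map_cong[OF continuous_map_compose[OF s(1) T(1)] _ _ _ pl pl v]) (use s T T' in auto)
    also have "\<dots> = cech_map Z' {b} 1 T' (cech_map Z' {b} 1 s v)"
      by (rule cech_map_comp[OF T'(1) ba(4) s(1) ba(2) pl pl pl v, symmetric])
    finally show "cech_map Z' {b} 1 s (cech_map Z {a} 1 T v) = cech_map Z' {b} 1 T' (cech_map Z' {b} 1 s v)" .
    have "cech_map Z {a} 1 r (cech_map Z' {b} 1 s v) = cech_map Z {a} 1 (s \<circ> r) v"
      by (rule cech_map_comp[OF r(1) ba(1) s(1) ba(2) pl pl pl v])
    also have "\<dots> = cech_map Z {a} 1 (T ^^ m) v"
      by (rule cech_map_cong[OF continuous_map_compose[OF r(1) s(1)] _ _ _ pl pl v]) (use sr r s powT[of m] in auto)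
    also have "\<dots> = (cech_map Z {a} 1 T ^^ m) v" by (rule cech_map_funpow_eq[OF T(1) ba(3) pl v, symmetric])
    finally show "cech_map Z {a} 1 r (cech_map Z' {b} 1 s v) = (cech_map Z {a} 1 T ^^ m) v" .
  next
    fix v assume v: "v \<in> carrier ?W"
    have "cech_map Z {a} 1 r (cech_map Z' {b} 1 T' v) = cech_map Z {a} 1 (T' \<circ> r) v"
      by (rule cech_map_comp[OF r(1) ba(1) T'(1) ba(4) pl pl pl v])
    also have "\<dots> = cech_map Z {a} 1 (r \<circ> T) v"
      by (rule cech_map_cong[OF continuous_map_compose[OF r(1) T'(1)] _ _ _ pl pl v]) (use r T T' in auto)
    also have "\<dots> = cech_map Z {a} 1 T (cech_map Z {a} 1 r v)"
      by (rule cech_map_comp[OF T(1) ba(3) r(1) ba(1) pl pl pl v, symmetric])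
    finally show "cech_map Z {a} 1 r (cech_map Z' {b} 1 T' v) = cech_map Z {a} 1 T (cech_map Z {a} 1 r v)" .
    have "cech_map Z' {b} 1 s (cech_map Z {a} 1 r v) = cech_map Z' {b} 1 (r \<circ> s) v"
      by (rule cech_map_comp[OF s(1) ba(2) r(1) ba(1) pl pl pl v])
    also have "\<dots> = cech_map Z' {b} 1 (T' ^^ m) v"
      by (rule cech_map_cong[OF continuous_map_compose[OF s(1) r(1)] _ _ _ pl pl v]) (use rs r s powT'[of m] in auto)
    also have "\<dots> = (cech_map Z' {b} 1 T' ^^ m) v" by (rule cech_map_funpow_eq[OF T'(1) ba(4) pl v, symmetric])
    finally show "cech_map Z' {b} 1 s (cech_map Z {a} 1 r v) = (cech_map Z' {b} 1 T' ^^ m) v" .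
  qed
qed

section \<open>Index pairs for iterates and the comparison of index pairs\<close>

context partial_system
begin

lemma compact_orbit_set:
  assumes N: "compactin M N" "N \<subseteq> D" and C: "compactin M C"
  shows "compactin M {x. (\<forall>i<k. (f ^^ i) x \<in> N) \<and> (f ^^ k) x \<in> C}"
proof (induction k)
  case (Suc k)
  have "{x. (\<forall>i<Suc k. (f ^^ i) x \<in> N) \<and> (f ^^ Suc k) x \<in> C} =
      {x \<in> N. f x \<in> {x. (\<forall>i<k. (f ^^ i) x \<in> N) \<and> (f ^^ k) x \<in> C}}"
    unfolding All_less_Suc2 by (auto simp: funpow_swap1)
  then show ?case using preimage_closed[OF N compactin_imp_closedin[OF Hausdorff_M Suc]] by simp
qed (use C in simp)

lemma open_orbit_set:
  assumes A: "openin M A" "A \<subseteq> D"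
  shows "openin M {x. \<forall>i\<le>k. (f ^^ i) x \<in> A}"
proof (induction k)
  case (Suc k)
  have "{x. \<forall>i\<le>Suc k. (f ^^ i) x \<in> A} = A \<inter> {x \<in> D. f x \<in> {x. \<forall>i\<le>k. (f ^^ i) x \<in> A}}"
    using A(2) unfolding less_Suc_eq_le[symmetric] All_less_Suc2[of "Suc k"] by (auto simp: funpow_swap1)
  then show ?case using openin_Int[OF A(1) preimage_open[OF Suc]] by simp
qed (use A in simp)

end

context index_system
begin

lemma fkX: "(f ^^ k) ` X = X"
proof (induction k)
  case (Suc k)
  have "(f ^^ Suc k) ` X = f ` (f ^^ k) ` X" by auto
  then show ?case using Suc fX by simp
qed simp

lemma fkX_in: "x \<in> X \<Longrightarrow> (f ^^ k) x \<in> X"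
  using fkX by blast

lemma X_orbit:
  assumes "x \<in> X" obtains p :: "int \<Rightarrow> 'a" where "\<And>i. p i \<in> X" "p 0 = x" "\<And>i. f (p i) = p (i + 1)"
proof -
  obtain p :: "int \<Rightarrow> 'a" where p: "\<forall>i. p i \<in> E" "p 0 = x" "\<forall>i. f (p i) = p (i + 1)"
    using assms E_subset(5) unfolding Inv_def by auto
  have "p j \<in> X" for j
  proof -
    have "p j \<in> Inv f E" unfolding Inv_def using p
      by (auto intro!: exI[of _ "\<lambda>i. p (i + j)"] simp: algebra_simps)
    then show ?thesis using E_subset(5) by simp
  qed
  then show thesis using that p by blast
qed

text \<open>Points of \<open>N_iter n - U_iter n\<close> leave \<open>N - L\<close> within \<open>2 n - 2\<close> steps.  This range of
  times is what makes both conditions on an index pair hold for \<open>f ^^ n\<close>: a point of \<open>U_iter n\<close>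
  remains in \<open>N\<close> up to time \<open>2 n - 1\<close>, hence its image remains in \<open>N\<close> up to time \<open>n - 1\<close>.\<close>

definition N_iter :: "nat \<Rightarrow> 'a set" where "N_iter n = {x. \<forall>i<n. (f ^^ i) x \<in> N}"
definition U_iter :: "nat \<Rightarrow> 'a set" where "U_iter n = {x. \<forall>i\<le>2 * n - 2. (f ^^ i) x \<in> N - L}"

lemma stay_L:
  assumes "(f ^^ i) x \<in> L" "i \<le> k" "\<And>j. i \<le> j \<Longrightarrow> j \<le> k \<Longrightarrow> (f ^^ j) x \<in> N"
  shows "(f ^^ k) x \<in> L"
  using assms(2,1,3)
proof (induction k rule: dec_induct)
  case (step k)
  have "(f ^^ k) x \<in> L" by (rule step.IH) (use step.prems in auto)
  moreover have "(f ^^ Suc k) x \<in> N" by (rule step.prems(2)) (use step.hyps in auto)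
  ultimately show ?case using f_L by simp
qed

text \<open>At the first time outside \<open>N - L\<close> the orbit is still in \<open>N\<close>,
  either as its start or because the previous point was in \<open>N - L\<close>; so it is in
  \<open>L\<close>.\<close>

lemma first_exit:
  assumes "x \<in> N" "(f ^^ i) x \<notin> N - L"
  obtains j where "j \<le> i" "\<And>l. l < j \<Longrightarrow> (f ^^ l) x \<in> N" "(f ^^ j) x \<in> L"
proof -
  define j where "j = (LEAST j. (f ^^ j) x \<notin> N - L)"
  have j: "(f ^^ j) x \<notin> N - L" unfolding j_def using assms(2) by (rule LeastI)
  have l: "(f ^^ l) x \<in> N - L" if "l < j" for l using not_less_Least that unfolding j_def by blast
  have "(f ^^ j) x \<in> N"
  proof (cases j)
    case 0 then show ?thesis using assms(1) by simp
  next
    case (Suc k)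
    then show ?thesis using l[of k] f_NL by simp
  qed
  moreover have "j \<le> i" unfolding j_def using assms(2) by (rule Least_le)
  ultimately show thesis using that[of j] j l by blast
qed

lemma iterate_index_pair:
  assumes n: "n \<ge> 1"
  shows "index_pair M (f ^^ n) (iterate_domain f D n) X (N_iter n) (N_iter n - U_iter n)"
proof -
  let ?P = "N_iter n" and ?U = "U_iter n" and ?E = "{x. \<forall>i<Suc (2 * n - 2). (f ^^ i) x \<in> E}"
  have UP: "?U \<subseteq> ?P" unfolding U_iter_def N_iter_def using n by auto
  have PD: "?P \<subseteq> iterate_domain f D n" unfolding N_iter_def iterate_domain_def using ND by auto
  obtain k where k: "n = Suc k" using n by (cases n) auto
  have Pc: "compactin M ?P"
  proof -
    have "?P = {x. (\<forall>i<k. (f ^^ i) x \<in> N) \<and> (f ^^ k) x \<in> N}"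
      unfolding N_iter_def k by (auto simp: less_Suc_eq)
    then show ?thesis using compact_orbit_set[OF N_compact ND N_compact] by simp
  qed
  have Ec: "compactin M ?E"
  proof -
    have "?E = {x. (\<forall>i<2 * n - 2. (f ^^ i) x \<in> E) \<and> (f ^^ (2 * n - 2)) x \<in> E}"
      by (auto simp: less_Suc_eq)
    then show ?thesis using compact_orbit_set[OF E_subset(4,3,4)] by simp
  qed
  \<comment> \<open>Being in \<open>L\<close> at a given time, and in \<open>N\<close> before, is a
    compact condition; this finite union yields compactness of the new exit set.\<close>
  have Qeq: "?P - ?U = ?P \<inter> (\<Union>i\<le>2 * n - 2. {x. (\<forall>j<i. (f ^^ j) x \<in> N) \<and> (f ^^ i) x \<in> L})"
  proof (intro Set.set_eqI iffI)
    fix x assume x: "x \<in> ?P - ?U"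
    then obtain i where i: "i \<le> 2 * n - 2" "(f ^^ i) x \<notin> N - L" unfolding U_iter_def by auto
    have "x \<in> N" using x n unfolding N_iter_def by force
    obtain j where j: "j \<le> i" "\<And>l. l < j \<Longrightarrow> (f ^^ l) x \<in> N" "(f ^^ j) x \<in> L"
      by (rule first_exit[OF \<open>x \<in> N\<close> i(2)]) (rule that)
    then have "j \<in> {..2 * n - 2}" "x \<in> {x. (\<forall>l<j. (f ^^ l) x \<in> N) \<and> (f ^^ j) x \<in> L}" using i by auto
    then show "x \<in> ?P \<inter> (\<Union>i\<le>2 * n - 2. {x. (\<forall>j<i. (f ^^ j) x \<in> N) \<and> (f ^^ i) x \<in> L})"
      using x by blast
  qed (auto simp: U_iter_def)
  have Qc: "compactin M (?P - ?U)" unfolding Qeq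
  proof (rule compact_Int_closedin[OF Pc], rule compactin_imp_closedin[OF Hausdorff_M], rule compactin_Union)
    show "compactin M S" if "S \<in> (\<lambda>i. {x. (\<forall>j<i. (f ^^ j) x \<in> N) \<and> (f ^^ i) x \<in> L}) ` {..2 * n - 2}" for S
      using that compact_orbit_set[OF N_compact ND L_compact] by auto
  qed auto
  have dif: "?P - (?P - ?U) = ?U" using UP by blast
  let ?F = "M closure_of ?U"
  have FE: "?F \<subseteq> ?E"
    by (rule closure_of_minimal[OF _ compactin_imp_closedin[OF Hausdorff_M Ec]])
      (use E_subset(1) in \<open>auto simp: U_iter_def\<close>)
  have Fc: "compactin M ?F" using closed_compactin[OF Ec FE] by simp
  have FD: "?F \<subseteq> iterate_domain f D n"
    using FE E_subset(3) n unfolding iterate_domain_def by fastforce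
  have V: "openin M {x. \<forall>i\<le>2 * n - 2. (f ^^ i) x \<in> A0}"
    by (rule open_orbit_set[OF A0(1)]) (use A0(3) ND in auto)
  have VU: "{x. \<forall>i\<le>2 * n - 2. (f ^^ i) x \<in> A0} \<subseteq> ?U" unfolding U_iter_def using A0(3) by auto
  have UF: "?U \<subseteq> ?F" using compactin_subset_topspace[OF Pc] UP by (intro closure_of_subset) auto
  have XV: "X \<subseteq> {x. \<forall>i\<le>2 * n - 2. (f ^^ i) x \<in> A0}" using fkX_in A0(2) by auto
  have "X = Inv (f ^^ n) ?F"
  proof
    show "X \<subseteq> Inv (f ^^ n) ?F"
    proof
      fix x assume x: "x \<in> X"
      obtain p :: "int \<Rightarrow> 'a" where p: "\<And>i. p i \<in> X" "p 0 = x" "\<And>i. f (p i) = p (i + 1)" by (rule X_orbit[OF x]) (rule that)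
      have fp: "(f ^^ j) (p i) = p (i + int j)" for i j by (induction j) (auto simp: p algebra_simps)
      have "p i \<in> ?F" for i using p(1)[of i] XV VU UF by blast
      then show "x \<in> Inv (f ^^ n) ?F" unfolding Inv_def using p(2)
        by (auto intro!: exI[of _ "\<lambda>i. p (int n * i)"] simp: fp algebra_simps)
    qed
    show "Inv (f ^^ n) ?F \<subseteq> X"
    proof
      fix x assume "x \<in> Inv (f ^^ n) ?F"
      then obtain q :: "int \<Rightarrow> 'a" where q: "\<And>i. q i \<in> ?F" "q 0 = x" "\<And>i. (f ^^ n) (q i) = q (i + 1)"
        unfolding Inv_def by auto
      \<comment> \<open>An orbit of \<open>f ^^ n\<close> in the closure of \<open>U_iter n\<close>
        is filled in to an orbit of \<open>f\<close>. Points of this closure stay in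
        \<open>E\<close> for \<open>2 * n - 1\<close> consecutive times, which covers the
        \<open>n\<close> times needed.\<close>
      define p where "p j = (f ^^ nat (j mod int n)) (q (j div int n))" for j
      have pE: "p j \<in> E" for j
      proof -
        have "j mod int n < int n" using n by (intro pos_mod_bound) simp
        then have "nat (j mod int n) < Suc (2 * n - 2)" using n by linarith
        then show ?thesis using q(1)[of "j div int n"] FE unfolding p_def by blast
      qed
      moreover have "f (p j) = p (j + 1)" for j
      proof -
        define d where "d = j div int n"
        define l where "l = nat (j mod int n)"
        have b: "0 \<le> j mod int n" "j mod int n < int n" using n by simp_all
        have j: "j = int n * d + int l" unfolding d_def l_def using b(1) by simp
        have ln: "l < n" unfolding l_def using b by linarith
        have pj: "p j = (f ^^ l) (q d)" unfolding p_def d_def l_def ..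
        show ?thesis
        proof (cases "Suc l = n")
          case True
          have "j + 1 = int n * (d + 1)" unfolding j using True by (simp add: algebra_simps)
          then have "p (j + 1) = q (d + 1)" unfolding p_def using n by simp
          then show ?thesis unfolding pj q(3)[symmetric] True[symmetric] by simp
        next
          case False
          then have "Suc l < n" using ln by simp
          then have "(j + 1) div int n = d" "nat ((j + 1) mod int n) = Suc l"
            using int_div_pos_eq[of "j + 1" "int n" d "int (Suc l)"] int_mod_pos_eq[of "j + 1" "int n" d "int (Suc l)"]
            by (simp_all add: j algebra_simps)
          then show ?thesis unfolding pj unfolding p_def by simp
        qed
      qed
      moreover have "p 0 = x" unfolding p_def using q(2) by simp
      ultimately have "x \<in> Inv f E" unfolding Inv_def using pE[of 0] by auto
      then show "x \<in> X" using E_subset(5) by simp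
    qed
  qed
  moreover have "neighbourhood_of M ?F X"
    unfolding neighbourhood_of_def
    using interior_of_maximal[OF subset_trans[OF VU UF] V] XV compactin_subset_topspace[OF Fc] by blast
  ultimately have iso: "isolating_neighbourhood M (f ^^ n) (iterate_domain f D n) X ?F"
    unfolding isolating_neighbourhood_def using Fc FD by blast
  have ii: "(f ^^ n) x \<in> ?P" if "x \<in> ?U" for x
  proof -
    have "(f ^^ (i + n)) x \<in> N" if "i < n" for i
    proof (cases "i + n \<le> 2 * n - 2")
      case True then show ?thesis using \<open>x \<in> ?U\<close> unfolding U_iter_def by blast
    next
      case False
      then have "i + n = Suc (2 * n - 2)" using that by linarith
      moreover have "(f ^^ (2 * n - 2)) x \<in> N - L" using \<open>x \<in> ?U\<close> unfolding U_iter_def by blast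
      ultimately show ?thesis using f_NL by simp
    qed
    then show ?thesis unfolding N_iter_def by (auto simp: funpow_add)
  qed
  have iii: "(f ^^ n) x \<notin> ?U" if x: "x \<in> ?P" "x \<notin> ?U" for x
  proof
    assume "(f ^^ n) x \<in> ?U"
    then have U: "(f ^^ (i + n)) x \<in> N - L" if "i \<le> 2 * n - 2" for i
      using that unfolding U_iter_def by (simp add: funpow_add)
    obtain i where i: "i \<le> 2 * n - 2" "(f ^^ i) x \<notin> N - L" using x unfolding U_iter_def by auto
    \<comment> \<open>Failures from time \<open>n\<close> on are excluded by \<open>U\<close>. The
      exit thus happens before time \<open>n\<close>, and as the orbit stays in \<open>N\<close>
      until then, it is still in \<open>L\<close> at time \<open>n\<close>.\<close>
    have "i < n" using U[of "i - n"] i by (cases "i < n") auto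
    then have "(f ^^ i) x \<in> L" using i(2) x(1) unfolding N_iter_def by blast
    moreover have "(f ^^ j) x \<in> N" if "j \<le> n" for j
      using U[of 0] x(1) that unfolding N_iter_def by (cases "j = n") auto
    ultimately have "(f ^^ n) x \<in> L" using stay_L[of i x n] \<open>i < n\<close> by simp
    then show False using U[of 0] by simp
  qed
  have XQ: "X \<inter> (?P - ?U) = {}" using XV VU by blast
  show ?thesis unfolding index_pair_def dif
    using Pc Qc PD iso XQ ii iii by blast
qed

lemma quotient_open_iff:
  assumes A: "openin M A" "A \<subseteq> N - L" and S: "S \<subseteq> A"
  shows "openin Z (Some ` S) \<longleftrightarrow> openin M S"
proof
  assume o: "openin M S"
  have "Some ` (S \<inter> N) = Some ` S" using A S by auto
  then show "openin Z (Some ` S)" using quotient_openI(1)[OF o N_top, of L] A S by auto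
next
  assume "openin Z (Some ` S)"
  then have "openin (subtopology M N) {x \<in> topspace (subtopology M N). collapse L x \<in> Some ` S}"
    unfolding openin_quotient_space by blast
  moreover have "{x \<in> topspace (subtopology M N). collapse L x \<in> Some ` S} = S"
    using A S N_top by (auto simp: collapse_def)
  ultimately obtain O' where "openin M O'" "S = O' \<inter> N" unfolding openin_subtopology by auto
  moreover have "O' \<inter> N = O' \<inter> A" using calculation A S by auto
  ultimately show "openin M S" using A by auto
qed

lemma quotient_closed:
  assumes "openin M V" "L \<subseteq> V" shows "closedin Z (Some ` (N - V))"
proof -
  have "topspace Z - insert None (Some ` (V \<inter> N - L)) = Some ` (N - V)" unfolding top_Z using assms(2) by auto
  then show ?thesis using quotient_openI(2)[OF assms(1) N_top assms(2)] openin_closedin_eq by (metis closedin_diff closedin_topspace)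
qed

lemma base_closed: "closedin Z {None}"
  using closedin_Hausdorff_sing_eq[OF Z_Hausdorff] by (simp add: top_Z)

end

text \<open>Links the power \<open>n\<close> of the index map of one pair to the index map of a pair
  for \<open>f ^^ n\<close>. The case \<open>n = 1\<close> compares two index pairs of the same
  map.\<close>

lemma index_shift_pair:
  assumes a: "index_system M f D X N L" and b: "index_system M (f ^^ n) D' X P Q" and n: "n \<ge> 1"
  obtains A m B B' where "shift_pair (quotient_space M N L) (quotient_space M P Q) (index_map f N L ^^ n)
    (index_map (f ^^ n) P Q) (f ^^ n) A m B B'"
proof -
  interpret a: index_system M f D X N L by fact
  interpret b: index_system M "f ^^ n" D' X P Q by fact
  have "disjnt X (L \<union> Q)" using a.XL b.XL unfolding disjnt_def by blast
  then obtain V1 V2 where V: "openin M V1" "openin M V2" "X \<subseteq> V1" "L \<union> Q \<subseteq> V2" "disjnt V1 V2"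
    using Hausdorff_space_compact_separation[OF a.Hausdorff_M a.X_compact compactin_Un[OF a.L_compact b.L_compact]] by blast
  \<comment> \<open>The iterates up to time \<open>n\<close> stay in both sets \<open>A0\<close>, so
    on \<open>A\<close> the power of the first index map and the second index map both act as
    \<open>f ^^ n\<close>. Disjointness from \<open>V2\<close> keeps \<open>A\<close> away from the
    base points.\<close>
  define A where "A = V1 \<inter> {x. \<forall>i\<le>n. (f ^^ i) x \<in> a.A0 \<inter> b.A0}"
  have A: "openin M A" unfolding A_def
    by (intro openin_Int V a.open_orbit_set a.A0 b.A0) (use a.A0(3) a.ND in auto)
  have XA: "X \<subseteq> A" unfolding A_def using V(3) a.A0(2) b.A0(2) a.fkX_in by auto
  have orb: "x \<in> A \<Longrightarrow> i \<le> n \<Longrightarrow> (f ^^ i) x \<in> N - L" "x \<in> A \<Longrightarrow> i \<le> n \<Longrightarrow> (f ^^ i) x \<in> P - Q" for x i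
    unfolding A_def using a.A0(3) b.A0(3) by auto
  have AN: "A \<subseteq> N - L" "A \<subseteq> P - Q" using orb(1)[of _ 0] orb(2)[of _ 0] by auto
  have AV: "A \<inter> V2 = {}" unfolding A_def using V(5) unfolding disjnt_def by blast
  obtain m1 where m1: "\<And>k z. z \<in> topspace a.Z \<Longrightarrow> k \<ge> m1 \<Longrightarrow> (a.T ^^ (2 * k)) z \<noteq> None \<Longrightarrow> (a.T ^^ k) z \<in> Some ` A"
    by (rule a.T_core[OF A XA]) (rule that)
  obtain m2 where m2: "\<And>k z. z \<in> topspace b.Z \<Longrightarrow> k \<ge> m2 \<Longrightarrow> (b.T ^^ (2 * k)) z \<noteq> None \<Longrightarrow> (b.T ^^ k) z \<in> Some ` A"
    by (rule b.T_core[OF A XA]) (rule that)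
  have "shift_pair a.Z b.Z (a.T ^^ n) b.T (f ^^ n) A (max m1 m2) (Some ` (N - V2)) (Some ` (P - V2))"
  proof
    show "continuous_map a.Z a.Z (a.T ^^ n)" by (rule continuous_map_funpow[OF a.T_cont])
    show "continuous_map b.Z b.Z b.T" by (rule b.T_cont)
    show "None \<in> topspace a.Z" "None \<in> topspace b.Z" using a.top_Z b.top_Z by auto
    show "(a.T ^^ n) None = None" "b.T None = None" by simp_all
    show "closedin a.Z {None}" "closedin b.Z {None}" by (rule a.base_closed b.base_closed)+
    show "openin a.Z (Some ` A)" "openin b.Z (Some ` A)"
      using a.quotient_open_iff[OF A AN(1)] b.quotient_open_iff[OF A AN(2)] A by auto
    then show "subtopology a.Z (Some ` A) = subtopology b.Z (Some ` A)"
      unfolding topology_eq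
      using a.quotient_open_iff[OF A AN(1)] b.quotient_open_iff[OF A AN(2)]
      by (auto simp: openin_open_subtopology subset_image_iff)
    show "(a.T ^^ n) (Some x) = Some ((f ^^ n) x)" if "x \<in> A" for x
      using a.Tk_Some[of n x] orb(1)[OF that] by blast
    show "b.T (Some x) = Some ((f ^^ n) x)" if "x \<in> A" for x
      using orb(2)[OF that, of 0] orb(2)[OF that, of n] by (simp add: b.T_Some)
    show "(a.T ^^ n) (Some x) = Some ((f ^^ n) x)" if "(a.T ^^ n) (Some x) \<noteq> None" for x
      using a.Tk_Some(2)[OF that] .
    show "b.T (Some x) = Some ((f ^^ n) x)" if "b.T (Some x) \<noteq> None" for x
      using that by (auto simp: b.T_Some split: if_splits)
    show "((a.T ^^ n) ^^ max m1 m2) z \<in> Some ` A" if "z \<in> topspace a.Z" "((a.T ^^ n) ^^ (2 * max m1 m2)) z \<noteq> None" for z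
    proof -
      \<comment> \<open>Time for the first system is counted in steps of \<open>f\<close>: the power
        \<open>max m1 m2\<close> of \<open>T ^^ n\<close> takes \<open>n * max m1 m2\<close>
        steps.\<close>
      have "m1 \<le> n * max m1 m2" using n by (cases n) auto
      moreover have "(a.T ^^ (2 * (n * max m1 m2))) z \<noteq> None" using that(2) by (simp add: funpow_mult algebra_simps)
      ultimately show ?thesis using m1[OF that(1)] by (simp add: funpow_mult)
    qed
    show "(b.T ^^ max m1 m2) z \<in> Some ` A" if "z \<in> topspace b.Z" "(b.T ^^ (2 * max m1 m2)) z \<noteq> None" for z
      by (rule m2) (use that in auto)
    show "closedin a.Z (Some ` (N - V2))" "closedin b.Z (Some ` (P - V2))"
      using a.quotient_closed[OF V(2)] b.quotient_closed[OF V(2)] V(4) by auto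
    show "Some ` A \<subseteq> Some ` (N - V2)" "Some ` A \<subseteq> Some ` (P - V2)" using AN AV by auto
  qed auto
  then show thesis by (rule that)
qed

lemma index_shift_maps:
  assumes "index_system M f D X N L" "index_system M (f ^^ n) D' X P Q" "n \<ge> 1"
  obtains r s k where
    "continuous_map (quotient_space M N L) (quotient_space M P Q) r" "r None = None"
    "\<And>z. z \<in> topspace (quotient_space M N L) \<Longrightarrow> r ((index_map f N L ^^ n) z) = index_map (f ^^ n) P Q (r z)"
    "continuous_map (quotient_space M P Q) (quotient_space M N L) s" "s None = None"
    "\<And>z. z \<in> topspace (quotient_space M P Q) \<Longrightarrow> s (index_map (f ^^ n) P Q z) = (index_map f N L ^^ n) (s z)"
    "\<And>z. z \<in> topspace (quotient_space M N L) \<Longrightarrow> s (r z) = ((index_map f N L ^^ n) ^^ k) z"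
    "\<And>z. z \<in> topspace (quotient_space M P Q) \<Longrightarrow> r (s z) = (index_map (f ^^ n) P Q ^^ k) z"
proof -
  obtain A m B B' where "shift_pair (quotient_space M N L) (quotient_space M P Q) (index_map f N L ^^ n)
    (index_map (f ^^ n) P Q) (f ^^ n) A m B B'" by (rule index_shift_pair[OF assms])
  then interpret shift_pair "quotient_space M N L" "quotient_space M P Q" "index_map f N L ^^ n"
    "index_map (f ^^ n) P Q" "f ^^ n" A m B B' .
  show thesis
  proof (rule s_exists)
    fix s assume s: "continuous_map (quotient_space M P Q) (quotient_space M N L) s" "s None = None"
      "\<And>z. z \<in> topspace (quotient_space M P Q) \<Longrightarrow> s (index_map (f ^^ n) P Q z) = (index_map f N L ^^ n) (s z)"
      "\<And>z. z \<in> topspace (quotient_space M N L) \<Longrightarrow> s (r z) = ((index_map f N L ^^ n) ^^ (6 * m)) z"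
      "\<And>z. z \<in> topspace (quotient_space M P Q) \<Longrightarrow> r (s z) = (index_map (f ^^ n) P Q ^^ (6 * m)) z"
    show thesis by (rule that[OF r_cont r_None r_T s])
  qed
qed

context index_system
begin

lemma iterate_index_system:
  assumes n: "n \<ge> 1" and "index_pair M (f ^^ n) (iterate_domain f D n) X P Q"
  shows "index_system M (f ^^ n) (iterate_domain f D n) X P Q"
  by (rule index_system.intro[OF iterate_system[OF n]], unfold_locales) (use assms(2) X_compact fkX in auto)

text \<open>The cohomology of \<open>Z\<close> with the map induced by \<open>T ^^ n\<close> belongs
  to the class: \<open>iterate_index_pair\<close> provides an index pair of \<open>f ^^ n\<close>,
  whose index map is shift equivalent to \<open>T ^^ n\<close>. Any other finite dimensional member
  has the same trace.\<close>

lemma conley_index_trace: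
  assumes fd: "fin_dim_vs (cech_cohomology Z {None} 1 :: ('k::field, ('a option, 'k) cech) module)" and n: "n \<ge> 1"
  shows "shift_class_trace (conley_index M (f ^^ n) (iterate_domain f D n) X 1 ::
      (('k, ('a option, 'k) cech) module \<times> _) set) =
    linear_trace (cech_cohomology Z {None} 1 :: ('k, ('a option, 'k) cech) module) (cech_map Z {None} 1 (T ^^ n))"
proof -
  let ?V = "cech_cohomology Z {None} 1 :: ('k, ('a option, 'k) cech) module"
  let ?S = "cech_map Z {None} 1 (T ^^ n) :: ('a option, 'k) cech \<Rightarrow> _"
  have se: "shift_equivalent (?V, ?S) (pointed_cohomology M P Q 1, index_cohomology_map M (f ^^ n) P Q 1)"
    if pq: "index_pair M (f ^^ n) (iterate_domain f D n) X P Q" for P Q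
  proof (rule index_shift_maps[OF index_system_axioms iterate_index_system[OF n pq] n])
    interpret b: index_system M "f ^^ n" "iterate_domain f D n" X P Q by (rule iterate_index_system[OF n pq])
    fix r s k
    assume *: "continuous_map Z b.Z r" "r None = None" "\<And>z. z \<in> topspace Z \<Longrightarrow> r ((T ^^ n) z) = b.T (r z)"
      "continuous_map b.Z Z s" "s None = None" "\<And>z. z \<in> topspace b.Z \<Longrightarrow> s (b.T z) = (T ^^ n) (s z)"
      "\<And>z. z \<in> topspace Z \<Longrightarrow> s (r z) = ((T ^^ n) ^^ k) z" "\<And>z. z \<in> topspace b.Z \<Longrightarrow> r (s z) = (b.T ^^ k) z"
    show ?thesis
      by (rule shift_equivalent_cech[OF continuous_map_funpow[OF T_cont] Tk_None b.T_cont b.T_None *])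
  qed
  let ?C = "conley_index M (f ^^ n) (iterate_domain f D n) X 1 :: (('k, ('a option, 'k) cech) module \<times> _) set"
  have mem: "(?V, ?S) \<in> ?C" unfolding conley_index_def using iterate_index_pair[OF n] se by blast
  have fdV: "vectorspace.fin_dim class_ring ?V" using fd by (simp only: fin_dim_vs_iff)
  show ?thesis unfolding shift_class_trace_def
  proof (rule the_equality)
    show "\<exists>(V, T)\<in>?C. vectorspace.fin_dim class_ring V \<and> linear_trace ?V ?S = linear_trace V T"
      using mem fdV by blast
    fix t assume "\<exists>(V, T)\<in>?C. vectorspace.fin_dim class_ring V \<and> t = linear_trace V T"
    then obtain V T' where V: "(V, T') \<in> ?C" "vectorspace.fin_dim class_ring V" "t = linear_trace V T'" by blast
    from V(1) obtain P Q where pq: "index_pair M (f ^^ n) (iterate_domain f D n) X P Q"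
      "shift_equivalent (V, T') (pointed_cohomology M P Q 1, index_cohomology_map M (f ^^ n) P Q 1)"
      unfolding conley_index_def by blast
    have "shift_equivalent (V, T') (?V, ?S)" by (rule shift_equivalent_trans[OF pq(2) shift_equivalent_sym[OF se[OF pq(1)]]])
    from shift_equivalent_trace[OF this V(2) fdV] show "t = linear_trace ?V ?S" using V(3) by simp
  qed
qed

end

section \<open>Dynamics on the compactified unstable manifold\<close>

context index_system
begin

sublocale lim: inverse_limit Z T
  by unfold_locales (rule Z_compact Z_Hausdorff T_cont)+

lemma W_eq: "unstable_compactification M f N L = lim.W"
  unfolding unstable_compactification_def lim.W_def ..

lemma F_eq: "lifted_map f N L = lim.F"
  unfolding lifted_map_def lim.F_def by (rule ext) simp

definition Q :: "(nat \<Rightarrow> 'a option) set" where "Q = {\<xi> \<in> topspace lim.W. \<xi> 0 \<noteq> None}"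
definition K :: "(nat \<Rightarrow> 'a option) set" where "K = {\<xi> \<in> topspace lim.W. \<forall>i. \<xi> i \<in> Some ` X}"

lemma K_eq: "lifted_set M f N L X = K"
  unfolding lifted_set_def K_def W_eq ..

lemma T_X: "x \<in> X \<Longrightarrow> (T ^^ k) (Some x) = Some ((f ^^ k) x)"
  using Tk_Some[of k x] fkX_in A0 by blast

text \<open>A point of the limit has an infinite past. Survival for \<open>m\<close> steps after
  time 0 therefore gives every coordinate \<open>m\<close> steps on either side, which forces it
  into the core.\<close>

lemma core_W:
  assumes A: "openin M A" "X \<subseteq> A"
  obtains m where "\<And>\<xi> i. \<xi> \<in> topspace lim.W \<Longrightarrow> (T ^^ m) (\<xi> 0) \<noteq> None \<Longrightarrow> \<xi> i \<in> Some ` A"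
proof -
  obtain m where m: "\<And>k z. z \<in> topspace Z \<Longrightarrow> k \<ge> m \<Longrightarrow> (T ^^ (2 * k)) z \<noteq> None \<Longrightarrow> (T ^^ k) z \<in> Some ` A"
    by (rule T_core[OF A]) (rule that)
  show thesis
  proof (rule that[of m])
    fix \<xi> i assume x: "\<xi> \<in> topspace lim.W" "(T ^^ m) (\<xi> 0) \<noteq> None"
    have "(T ^^ i) ((T ^^ m) (\<xi> i)) = (T ^^ m) ((T ^^ i) (\<xi> (0 + i)))"
      by (simp add: funpow_add[THEN fun_cong, simplified, symmetric] add.commute)
    also have "\<dots> = (T ^^ m) (\<xi> 0)" using lim.fpow_proj[OF x(1), of i 0] by simp
    finally have "(T ^^ m) (\<xi> i) \<noteq> None" using x(2) by (metis Tk_None)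
    then have "(T ^^ (2 * m)) (\<xi> (i + m)) \<noteq> None"
      using lim.fpow_proj[OF x(1), of m i] by (simp add: mult_2 funpow_add)
    from m[OF _ order_refl this] show "\<xi> i \<in> Some ` A"
      using lim.fpow_proj[OF x(1), of m i] x(1) unfolding lim.topspace_W by auto
  qed
qed

lemma X_closed: "closedin M X"
  by (rule compactin_imp_closedin[OF Hausdorff_M X_compact])

lemma X_NL: "X \<subseteq> N - L"
  using A0 by blast

lemma Q_open: "openin lim.W Q"
proof -
  have "openin lim.W {\<xi> \<in> topspace lim.W. \<xi> 0 \<in> topspace Z - {None}}"
    by (rule openin_continuous_map_preimage[OF lim.proj_cont]) (use base_closed in auto)
  moreover have "{\<xi> \<in> topspace lim.W. \<xi> 0 \<in> topspace Z - {None}} = Q"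
    unfolding Q_def lim.topspace_W by auto
  ultimately show ?thesis by simp
qed

text \<open>If a coordinate were not in \<open>X\<close>, \<open>core_W\<close> applied to the
  complement of that single value would contradict survival for all times.\<close>

lemma K_iff: "K = (\<Inter>k. {\<xi> \<in> topspace lim.W. (lim.F ^^ k) \<xi> \<in> Q})"
proof (intro Set.set_eqI iffI)
  fix \<xi> assume "\<xi> \<in> K"
  then have x: "\<xi> \<in> topspace lim.W" "\<xi> 0 \<in> Some ` X" unfolding K_def by auto
  have "(lim.F ^^ k) \<xi> \<in> topspace lim.W" for k using x lim.F_in by (induction k) auto
  moreover have "(T ^^ k) (\<xi> 0) \<noteq> None" for k using x(2) T_X by auto
  ultimately show "\<xi> \<in> (\<Inter>k. {\<xi> \<in> topspace lim.W. (lim.F ^^ k) \<xi> \<in> Q})"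
    using x unfolding Q_def by (simp add: lim.Fk_0)
next
  fix \<xi> assume "\<xi> \<in> (\<Inter>k. {\<xi> \<in> topspace lim.W. (lim.F ^^ k) \<xi> \<in> Q})"
  then have x: "\<xi> \<in> topspace lim.W" "\<And>k. (T ^^ k) (\<xi> 0) \<noteq> None" unfolding Q_def by (auto simp: lim.Fk_0)
  have "\<xi> i \<in> Some ` X" for i
  proof (rule ccontr)
    assume n: "\<xi> i \<notin> Some ` X"
    define S where "S = {y \<in> topspace M. \<xi> i = Some y}"
    have "openin M (topspace M - S)"
    proof (cases "\<xi> i")
      case None then show ?thesis unfolding S_def by simp
    next
      case (Some y)
      then have "S \<subseteq> {y}" "S = {} \<or> y \<in> topspace M" unfolding S_def by auto
      then have "S = {} \<or> (S = {y} \<and> y \<in> topspace M)" by auto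
      then show ?thesis using closedin_Hausdorff_sing_eq[OF Hausdorff_M, of y] by auto
    qed
    moreover have "X \<subseteq> topspace M - S" using n X_closed closedin_subset unfolding S_def by fastforce
    ultimately obtain m where "\<And>\<xi> i. \<xi> \<in> topspace lim.W \<Longrightarrow> (T ^^ m) (\<xi> 0) \<noteq> None \<Longrightarrow> \<xi> i \<in> Some ` (topspace M - S)"
      by (rule core_W) (rule that)
    from this[OF x(1) x(2), of i] show False unfolding S_def by auto
  qed
  then show "\<xi> \<in> K" unfolding K_def using x by simp
qed

text \<open>As for \<open>K_iff\<close>, but the excluded value and \<open>L\<close> are separated
  from \<open>X\<close> by disjoint open sets; the resulting constraint on the coordinate is closed
  and passes to the closure.\<close>

lemma K_cl: "(\<Inter>k. lim.W closure_of {\<xi> \<in> topspace lim.W. (lim.F ^^ k) \<xi> \<in> Q}) \<subseteq> K"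
proof
  fix \<xi> assume cl: "\<xi> \<in> (\<Inter>k. lim.W closure_of {\<xi> \<in> topspace lim.W. (lim.F ^^ k) \<xi> \<in> Q})"
  then have x: "\<xi> \<in> topspace lim.W" using closure_of_subset_topspace by fastforce
  have "\<xi> i \<in> Some ` X" for i
  proof (rule ccontr)
    assume n: "\<xi> i \<notin> Some ` X"
    define S where "S = L \<union> {y \<in> N. \<xi> i = Some y}"
    have "finite {y \<in> N. \<xi> i = Some y}" by (rule finite_subset[of _ "{the (\<xi> i)}"]) auto
    then have "compactin M {y \<in> N. \<xi> i = Some y}" using N_top by (intro finite_imp_compactin) auto
    then have "compactin M S" unfolding S_def by (rule compactin_Un[OF L_compact])
    moreover have "disjnt X S" unfolding S_def disjnt_def using XL n by auto
    ultimately obtain V1 V2 where V: "openin M V1" "openin M V2" "X \<subseteq> V1" "S \<subseteq> V2" "disjnt V1 V2"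
      using Hausdorff_space_compact_separation[OF Hausdorff_M X_compact] by blast
    obtain m where m: "\<And>\<eta> i. \<eta> \<in> topspace lim.W \<Longrightarrow> (T ^^ m) (\<eta> 0) \<noteq> None \<Longrightarrow> \<eta> i \<in> Some ` V1"
      by (rule core_W[OF V(1,3)]) (rule that)
    define B where "B = {\<eta> \<in> topspace lim.W. \<eta> i \<in> Some ` (N - V2)}"
    have "closedin Z (Some ` (N - V2))" by (rule quotient_closed[OF V(2)]) (use V(4) in \<open>auto simp: S_def\<close>)
    then have "closedin lim.W B" unfolding B_def by (rule closedin_continuous_map_preimage[OF lim.proj_cont])
    moreover have "{\<xi> \<in> topspace lim.W. (lim.F ^^ m) \<xi> \<in> Q} \<subseteq> B"
    proof
      fix \<eta> assume "\<eta> \<in> {\<xi> \<in> topspace lim.W. (lim.F ^^ m) \<xi> \<in> Q}"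
      then have e: "\<eta> \<in> topspace lim.W" "(T ^^ m) (\<eta> 0) \<noteq> None" unfolding Q_def by (auto simp: lim.Fk_0)
      then have "\<eta> i \<in> topspace Z" unfolding lim.topspace_W by blast
      then show "\<eta> \<in> B" using m[OF e, of i] e(1) V(5) unfolding B_def top_Z disjnt_def by auto
    qed
    ultimately have "lim.W closure_of {\<xi> \<in> topspace lim.W. (lim.F ^^ m) \<xi> \<in> Q} \<subseteq> B" by (intro closure_of_minimal)
    then have "\<xi> \<in> B" using cl by blast
    then show False using V(4) unfolding B_def S_def by auto
  qed
  then show "\<xi> \<in> K" unfolding K_def using x by simp
qed

text \<open>\<open>K\<close> is itself the inverse limit of the index map on \<open>X\<close>, so
  the results on inverse limits apply to it. As \<open>f\<close> maps \<open>X\<close> onto itself,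
  the stable image is all of \<open>X\<close>.\<close>

lemma restricted_limit:
  shows "inverse_limit (subtopology Z (Some ` X)) T"
    and "inverse_limit.W (subtopology Z (Some ` X)) T = subtopology lim.W K"
    and "inverse_limit.\<Omega> (subtopology Z (Some ` X)) T = Some ` X"
proof -
  have XZ: "Some ` X \<subseteq> topspace Z" using X_NL by (auto simp: top_Z)
  have TX: "T ` Some ` X = Some ` X" using T_X[of _ 1] fX by (auto simp: image_iff) (metis imageE)
  have "continuous_map (subtopology M N) Z (collapse L)"
    unfolding continuous_map_def openin_quotient_space using N_top top_Z by (auto simp: collapse_def)
  then have "compactin Z (collapse L ` X)"
    using X_compact X_NL by (intro image_compactin) (auto simp: compactin_subtopology)
  moreover have "collapse L ` X = Some ` X" using XL by (auto simp: collapse_def)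
  ultimately have c: "compactin Z (Some ` X)" by simp
  show il: "inverse_limit (subtopology Z (Some ` X)) T"
  proof
    show "compact_space (subtopology Z (Some ` X))" by (rule compact_space_subtopology[OF c])
    show "Hausdorff_space (subtopology Z (Some ` X))" by (rule Hausdorff_space_subtopology[OF Z_Hausdorff])
    show "continuous_map (subtopology Z (Some ` X)) (subtopology Z (Some ` X)) T"
      using T_cont TX by (auto simp: continuous_map_in_subtopology continuous_map_from_subtopology)
  qed
  interpret x: inverse_limit "subtopology Z (Some ` X)" T by (rule il)
  have "K = {\<xi>. \<forall>i. T (\<xi> (Suc i)) = \<xi> i} \<inter> (\<Pi>\<^sub>E i\<in>UNIV. Some ` X)"
    unfolding K_def lim.topspace_W using XZ by (auto simp: PiE_def) blast
  then show "x.W = subtopology lim.W K"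
    unfolding x.W_def lim.W_def subtopology_product_topology[symmetric] subtopology_subtopology
    by (simp add: Int_commute Int_left_commute)
  have "(T ^^ m) ` Some ` X = Some ` X" for m
  proof (induction m)
    case (Suc m)
    have "(T ^^ Suc m) ` Some ` X = T ` (T ^^ m) ` Some ` X" by auto
    then show ?case using Suc TX by simp
  qed simp
  then show "x.\<Omega> = Some ` X" unfolding x.\<Omega>_def using XZ by (simp add: inf_absorb2)
qed

lemma Some_connected: "connectedin M X \<Longrightarrow> connectedin Z (Some ` X)"
proof -
  assume X: "connectedin M X"
  have "continuous_map (subtopology M N) Z (collapse L)"
    unfolding continuous_map_def openin_quotient_space using N_top top_Z by (auto simp: collapse_def)
  moreover have "connectedin (subtopology M N) X" using X X_NL by (auto simp: connectedin_subtopology)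
  ultimately have "connectedin Z (collapse L ` X)" by (rule connectedin_continuous_map_image)
  moreover have "collapse L ` X = Some ` X" using XL by (auto simp: collapse_def)
  ultimately show ?thesis by simp
qed

text \<open>A clopen subset of an inverse limit comes from a clopen subset at one level, and here
  each level is a copy of the quotient image of the connected set \<open>X\<close>.\<close>

lemma K_connected:
  assumes "connectedin M X" shows "connectedin lim.W K"
proof -
  interpret x: inverse_limit "subtopology Z (Some ` X)" T by (rule restricted_limit)
  have cx: "connected_space (subtopology Z (Some ` X))" using Some_connected[OF assms] by (simp add: connectedin_def)
  have "connected_space x.W"
    unfolding connected_space_clopen_in
  proof (intro allI impI)
    fix P assume "openin x.W P \<and> closedin x.W P"
    then obtain k E where E: "openin (subtopology Z (Some ` X)) E" "closedin (subtopology Z (Some ` X)) E"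
      "P = {\<xi> \<in> topspace x.W. \<xi> k \<in> E}" by (elim conjE) (rule x.clopen_level, assumption, assumption, rule that)
    then have "E = {} \<or> E = topspace (subtopology Z (Some ` X))" using cx unfolding connected_space_clopen_in by blast
    then show "P = {} \<or> P = topspace x.W" unfolding E(3) x.topspace_W by auto
  qed
  then show ?thesis unfolding restricted_limit(2) connectedin_def K_def by auto
qed

lemma K_nonempty: "X \<noteq> {} \<Longrightarrow> K \<noteq> {}"
proof -
  interpret x: inverse_limit "subtopology Z (Some ` X)" T by (rule restricted_limit)
  assume "X \<noteq> {}"
  then have "topspace x.W \<noteq> {}" using x.\<Omega>_proj[of 0] unfolding restricted_limit(3) by auto
  then show ?thesis unfolding restricted_limit(2) by auto
qed

lemma infinity_in: "infinity_point \<in> topspace lim.W"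
  unfolding lim.topspace_W infinity_point_def by (simp add: top_Z)

lemma exhaust: "\<xi> \<noteq> infinity_point \<Longrightarrow> \<xi> \<in> topspace lim.W \<Longrightarrow> \<exists>k. (lim.G ^^ k) \<xi> \<in> Q"
proof -
  assume x: "\<xi> \<noteq> infinity_point" "\<xi> \<in> topspace lim.W"
  then have "\<exists>k. \<xi> k \<noteq> None" unfolding infinity_point_def by (simp add: fun_eq_iff)
  then obtain k where "\<xi> k \<noteq> None" ..
  moreover have "(lim.G ^^ k) \<xi> \<in> topspace lim.W" using x(2) lim.G_in by (induction k) auto
  ultimately show ?thesis unfolding Q_def by (intro exI[of _ k]) (simp add: lim.Gk_proj)
qed

end

locale continuum_system = index_system +
  assumes X_connected: "connectedin M X" and X_nonempty: "X \<noteq> {}"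
begin

sublocale ar: attractor_repeller lim.W lim.F lim.G Q K infinity_point
proof
  show "compact_space lim.W" "Hausdorff_space lim.W" by (rule lim.compact_W lim.Hausdorff_W)+
  show "continuous_map lim.W lim.W lim.F" "continuous_map lim.W lim.W lim.G" by (rule lim.F_cont lim.G_cont)+
  show "lim.F (lim.G \<xi>) = \<xi>" if "\<xi> \<in> topspace lim.W" for \<xi> by (rule lim.FG[OF that])
  show "lim.G (lim.F \<xi>) = \<xi>" for \<xi> by (rule lim.GF)
  show "openin lim.W Q" by (rule Q_open)
  show "lim.G \<xi> \<in> Q" if "\<xi> \<in> Q" for \<xi>
  proof -
    have "\<xi> \<in> topspace lim.W" "\<xi> 0 \<noteq> None" using that unfolding Q_def by auto
    then have "T (\<xi> (Suc 0)) \<noteq> None" "lim.G \<xi> \<in> topspace lim.W" using lim.G_in unfolding lim.topspace_W by auto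
    moreover from this have "\<xi> (Suc 0) \<noteq> None" using T_None by metis
    ultimately show ?thesis unfolding Q_def lim.G_def by simp
  qed
  show "infinity_point \<in> topspace lim.W" by (rule infinity_in)
  show "lim.F infinity_point = infinity_point" unfolding lim.F_def infinity_point_def by (auto split: nat.split)
  show "infinity_point \<notin> Q" unfolding Q_def infinity_point_def by simp
  show "K = (\<Inter>k. {x \<in> topspace lim.W. (lim.F ^^ k) x \<in> Q})" by (rule K_iff)
  show "(\<Inter>k. lim.W closure_of {x \<in> topspace lim.W. (lim.F ^^ k) x \<in> Q}) \<subseteq> K" by (rule K_cl)
  show "\<exists>k. (lim.G ^^ k) y \<in> Q" if "y \<in> topspace lim.W" "y \<noteq> infinity_point" for y by (rule exhaust[OF that(2,1)])
  show "connectedin lim.W K" by (rule K_connected[OF X_connected])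
  show "K \<noteq> {}" by (rule K_nonempty[OF X_nonempty])
qed

lemma J_eq: "essential_quasicomponents M f N L X = ar.J"
  unfolding essential_quasicomponents_def Let_def W_eq K_eq ar.J_def ar.Y_def ..

text \<open>The permutation in the formula is given by the inverse of the lifted map, the trace on
  the kernel by the lifted map itself; their powers fix the same sets.\<close>

lemma shift_fixes_iff:
  assumes "F \<in> ar.J"
  shows "(quasicomponent_shift M f N L ^^ n) F = F \<longleftrightarrow> (lim.F ^^ n) ` F = F"
proof -
  have "F \<subseteq> topspace lim.W" using ar.J_D(1)[OF assms] unfolding ar.Y_def by auto
  have inv: "inv_into (topspace lim.W) lim.F \<xi> = lim.G \<xi>" if "\<xi> \<in> topspace lim.W" for \<xi>
  proof (rule inv_into_f_eq)
    show "inj_on lim.F (topspace lim.W)" by (rule inj_on_inverseI[of _ lim.G]) (rule lim.GF)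
  qed (use that lim.FG lim.G_in in auto)
  have "(quasicomponent_shift M f N L ^^ n) F = (lim.G ^^ n) ` F \<and> (lim.G ^^ n) ` F \<subseteq> topspace lim.W"
  proof (induction n)
    case (Suc n)
    have "quasicomponent_shift M f N L ((lim.G ^^ n) ` F) = lim.G ` (lim.G ^^ n) ` F"
      unfolding quasicomponent_shift_def W_eq F_eq by (rule image_cong[OF refl inv]) (use Suc in blast)
    then show ?case using Suc lim.G_in by (auto simp: image_image)
  qed (use \<open>F \<subseteq> topspace lim.W\<close> in simp)
  moreover have "(lim.F ^^ n) ` (lim.G ^^ n) ` F = F" "(lim.G ^^ n) ` (lim.F ^^ n) ` F = F"
    using ar.ggk[of _ n] \<open>F \<subseteq> topspace lim.W\<close> by (force simp: image_image)+
  ultimately show ?thesis by metis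
qed

end

section \<open>The first cohomology of the limit\<close>

lemma as_class_cong:
  fixes C D :: "'x \<times> 'x \<Rightarrow> 'k::field"
  assumes "C \<in> asc X" "D \<in> asc X" "pointlike A" "\<And>x y. x \<in> topspace X \<Longrightarrow> y \<in> topspace X \<Longrightarrow> C (x, y) = D (x, y)"
  shows "as_class X A C = as_class X A D"
proof -
  have "near X (\<lambda>x y. C (x, y) - D (x, y) = 0 - (0::'k))"
    by (rule nearI) (use assms(4) in \<open>auto intro!: exI[of _ "topspace X"]\<close>)
  then have "cobounds X (\<lambda>w. C w - D w)" unfolding cobounds_def by (intro exI[of _ "\<lambda>_. 0"])
  then show ?thesis using as_class_eq_iff[OF assms(1-3)] by blast
qed

lemma cobounds_cong:
  assumes "cobounds X C" "\<And>x y. x \<in> topspace X \<Longrightarrow> y \<in> topspace X \<Longrightarrow> C (x, y) = D (x, y)"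
  shows "cobounds X D"
proof -
  obtain \<alpha> where "near X (\<lambda>y z. C (y, z) = \<alpha> z - \<alpha> y)" using assms(1) unfolding cobounds_def by (elim exE)
  then have "near X (\<lambda>y z. D (y, z) = \<alpha> z - \<alpha> y)" by (rule near_mono) (use assms(2) in simp)
  then show ?thesis unfolding cobounds_def by (intro exI[of _ \<alpha>])
qed

lemma as_class_zero_iff:
  fixes C :: "'x \<times> 'x \<Rightarrow> 'k::field"
  assumes "C \<in> asc X" "pointlike A"
  shows "as_class X A C = \<zero>\<^bsub>cech_cohomology X A 1\<^esub> \<longleftrightarrow> cobounds X C"
proof -
  have "(\<lambda>w. C w - 0) = C" by simp
  then show ?thesis unfolding zero_cech_1[OF assms(2)] as_class_eq_iff[OF assms(1) asc_0 assms(2)] by simp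
qed

context inverse_limit
begin

text \<open>\<open>Z'\<close> will be the quotient of the index pair with finite dimensional
  cohomology, linked to \<open>Z\<close> by \<open>r\<close> and \<open>s\<close>. Continuity of
  cohomology enters through \<open>pullback_kernel\<close> and \<open>pullback_surj\<close>, and the
  links cost only further powers of the maps.\<close>

lemma limit_cohomology:
  fixes Z' :: "'y topology" and b :: 'y and V' :: "('k::field, ('y, 'k) cech) module"
    and HW :: "('k, (nat \<Rightarrow> 'z, 'k) cech) module"
  defines "V' \<equiv> cech_cohomology Z' {b} 1" and "HW \<equiv> cech_cohomology W {} 1"
  assumes T': "continuous_map Z' Z' T'" "T' b = b" and r: "continuous_map Z Z' r" and s: "continuous_map Z' Z s"
    and rf: "\<And>z. z \<in> topspace Z \<Longrightarrow> r (f z) = T' (r z)"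
    and sr: "\<And>z. z \<in> topspace Z \<Longrightarrow> s (r z) = (f ^^ k) z"
    and rs: "\<And>z. z \<in> topspace Z' \<Longrightarrow> r (s z) = (T' ^^ k) z"
    and fd: "fin_dim_vs V'" and n: "n \<ge> 1"
  shows "fin_dim_vs HW"
    and "linear_trace V' (cech_map Z' {b} 1 (T' ^^ n)) = linear_trace HW (cech_map W {} 1 F ^^ n)"
proof -
  define \<rho> where "\<rho> \<xi> = r (\<xi> 0)" for \<xi> :: "nat \<Rightarrow> 'z"
  define p where "p = (cech_map W {} 1 \<rho> :: ('y, 'k) cech \<Rightarrow> _)"
  define S where "S = (cech_map W {} 1 F :: (nat \<Rightarrow> 'z, 'k) cech \<Rightarrow> _)"
  define R where "R = (cech_map Z' {b} 1 (T' ^^ n) :: ('y, 'k) cech \<Rightarrow> _)"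
  note pl = pointlike_simps
  have \<rho>: "continuous_map W Z' \<rho>"
    using continuous_map_compose[OF proj_cont r] unfolding \<rho>_def by (simp add: o_def)
  have Tn: "continuous_map Z' Z' (T' ^^ j)" "(T' ^^ j) ` {b} \<subseteq> {b}" for j
    using continuous_map_funpow[OF T'(1)] funpow_image_subset[of T' "{b}"] T'(2) by auto
  have vs: "is_vs V'" "is_vs HW" unfolding V'_def HW_def by (rule vs_cech_1[OF pl(2)] vs_cech_1[OF pl(1)])+
  have cV: "carrier V' = as_class Z' {b} ` asc Z'" and cW: "carrier HW = as_class W {} ` asc W"
    unfolding V'_def HW_def by (rule carrier_cech_1[OF pl(2)] carrier_cech_1[OF pl(1)])+
  have lp: "lin_map V' HW p" unfolding p_def V'_def HW_def
    by (rule cech_map_lin_map[OF \<rho> _ pl]) simp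
  have lR: "lin_map V' V' R" unfolding R_def V'_def by (rule cech_map_lin_map[OF Tn pl(2) pl(2)])
  have lS: "lin_map HW HW S" unfolding S_def HW_def by (rule cech_map_lin_map[OF F_cont _ pl(1) pl(1)]) simp
  have lSn: "lin_map HW HW (S ^^ j)" for j by (rule lin_map_funpow[OF lS])
  have pC: "p (as_class Z' {b} C) = as_class W {} (\<lambda>(x, y). C (\<rho> x, \<rho> y))" "(\<lambda>(x, y). C (\<rho> x, \<rho> y)) \<in> asc W"
    if "C \<in> asc Z'" for C :: "'y \<times> 'y \<Rightarrow> 'k"
    unfolding p_def using cech_map_as_class[OF \<rho> _ pl that, of b] asc_continuous[OF that \<rho>] by simp_all
  have RC: "(R ^^ j) (as_class Z' {b} C) = as_class Z' {b} (\<lambda>(x, y). C ((T' ^^ (n * j)) x, (T' ^^ (n * j)) y))"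
    "(\<lambda>(x, y). C ((T' ^^ j) x, (T' ^^ j) y)) \<in> asc Z'"
    if "C \<in> asc Z'" for C :: "'y \<times> 'y \<Rightarrow> 'k" and j
    unfolding R_def using cech_map_funpow(1)[OF Tn(1)[of n] Tn(2)[of n] pl(2) that, of j] asc_continuous[OF that Tn(1)[of j]]
    by (simp_all add: funpow_mult mult.commute del: One_nat_def)
  have SC: "(S ^^ j) (as_class W {} C) = as_class W {} (\<lambda>(x, y). C ((F ^^ j) x, (F ^^ j) y))"
    "(\<lambda>(x, y). C ((F ^^ j) x, (F ^^ j) y)) \<in> asc W"
    if "C \<in> asc W" for C :: "(nat \<Rightarrow> 'z) \<times> (nat \<Rightarrow> 'z) \<Rightarrow> 'k" and j
    unfolding S_def using cech_map_funpow[OF F_cont _ pl(1) that, of j] by simp_all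
  have rfj: "r ((f ^^ j) z) = (T' ^^ j) (r z)" if "z \<in> topspace Z" for j z
  proof (induction j)
    case (Suc j) then show ?case using rf[OF f_in(2)[OF that, of j]] by simp
  qed simp
  have W0: "\<xi> i \<in> topspace Z" if "\<xi> \<in> topspace W" for \<xi> i using that unfolding topspace_W by blast
  have \<rho>F: "\<rho> ((F ^^ j) \<xi>) = (T' ^^ j) (\<rho> \<xi>)" if "\<xi> \<in> topspace W" for j \<xi>
    unfolding \<rho>_def Fk_0 by (rule rfj[OF W0[OF that]])
  have eq: "p (R v) = (S ^^ n) (p v)" if "v \<in> carrier V'" for v
  proof -
    obtain C where C: "C \<in> asc Z'" "v = as_class Z' {b} C" using \<open>v \<in> carrier V'\<close> unfolding cV by auto
    have "R v = as_class Z' {b} (\<lambda>(x, y). C ((T' ^^ n) x, (T' ^^ n) y))" using RC(1)[OF C(1), of 1] C(2) by simp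
    then have "p (R v) = as_class W {} (\<lambda>(x, y). C ((T' ^^ n) (\<rho> x), (T' ^^ n) (\<rho> y)))"
      using pC(1)[OF RC(2)[OF C(1), of n]] by simp
    also have "\<dots> = as_class W {} (\<lambda>(x, y). C (\<rho> ((F ^^ n) x), \<rho> ((F ^^ n) y)))"
      by (rule as_class_cong[OF _ _ pl(1)])
        (use pC(2)[OF RC(2)[OF C(1), of n]] SC(2)[OF pC(2)[OF C(1)], of n] \<rho>F in auto)
    also have "\<dots> = (S ^^ n) (p v)" using SC(1)[OF pC(2)[OF C(1)], of n] pC(1)[OF C(1)] C(2) by simp
    finally show ?thesis .
  qed
  \<comment> \<open>\<open>G\<close> inverts \<open>F\<close>, so the induced map has a left
    inverse.\<close>
  have injS: "inj_on S (carrier HW)"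
  proof (rule inj_on_inverseI[of _ "cech_map W {} 1 G"])
    fix v assume v: "v \<in> carrier HW"
    have "cech_map W {} 1 G (S v) = cech_map W {} 1 (F \<circ> G) v"
      unfolding S_def by (rule cech_map_comp[OF G_cont _ F_cont _ pl(1) pl(1) pl(1)]) (use v in \<open>auto simp: HW_def\<close>)
    also have "\<dots> = cech_map W {} 1 id v"
      by (rule cech_map_cong[OF continuous_map_compose[OF G_cont F_cont] _ _ _ pl(1) pl(1)]) (use v FG in \<open>auto simp: HW_def\<close>)
    also have "\<dots> = v" by (rule cech_map_id[OF pl(1)]) (use v in \<open>simp add: HW_def\<close>)
    finally show "cech_map W {} 1 G (S v) = v" .
  qed
  have ker: "\<exists>j. (R ^^ j) v = \<zero>\<^bsub>V'\<^esub>" if v: "v \<in> carrier V'" "p v = \<zero>\<^bsub>HW\<^esub>" for v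
  proof -
    obtain C where C: "C \<in> asc Z'" "v = as_class Z' {b} C" using v(1) unfolding cV by auto
    have "cobounds W (\<lambda>(x, y). C (\<rho> x, \<rho> y))"
      using as_class_zero_iff[OF pC(2)[OF C(1)] pl(1)] pC(1)[OF C(1)] C(2) v(2) unfolding HW_def by simp
    moreover have "(\<lambda>(x, y). C (\<rho> x, \<rho> y)) = (\<lambda>(\<xi>, \<eta>). (\<lambda>(x, y). C (r x, r y)) (\<xi> 0, \<eta> 0))" unfolding \<rho>_def by auto
    ultimately have "cobounds W (\<lambda>(\<xi>, \<eta>). (\<lambda>(x, y). C (r x, r y)) (\<xi> 0, \<eta> 0))" by simp
    then obtain j where "cobounds Z (\<lambda>(x, y). (\<lambda>(x, y). C (r x, r y)) ((f ^^ j) x, (f ^^ j) y))"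
      by (rule pullback_kernel[OF asc_continuous[OF C(1) r]]) (rule that)
    from cobounds_continuous[OF this s]
    have 1: "cobounds Z' (\<lambda>(x, y). C ((T' ^^ (j + k)) x, (T' ^^ (j + k)) y))"
    proof (rule cobounds_cong)
      have "r ((f ^^ j) (s z)) = (T' ^^ (j + k)) z" if "z \<in> topspace Z'" for z
        using rfj[of "s z" j] rs[OF that] s that by (simp add: continuous_map_def funpow_add Pi_iff)
      then show "(\<lambda>(x, y). (\<lambda>(x, y). (\<lambda>(x, y). C (r x, r y)) ((f ^^ j) x, (f ^^ j) y)) (s x, s y)) (x, y) =
          (\<lambda>(x, y). C ((T' ^^ (j + k)) x, (T' ^^ (j + k)) y)) (x, y)" if "x \<in> topspace Z'" "y \<in> topspace Z'" for x y
        using that by simp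
    qed
    \<comment> \<open>\<open>R\<close> is induced by the power \<open>n\<close> of
      \<open>T'\<close>, so its iterates see only multiples of \<open>n\<close>; the exponent is
      enlarged to such a multiple.\<close>
    have "n * (j + k) = (j + k) + (n * (j + k) - (j + k))" using n by (cases n) auto
    then have e: "(T' ^^ (n * (j + k))) x = (T' ^^ (j + k)) ((T' ^^ (n * (j + k) - (j + k))) x)" for x
      by (metis funpow_add comp_apply)
    have "cobounds Z' (\<lambda>(x, y). C ((T' ^^ (n * (j + k))) x, (T' ^^ (n * (j + k))) y))"
      using cobounds_continuous[OF 1 Tn(1)[of "n * (j + k) - (j + k)"]] unfolding e by simp
    then have "(R ^^ (j + k)) v = \<zero>\<^bsub>V'\<^esub>"
      unfolding C(2) RC(1)[OF C(1)] V'_def using as_class_zero_iff[OF RC(2)[OF C(1)] pl(2)] by blast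
    then show ?thesis by blast
  qed
  have coker: "\<exists>j. \<forall>l\<ge>j. (S ^^ l) w \<in> p ` carrier V'" if w: "w \<in> carrier HW" for w
  proof -
    obtain C where C: "C \<in> asc W" "w = as_class W {} C" using w unfolding cW by auto
    obtain m D where D: "D \<in> asc Z" "cobounds W (\<lambda>w. C w - (\<lambda>(\<xi>, \<eta>). D (\<xi> m, \<eta> m)) w)"
      by (rule pullback_surj[OF C(1)]) (rule that)
    have Dm: "(\<lambda>(\<xi>, \<eta>). D (\<xi> m, \<eta> m)) \<in> asc W" using asc_continuous[OF D(1) proj_cont] .
    have w: "w = as_class W {} (\<lambda>(\<xi>, \<eta>). D (\<xi> m, \<eta> m))" unfolding C(2) using as_class_eq_iff[OF C(1) Dm pl(1)] D(2) by blast
    have "(S ^^ l) w \<in> p ` carrier V'" if l: "l \<ge> m + k" for l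
    proof -
      define i where "i = l - m - k"
      have cs: "continuous_map Z' Z ((f ^^ i) \<circ> s)" by (rule continuous_map_compose[OF s fpow_cont])
      define C' where "C' = (\<lambda>(x, y). D (((f ^^ i) \<circ> s) x, ((f ^^ i) \<circ> s) y))"
      have C': "C' \<in> asc Z'" unfolding C'_def by (rule asc_continuous[OF D(1) cs])
      have pt: "((f ^^ i) \<circ> s) (\<rho> \<xi>) = (F ^^ l) \<xi> m" if x: "\<xi> \<in> topspace W" for \<xi>
      proof -
        have "((f ^^ i) \<circ> s) (\<rho> \<xi>) = (f ^^ (i + k)) (\<xi> 0)" using sr[OF W0[OF x, of 0]] unfolding \<rho>_def by (simp add: funpow_add)
        also have "i + k = l - m" using l unfolding i_def by simp
        also have "(f ^^ (l - m)) (\<xi> 0) = (F ^^ l) \<xi> m" using l by (cases "m < l") (auto simp: Fk_proj)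
        finally show ?thesis .
      qed
      have "(S ^^ l) w = as_class W {} (\<lambda>(x, y). D ((F ^^ l) x m, (F ^^ l) y m))" unfolding w using SC(1)[OF Dm] by simp
      also have "\<dots> = as_class W {} (\<lambda>(x, y). C' (\<rho> x, \<rho> y))"
        by (rule as_class_cong[OF _ pC(2)[OF C'] pl(1)]) (use SC(2)[OF Dm, of l] pt in \<open>simp_all add: C'_def\<close>)
      also have "\<dots> = p (as_class Z' {b} C')" using pC(1)[OF C'] by simp
      finally show ?thesis using C' unfolding cV by blast
    qed
    then show ?thesis by blast
  qed
  let ?U = "p ` carrier V'"
  have U: "is_sub HW ?U" by (rule is_sub_image[OF vs lp])
  have fdU: "fin_dim_vs (HW\<lparr>carrier := ?U\<rparr>)" by (rule fin_dim_image[OF fd vs(2) lp lR lSn eq])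
  have SU: "S u \<in> ?U" if u: "u \<in> ?U" for u
  proof -
    obtain C where C: "C \<in> asc Z'" "u = p (as_class Z' {b} C)" using u unfolding cV by auto
    have "S u = as_class W {} (\<lambda>(x, y). C (\<rho> (F x), \<rho> (F y)))"
      using SC(1)[OF pC(2)[OF C(1)], of 1] pC(1)[OF C(1)] C(2) by simp
    also have "\<dots> = as_class W {} (\<lambda>(x, y). C (T' (\<rho> x), T' (\<rho> y)))"
      by (rule as_class_cong[OF _ _ pl(1)])
        (use pC(2)[OF RC(2)[OF C(1), of 1]] SC(2)[OF pC(2)[OF C(1)], of 1] \<rho>F[of _ 1] in auto)
    also have "\<dots> = p (as_class Z' {b} (\<lambda>(x, y). C (T' x, T' y)))" using pC(1)[OF RC(2)[OF C(1), of 1]] by simp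
    finally show ?thesis using RC(2)[OF C(1), of 1] unfolding cV by auto
  qed
  have "S ` ?U = ?U"
    using injective_endo_surj[OF fdU lin_map_sub(2)[OF U lS SU]] inj_on_subset[OF injS] U unfolding is_sub_def by simp
  then have SjU: "(S ^^ j) ` ?U = ?U" for j
  proof (induction j)
    case (Suc j)
    have "(S ^^ Suc j) ` ?U = S ` (S ^^ j) ` ?U" by auto
    then show ?case using Suc by simp
  qed simp
  have injSj: "v = w" if "v \<in> carrier HW" "w \<in> carrier HW" "(S ^^ j) v = (S ^^ j) w" for v w j
    using that(3)
  proof (induction j)
    case (Suc j)
    have "(S ^^ j) v \<in> carrier HW" "(S ^^ j) w \<in> carrier HW"
      using lin_mapD(1)[OF lSn] that by blast+
    then have "(S ^^ j) v = (S ^^ j) w" using injS Suc.prems unfolding inj_on_def by simp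
    then show ?case by (rule Suc.IH)
  qed simp
  \<comment> \<open>On the finite dimensional invariant image the injective map \<open>S\<close> is
    onto. A class that a power of \<open>S\<close> moves into the image was therefore in it from the
    start.\<close>
  have "carrier HW \<subseteq> ?U"
  proof
    fix w assume w: "w \<in> carrier HW"
    obtain j where "(S ^^ j) w \<in> ?U" using coker[OF w] by blast
    then have "(S ^^ j) w \<in> (S ^^ j) ` ?U" by (simp only: SjU)
    then obtain u where u: "u \<in> ?U" "(S ^^ j) w = (S ^^ j) u" by (rule imageE) (rule that)
    then have "u \<in> carrier HW" using U unfolding is_sub_def by blast
    then show "w \<in> ?U" using injSj[OF w _ u(2)] u(1) by simp
  qed
  then have "?U = carrier HW" using U unfolding is_sub_def by blast
  then show fdW: "fin_dim_vs HW" using fdU by simp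
  have ck: "\<exists>j. ((S ^^ n) ^^ j) w \<in> ?U" if "w \<in> carrier HW" for w
    using subsetD[OF \<open>carrier HW \<subseteq> ?U\<close> that] by (intro exI[of _ 0]) (simp only: funpow_0)
  have "linear_trace V' R = linear_trace HW (S ^^ n)"
    by (rule linear_trace_eventual_iso[OF fd fdW lp lR lSn eq ker ck])
  then show "linear_trace V' (cech_map Z' {b} 1 (T' ^^ n)) = linear_trace HW (cech_map W {} 1 F ^^ n)"
    unfolding R_def S_def .
qed

end

section \<open>Attractors\<close>

context continuum_system
begin

text \<open>Orbits in a positively invariant neighbourhood inside \<open>A0\<close> never reach the
  base point. A point of the limit other than infinity has a coordinate in its past that lies in
  this neighbourhood, so its forward orbit survives and the point is in \<open>K\<close>.\<close>

lemma full_if_attractor: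
  assumes "attractor M f D X" shows "topspace lim.W = insert infinity_point K"
proof -
  have "neighbourhood_of M A0 X"
    unfolding neighbourhood_of_def using A0 openin_subset interior_of_openin by metis
  moreover have "\<forall>U. neighbourhood_of M U X \<longrightarrow> (\<exists>P. neighbourhood_of M P X \<and> P \<subseteq> U \<and> P \<subseteq> D \<and> f ` P \<subseteq> P)"
    using assms unfolding attractor_def by (rule conjunct1)
  ultimately obtain P where P: "neighbourhood_of M P X" "P \<subseteq> A0" "f ` P \<subseteq> P" by meson
  have P_orb: "(T ^^ j) (Some x) \<noteq> None" if "x \<in> P" for x j
  proof -
    have "(f ^^ i) x \<in> P" for i using that P(3) by (induction i) auto
    then have "(f ^^ i) x \<in> N - L" for i using P(2) A0(3) by blast
    then show ?thesis using Tk_Some(1)[of j x] by blast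
  qed
  obtain m where m: "\<And>k z. z \<in> topspace Z \<Longrightarrow> k \<ge> m \<Longrightarrow> (T ^^ (2 * k)) z \<noteq> None \<Longrightarrow> (T ^^ k) z \<in> Some ` (M interior_of P)"
  proof -
    have "X \<subseteq> M interior_of P" using P(1) unfolding neighbourhood_of_def by blast
    then show thesis by (rule T_core[OF openin_interior_of]) (rule that)
  qed
  have "\<xi> \<in> K" if x: "\<xi> \<in> topspace lim.W" "\<xi> \<noteq> infinity_point" for \<xi>
  proof -
    have "\<exists>k. \<xi> k \<noteq> None" using x(2) unfolding infinity_point_def by (simp add: fun_eq_iff)
    then obtain k where k: "\<xi> k \<noteq> None" ..
    have "\<xi> (k + m + m) \<in> topspace Z" using x(1) unfolding lim.topspace_W by blast
    moreover have "(T ^^ (2 * m)) (\<xi> (k + m + m)) = \<xi> k"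
      using lim.fpow_proj[OF x(1), of "2 * m" k] by (simp add: mult_2 add.assoc)
    moreover have "(T ^^ m) (\<xi> (k + m + m)) = \<xi> (k + m)" by (rule lim.fpow_proj[OF x(1)])
    ultimately have "\<xi> (k + m) \<in> Some ` (M interior_of P)" using m[OF _ order_refl] k by metis
    then obtain y where y: "y \<in> P" "\<xi> (k + m) = Some y" using interior_of_subset[of M P] by blast
    have "(T ^^ j) (\<xi> 0) \<noteq> None" for j
      using P_orb[OF y(1), of "j + (k + m)"] lim.fpow_proj[OF x(1), of "k + m" 0] y(2) by (simp add: funpow_add)
    moreover have "(lim.F ^^ j) \<xi> \<in> topspace lim.W" for j using x(1) lim.F_in by (induction j) auto
    ultimately show ?thesis unfolding K_iff Q_def using x(1) by (simp add: lim.Fk_0)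
  qed
  then show ?thesis using infinity_in unfolding K_def by auto
qed

text \<open>If \<open>W\<close> is \<open>K\<close> together with infinity, the stable image is
  \<open>X\<close> with the base point, so \<open>m\<close> steps bring every point of the quotient
  close to one of the two. The set of points whose iterates up to time \<open>m\<close> lie in
  \<open>H\<close> is then invariant, because the next iterate cannot be close to the base
  point.\<close>

lemma invariant_neighbourhood:
  assumes full: "topspace lim.W = insert infinity_point K" and V: "openin M V1" "X \<subseteq> V1" "openin M V2" "L \<subseteq> V2" "disjnt V1 V2"
    and G: "openin M G" "X \<subseteq> G"
  obtains P m where "openin M P" "X \<subseteq> P" "P \<subseteq> G \<inter> V1 \<inter> A0" "f ` P \<subseteq> P"
    "\<And>z. z \<in> topspace Z \<Longrightarrow> (T ^^ m) z \<in> Some ` G \<union> insert None (Some ` V2)"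
proof -
  \<comment> \<open>The condition on \<open>f x\<close> looks one step ahead: it keeps the next
    iterate in \<open>V1\<close>, away from the neighbourhood \<open>V2\<close> of \<open>L\<close>,
    so of the two alternatives only \<open>H\<close> remains.\<close>
  define H where "H = G \<inter> V1 \<inter> A0 \<inter> {x \<in> D. f x \<in> V1 \<inter> A0}"
  have H: "openin M H" unfolding H_def by (intro openin_Int G V A0(1) preimage_open)
  have XH: "X \<subseteq> H" unfolding H_def using G V A0 ND fX by auto
  have HN: "H \<subseteq> N - L" unfolding H_def using A0(3) by auto
  define O1 where "O1 = Some ` (H \<inter> N) \<union> insert None (Some ` (V2 \<inter> N - L))"
  have "openin Z O1" unfolding O1_def
    using quotient_openI(1)[OF H N_top, of L] quotient_openI(2)[OF V(3) N_top V(4)] HN by (intro openin_Un) auto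
  moreover have "lim.\<Omega> \<subseteq> O1"
  proof
    fix z assume "z \<in> lim.\<Omega>"
    then have "z \<in> (\<lambda>\<xi>. \<xi> 0) ` insert infinity_point K" using lim.\<Omega>_proj[of 0] unfolding full by blast
    then have "z = None \<or> z \<in> Some ` X" unfolding K_def infinity_point_def by auto
    then show "z \<in> O1" using XH HN unfolding O1_def by blast
  qed
  ultimately obtain m where "(T ^^ m) ` topspace Z \<subseteq> O1" by (rule lim.eventually_in) (rule that)
  then have m: "(T ^^ m) z \<in> O1" if "z \<in> topspace Z" for z using that by blast
  define P where "P = {x. \<forall>i\<le>m. (f ^^ i) x \<in> H}"
  have Po: "openin M P" unfolding P_def by (rule open_orbit_set[OF H]) (use HN ND in auto)
  have PH: "P \<subseteq> H" unfolding P_def by auto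
  have fP: "f x \<in> P" if x: "x \<in> P" for x
  proof -
    have orb: "(f ^^ i) x \<in> H" if "i \<le> m" for i using that x unfolding P_def by blast
    have NL: "(f ^^ i) x \<in> N - L" if "i \<le> m" for i using HN orb[OF that] by blast
    have last: "(f ^^ Suc m) x \<in> V1 \<inter> A0" using orb[OF order_refl] unfolding H_def by simp
    then have "(f ^^ Suc m) x \<in> N - L" using A0(3) by blast
    then have "\<forall>i\<le>Suc m. (f ^^ i) x \<in> N - L" using NL by (auto simp: le_Suc_eq)
    then have T1: "(T ^^ Suc m) (Some x) = Some ((f ^^ Suc m) x)" using Tk_Some[of "Suc m" x] by blast
    have "T (Some x) \<in> topspace Z" using NL[of 0] by (intro T_in) (simp add: top_Z)
    then have "(T ^^ m) (T (Some x)) \<in> O1" by (rule m)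
    then have "Some ((f ^^ Suc m) x) \<in> O1" using T1 by (simp add: funpow_swap1)
    then have "(f ^^ Suc m) x \<in> H" using last V(5) unfolding O1_def disjnt_def by auto
    then have "(f ^^ i) (f x) \<in> H" if "i \<le> m" for i
      using orb[of "Suc i"] that by (cases "i = m") (simp_all add: funpow_swap1)
    then show ?thesis unfolding P_def by blast
  qed
  show thesis
  proof (rule that[OF Po])
    show "X \<subseteq> P" unfolding P_def using XH fkX_in by blast
    show "P \<subseteq> G \<inter> V1 \<inter> A0" using PH unfolding H_def by blast
    show "f ` P \<subseteq> P" using fP by blast
    show "(T ^^ m) z \<in> Some ` G \<union> insert None (Some ` V2)" if "z \<in> topspace Z" for z
      using m[OF that] unfolding O1_def H_def by blast
  qed
qed

text \<open>Orbits in an invariant neighbourhood inside \<open>V1\<close> never meet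
  \<open>V2\<close>. Of the two alternatives after \<open>m\<close> steps only nearness to
  \<open>X\<close> remains, and every later time is \<open>m\<close> steps after some point of the
  orbit.\<close>

lemma attractor_if_full:
  assumes full: "topspace lim.W = insert infinity_point K" shows "attractor M f D X"
proof -
  obtain V1 V2 where V: "openin M V1" "openin M V2" "X \<subseteq> V1" "L \<subseteq> V2" "disjnt V1 V2"
    using Hausdorff_space_compact_separation[OF Hausdorff_M X_compact L_compact] XL unfolding disjnt_def by metis
  note inv = invariant_neighbourhood[OF full V(1,3,2,4,5)]
  have nb: "neighbourhood_of M P X" if "openin M P" "X \<subseteq> P" for P
    unfolding neighbourhood_of_def using that openin_subset interior_of_openin by metis
  obtain P0 where P0: "openin M P0" "X \<subseteq> P0" "P0 \<subseteq> V1 \<inter> A0" "f ` P0 \<subseteq> P0"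
    by (rule inv[OF V(1,3)]) (rule that, auto)
  show ?thesis unfolding attractor_def
  proof (rule conjI; (intro allI impI)?)
    fix U assume U: "neighbourhood_of M U X"
    have io: "openin M (M interior_of U)" "X \<subseteq> M interior_of U" "M interior_of U \<subseteq> U"
      using U interior_of_subset[of M U] unfolding neighbourhood_of_def by auto
    obtain P where P: "openin M P" "X \<subseteq> P" "P \<subseteq> M interior_of U \<inter> V1 \<inter> A0" "f ` P \<subseteq> P"
      by (rule inv[OF io(1,2)]) (rule that)
    then show "\<exists>P. neighbourhood_of M P X \<and> P \<subseteq> U \<and> P \<subseteq> D \<and> f ` P \<subseteq> P"
      using nb[OF P(1,2)] io(3) A0(3) ND by (intro exI[of _ P]) blast
  next
   show "\<exists>V. neighbourhood_of M V X \<and> (\<forall>x\<in>V. \<forall>U. neighbourhood_of M U X \<longrightarrow>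
           (\<exists>k. \<forall>j\<ge>k. x \<in> iterate_domain f D j \<and> (f ^^ j) x \<in> U))"
   proof (intro exI[of _ P0] conjI ballI allI impI)
    show "neighbourhood_of M P0 X" by (rule nb[OF P0(1,2)])
    fix x U assume x: "x \<in> P0" and U: "neighbourhood_of M U X"
    have io: "openin M (M interior_of U)" "X \<subseteq> M interior_of U" "M interior_of U \<subseteq> U"
      using U interior_of_subset[of M U] unfolding neighbourhood_of_def by auto
    obtain m where m: "\<And>z. z \<in> topspace Z \<Longrightarrow> (T ^^ m) z \<in> Some ` (M interior_of U) \<union> insert None (Some ` V2)"
      by (rule inv[OF io(1,2)]) (rule that)
    have orb: "(f ^^ i) x \<in> P0" for i using x P0(4) by (induction i) auto
    then have NL: "(f ^^ i) x \<in> N - L" for i using P0(3) A0(3) by blast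
    show "\<exists>k. \<forall>j\<ge>k. x \<in> iterate_domain f D j \<and> (f ^^ j) x \<in> U"
    proof (intro exI[of _ m] allI impI conjI)
      fix j assume j: "m \<le> j"
      show "x \<in> iterate_domain f D j" unfolding iterate_domain_def using NL ND by blast
      have "Some ((f ^^ (j - m)) x) \<in> topspace Z" using NL by (auto simp: top_Z)
      from m[OF this] have "(T ^^ m) (Some ((f ^^ (j - m)) x)) \<in> Some ` (M interior_of U) \<union> insert None (Some ` V2)" .
      moreover have "(f ^^ i) ((f ^^ (j - m)) x) = (f ^^ (i + (j - m))) x" for i by (simp add: funpow_add)
      then have "\<forall>i\<le>m. (f ^^ i) ((f ^^ (j - m)) x) \<in> N - L" using NL by presburger
      then have "(T ^^ m) (Some ((f ^^ (j - m)) x)) = Some ((f ^^ m) ((f ^^ (j - m)) x))" using Tk_Some by blast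
      moreover have "(f ^^ m) ((f ^^ (j - m)) x) = (f ^^ j) x" using j by (metis comp_apply funpow_add le_add_diff_inverse)
      ultimately have "(f ^^ j) x \<in> M interior_of U \<union> V2" by auto
      moreover have "(f ^^ j) x \<notin> V2" using orb[of j] P0(3) V(5) unfolding disjnt_def by blast
      ultimately show "(f ^^ j) x \<in> U" using io(3) by blast
    qed
   qed
  qed
qed

text \<open>Infinity is isolated here, and a potential on \<open>K\<close> serves on all of
  \<open>W\<close>, since the cocycle vanishes at the pair of infinity with itself.\<close>

lemma full_ker_restrict:
  assumes full: "topspace lim.W = insert infinity_point K"
  shows "(ar.ker_restrict :: (nat \<Rightarrow> 'a option, 'k::field) cech set) = {\<zero>\<^bsub>cech_cohomology lim.W {} 1 :: ('k, (nat \<Rightarrow> 'a option, 'k) cech) module\<^esub>}"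
proof -
  let ?H = "cech_cohomology lim.W {} 1 :: ('k, (nat \<Rightarrow> 'a option, 'k) cech) module"
  note pl = pointlike_simps(1)
  have "closedin lim.W {infinity_point}" using closedin_Hausdorff_sing_eq[OF lim.Hausdorff_W] infinity_in by blast
  moreover have "topspace lim.W - {infinity_point} = K" using full ar.p_notin_K by auto
  ultimately have Ko: "openin lim.W K" by (metis openin_diff openin_topspace)
  have "topspace lim.W - K = {infinity_point}" using full ar.p_notin_K by auto
  then have po: "openin lim.W {infinity_point}" using ar.K_closed by (metis openin_diff openin_topspace)
  have "v = \<zero>\<^bsub>?H\<^esub>" if v: "v \<in> ar.ker_restrict" for v :: "(nat \<Rightarrow> 'a option, 'k) cech"
  proof -
    have "v \<in> carrier ?H" using v unfolding ar.ker_restrict_def by blast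
    then obtain C where C: "C \<in> asc lim.W" "v = as_class lim.W {} C" unfolding carrier_cech_1[OF pl] by auto
    have "cobounds (subtopology lim.W K) C" using v ar.ker_restrict_iff[OF C(1)] C(2) by blast
    then obtain \<alpha> where \<alpha>: "near (subtopology lim.W K) (\<lambda>y z. C (y, z) = \<alpha> z - \<alpha> y)" unfolding cobounds_def by (elim exE)
    have "near lim.W (\<lambda>y z. C (y, z) = \<alpha> z - \<alpha> y)"
    proof (rule nearI)
      fix \<xi> assume "\<xi> \<in> topspace lim.W"
      then consider "\<xi> \<in> K" | "\<xi> = infinity_point" using full by blast
      then show "\<exists>U. openin lim.W U \<and> \<xi> \<in> U \<and> (\<forall>y\<in>U. \<forall>z\<in>U. C (y, z) = \<alpha> z - \<alpha> y)"
      proof cases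
        case 1
        obtain U where "openin lim.W U" "\<xi> \<in> U" "U \<subseteq> K" "\<And>y z. y \<in> U \<Longrightarrow> z \<in> U \<Longrightarrow> C (y, z) = \<alpha> z - \<alpha> y"
          by (rule near_open_subtopologyE[OF \<alpha> Ko 1]) (rule that)
        then show ?thesis by (intro exI[of _ U]) blast
      next
        case 2
        then show ?thesis using po asc_diag[OF C(1) infinity_in] by (intro exI[of _ "{infinity_point}"]) simp
      qed
    qed
    then have "cobounds lim.W C" unfolding cobounds_def by (intro exI[of _ \<alpha>])
    then show ?thesis unfolding C(2) using as_class_zero_iff[OF C(1) pl] by blast
  qed
  moreover have "\<zero>\<^bsub>?H\<^esub> \<in> ar.ker_restrict" using ar.ker_restrict_sub unfolding is_sub_def by blast
  ultimately show ?thesis by blast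
qed

text \<open>If \<open>P\<close> separates \<open>K\<close> from infinity, the indicators of the preimages of \<open>P\<close> under the
  iterates are linearly dependent since \<open>H\<^sup>0\<close> is finite dimensional.  A sequence which is 1 at
  some time and eventually 0 satisfies no linear recurrence, so no orbit leaves \<open>P\<close> for good and \<open>P = K\<close>.\<close>

lemma full_if_no_J:
  fixes Z' :: "'y topology"
  assumes fd: "vectorspace.fin_dim class_ring (cech_cohomology Z' {} 0 :: ('k::field, ('y, 'k) cech) module)"
    and T': "continuous_map Z' Z' T'" and r: "continuous_map Z Z' r" and s: "continuous_map Z' Z s"
    and rT: "\<And>z. z \<in> topspace Z \<Longrightarrow> r (T z) = T' (r z)"
    and sr: "\<And>z. z \<in> topspace Z \<Longrightarrow> s (r z) = (T ^^ k) z"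
    and J: "ar.J = {}"
  shows "topspace lim.W = insert infinity_point K"
proof -
  obtain P where P: "openin lim.W P" "closedin lim.W P" "K \<subseteq> P" "infinity_point \<notin> P"
    by (rule ar.J_empty_clopen[OF J]) (rule that)
  obtain l E where E: "openin Z E" "closedin Z E" "P = {\<xi> \<in> topspace lim.W. \<xi> l \<in> E}"
    by (rule lim.clopen_level[OF P(1,2)]) (rule that)
  have Fin: "(lim.F ^^ j) \<xi> \<in> topspace lim.W" if "\<xi> \<in> topspace lim.W" for j \<xi> by (rule ar.gk_in(1)[OF that])
  \<comment> \<open>The indicators are formed on \<open>Z'\<close>, whose cohomology is finite
    dimensional; \<open>rec\<close> transfers the linear relation to \<open>W\<close>.\<close>
  define c where "c j z = (if s ((T' ^^ j) z) \<in> E then 1 else 0 :: 'k)" for j z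
  have "locally_constant Z' (c j)" for j
    unfolding locally_constant_def
  proof (rule nearI)
    fix z assume z: "z \<in> topspace Z'"
    have cont: "continuous_map Z' Z (s \<circ> (T' ^^ j))" by (rule continuous_map_compose[OF continuous_map_funpow[OF T'] s])
    let ?A = "{z \<in> topspace Z'. (s \<circ> (T' ^^ j)) z \<in> E}"
    let ?B = "{z \<in> topspace Z'. (s \<circ> (T' ^^ j)) z \<in> topspace Z - E}"
    have "openin Z' ?A" "openin Z' ?B"
      using openin_continuous_map_preimage[OF cont E(1)] openin_continuous_map_preimage[OF cont, of "topspace Z - E"] E(2)
      by auto
    moreover have "z \<in> ?A \<or> z \<in> ?B" using z cont by (auto simp: continuous_map_def)
    ultimately show "\<exists>U. openin Z' U \<and> z \<in> U \<and> (\<forall>x\<in>U. \<forall>y\<in>U. c j x = c j y)"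
      unfolding c_def by (elim disjE) (rule exI, intro conjI, assumption, assumption, simp)+
  qed
  then obtain n a where a: "\<exists>j\<le>n. a j \<noteq> 0" "\<And>z. z \<in> topspace Z' \<Longrightarrow> (\<Sum>j\<le>n. a j * c j z) = 0"
    by (rule locally_constant_dependent[OF fd]) (rule that)
  \<comment> \<open>The index of the first nonzero coefficient. An orbit will be shifted so that its
    last visit to \<open>P\<close> occurs at time \<open>j0\<close>, where the relation reduces to
    this coefficient.\<close>
  define j0 where "j0 = (LEAST j. a j \<noteq> 0)"
  have j0: "a j0 \<noteq> 0" "j0 \<le> n" unfolding j0_def using a(1) LeastI[of "\<lambda>j. a j \<noteq> 0"] Least_le[of "\<lambda>j. a j \<noteq> 0"]
    by (blast, meson order_trans)
  have j0_min: "a j = 0" if "j < j0" for j using not_less_Least that unfolding j0_def by blast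
  have rec: "(\<Sum>j\<le>n. a j * (if (lim.F ^^ j) \<xi> \<in> P then 1 else 0)) = 0" if x: "\<xi> \<in> topspace lim.W" for \<xi>
  proof -
    \<comment> \<open>The passage through \<open>Z'\<close> by \<open>r\<close> and \<open>s\<close>
      advances by \<open>k\<close> steps; starting \<open>k\<close> steps earlier compensates for
      this.\<close>
    define \<eta> where "\<eta> = (lim.G ^^ k) \<xi>"
    have e: "\<eta> \<in> topspace lim.W" unfolding \<eta>_def by (rule ar.gk_in(2)[OF x])
    have el: "\<eta> l \<in> topspace Z" using e unfolding lim.topspace_W by blast
    have "c j (r (\<eta> l)) = (if (lim.F ^^ j) \<xi> \<in> P then 1 else 0)" for j
    proof -
      have Tz: "(T ^^ j) z \<in> topspace Z \<and> r ((T ^^ j) z) = (T' ^^ j) (r z)" if "z \<in> topspace Z" for z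
      proof (induction j)
        case (Suc j) then show ?case using rT T_in by simp
      qed (use that in simp)
      have "s ((T' ^^ j) (r (\<eta> l))) = (T ^^ k) ((T ^^ j) (\<eta> l))" using sr Tz[OF el] by metis
      also have "\<dots> = (T ^^ (j + k)) (\<eta> l)" by (simp add: add.commute[of j] funpow_add)
      also have "\<dots> = (lim.F ^^ (j + k)) \<eta> l"
      proof -
        have "(T ^^ (j + k)) ((lim.F ^^ (j + k)) \<eta> (l + (j + k))) = (lim.F ^^ (j + k)) \<eta> l"
          by (rule lim.fpow_proj[OF Fin[OF e]])
        then show ?thesis by (simp add: lim.Fk_proj)
      qed
      also have "(lim.F ^^ (j + k)) \<eta> = (lim.F ^^ j) \<xi>" unfolding \<eta>_def using ar.ggk(1)[OF x, of k] by (simp add: funpow_add)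
      finally show ?thesis unfolding c_def E(3) using Fin[OF x, of j] by simp
    qed
    then show ?thesis using a(2)[of "r (\<eta> l)"] el r by (simp add: continuous_map_def Pi_iff)
  qed
  have PK: "\<xi> \<in> K" if x: "\<xi> \<in> P" for \<xi>
  proof (rule ccontr)
    assume nK: "\<xi> \<notin> K"
    have xW: "\<xi> \<in> topspace lim.W" using x E(3) by blast
    have "openin lim.W (topspace lim.W - P)" using P(2) by blast
    moreover have "infinity_point \<in> topspace lim.W - P" using P(4) infinity_in by blast
    ultimately have "\<exists>i. \<forall>j\<ge>i. (lim.F ^^ j) \<xi> \<notin> P"
    proof (elim ar.p_basis[elim_format])
      fix i assume i: "ar.Rk i \<subseteq> topspace lim.W - P"
      obtain j where j: "(lim.F ^^ j) \<xi> \<in> ar.Rk i" by (rule ar.eventually_Rk[OF xW nK]) (rule that)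
      have "(lim.F ^^ (j' + j)) \<xi> \<in> ar.Rk i" for j' using j ar.g_Rk by (induction j') auto
      then have nP: "(lim.F ^^ (j' + j)) \<xi> \<notin> P" for j' using i by blast
      show ?thesis
      proof (intro exI[of _ j] allI impI)
        fix l assume "j \<le> l"
        then show "(lim.F ^^ l) \<xi> \<notin> P" using nP[of "l - j"] by simp
      qed
    qed
    then obtain i where i: "\<forall>j\<ge>i. (lim.F ^^ j) \<xi> \<notin> P" ..
    define i0 where "i0 = (LEAST i. \<forall>j\<ge>i. (lim.F ^^ j) \<xi> \<notin> P)"
    have i0: "\<forall>j\<ge>i0. (lim.F ^^ j) \<xi> \<notin> P" unfolding i0_def by (rule LeastI[of _ i]) (rule i)
    have "i0 \<noteq> 0" using i0 x by (metis funpow_0 le_numeral_extra(3))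
    then obtain i1 where i1: "i0 = Suc i1" by (cases i0) auto
    have "i1 < i0" using i1 by simp
    then have "\<not> (\<forall>j\<ge>i1. (lim.F ^^ j) \<xi> \<notin> P)" unfolding i0_def by (rule not_less_Least)
    then have last: "(lim.F ^^ i1) \<xi> \<in> P" using i0 unfolding i1 by (metis Suc_leI le_neq_implies_less)
    define \<eta> where "\<eta> = (lim.G ^^ j0) ((lim.F ^^ i1) \<xi>)"
    have e: "\<eta> \<in> topspace lim.W" unfolding \<eta>_def by (rule ar.gk_in(2)[OF Fin[OF xW]])
    have Fe: "(lim.F ^^ (j + j0)) \<eta> = (lim.F ^^ (j + i1)) \<xi>" for j
      unfolding \<eta>_def using ar.ggk(1)[OF Fin[OF xW, of i1], of j0] by (simp add: funpow_add)
    have "(\<Sum>j\<le>n. a j * (if (lim.F ^^ j) \<eta> \<in> P then 1 else 0)) = (\<Sum>j\<le>n. if j = j0 then a j0 else 0)"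
    proof (rule sum.cong[OF refl])
      fix j
      consider "j < j0" | "j = j0" | "j > j0" by linarith
      then show "a j * (if (lim.F ^^ j) \<eta> \<in> P then 1 else 0) = (if j = j0 then a j0 else 0)"
      proof cases
        case 1 then show ?thesis using j0_min by simp
      next
        case 2 then show ?thesis using Fe[of 0] last by simp
      next
        case 3
        then have "(lim.F ^^ j) \<eta> = (lim.F ^^ (j - j0 + i1)) \<xi>" using Fe[of "j - j0"] by simp
        then have "(lim.F ^^ j) \<eta> \<notin> P" using i0 3 unfolding i1 by simp
        then show ?thesis using 3 by simp
      qed
    qed
    also have "\<dots> = a j0" using j0(2) by simp
    finally show False using rec[OF e] j0(1) by simp
  qed
  \<comment> \<open>Backwards in time, any point other than infinity enters a neighbourhood of
    \<open>K\<close> inside \<open>P\<close>; it is then in \<open>K\<close>, and invariance of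
    \<open>K\<close> brings the conclusion back to the point itself.\<close>
  show ?thesis
  proof (rule ccontr)
    assume n: "topspace lim.W \<noteq> insert infinity_point K"
    have "insert infinity_point K \<subseteq> topspace lim.W" using infinity_in ar.K_subset(2) by blast
    then obtain \<xi> where x: "\<xi> \<in> topspace lim.W" "\<xi> \<noteq> infinity_point" "\<xi> \<notin> K" using n by blast
    obtain i where i: "lim.W closure_of (ar.Qk i) \<subseteq> P" by (rule ar.K_basis[OF P(1,3)]) (rule that)
    obtain j where "(lim.G ^^ j) \<xi> \<in> Q" using exhaust[OF x(2,1)] by blast
    then have j: "(lim.G ^^ (i + j)) \<xi> \<in> ar.Qk i"
      unfolding ar.Qk_def using ar.gk_in(2)[OF x(1)] ar.ggk(1)[OF ar.gk_in(2)[OF x(1), of j], of i]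
        ar.gk_in(2)[OF ar.gk_in(2)[OF x(1), of j], of i]
      by (simp add: funpow_add)
    have "ar.Qk i \<subseteq> P" using i closure_of_subset[of "ar.Qk i" lim.W] unfolding ar.Qk_def by blast
    then have "(lim.G ^^ (i + j)) \<xi> \<in> K" using j PK by blast
    then have "(lim.F ^^ (i + j)) ((lim.G ^^ (i + j)) \<xi>) \<in> K"
      using ar.g_K(1) by (induction "i + j") (auto intro: funpow_closed)
    then show False using ar.ggk(1)[OF x(1)] x(3) by simp
  qed
qed

end

section \<open>The trace formula\<close>

theorem corollary3:
  fixes M :: "'a topology" and f :: "'a \<Rightarrow> 'a" and D X N L :: "'a set" and n :: nat
  assumes "Hausdorff_space M" "locally_compact_space M" "paracompact_space M"
    and "openin M D" "continuous_map (subtopology M D) M f"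
    and "isolated_invariant_set M f D X" "continuum_in M X"
    and "\<exists>N' L'. index_pair M f D X N' L' \<and>
           (\<forall>q. vectorspace.fin_dim class_ring
              (cech_cohomology (quotient_space M N' L') {} q
                :: ('k::rat_or_complex, ('a option, 'k) cech) module))"
    and "index_pair M f D X N L"
    and "n \<ge> 1"
  shows
    "let W = unstable_compactification M f N L;
         X' = subtopology W (lifted_set M f N L X);
         HW = (cech_cohomology W {} 1 :: ('k, (nat \<Rightarrow> 'a option, 'k) cech) module);
         HX = (cech_cohomology X' {} 1 :: ('k, (nat \<Rightarrow> 'a option, 'k) cech) module);
         im_i = HX\<lparr>carrier := cech_map X' {} 1 id ` carrier HW\<rparr>;
         f_star = cech_map X' {} 1 (lifted_map f N L);
         J = essential_quasicomponents M f N L X;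
         \<phi> = quasicomponent_shift M f N L;
         h = (conley_index M (f ^^ n) (iterate_domain f D n) X 1
               :: (('k, ('a option, 'k) cech) module \<times> _) set)
     in finite J \<and>
        shift_class_trace h =
          (if attractor M f D X then linear_trace im_i (f_star ^^ n)
           else -1 + of_nat (card {F \<in> J. (\<phi> ^^ n) F = F}) + linear_trace im_i (f_star ^^ n))"
proof -
  have X: "X \<noteq> {}" "compactin M X" "connectedin M X" "f ` X = X"
    using assms(6,7) unfolding isolated_invariant_set_def continuum_in_def by auto
  obtain N' L' where p': "index_pair M f D X N' L'"
    "\<And>q. vectorspace.fin_dim class_ring
       (cech_cohomology (quotient_space M N' L') {} q :: ('k, ('a option, 'k) cech) module)"
    using assms(8) by blast
  \<comment> \<open>Two systems are used: the given pair \<open>(N, L)\<close>, in which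
    \<open>W\<close> and \<open>J\<close> are formed, and the pair \<open>(N', L')\<close> known to
    have finite dimensional cohomology.\<close>
  interpret continuum_system M f D X N L
    by unfold_locales (use assms X in auto)
  interpret b: continuum_system M f D X N' L'
    by unfold_locales (use assms X p'(1) in auto)
  note pl = pointlike_simps
  have fd': "fin_dim_vs (cech_cohomology b.Z {None} 1 :: ('k, ('a option, 'k) cech) module)"
    by (rule fin_dim_cech_1_rel[OF p'(2)])
  \<comment> \<open>With exponent 1 the comparison with a pair for an iterate becomes one between
    two index pairs of \<open>f\<close>.\<close>
  have b1: "index_system M (f ^^ 1) D X N' L'" using b.index_system_axioms by simp
  obtain r s k where rs: "continuous_map Z b.Z r" "\<And>z. z \<in> topspace Z \<Longrightarrow> r (T z) = b.T (r z)"
    "continuous_map b.Z Z s" "\<And>z. z \<in> topspace Z \<Longrightarrow> s (r z) = (T ^^ k) z"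
    "\<And>z. z \<in> topspace b.Z \<Longrightarrow> r (s z) = (b.T ^^ k) z"
  proof (rule index_shift_maps[OF index_system_axioms b1 order_refl])
    fix r s k
    assume *: "continuous_map Z b.Z r" "\<And>z. z \<in> topspace Z \<Longrightarrow> r ((T ^^ 1) z) = index_map (f ^^ 1) N' L' (r z)"
      "continuous_map b.Z Z s" "\<And>z. z \<in> topspace Z \<Longrightarrow> s (r z) = ((T ^^ 1) ^^ k) z"
      "\<And>z. z \<in> topspace b.Z \<Longrightarrow> r (s z) = (index_map (f ^^ 1) N' L' ^^ k) z"
    show thesis by (rule that[OF *(1) _ *(3)]) (use *(2,4,5) in simp_all)
  qed
  define HW where "HW = (cech_cohomology lim.W {} 1 :: ('k, (nat \<Rightarrow> 'a option, 'k) cech) module)"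
  define X' where "X' = subtopology lim.W K"
  define HX where "HX = (cech_cohomology X' {} 1 :: ('k, (nat \<Rightarrow> 'a option, 'k) cech) module)"
  define i where "i = (cech_map X' {} 1 id :: (nat \<Rightarrow> 'a option, 'k) cech \<Rightarrow> _)"
  define f_star where "f_star = (cech_map X' {} 1 lim.F :: (nat \<Rightarrow> 'a option, 'k) cech \<Rightarrow> _)"
  define im_i where "im_i = HX\<lparr>carrier := i ` carrier HW\<rparr>"
  define h where "h = (conley_index M (f ^^ n) (iterate_domain f D n) X 1 :: (('k, ('a option, 'k) cech) module \<times> _) set)"
  define S where "S = (cech_map lim.W {} 1 lim.F :: (nat \<Rightarrow> 'a option, 'k) cech \<Rightarrow> _)"
  note lc = lim.limit_cohomology[OF b.T_cont b.T_None rs(1,3,2,4,5) fd' assms(10)]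
  have fdW: "fin_dim_vs HW" unfolding HW_def by (rule lc(1))
  have tr: "shift_class_trace h = linear_trace HW (S ^^ n)"
    unfolding h_def b.conley_index_trace[OF fd' assms(10)] HW_def S_def by (rule lc(2))
  have lS: "lin_map HW HW (S ^^ n)"
    unfolding HW_def S_def by (rule lin_map_funpow[OF cech_map_lin_map[OF lim.F_cont _ pl(1) pl(1)]]) simp
  have FX: "continuous_map X' X' lim.F"
    unfolding X'_def using lim.F_cont ar.g_K(1)
    by (auto simp: continuous_map_in_subtopology continuous_map_from_subtopology)
  have lf: "lin_map HX HX (f_star ^^ n)"
    unfolding HX_def f_star_def by (rule lin_map_funpow[OF cech_map_lin_map[OF FX _ pl(1) pl(1)]]) simp
  have li: "lin_map HW HX i" unfolding HW_def HX_def X'_def i_def by (rule ar.restrict_lin_map)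
  have eq: "i ((S ^^ n) v) = (f_star ^^ n) (i v)" if v: "v \<in> carrier HW" for v
  proof -
    obtain C where C: "C \<in> asc lim.W" "v = as_class lim.W {} C"
      using v unfolding HW_def carrier_cech_1[OF pl(1)] by auto
    note SC = cech_map_funpow[OF lim.F_cont _ pl(1) C(1), of n]
    have "i ((S ^^ n) v) = as_class X' {} (\<lambda>(x, y). C ((lim.F ^^ n) x, (lim.F ^^ n) y))"
      unfolding i_def S_def C(2) X'_def using SC ar.restrict_as_class(1)[OF SC(2)] by simp
    also have "\<dots> = (f_star ^^ n) (i v)"
      using cech_map_funpow(1)[OF FX _ pl(1), of C n] ar.restrict_as_class[OF C(1)]
      unfolding f_star_def i_def C(2) X'_def by simp
    finally show ?thesis .
  qed
  have vX: "is_vs HX" unfolding HX_def by (rule vs_cech_1[OF pl(1)])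
  have ker: "HW\<lparr>carrier := {v \<in> carrier HW. i v = \<zero>\<^bsub>HX\<^esub>}\<rparr> = HW\<lparr>carrier := ar.ker_restrict\<rparr>"
    unfolding ar.ker_restrict_def HW_def HX_def X'_def i_def ..
  have exact: "linear_trace HW (S ^^ n) = linear_trace (HW\<lparr>carrier := ar.ker_restrict\<rparr>) (S ^^ n) + linear_trace im_i (f_star ^^ n)"
    unfolding im_i_def ker[symmetric] by (rule linear_trace_exact[OF fdW vX li lS lf eq])
  note kt = ar.kernel_trace[OF fdW[unfolded HW_def]]
  have J: "{F \<in> ar.J. (quasicomponent_shift M f N L ^^ n) F = F} = {F \<in> ar.J. (lim.F ^^ n) ` F = F}"
    using shift_fixes_iff by blast
  have main: "shift_class_trace h = (if attractor M f D X then linear_trace im_i (f_star ^^ n)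
      else -1 + of_nat (card {F \<in> ar.J. (quasicomponent_shift M f N L ^^ n) F = F}) + linear_trace im_i (f_star ^^ n))"
  proof (cases "attractor M f D X")
    case True
    have "linear_trace (HW\<lparr>carrier := ar.ker_restrict\<rparr>) (S ^^ n) = 0"
      unfolding full_ker_restrict[OF full_if_attractor[OF True]] HW_def
      by (rule linear_trace_zero_space[OF vs_cech_1[OF pl(1)]])
    then show ?thesis using True tr exact by simp
  next
    case False
    have "ar.J \<noteq> {}"
      using full_if_no_J[OF p'(2) b.T_cont rs(1,3,2,4)] attractor_if_full False by blast
    from kt(2)[OF this, of n] show ?thesis
      using False tr exact unfolding J HW_def S_def by simp
  qed
  show ?thesis
    unfolding Let_def W_eq F_eq K_eq J_eq
    using kt(1) main unfolding h_def im_i_def f_star_def i_def HX_def X'_def HW_def by blast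
qed

end
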